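(* Let Assumption 1 (stated in the context) hold. Let $C\ge 0$ be a constant, let $q\in[0,C]$, and for each $N$ consider a test matrix $$\mathbf K=\sum_{i=1}^{\lfloor N^q\rfloor}\lambda_i\,\mathbf u_i\mathbf v_i^\top ,$$ where $\mathbf u_i,\mathbf v_i\in\mathbb R^N$ (possibly random) satisfy $\|\mathbf u_i\|=\|\mathbf v_i\|=1$ and the real numbers $\lambda_i$ (possibly random) satisfy $\limsup_{N\to\infty}\max_i|\lambda_i|<\infty$ almost surely. No orthogonality is assumed among the vectors in $\mathcal M=\{\mathbf u_i,\mathbf v_i\}_{i\le\lfloor N^q\rfloor}$. Let $\mathbf O\in\mathbb R^{N\times N}$ be a Haar-distributed orthogonal matrix that is independent of $(\mathbf A,\mathbf B,\mathcal M)$. Then, almost surely, $$\lim_{N\to\infty}\frac1{N^q}\operatorname{tr}\Bigl(\mathbf K\bigl[(\mathbf O^\top\mathbf A\mathbf O+\mathbf B)^{-1}-(\mathbf B-z^\star\mathbf I_N)^{-1}\bigr]\Bigr)=0 .$$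
   Context: All objects are sequences indexed by $N$ (the index is suppressed). $\mathbf I_N$ is the $N\times N$ identity; $\|\cdot\|$ is the Euclidean norm; $\sigma_{\min}(\cdot),\sigma_{\max}(\cdot)$ are the smallest and largest singular values. Assumption 1: $\mathbf A=\mathbf A_N,\mathbf B=\mathbf B_N\in\mathbb R^{N\times N}$ are symmetric positive definite, in general random, and may depend on each other (e.g. $\mathbf A=\mathbf B$). The empirical eigenvalue distributions of $\mathbf A$ and $\mathbf B$ converge almost surely, as $N\to\infty$, to deterministic limiting distributions $\mathrm F_{\mathbf A}$ and $\mathrm F_{\mathbf B}$. Almost surely $\liminf_{N\to\infty}\sigma_{\min}(\mathbf A)>0$ and $\limsup_{N\to\infty}\sigma_{\max}(\mathbf A)<\infty$, and likewise for $\mathbf B$. R-transform: for a random variable $X\ge 0$ with distribution $\mathrm F_X$, let $\mu_{X^{-1}}=\mathbb E[X^{-1}]$ (with $\mu_{X^{-1}}=\infty$ if $\mathrm F_X(0)>0$), let $s_X(z)=\mathbb E[(X-z)^{-1}]$ for $z\in(-\infty,0)$, and let $z_X$ be the functional inverse of $s_X$. The R-transform of $\mathrm F_X$ is $\mathrm R_X(s)=z_X(-s)-s^{-1}$ for $s\in(-\mu_{X^{-1}},0)$. $\mathrm R_{\mathbf A}$ denotes the R-transform of $\mathrm F_{\mathbf A}$. Let $\mathrm F=\mathrm F_{\mathbf A}\boxplus\mathrm F_{\mathbf B}$ be the free additive convolution, and define $\chi=\int x^{-1}\,\mathrm{dF}(x)$ and $z^\star=-\mathrm R_{\mathbf A}(-\chi)$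 (one has $z^\star<0$). *)

theory Defs
  imports
    "HOL-Probability.Probability"
    "Jordan_Normal_Form.Gauss_Jordan_Elimination"
    "Jordan_Normal_Form.Char_Poly"
begin

definition symmetric_positive_definite :: "nat \<Rightarrow> real mat \<Rightarrow> bool" where
  "symmetric_positive_definite n A \<longleftrightarrow> A \<in> carrier_mat n n \<and> transpose_mat A = A \<and>
     (\<forall>x \<in> carrier_vec n. x \<noteq> 0\<^sub>v n \<longrightarrow> scalar_prod x (A *\<^sub>v x) > 0)"

(* The library predicate orthogonal_mat only asks for pairwise orthogonal nonzero columns. *)
definition orthogonal_matrices :: "nat \<Rightarrow> real mat set" where
  "orthogonal_matrices n =
     {Q \<in> carrier_mat n n. transpose_mat Q * Q = 1\<^sub>m n \<and> Q * transpose_mat Q = 1\<^sub>m n}"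

definition euclidean_norm :: "real Matrix.vec \<Rightarrow> real" where
  "euclidean_norm x = sqrt (scalar_prod x x)"

definition matrix_trace :: "real mat \<Rightarrow> real" where
  "matrix_trace A = (\<Sum>i<dim_row A. A $$ (i, i))"

(* Unspecified for singular matrices. *)
definition matrix_inverse :: "real mat \<Rightarrow> real mat" where
  "matrix_inverse A = the (mat_inverse A)"

(* Meant for square matrices (for wide ones, the Gram matrix has extra zero eigenvalues). *)
definition singular_values :: "real mat \<Rightarrow> real set" where
  "singular_values A = sqrt ` {l. eigenvalue (transpose_mat A * A) l}"

definition sigma_min :: "real mat \<Rightarrow> real" where
  "sigma_min A = Min (singular_values A)"

definition sigma_max :: "real mat \<Rightarrow> real" where
  "sigma_max A = Max (singular_values A)"

(* The sum of l i * u i * (v i)^T; entrywise, as JNF matrices have no neutral element for sum. *)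
definition sum_rank_one ::
  "nat \<Rightarrow> nat \<Rightarrow> (nat \<Rightarrow> real) \<Rightarrow> (nat \<Rightarrow> real Matrix.vec) \<Rightarrow> (nat \<Rightarrow> real Matrix.vec) \<Rightarrow> real mat"
where
  "sum_rank_one n m l u v =
     Matrix.mat n n (\<lambda>(r, c). \<Sum>i = 1..m. l i * vec_index (u i) r * vec_index (v i) c)"

definition borel_mat :: "nat \<Rightarrow> real mat measure" where
  "borel_mat n = vimage_algebra (carrier_mat n n)
     (\<lambda>A. \<lambda>p \<in> {..<n} \<times> {..<n}. A $$ p) (Pi\<^sub>M ({..<n} \<times> {..<n}) (\<lambda>_. borel))"

definition borel_vec :: "nat \<Rightarrow> real Matrix.vec measure" where
  "borel_vec n = vimage_algebra (carrier_vec n)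
     (\<lambda>x. \<lambda>i \<in> {..<n}. vec_index x i) (Pi\<^sub>M {..<n} (\<lambda>_. borel))"

(* Only the distribution matters. Left invariance suffices, since the group is compact. *)
definition haar_orthogonal :: "'w measure \<Rightarrow> nat \<Rightarrow> ('w \<Rightarrow> real mat) \<Rightarrow> bool" where
  "haar_orthogonal P n U \<longleftrightarrow>
     U \<in> measurable P (borel_mat n) \<and> (AE w in P. U w \<in> orthogonal_matrices n) \<and>
     (\<forall>Q \<in> orthogonal_matrices n.
        distr P (borel_mat n) (\<lambda>w. Q * U w) = distr P (borel_mat n) U)"

(* Meant for symmetric matrices, whose characteristic polynomial has only real roots. *)
definition empirical_eigenvalue_distribution :: "real mat \<Rightarrow> real measure" where
  "empirical_eigenvalue_distribution A =
     distr (measure_pmf (pmf_of_multiset (proots (char_poly A)))) borel (\<lambda>x. x)"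

definition stieltjes :: "real measure \<Rightarrow> real \<Rightarrow> real" where
  "stieltjes \<mu> z = (LINT x|\<mu>. 1 / (x - z))"

(* For \<mu> concentrated on the nonnegative reals, stieltjes \<mu> is a strictly increasing bijection
   from the negative reals onto the open interval from 0 to the (possibly infinite) mean of 1/x,
   so R_transform \<mu> s is meaningful exactly when -s lies in that interval. *)
definition R_transform :: "real measure \<Rightarrow> real \<Rightarrow> real" where
  "R_transform \<mu> s = the_inv_into {..<0} (stieltjes \<mu>) (- s) - 1 / s"

definition compactly_supported :: "real measure \<Rightarrow> bool" where
  "compactly_supported \<mu> \<longleftrightarrow> real_distribution \<mu> \<and> (\<exists>K. AE x in \<mu>. \<bar>x\<bar> \<le> K)"

(* The joint law of two elements a, b of a noncommutative probability space is given by the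
   values m w of the state on all words w in a and b; False stands for the letter a and True
   for b. For a list of pairs (i, p), joint_moment m computes, by multilinearity, the value of
   the state on the product of the elements p(a) (i = False) or p(b) (i = True) in that order. *)
fun joint_moment :: "(bool list \<Rightarrow> real) \<Rightarrow> (bool \<times> real poly) list \<Rightarrow> real" where
  "joint_moment m [] = m []"
| "joint_moment m ((i, p) # ps) =
     (\<Sum>k\<le>degree p. coeff p k * joint_moment (\<lambda>w. m (replicate k i @ w)) ps)"

(* Freeness of the unital algebras generated by a and by b: alternating products of centred
   elements are centred. *)
definition free_joint_law :: "(bool list \<Rightarrow> real) \<Rightarrow> bool" where
  "free_joint_law m \<longleftrightarrow> m [] = 1 \<and>
     (\<forall>ps. ps \<noteq> [] \<longrightarrow> distinct_adj (map fst ps) \<longrightarrow>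
        (\<forall>ip \<in> set ps. joint_moment m [ip] = 0) \<longrightarrow> joint_moment m ps = 0)"

(* \<rho> is the distribution of a + b for free a, b with distributions \<mu>, \<nu>; the n-th moment of
   a + b is the sum of m over all words of length n. Freeness and the marginals determine m, and
   a compactly supported distribution is determined by its moments, so \<rho> is unique. *)
definition is_free_additive_convolution ::
  "real measure \<Rightarrow> real measure \<Rightarrow> real measure \<Rightarrow> bool" where
  "is_free_additive_convolution \<mu> \<nu> \<rho> \<longleftrightarrow>
     compactly_supported \<mu> \<and> compactly_supported \<nu> \<and> compactly_supported \<rho> \<and>
     (\<exists>m. free_joint_law m \<and>
        (\<forall>n. m (replicate n False) = (LINT x|\<mu>. x ^ n)) \<and>
        (\<forall>n. m (replicate n True) = (LINT x|\<nu>. x ^ n)) \<and>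
        (\<forall>n. (LINT x|\<rho>. x ^ n) = (\<Sum>w | length w = n. m w)))"

end

(* Write A' = O^T A O and G = (A' + B)^(-1). Rotating O along Cayley rotations generated by
   x y^T - y x^T and using the right invariance of the Haar law gives Schwinger-Dyson identities:
   for every word W in A', B, G, the quantity Y obtained by pairing the left part of the
   derivative of W with fixed vectors and the right part with the normalised trace has mean O(1/N).
   Integrating Y^(2k) by parts in the same way bounds E Y^(2k) by C E Y^(2k-2) / N, so no separate
   concentration inequality is needed; with k large, Borel-Cantelli gives Y -> 0 almost surely,
   even uniformly over the polynomially many rank one terms of K.

   For words in A' and B alone this says that the free difference quotient of the trace state
   vanishes in the limit, hence A' and B are asymptotically free and g = tr G / N tends to chi.
   For the words A'^k G it yields the subordination equation, which identifies the limit of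
   tr (A' G) / tr G with R_A(-chi) = -zstar. Finally, for W = G and x = (B - zstar)^(-1) u the
   number Y equals v^T (G - (B - zstar)^(-1)) u times g, up to an error of the order of
   tr (A' G) / tr G + zstar. *)
theory Submission
  imports Defs "HOL-Computational_Algebra.Fundamental_Theorem_Algebra"
begin

section \<open>Asymptotic freeness from the free difference quotient\<close>

text \<open>\<open>A\<close>, \<open>B\<close> and the test vectors are random and may depend on one
  another. Every moment estimate therefore integrates over the Haar matrix alone, with the other
  data frozen, and its constant involves only the word, the moment order and a bound \<kappa> on
  norms and inverses. The bounds on the spectra hold only eventually and with constants that vary
  with the realisation; \<kappa> and the accuracies range over natural numbers, which leaves
  countably many exceptional sets, and \<kappa> is fixed once a realisation is chosen. Cayley
  rotations stay orthogonal for every t and are rational in t, so no matrix exponential is involved.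
  The trace in Y arises from closing the right end of the word by unit vectors e_j, rotating along x
  e_j^T - e_j x^T and summing over j; the transposed half of the generator yields an error of order
  1/N.\<close>

definition linext :: "(nat \<Rightarrow> real) \<Rightarrow> real poly \<Rightarrow> real" where
  "linext T p = (\<Sum>k\<le>degree p. coeff p k * T k)"

lemma linext_bound: "degree p \<le> d \<Longrightarrow> linext T p = (\<Sum>k\<le>d. coeff p k * T k)"
  unfolding linext_def by (rule sum.mono_neutral_left) (auto simp: coeff_eq_0)

lemma linext_add_poly: "linext T (p + q) = linext T p + linext T q"
proof -
  let ?d = "max (degree p) (degree q)"
  have "linext T (p + q) = (\<Sum>k\<le>?d. coeff (p + q) k * T k)"
    by (rule linext_bound) (rule degree_add_le_max)
  moreover have "linext T p = (\<Sum>k\<le>?d. coeff p k * T k)" by (rule linext_bound) simp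
  moreover have "linext T q = (\<Sum>k\<le>?d. coeff q k * T k)" by (rule linext_bound) simp
  ultimately show ?thesis by (simp add: sum.distrib[symmetric] algebra_simps)
qed

lemma linext_smult_poly: "linext T (Polynomial.smult c p) = c * linext T p"
proof -
  have "linext T (Polynomial.smult c p) = (\<Sum>k\<le>degree p. coeff (Polynomial.smult c p) k * T k)"
    by (rule linext_bound) (rule degree_smult_le)
  then show ?thesis by (simp add: linext_def sum_distrib_left mult.assoc)
qed

lemma linext_zero [simp]: "linext T 0 = 0" by (simp add: linext_def)

lemma linext_const [simp]: "linext T [:c:] = c * T 0" by (simp add: linext_def)

lemma linext_pCons: "linext T (pCons a p) = a * T 0 + linext (\<lambda>k. T (Suc k)) p"
proof -
  have "linext T (pCons a p) = (\<Sum>k\<le>Suc (degree p). coeff (pCons a p) k * T k)"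
    by (rule linext_bound) (rule degree_pCons_le)
  also have "\<dots> = a * T 0 + (\<Sum>k\<le>degree p. coeff p k * T (Suc k))"
    by (subst sum.atMost_Suc_shift) simp
  finally show ?thesis by (simp add: linext_def)
qed

lemma linext_monom: "linext T (monom 1 k) = T k"
proof -
  have "linext T (monom 1 k) = (\<Sum>j\<le>k. coeff (monom 1 k) j * T j)"
    by (rule linext_bound) (rule degree_monom_le)
  also have "\<dots> = (\<Sum>j\<le>k. if k = j then T j else 0)"
    by (rule sum.cong) auto
  finally show ?thesis by simp
qed

lemma linext_zero_fun [simp]: "linext (\<lambda>k. 0) p = 0" by (simp add: linext_def)

lemma linext_add: "linext (\<lambda>k. S k + T k) p = linext S p + linext T p"
  by (simp add: linext_def sum.distrib algebra_simps)

lemma linext_diff: "linext (\<lambda>k. S k - T k) p = linext S p - linext T p"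
  by (simp add: linext_def sum_subtractf algebra_simps)

lemma linext_cmult: "linext (\<lambda>k. c * T k) p = c * linext T p"
  by (simp add: linext_def sum_distrib_left algebra_simps)

lemma linext_sum: "linext (\<lambda>k. \<Sum>j\<in>S. T j k) p = (\<Sum>j\<in>S. linext (T j) p)"
  unfolding linext_def sum_distrib_left by (rule sum.swap)

lemma linext_swap: "linext (\<lambda>k. linext (T k) q) p = linext (\<lambda>l. linext (\<lambda>k. T k l) p) q"
proof -
  have "linext (\<lambda>k. linext (T k) q) p
      = (\<Sum>k\<le>degree p. \<Sum>l\<le>degree q. coeff p k * (coeff q l * T k l))"
    by (simp add: linext_def sum_distrib_left)
  also have "\<dots> = (\<Sum>l\<le>degree q. \<Sum>k\<le>degree p. coeff p k * (coeff q l * T k l))"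
    by (rule sum.swap)
  finally show ?thesis by (simp add: linext_def sum_distrib_left algebra_simps)
qed

lemma linext_mult_poly: "linext T (p * q) = linext (\<lambda>k. linext (\<lambda>l. T (k + l)) q) p"
  by (induction p arbitrary: T)
     (simp_all add: linext_pCons linext_add_poly linext_smult_poly)

lemma tendsto_linext:
  "(\<And>k. ((\<lambda>N. T N k) \<longlongrightarrow> S k) F) \<Longrightarrow> ((\<lambda>N. linext (T N) p) \<longlongrightarrow> linext S p) F"
  unfolding linext_def by (intro tendsto_intros)

section \<open>Multilinearity and traciality of \<open>joint_moment\<close>\<close>

lemma joint_moment_Cons:
  "joint_moment m ((i, p) # ps) = linext (\<lambda>k. joint_moment (\<lambda>w. m (replicate k i @ w)) ps) p"
  by (simp add: linext_def)

declare joint_moment.simps(2) [simp del]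

lemma joint_moment_add:
  "joint_moment (\<lambda>w. f w + g w) ps = joint_moment f ps + joint_moment g ps"
  by (induction ps arbitrary: f g) (auto simp: joint_moment_Cons linext_add)

lemma joint_moment_diff:
  "joint_moment (\<lambda>w. f w - g w) ps = joint_moment f ps - joint_moment g ps"
  by (induction ps arbitrary: f g) (auto simp: joint_moment_Cons linext_diff)

lemma joint_moment_cmult: "joint_moment (\<lambda>w. c * f w) ps = c * joint_moment f ps"
  by (induction ps arbitrary: f) (auto simp: joint_moment_Cons linext_cmult)

lemma joint_moment_multc: "joint_moment (\<lambda>w. f w * c) ps = joint_moment f ps * c"
  using joint_moment_cmult[of c f ps] by (simp add: mult.commute)

lemma joint_moment_linext:
  "joint_moment (\<lambda>w. linext (\<lambda>k. f k w) p) ps = linext (\<lambda>k. joint_moment (f k) ps) p"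
proof (induction ps arbitrary: f)
  case (Cons a ps)
  then show ?case
    by (cases a) (simp add: joint_moment_Cons linext_swap[of _ p])
qed simp

lemma joint_moment_append:
  "joint_moment m (xs @ ys) = joint_moment (\<lambda>u. joint_moment (\<lambda>v. m (u @ v)) ys) xs"
proof (induction xs arbitrary: m)
  case (Cons a xs)
  then show ?case by (cases a) (simp add: joint_moment_Cons)
qed simp

lemma joint_moment_swap:
  "joint_moment (\<lambda>u. joint_moment (\<lambda>v. f u v) ys) xs
     = joint_moment (\<lambda>v. joint_moment (\<lambda>u. f u v) xs) ys"
proof (induction xs arbitrary: f)
  case (Cons a xs)
  then show ?case by (cases a) (simp add: joint_moment_Cons joint_moment_linext)
qed simp

text \<open>Appending amounts to evaluating two blocks independently, and the order of the two
  evaluations is immaterial; traciality on words therefore lifts to products of polynomials.\<close>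

lemma joint_moment_cyclic:
  assumes "\<And>u v. m (u @ v) = m (v @ u)"
  shows "joint_moment m (xs @ ys) = joint_moment m (ys @ xs)"
proof -
  have "joint_moment m (xs @ ys) = joint_moment (\<lambda>u. joint_moment (\<lambda>v. m (v @ u)) ys) xs"
    unfolding joint_moment_append by (subst assms) (rule refl)
  also have "\<dots> = joint_moment m (ys @ xs)"
    by (subst joint_moment_swap) (simp add: joint_moment_append)
  finally show ?thesis .
qed

lemma tendsto_joint_moment:
  assumes "\<And>w. ((\<lambda>N. M N w) \<longlongrightarrow> m w) F"
  shows "((\<lambda>N. joint_moment (M N) ps) \<longlongrightarrow> joint_moment m ps) F"
  using assms
proof (induction ps arbitrary: M m)
  case (Cons a ps)
  then show ?case by (cases a) (auto simp: joint_moment_Cons intro!: tendsto_linext)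
qed simp

lemma joint_moment_middle_add:
  "joint_moment m (xs @ (i, p + q) # ys)
     = joint_moment m (xs @ (i, p) # ys) + joint_moment m (xs @ (i, q) # ys)"
  by (simp add: joint_moment_append joint_moment_Cons linext_add_poly joint_moment_add)

lemma joint_moment_middle_const:
  "joint_moment m (xs @ (i, [:c:]) # ys) = c * joint_moment m (xs @ ys)"
  by (simp add: joint_moment_append joint_moment_Cons joint_moment_cmult)

lemma joint_moment_middle_mult:
  "joint_moment m (xs @ (i, p) # (i, q) # ys) = joint_moment m (xs @ (i, p * q) # ys)"
  by (simp add: joint_moment_append joint_moment_Cons linext_mult_poly replicate_add)

text \<open>Voiculescu's derivation from liberation theory, which sends the letter a
  (\<open>False\<close>) to a tensor 1 - 1 tensor a and the letter b to 0; \<open>f\<close>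
  evaluates the two tensor legs. If its value under the tensor square of a trace vanishes on all
  words, then a and b are free for that trace.\<close>

fun word_dq :: "(bool list \<Rightarrow> bool list \<Rightarrow> real) \<Rightarrow> bool list \<Rightarrow> real" where
  "word_dq f [] = 0"
| "word_dq f (i # w) =
     (if i then 0 else f [False] w - f [] (False # w)) + word_dq (\<lambda>u v. f (i # u) v) w"

text \<open>Inside a block of equal letters the cut after one letter cancels the cut before the
  next, so only the two ends of the block survive.\<close>

lemma word_dq_replicate_False:
  "word_dq f (replicate k False @ w)
     = f (replicate k False) w - f [] (replicate k False @ w)
       + word_dq (\<lambda>u v. f (replicate k False @ u) v) w"
  by (induction k arbitrary: f) auto

lemma word_dq_replicate_True:
  "word_dq f (replicate k True @ w) = word_dq (\<lambda>u v. f (replicate k True @ u) v) w"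
  by (induction k arbitrary: f) auto

text \<open>The telescoping within powers persists under multilinear extension: a factor p(a)
  contributes the cut behind it minus the cut in front of it, whatever p is, and a factor p(b)
  contributes nothing.\<close>

lemma joint_moment_word_dq:
  "joint_moment (word_dq f) ps = (\<Sum>j<length ps. if fst (ps ! j) then 0 else
      joint_moment (\<lambda>u. joint_moment (f u) (drop (Suc j) ps)) (take (Suc j) ps)
      - joint_moment (\<lambda>u. joint_moment (f u) (drop j ps)) (take j ps))"
proof (induction ps arbitrary: f)
  case (Cons a ps)
  obtain i p where a: "a = (i, p)" by (cases a)
  show ?case
  proof (cases i)
    case True
    have *: "joint_moment (word_dq f) (a # ps)
        = linext (\<lambda>k. joint_moment (word_dq (\<lambda>u v. f (replicate k True @ u) v)) ps) p"
      using True by (simp add: a joint_moment_Cons word_dq_replicate_True)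
    show ?thesis
      unfolding * Cons.IH linext_sum length_Cons sum.lessThan_Suc_shift
      using True
      by (auto simp: a joint_moment_Cons linext_diff[symmetric] intro!: sum.cong)
  next
    case False
    have *: "joint_moment (word_dq f) (a # ps)
        = linext (\<lambda>k. joint_moment (f (replicate k False)) ps) p
          - linext (\<lambda>k. joint_moment (\<lambda>w. f [] (replicate k False @ w)) ps) p
          + linext (\<lambda>k. joint_moment (word_dq (\<lambda>u v. f (replicate k False @ u) v)) ps) p"
      using False
      by (simp add: a joint_moment_Cons word_dq_replicate_False joint_moment_add
          joint_moment_diff linext_add linext_diff)
    show ?thesis
      unfolding * Cons.IH linext_sum length_Cons sum.lessThan_Suc_shift
      using False
      by (auto simp: a joint_moment_Cons linext_diff[symmetric] intro!: sum.cong)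
  qed
qed simp

section \<open>Alternating products and centred factors\<close>

lemma distinct_adj_append_iff2:
  "distinct_adj (xs @ x # y # ys) \<longleftrightarrow> distinct_adj (xs @ [x]) \<and> x \<noteq> y \<and> distinct_adj (y # ys)"
  by (induction xs rule: induct_list012) (auto simp: distinct_adj_Cons)

lemma not_distinct_adj_split:
  "\<not> distinct_adj xs \<Longrightarrow> \<exists>al x bs. xs = al @ x # x # bs"
proof (induction xs rule: induct_list012)
  case (3 x y zs)
  show ?case
  proof (cases "x = y")
    case True
    then show ?thesis by (intro exI[of _ "[]"]) auto
  next
    case False
    then obtain al z bs where "y # zs = al @ z # z # bs" using 3 by auto
    then show ?thesis by (intro exI[of _ "x # al"]) auto
  qed
qed auto

lemma distinct_adj_take: "distinct_adj xs \<Longrightarrow> distinct_adj (take k xs)"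
  by (metis append_take_drop_id distinct_adj_append_iff)

lemma distinct_adj_drop: "distinct_adj xs \<Longrightarrow> distinct_adj (drop k xs)"
  by (metis append_take_drop_id distinct_adj_append_iff)

lemma free_joint_law_alternating:
  assumes "free_joint_law m" "ps \<noteq> []" "distinct_adj (map fst ps)"
    "\<And>ip. ip \<in> set ps \<Longrightarrow> joint_moment m [ip] = 0"
  shows "joint_moment m ps = 0"
  using assms unfolding free_joint_law_def by blast

lemma joint_moment_center:
  assumes "m [] = 1"
  shows "joint_moment m [(i, p - [:joint_moment m [(i, p)]:])] = 0"
proof -
  have "joint_moment m ([] @ (i, (p - [:joint_moment m [(i, p)]:]) + [:joint_moment m [(i, p)]:]) # [])
     = joint_moment m [(i, p - [:joint_moment m [(i, p)]:])] + joint_moment m [(i, p)] * m []"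
    unfolding joint_moment_middle_add joint_moment_middle_const by simp
  then show ?thesis using assms by simp
qed

text \<open>A tracial family of functionals whose free difference quotient vanishes asymptotically is
  asymptotically free: on an alternating centred product, the quotient at the first letter
  reproduces the product itself, and every other term has a shorter alternating factor.\<close>
lemma asymptotic_freeness:
  fixes M :: "nat \<Rightarrow> bool list \<Rightarrow> real"
  assumes free: "free_joint_law m"
    and cyclic: "\<And>N u v. M N (u @ v) = M N (v @ u)"
    and dq: "\<And>w. (\<lambda>N. word_dq (\<lambda>u v. M N u * M N v) w) \<longlonglongrightarrow> 0"
    and marginal: "\<And>i k. (\<lambda>N. M N (replicate k i)) \<longlonglongrightarrow> m (replicate k i)"
  shows "(\<lambda>N. M N w) \<longlonglongrightarrow> m w"
proof -
  have m1: "m [] = 1" using free by (simp add: free_joint_law_def)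
  have M1: "(\<lambda>N. M N []) \<longlonglongrightarrow> 1" using marginal[of 0 True] m1 by simp
  \<comment> \<open>Strong induction on the number of factors: shorter products converge whatever
    their indices and centring.\<close>
  have main: "length ps = n \<Longrightarrow> (\<lambda>N. joint_moment (M N) ps) \<longlonglongrightarrow> joint_moment m ps" for ps n
  proof (induction n arbitrary: ps rule: less_induct)
    case (less n)
    have IH: "(\<lambda>N. joint_moment (M N) qs) \<longlonglongrightarrow> joint_moment m qs" if "length qs < n" for qs
      using less.IH[OF that] by simp
    consider "n = 0" | "n = 1" | "n \<ge> 2" by linarith
    then show ?case
    proof cases
      case 1
      then show ?thesis using less.prems M1 m1 by simp
    next
      case 2
      then obtain i p where ps: "ps = [(i, p)]" using less.prems
        by (cases ps) (auto simp: length_Suc_conv)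
      show ?thesis by (simp add: ps joint_moment_Cons tendsto_linext marginal)
    next
      case 3
      \<comment> \<open>Only this pattern is settled by the difference quotient. A leading a-factor
        yields the term that contains the whole product; a final a-factor would yield it again with
        the opposite sign, hence the demand for a b-factor at the end.\<close>
      have alt1: "(\<lambda>N. joint_moment (M N) qs) \<longlonglongrightarrow> 0"
        if qs: "length qs = n" "distinct_adj (map fst qs)" "\<forall>ip\<in>set qs. joint_moment m [ip] = 0"
          "\<not> fst (hd qs)" "fst (last qs)" for qs
      proof -
        define trm where "trm N j = joint_moment (M N) (take (Suc j) qs) * joint_moment (M N) (drop (Suc j) qs)
              - joint_moment (M N) (take j qs) * joint_moment (M N) (drop j qs)" for N j
        have dqe: "joint_moment (word_dq (\<lambda>u v. M N u * M N v)) qs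
            = (\<Sum>j<length qs. if fst (qs ! j) then 0 else trm N j)" for N
          unfolding joint_moment_word_dq joint_moment_cmult joint_moment_multc trm_def ..
        have "(\<lambda>N. joint_moment (word_dq (\<lambda>u v. M N u * M N v)) qs) \<longlonglongrightarrow> joint_moment (\<lambda>w. 0) qs"
          by (rule tendsto_joint_moment) (rule dq)
        moreover have "joint_moment (\<lambda>w. 0) qs = 0" using joint_moment_cmult[of 0 "\<lambda>w. 0" qs] by simp
        ultimately have lim0: "(\<lambda>N. \<Sum>j<n. if fst (qs ! j) then 0 else trm N j) \<longlonglongrightarrow> 0"
          unfolding dqe qs(1) by simp
        have zero: "joint_moment m (take k qs) = 0" if "0 < k" "k \<le> n" for k
          by (rule free_joint_law_alternating[OF free])
             (use that qs in \<open>auto simp: take_map[symmetric] distinct_adj_take dest: in_set_takeD\<close>)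
        have zero': "joint_moment m (drop k qs) = 0" if "k < n" for k
          by (rule free_joint_law_alternating[OF free])
             (use that qs in \<open>auto simp: drop_map[symmetric] distinct_adj_drop dest: in_set_dropD\<close>)
        have tz: "(\<lambda>N. if fst (qs ! j) then 0 else trm N j) \<longlonglongrightarrow> 0" if j: "0 < j" "j < n" for j
        proof (cases "fst (qs ! j)")
          case False
          have "j \<noteq> n - 1" using False qs(1,5) 3 by (metis last_conv_nth list.size(3) not_numeral_le_zero)
          then have jn: "Suc j < n" using j by simp
          have "(\<lambda>N. trm N j) \<longlonglongrightarrow>
               joint_moment m (take (Suc j) qs) * joint_moment m (drop (Suc j) qs)
              - joint_moment m (take j qs) * joint_moment m (drop j qs)"
            unfolding trm_def by (intro tendsto_intros IH) (use jn j qs(1) in auto)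
          then show ?thesis using False zero[of j] zero[of "Suc j"] j jn by simp
        qed simp
        obtain n' where n': "n = Suc n'" using 3 by (cases n) auto
        have "(\<lambda>N. (\<Sum>j<n. if fst (qs ! j) then 0 else trm N j)
             - (\<Sum>j<n'. if fst (qs ! Suc j) then 0 else trm N (Suc j))) \<longlonglongrightarrow> 0 - (\<Sum>j<n'. 0)"
          by (intro tendsto_diff lim0 tendsto_sum tz) (auto simp: n')
        moreover have "(\<Sum>j<n. if fst (qs ! j) then 0 else trm N j)
             - (\<Sum>j<n'. if fst (qs ! Suc j) then 0 else trm N (Suc j)) = trm N 0" for N
          unfolding n' sum.lessThan_Suc_shift using qs(4) qs(1) n' by (cases qs) auto
        ultimately have t0: "(\<lambda>N. trm N 0) \<longlonglongrightarrow> 0" by simp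
        have "(\<lambda>N. joint_moment (M N) (take (Suc 0) qs) * joint_moment (M N) (drop (Suc 0) qs) - trm N 0)
             \<longlonglongrightarrow> joint_moment m (take (Suc 0) qs) * joint_moment m (drop (Suc 0) qs) - 0"
          by (intro tendsto_intros IH t0) (use 3 qs(1) in auto)
        moreover have "joint_moment m (take (Suc 0) qs) = 0" using zero[of "Suc 0"] 3 by simp
        ultimately have "(\<lambda>N. M N [] * joint_moment (M N) qs) \<longlonglongrightarrow> 0"
          by (simp add: trm_def)
        \<comment> \<open>Only the limit of \<open>M N []\<close> is known to be 1, so this factor
          has to be divided away.\<close>
        then have "(\<lambda>N. (M N [] * joint_moment (M N) qs) / M N []) \<longlonglongrightarrow> 0 / 1"
          by (intro tendsto_divide M1) auto
        moreover have "\<forall>\<^sub>F N in sequentially. M N [] \<noteq> 0"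
          using M1 by (rule tendsto_imp_eventually_ne) simp
        then have "\<forall>\<^sub>F N in sequentially. (M N [] * joint_moment (M N) qs) / M N [] = joint_moment (M N) qs"
          by eventually_elim simp
        ultimately show ?thesis by (simp add: tendsto_cong)
      qed
      have alt: "(\<lambda>N. joint_moment (M N) qs) \<longlonglongrightarrow> joint_moment m qs"
        if qs: "length qs = n" "distinct_adj (map fst qs)" "\<forall>ip\<in>set qs. joint_moment m [ip] = 0" for qs
      proof -
        have ne: "qs \<noteq> []" using qs(1) 3 by auto
        have m0: "joint_moment m qs = 0"
          using free_joint_law_alternating[OF free ne qs(2)] qs(3) by blast
        obtain i p qs' where qs': "qs = (i, p) # qs'" using ne by (cases qs) auto
        have "qs' \<noteq> []" using qs' qs(1) 3 by auto
        then obtain mid j q where mid: "qs' = mid @ [(j, q)]" by (cases qs' rule: rev_cases) auto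
        show ?thesis
        proof (cases "i = j")
          \<comment> \<open>Equal end factors are merged by traciality into q * p, which leaves
            fewer factors. The limit is 0 because both the centred and the scalar part of q * p give
            alternating centred products.\<close>
          case True
          have da: "distinct_adj (map fst (mid @ [(i, q)]))" "distinct_adj (map fst ((i, p) # mid))"
            using qs(2) unfolding qs' mid True 
            by (auto simp: distinct_adj_Cons distinct_adj_append_iff split: if_splits)
          have mne: "mid \<noteq> []" using qs(2) unfolding qs' mid True by auto
          have dmid: "distinct_adj (map fst mid)" using da(2) by (cases mid) (auto simp: distinct_adj_Cons)
          let ?c = "joint_moment m [(i, q * p)]"
          have eq: "joint_moment f ((i, q * p) # mid)
             = joint_moment f ((i, q * p - [:?c:]) # mid) + ?c * joint_moment f mid" for f
            using joint_moment_middle_add[of f "[]" i "q * p - [:?c:]" "[:?c:]" mid]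
              joint_moment_middle_const[of f "[]" i ?c mid] by simp
          have "joint_moment m mid = 0"
            by (rule free_joint_law_alternating[OF free mne dmid]) (use qs(3) qs' mid in auto)
          moreover have "joint_moment m ((i, q * p - [:?c:]) # mid) = 0"
          proof (rule free_joint_law_alternating[OF free])
            show "distinct_adj (map fst ((i, q * p - [:?c:]) # mid))" using da(2) by simp
            fix ip assume "ip \<in> set ((i, q * p - [:?c:]) # mid)"
            then show "joint_moment m [ip] = 0"
              using qs(3) qs' mid joint_moment_center[where m=m, OF m1, of i "q * p"] by auto
          qed simp
          ultimately have z: "joint_moment m ((i, q * p) # mid) = 0" unfolding eq[of m] by simp
          have "joint_moment (M N) qs = joint_moment (M N) ((i, q * p) # mid)" for N
            using joint_moment_cyclic[of "M N" "(i,p) # mid" "[(i,q)]", OF cyclic]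
              joint_moment_middle_mult[of "M N" "[]" i q p mid] unfolding qs' mid True by simp
          moreover have "(\<lambda>N. joint_moment (M N) ((i, q * p) # mid)) \<longlonglongrightarrow> joint_moment m ((i, q * p) # mid)"
            by (rule IH) (use qs(1) qs' mid in auto)
          ultimately show ?thesis using z m0 by simp
        next
          case False
          show ?thesis
          proof (cases i)
            case False
            then show ?thesis unfolding m0 using alt1[OF qs] qs' mid \<open>i \<noteq> j\<close> by simp
          next
            case True
            \<comment> \<open>The leading b-factor is moved to the end, which produces the pattern
              of \<open>alt1\<close>.\<close>
            let ?qs = "mid @ [(j, q)] @ [(i, p)]"
            have "distinct_adj (i # (map fst mid @ [j]))"
              using qs(2) unfolding qs' mid by simp
            then have "distinct_adj (map fst mid @ [j])" by (rule distinct_adj_ConsD)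
            then have "distinct_adj (map fst ?qs)"
              using \<open>i \<noteq> j\<close> by (simp add: distinct_adj_append_iff2)
            then have "(\<lambda>N. joint_moment (M N) ?qs) \<longlonglongrightarrow> 0"
              using alt1[of ?qs] qs True \<open>i \<noteq> j\<close> unfolding qs' mid
              by (cases mid) (auto simp: distinct_adj_Cons)
            moreover have "joint_moment (M N) ?qs = joint_moment (M N) qs" for N
              using joint_moment_cyclic[of "M N" "[(i,p)]" "mid @ [(j,q)]", OF cyclic]
              unfolding qs' mid by simp
            ultimately show ?thesis unfolding m0 by simp
          qed
        qed
      qed
      \<comment> \<open>Factors are centred one at a time from the right: \<open>ys\<close> is
        centred already, \<open>xs\<close> is still arbitrary. Removing the mean of a factor costs a
        product with one factor fewer, which \<open>IH\<close> covers even if it is no longer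
        alternating.\<close>
      have alt2: "(\<lambda>N. joint_moment (M N) (xs @ ys)) \<longlonglongrightarrow> joint_moment m (xs @ ys)"
        if "length (xs @ ys) = n" "distinct_adj (map fst (xs @ ys))" "\<forall>ip\<in>set ys. joint_moment m [ip] = 0"
        for xs ys
        using that
      proof (induction xs arbitrary: ys rule: rev_induct)
        case Nil
        then show ?case using alt by simp
      next
        case (snoc a xs)
        obtain i p where a: "a = (i, p)" by (cases a)
        let ?c = "joint_moment m [(i, p)]"
        have eq: "joint_moment f ((xs @ [a]) @ ys)
             = joint_moment f (xs @ (i, p - [:?c:]) # ys) + ?c * joint_moment f (xs @ ys)" for f
          using joint_moment_middle_add[of f xs i "p - [:?c:]" "[:?c:]" ys]
            joint_moment_middle_const[of f xs i ?c ys] by (simp add: a)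
        show ?case unfolding eq
          by (intro tendsto_intros IH snoc.IH)
             (use snoc.prems joint_moment_center[where m=m, OF m1, of i p] in \<open>auto simp: a\<close>)
      qed
      show ?thesis
      proof (cases "distinct_adj (map fst ps)")
        case True
        then show ?thesis using alt2[of ps "[]"] less.prems by simp
      next
        case False
        then obtain al x bs where eq: "map fst ps = al @ x # x # bs"
          using not_distinct_adj_split by blast
        then obtain xs p q ys where ps: "ps = xs @ (x, p) # (x, q) # ys"
          by (auto simp: map_eq_append_conv map_eq_Cons_conv)
        show ?thesis unfolding ps joint_moment_middle_mult
          by (rule IH) (use ps less.prems in auto)
      qed
    qed
  qed
  \<comment> \<open>A word is the product of its letters, each read as the polynomial X.\<close>
  define ps where "ps = map (\<lambda>i. (i, monom 1 1 :: real poly)) w"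
  have "joint_moment f (map (\<lambda>i. (i, monom 1 1 :: real poly)) w) = f w" for f
    by (induction w arbitrary: f) (auto simp: joint_moment_Cons linext_monom[of _ 1, simplified])
  then show ?thesis using main[of ps "length ps"] by (simp add: ps_def)
qed

section \<open>Words in matrices\<close>

text \<open>Matrices are functions of two indices of which only those below the explicit dimension matter.\<close>
type_synonym fmat = "nat \<Rightarrow> nat \<Rightarrow> real"
type_synonym fvec = "nat \<Rightarrow> real"

text \<open>\<open>fid j\<close> doubles as the j-th unit vector.\<close>

definition fid :: fmat where "fid i j = (if i = j then 1 else 0)"
definition fmul :: "nat \<Rightarrow> fmat \<Rightarrow> fmat \<Rightarrow> fmat" where "fmul n M K i j = (\<Sum>k<n. M i k * K k j)"
definition ip :: "nat \<Rightarrow> fvec \<Rightarrow> fvec \<Rightarrow> real" where "ip n a b = (\<Sum>i<n. a i * b i)"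
definition mvec :: "nat \<Rightarrow> fmat \<Rightarrow> fvec \<Rightarrow> fvec" where "mvec n M b i = (\<Sum>j<n. M i j * b j)"
definition vmat :: "nat \<Rightarrow> fvec \<Rightarrow> fmat \<Rightarrow> fvec" where "vmat n a M j = (\<Sum>i<n. a i * M i j)"
definition bform :: "nat \<Rightarrow> fvec \<Rightarrow> fmat \<Rightarrow> fvec \<Rightarrow> real" where
  "bform n a M b = (\<Sum>i<n. \<Sum>j<n. a i * M i j * b j)"
definition vnorm :: "nat \<Rightarrow> fvec \<Rightarrow> real" where "vnorm n a = L2_set a {..<n}"
text \<open>An operator norm bound in terms of the form; it passes to products, conjugates and
  inverses without a supremum.\<close>

definition opbound :: "nat \<Rightarrow> real \<Rightarrow> fmat \<Rightarrow> bool" where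
  "opbound n c M \<longleftrightarrow> (\<forall>a b. \<bar>bform n a M b\<bar> \<le> c * vnorm n a * vnorm n b)"

section \<open>Bilinear forms and norm bounds\<close>

lemma bform_eq_ip_mvec: "bform n a M b = ip n a (mvec n M b)"
  by (simp add: bform_def ip_def mvec_def sum_distrib_left mult.assoc)

lemma bform_eq_ip_vmat: "bform n a M b = ip n (vmat n a M) b"
  unfolding bform_def ip_def vmat_def sum_distrib_right by (rule sum.swap)

lemma mvec_fmul: "mvec n (fmul n M K) b = mvec n M (mvec n K b)"
proof
  fix i
  have "mvec n (fmul n M K) b i = (\<Sum>j<n. \<Sum>k<n. M i k * (K k j * b j))"
    by (simp add: mvec_def fmul_def sum_distrib_right mult.assoc)
  also have "\<dots> = (\<Sum>k<n. \<Sum>j<n. M i k * (K k j * b j))" by (rule sum.swap)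
  finally show "mvec n (fmul n M K) b i = mvec n M (mvec n K b) i"
    by (simp add: mvec_def sum_distrib_left)
qed

lemma fmul_assoc: "fmul n (fmul n M K) L = fmul n M (fmul n K L)"
proof (intro ext)
  fix i j
  have "fmul n (fmul n M K) L i j = (\<Sum>k<n. \<Sum>l<n. M i l * (K l k * L k j))"
    by (simp add: fmul_def sum_distrib_right mult.assoc)
  also have "\<dots> = (\<Sum>l<n. \<Sum>k<n. M i l * (K l k * L k j))" by (rule sum.swap)
  finally show "fmul n (fmul n M K) L i j = fmul n M (fmul n K L) i j"
    by (simp add: fmul_def sum_distrib_left)
qed

lemma bform_fmul_mvec: "bform n a (fmul n M K) b = bform n a M (mvec n K b)"
  by (simp add: bform_eq_ip_mvec mvec_fmul)

lemma bform_fmul_vmat: "bform n a (fmul n M K) b = bform n (vmat n a M) K b"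
  by (simp add: bform_fmul_mvec bform_eq_ip_vmat[of n a M] bform_eq_ip_mvec[of n _ K])

lemma sum_fid_left [simp]: "i < n \<Longrightarrow> (\<Sum>k<n. fid i k * f k) = f i"
  by (simp add: fid_def if_distrib[where f="\<lambda>x. x * _"] cong: if_cong)

lemma sum_fid_left' [simp]: "i < n \<Longrightarrow> (\<Sum>k<n. fid k i * f k) = f i"
  by (simp add: fid_def if_distrib[where f="\<lambda>x. x * _"] cong: if_cong)

lemma sum_fid_right [simp]: "j < n \<Longrightarrow> (\<Sum>k<n. f k * fid k j) = f j"
  by (simp add: fid_def if_distrib[where f="\<lambda>x. _ * x"] cong: if_cong)

lemma sum_fid_right' [simp]: "j < n \<Longrightarrow> (\<Sum>k<n. f k * fid j k) = f j"
  by (simp add: fid_def if_distrib[where f="\<lambda>x. _ * x"] cong: if_cong)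

lemma fid_sym: "fid i j = fid j i" by (simp add: fid_def)

lemma bform_fid: "bform n a fid b = ip n a b"
  by (simp add: bform_eq_ip_mvec ip_def mvec_def)

lemma bform_unit: "i < n \<Longrightarrow> j < n \<Longrightarrow> bform n (fid i) M (fid j) = M i j"
  by (simp add: bform_eq_ip_mvec ip_def mvec_def)

lemma bform_cong:
  "(\<And>i. i < n \<Longrightarrow> a i = a' i) \<Longrightarrow> (\<And>i j. i < n \<Longrightarrow> j < n \<Longrightarrow> M i j = M' i j)
    \<Longrightarrow> (\<And>i. i < n \<Longrightarrow> b i = b' i) \<Longrightarrow> bform n a M b = bform n a' M' b'"
  by (simp add: bform_def)

lemma bform_left_sum: "(\<Sum>k<n. z k * bform n (fid k) M b) = bform n z M b"
proof -
  have "(\<Sum>k<n. z k * bform n (fid k) M b) = (\<Sum>k<n. z k * mvec n M b k)"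
    by (rule sum.cong) (auto simp: bform_eq_ip_mvec ip_def)
  then show ?thesis by (simp add: bform_eq_ip_mvec ip_def)
qed

lemma bform_right_sum: "(\<Sum>k<n. z k * bform n a M (fid k)) = bform n a M z"
proof -
  have "(\<Sum>k<n. z k * bform n a M (fid k)) = (\<Sum>k<n. z k * vmat n a M k)"
    by (rule sum.cong) (auto simp: bform_eq_ip_vmat ip_def)
  then show ?thesis by (simp add: bform_eq_ip_vmat ip_def mult.commute)
qed

lemma vnorm_nonneg [simp]: "0 \<le> vnorm n a" by (simp add: vnorm_def L2_set_nonneg)

lemma vnorm_sq: "(vnorm n a)\<^sup>2 = ip n a a"
  by (simp add: vnorm_def L2_set_def ip_def sum_nonneg power2_eq_square)

lemma vnorm_fid [simp]: "j < n \<Longrightarrow> vnorm n (fid j) = 1"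
  by (simp add: vnorm_def L2_set_def power2_eq_square) (simp add: fid_def)

lemma ip_le: "\<bar>ip n a b\<bar> \<le> vnorm n a * vnorm n b"
proof -
  have "\<bar>ip n a b\<bar> \<le> (\<Sum>i<n. \<bar>a i\<bar> * \<bar>b i\<bar>)"
    unfolding ip_def by (rule order_trans[OF sum_abs]) (simp add: abs_mult)
  also have "\<dots> \<le> vnorm n a * vnorm n b" unfolding vnorm_def by (rule L2_set_mult_ineq)
  finally show ?thesis .
qed

lemma opbound_fid: "opbound n 1 fid"
  using ip_le by (simp add: opbound_def bform_fid)

lemma opboundD: "opbound n c M \<Longrightarrow> \<bar>bform n a M b\<bar> \<le> c * vnorm n a * vnorm n b"
  by (simp add: opbound_def)

text \<open>The form is tested against M b itself, and one factor of its norm is cancelled.\<close>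

lemma vnorm_mvec:
  assumes "opbound n c M" "0 \<le> c" shows "vnorm n (mvec n M b) \<le> c * vnorm n b"
proof (cases "vnorm n (mvec n M b) = 0")
  case False
  then have p: "vnorm n (mvec n M b) > 0" using vnorm_nonneg[of n "mvec n M b"] by linarith
  have "(vnorm n (mvec n M b))\<^sup>2 = bform n (mvec n M b) M b"
    by (simp add: vnorm_sq bform_eq_ip_mvec)
  also have "\<dots> \<le> c * vnorm n (mvec n M b) * vnorm n b" using opboundD[OF assms(1)] abs_le_D1 by blast
  finally have "vnorm n (mvec n M b) * vnorm n (mvec n M b) \<le> vnorm n (mvec n M b) * (c * vnorm n b)"
    by (simp add: power2_eq_square mult_ac)
  then show ?thesis using p by simp
qed (use assms in simp)

lemma vnorm_vmat:
  assumes "opbound n c M" "0 \<le> c" shows "vnorm n (vmat n a M) \<le> c * vnorm n a"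
proof (cases "vnorm n (vmat n a M) = 0")
  case False
  then have p: "vnorm n (vmat n a M) > 0" using vnorm_nonneg[of n "vmat n a M"] by linarith
  have "(vnorm n (vmat n a M))\<^sup>2 = bform n a M (vmat n a M)"
    by (simp add: vnorm_sq bform_eq_ip_vmat)
  also have "\<dots> \<le> c * vnorm n a * vnorm n (vmat n a M)" using opboundD[OF assms(1)] abs_le_D1 by blast
  finally have "vnorm n (vmat n a M) * vnorm n (vmat n a M) \<le> vnorm n (vmat n a M) * (c * vnorm n a)"
    by (simp add: power2_eq_square mult_ac)
  then show ?thesis using p by simp
qed (use assms in simp)

lemma opbound_fmul:
  assumes "opbound n c M" "opbound n d K" "0 \<le> c" "0 \<le> d" shows "opbound n (c * d) (fmul n M K)"
  unfolding opbound_def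
proof (intro allI)
  fix a b
  have "\<bar>bform n a (fmul n M K) b\<bar> \<le> c * vnorm n a * vnorm n (mvec n K b)"
    unfolding bform_fmul_mvec by (rule opboundD[OF assms(1)])
  also have "\<dots> \<le> c * vnorm n a * (d * vnorm n b)"
    by (intro mult_left_mono vnorm_mvec assms) (use assms in auto)
  finally show "\<bar>bform n a (fmul n M K) b\<bar> \<le> c * d * vnorm n a * vnorm n b" by (simp add: mult_ac)
qed

text \<open>In the application the letters stand for the conjugate \<open>V\<^sup>T A V\<close>, for \<open>B\<close>, and for the inverse of their sum.\<close>
datatype letter = LA | LB | LG

primrec wmat :: "nat \<Rightarrow> (letter \<Rightarrow> fmat) \<Rightarrow> letter list \<Rightarrow> fmat" where
  "wmat n \<rho> [] = fid"
| "wmat n \<rho> (c # W) = fmul n (\<rho> c) (wmat n \<rho> W)"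

abbreviation wb :: "nat \<Rightarrow> (letter \<Rightarrow> fmat) \<Rightarrow> letter list \<Rightarrow> fvec \<Rightarrow> fvec \<Rightarrow> real" where
  "wb n \<rho> W a b \<equiv> bform n a (wmat n \<rho> W) b"

definition wtr :: "nat \<Rightarrow> (letter \<Rightarrow> fmat) \<Rightarrow> letter list \<Rightarrow> real" where
  "wtr n \<rho> W = (\<Sum>j<n. wb n \<rho> W (fid j) (fid j)) / real n"

lemma wb_Nil: "wb n \<rho> [] a b = ip n a b" by (simp add: bform_fid)

lemma wb_Cons: "wb n \<rho> (c # W) a b = wb n \<rho> W (vmat n a (\<rho> c)) b"
  by (simp add: bform_fmul_vmat)

lemma wb_Cons_sum: "wb n \<rho> (c # W) a b = (\<Sum>i<n. \<Sum>k<n. a i * \<rho> c i k * wb n \<rho> W (fid k) b)"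
proof -
  have "wb n \<rho> (c # W) a b = (\<Sum>k<n. vmat n a (\<rho> c) k * wb n \<rho> W (fid k) b)"
    unfolding wb_Cons bform_left_sum ..
  also have "\<dots> = (\<Sum>k<n. \<Sum>i<n. a i * \<rho> c i k * wb n \<rho> W (fid k) b)"
    by (simp add: vmat_def sum_distrib_right)
  finally show ?thesis by (subst sum.swap)
qed

lemma opbound_wmat:
  assumes "\<And>c. opbound n \<kappa> (\<rho> c)" "0 \<le> \<kappa>"
  shows "opbound n (\<kappa> ^ length W) (wmat n \<rho> W)"
  by (induction W) (auto simp: opbound_fid intro!: opbound_fmul assms zero_le_power)

lemma wtr_le:
  assumes "\<And>c. opbound n \<kappa> (\<rho> c)" "0 \<le> \<kappa>"
  shows "\<bar>wtr n \<rho> W\<bar> \<le> \<kappa> ^ length W"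
proof -
  have "\<bar>\<Sum>j<n. wb n \<rho> W (fid j) (fid j)\<bar> \<le> (\<Sum>j<n. \<kappa> ^ length W)"
  proof (rule order_trans[OF sum_abs sum_mono])
    fix j assume "j \<in> {..<n}"
    moreover have "opbound n (\<kappa> ^ length W) (wmat n \<rho> W)"
      by (rule opbound_wmat) (rule assms)+
    ultimately show "\<bar>wb n \<rho> W (fid j) (fid j)\<bar> \<le> \<kappa> ^ length W"
      using opboundD[of n "\<kappa> ^ length W" "wmat n \<rho> W" "fid j" "fid j"] by simp
  qed
  then show ?thesis using assms(2) by (cases "n = 0") (auto simp: wtr_def field_simps abs_div)
qed

text \<open>The derivation that moves the letter \<open>LA\<close> by a commutator and fixes \<open>LB\<close>; its value on \<open>LG\<close> is
  forced by \<open>LG\<close> being the inverse of \<open>LA + LB\<close>. The arguments of \<open>f\<close> are the two parts into which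
  the derivation cuts the word.\<close>
fun dq :: "(letter list \<Rightarrow> letter list \<Rightarrow> real) \<Rightarrow> letter list \<Rightarrow> real" where
  "dq f [] = 0"
| "dq f (LA # W) = f [LA] W - f [] (LA # W) + dq (\<lambda>u v. f (LA # u) v) W"
| "dq f (LB # W) = dq (\<lambda>u v. f (LB # u) v) W"
| "dq f (LG # W) = f [LG] (LA # LG # W) - f [LG, LA] (LG # W) + dq (\<lambda>u v. f (LG # u) v) W"

lemma dq_zero [simp]: "dq (\<lambda>u v. 0) W = 0"
proof (induction W)
  case (Cons c W) then show ?case by (cases c) auto
qed simp

lemma dq_add: "dq (\<lambda>u v. f u v + g u v) W = dq f W + dq g W"
proof (induction W arbitrary: f g)
  case (Cons c W)
  show ?case by (cases c) (simp_all add: Cons)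
qed simp

lemma dq_cmult: "dq (\<lambda>u v. c * f u v) W = c * dq f W"
proof (induction W arbitrary: f)
  case (Cons d W)
  show ?case by (cases d) (simp_all add: Cons algebra_simps)
qed simp

lemma dq_divide: "dq (\<lambda>u v. f u v / c) W = dq f W / c"
  using dq_cmult[of "inverse c" f W] by (simp add: field_simps)

lemma dq_sum: "dq (\<lambda>u v. \<Sum>j\<in>S. f j u v) W = (\<Sum>j\<in>S. dq (f j) W)"
  by (induction S rule: infinite_finite_induct) (auto simp: dq_add)

text \<open>Each letter contributes at most two cuts. A cut at \<open>LG\<close> makes the two parts
  together two letters longer than the word, whence the 2 in the exponent.\<close>

lemma dq_bound:
  assumes "\<And>u v. \<bar>f u v\<bar> \<le> c * \<kappa> ^ (length u + length v)" "1 \<le> \<kappa>" "0 \<le> c"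
  shows "\<bar>dq f W\<bar> \<le> 2 * real (length W) * c * \<kappa> ^ (length W + 2)"
  using assms(1,3)
proof (induction W arbitrary: f c)
  case (Cons d W)
  have k0: "0 \<le> \<kappa>" using assms(2) by simp
  have IH: "\<bar>dq (\<lambda>u v. f (d # u) v) W\<bar> \<le> 2 * real (length W) * (c * \<kappa>) * \<kappa> ^ (length W + 2)"
    by (rule Cons.IH) (use Cons.prems(1)[of "d # _"] Cons.prems(2) k0 in \<open>auto simp: mult_ac\<close>)
  have pw: "c * \<kappa> ^ m \<le> c * \<kappa> ^ (length W + 3)" if "m \<le> length W + 3" for m
    by (intro mult_left_mono power_increasing that assms Cons.prems)
  have b: "\<bar>f u v\<bar> \<le> c * \<kappa> ^ (length W + 3)" if "length u + length v \<le> length W + 3" for u v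
    using Cons.prems(1)[of u v] pw[OF that] by linarith
  have "\<bar>dq f (d # W)\<bar> \<le> 2 * (c * \<kappa> ^ (length W + 3)) + \<bar>dq (\<lambda>u v. f (d # u) v) W\<bar>"
  proof (cases d)
    case LA
    show ?thesis using b[of "[LA]" W] b[of "[]" "LA # W"] unfolding LA by (simp del: power_Suc)
  next
    case LB
    show ?thesis using Cons.prems(2) k0 unfolding LB by simp
  next
    case LG
    show ?thesis using b[of "[LG]" "LA # LG # W"] b[of "[LG, LA]" "LG # W"] unfolding LG 
      by (simp del: power_Suc)
  qed
  then show ?case using IH by (simp add: algebra_simps power_add numeral_eq_Suc)
qed simp

section \<open>Derivatives along Cayley rotations\<close>

text \<open>The derivative \<open>f'\<close> at time 0 along the flow \<open>T\<close> comes with a uniform second order bound, so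
  that differentiating an invariant integral needs no limit theorem.\<close>
definition diffb :: "'a set \<Rightarrow> (real \<Rightarrow> 'a \<Rightarrow> 'a) \<Rightarrow> ('a \<Rightarrow> real) \<Rightarrow> ('a \<Rightarrow> real) \<Rightarrow> bool" where
  "diffb S T f f' \<longleftrightarrow> (\<exists>c. \<forall>V\<in>S. \<forall>t\<in>{0..1}.
     \<bar>f (T t V) - f V - t * f' V\<bar> \<le> c * t\<^sup>2 \<and> \<bar>f V\<bar> \<le> c \<and> \<bar>f' V\<bar> \<le> c)"

lemma diffbI:
  assumes "\<And>V t. V \<in> S \<Longrightarrow> 0 \<le> t \<Longrightarrow> t \<le> 1 \<Longrightarrow> \<bar>f (T t V) - f V - t * f' V\<bar> \<le> c * t\<^sup>2"
    and "\<And>V. V \<in> S \<Longrightarrow> \<bar>f V\<bar> \<le> d" and "\<And>V. V \<in> S \<Longrightarrow> \<bar>f' V\<bar> \<le> e"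
  shows "diffb S T f f'"
  unfolding diffb_def
proof (intro exI[of _ "max c (max d e)"] ballI conjI)
  fix V and t :: real assume *: "V \<in> S" "t \<in> {0..1}"
  have "\<bar>f (T t V) - f V - t * f' V\<bar> \<le> c * t\<^sup>2" using assms(1)[OF *(1)] *(2) by auto
  also have "\<dots> \<le> max c (max d e) * t\<^sup>2" by (intro mult_right_mono) auto
  finally show "\<bar>f (T t V) - f V - t * f' V\<bar> \<le> max c (max d e) * t\<^sup>2" .
  show "\<bar>f V\<bar> \<le> max c (max d e)" "\<bar>f' V\<bar> \<le> max c (max d e)" using assms(2,3)[OF *(1)] by auto
qed

lemma diffbE:
  assumes "diffb S T f f'"
  obtains c where "0 \<le> c"
    "\<And>V t. V \<in> S \<Longrightarrow> 0 \<le> t \<Longrightarrow> t \<le> 1 \<Longrightarrow> \<bar>f (T t V) - f V - t * f' V\<bar> \<le> c * t\<^sup>2"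
    "\<And>V. V \<in> S \<Longrightarrow> \<bar>f V\<bar> \<le> c" "\<And>V. V \<in> S \<Longrightarrow> \<bar>f' V\<bar> \<le> c"
proof -
  obtain c where c: "\<forall>V\<in>S. \<forall>t\<in>{0..1}.
     \<bar>f (T t V) - f V - t * f' V\<bar> \<le> c * t\<^sup>2 \<and> \<bar>f V\<bar> \<le> c \<and> \<bar>f' V\<bar> \<le> c"
    using assms unfolding diffb_def by blast
  show ?thesis
  proof (rule that[of "max 0 c"])
    show "\<bar>f (T t V) - f V - t * f' V\<bar> \<le> max 0 c * t\<^sup>2" if *: "V \<in> S" "0 \<le> t" "t \<le> 1" for V t
    proof -
      have "\<bar>f (T t V) - f V - t * f' V\<bar> \<le> c * t\<^sup>2" using c * by auto
      also have "\<dots> \<le> max 0 c * t\<^sup>2" by (intro mult_right_mono) auto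
      finally show ?thesis .
    qed
    show "\<bar>f V\<bar> \<le> max 0 c" "\<bar>f' V\<bar> \<le> max 0 c" if "V \<in> S" for V
      using c that by (force simp: le_max_iff_disj)+
  qed simp
qed

lemma diffb_const: "diffb S T (\<lambda>V. k) (\<lambda>V. 0)"
  by (rule diffbI[where c=0 and d="\<bar>k\<bar>" and e=0]) auto

lemma diffb_add:
  assumes "diffb S T f f'" "diffb S T g g'"
  shows "diffb S T (\<lambda>V. f V + g V) (\<lambda>V. f' V + g' V)"
proof -
  obtain c where c: "0 \<le> c" "\<And>V t. V \<in> S \<Longrightarrow> 0 \<le> t \<Longrightarrow> t \<le> 1 \<Longrightarrow> \<bar>f (T t V) - f V - t * f' V\<bar> \<le> c * t\<^sup>2"
    "\<And>V. V \<in> S \<Longrightarrow> \<bar>f V\<bar> \<le> c" "\<And>V. V \<in> S \<Longrightarrow> \<bar>f' V\<bar> \<le> c" using diffbE[OF assms(1)] by metis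
  obtain d where d: "0 \<le> d" "\<And>V t. V \<in> S \<Longrightarrow> 0 \<le> t \<Longrightarrow> t \<le> 1 \<Longrightarrow> \<bar>g (T t V) - g V - t * g' V\<bar> \<le> d * t\<^sup>2"
    "\<And>V. V \<in> S \<Longrightarrow> \<bar>g V\<bar> \<le> d" "\<And>V. V \<in> S \<Longrightarrow> \<bar>g' V\<bar> \<le> d" using diffbE[OF assms(2)] by metis
  show ?thesis
  proof (rule diffbI[where c="c + d" and d="c + d" and e="c + d"])
    fix V t assume *: "V \<in> S" "0 \<le> t" "t \<le> (1::real)"
    show "\<bar>f (T t V) + g (T t V) - (f V + g V) - t * (f' V + g' V)\<bar> \<le> (c + d) * t\<^sup>2"
      using c(2)[OF *] d(2)[OF *] by (simp add: algebra_simps)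
  next
    fix V assume "V \<in> S"
    then show "\<bar>f V + g V\<bar> \<le> c + d" "\<bar>f' V + g' V\<bar> \<le> c + d"
      using c(3,4)[of V] d(3,4)[of V] by auto
  qed
qed

lemma diffb_mult:
  assumes "diffb S T f f'" "diffb S T g g'"
    and T: "\<And>V t. V \<in> S \<Longrightarrow> 0 \<le> t \<Longrightarrow> t \<le> 1 \<Longrightarrow> T t V \<in> S"
  shows "diffb S T (\<lambda>V. f V * g V) (\<lambda>V. f' V * g V + f V * g' V)"
proof -
  obtain c where c: "0 \<le> c" "\<And>V t. V \<in> S \<Longrightarrow> 0 \<le> t \<Longrightarrow> t \<le> 1 \<Longrightarrow> \<bar>f (T t V) - f V - t * f' V\<bar> \<le> c * t\<^sup>2"
    "\<And>V. V \<in> S \<Longrightarrow> \<bar>f V\<bar> \<le> c" "\<And>V. V \<in> S \<Longrightarrow> \<bar>f' V\<bar> \<le> c" using diffbE[OF assms(1)] by metis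
  obtain d where d: "0 \<le> d" "\<And>V t. V \<in> S \<Longrightarrow> 0 \<le> t \<Longrightarrow> t \<le> 1 \<Longrightarrow> \<bar>g (T t V) - g V - t * g' V\<bar> \<le> d * t\<^sup>2"
    "\<And>V. V \<in> S \<Longrightarrow> \<bar>g V\<bar> \<le> d" "\<And>V. V \<in> S \<Longrightarrow> \<bar>g' V\<bar> \<le> d" using diffbE[OF assms(2)] by metis
  have mul: "\<bar>x * y\<bar> \<le> a * b" if "\<bar>x\<bar> \<le> a" "\<bar>y\<bar> \<le> b" for x y a b :: real
    unfolding abs_mult by (intro mult_mono that) (use that in auto)
  show ?thesis
  proof (rule diffbI[where c="4 * c * d" and d="c * d" and e="2 * c * d"])
    fix V t assume *: "V \<in> S" "0 \<le> t" "t \<le> (1::real)"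
    let ?ft = "f (T t V)" and ?gt = "g (T t V)"
    have tf: "\<bar>t * f' V\<bar> \<le> c" using mul[of t 1 "f' V" c] c(4)[OF *(1)] * by simp
    have "?ft * ?gt - f V * g V - t * (f' V * g V + f V * g' V)
      = (?ft - f V - t * f' V) * ?gt + (f V + t * f' V) * (?gt - g V - t * g' V) + t\<^sup>2 * (f' V * g' V)"
      by (simp add: algebra_simps power2_eq_square)
    also have "\<bar>\<dots>\<bar> \<le> (c * t\<^sup>2) * d + (c + c) * (d * t\<^sup>2) + t\<^sup>2 * (c * d)"
    proof -
      have "\<bar>(?ft - f V - t * f' V) * ?gt\<bar> \<le> (c * t\<^sup>2) * d" by (intro mul c d * T)
      moreover have "\<bar>(f V + t * f' V) * (?gt - g V - t * g' V)\<bar> \<le> (c + c) * (d * t\<^sup>2)"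
        by (intro mul d *) (use tf c(3)[OF *(1)] in linarith)
      moreover have "\<bar>t\<^sup>2 * (f' V * g' V)\<bar> \<le> t\<^sup>2 * (c * d)" by (intro mul c d *) auto
      ultimately show ?thesis by linarith
    qed
    finally show "\<bar>?ft * ?gt - f V * g V - t * (f' V * g V + f V * g' V)\<bar> \<le> 4 * c * d * t\<^sup>2"
      by (simp add: algebra_simps)
  next
    fix V assume V: "V \<in> S"
    show "\<bar>f V * g V\<bar> \<le> c * d" by (intro mul c d V)
    show "\<bar>f' V * g V + f V * g' V\<bar> \<le> 2 * c * d"
      using mul[OF c(4)[OF V] d(3)[OF V]] mul[OF c(3)[OF V] d(4)[OF V]] by linarith
  qed
qed

lemma diffb_cong:
  assumes "diffb S T f f'" "\<And>V. V \<in> S \<Longrightarrow> g V = f V" "\<And>V. V \<in> S \<Longrightarrow> g' V = f' V"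
    and T: "\<And>V t. V \<in> S \<Longrightarrow> 0 \<le> t \<Longrightarrow> t \<le> 1 \<Longrightarrow> T t V \<in> S"
  shows "diffb S T g g'"
  using assms(1) unfolding diffb_def using assms(2,3) T by simp

definition outer_skew :: "fvec \<Rightarrow> fvec \<Rightarrow> fmat" where "outer_skew x y i j = x i * y j - y i * x j"

text \<open>Closed form of the Cayley transform of t (x y^T - y x^T); the cube of this skew matrix is a
  multiple of the matrix itself, which makes the inverse explicit.\<close>
definition cayley :: "nat \<Rightarrow> fvec \<Rightarrow> fvec \<Rightarrow> real \<Rightarrow> real mat" where
  "cayley n x y t = (let a = ip n x x; b = ip n y y; p = ip n x y;
     c = 4 / (4 + t\<^sup>2 * (a * b - p\<^sup>2)) in
     mat n n (\<lambda>(i, j). fid i j + c * t * outer_skew x y i j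
       + c * t\<^sup>2 / 2 * (p * (x i * y j + y i * x j) - b * x i * x j - a * y i * y j)))"

section \<open>Orthogonality of the Cayley matrices\<close>

lemma cauchy_ip: "0 \<le> ip n x x * ip n y y - (ip n x y)\<^sup>2"
proof -
  have "(ip n x y)\<^sup>2 \<le> (vnorm n x * vnorm n y)\<^sup>2"
    using ip_le[of n x y] by (metis abs_ge_zero power2_abs power_mono)
  then show ?thesis by (simp add: power_mult_distrib vnorm_sq)
qed

lemma cayley_carrier [simp]: "cayley n x y t \<in> carrier_mat n n"
  by (simp add: cayley_def Let_def)

lemma cayley_entry:
  assumes "k < n" "l < n"
    "c = 4 / (4 + t\<^sup>2 * (ip n x x * ip n y y - (ip n x y)\<^sup>2))"
  shows "cayley n x y t $$ (k, l) = fid k l + c * t * outer_skew x y k l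
     + c * t\<^sup>2 / 2 * (ip n x y * (x k * y l + y k * x l) - ip n y y * x k * x l - ip n x x * y k * y l)"
  unfolding cayley_def Let_def assms(3) using assms(1,2) by (subst index_mat(1)) simp_all

lemma cayley_transpose: "transpose_mat (cayley n x y t) = cayley n x y (- t)"
  by (rule eq_matI) (auto simp: cayley_def Let_def outer_skew_def fid_sym algebra_simps)

text \<open>For Q = I + x \<alpha>^T + y \<beta>^T the left side is an entry of Q^T Q - I; it is a
  multiple of the equation that defines c.\<close>

lemma cayley_alg:
  fixes c t a b p xi xj yi yj :: real
  defines "\<alpha> \<equiv> \<lambda>x y. c * t * y + c * t\<^sup>2 / 2 * (p * y - b * x)"
    and "\<beta> \<equiv> \<lambda>x y. - c * t * x + c * t\<^sup>2 / 2 * (p * x - a * y)"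
  assumes "c * (4 + t\<^sup>2 * (a * b - p\<^sup>2)) = 4"
  shows "xi * \<alpha> xj yj + yi * \<beta> xj yj + xj * \<alpha> xi yi + yj * \<beta> xi yi
    + a * \<alpha> xi yi * \<alpha> xj yj + p * (\<alpha> xi yi * \<beta> xj yj + \<beta> xi yi * \<alpha> xj yj)
    + b * \<beta> xi yi * \<beta> xj yj = 0"
proof -
  have "xi * \<alpha> xj yj + yi * \<beta> xj yj + xj * \<alpha> xi yi + yj * \<beta> xi yi
    + a * \<alpha> xi yi * \<alpha> xj yj + p * (\<alpha> xi yi * \<beta> xj yj + \<beta> xi yi * \<alpha> xj yj)
    + b * \<beta> xi yi * \<beta> xj yj
    = - (p * (xi * yj + yi * xj) - b * xi * xj - a * yi * yj) * (c * t\<^sup>2 / 4)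
      * (c * (4 + t\<^sup>2 * (a * b - p\<^sup>2)) - 4)"
    unfolding \<alpha>_def \<beta>_def by (simp add: field_simps power2_eq_square)
  then show ?thesis using assms(3) by simp
qed

lemma nonzero_divide_mult_cancel_right': "z \<noteq> 0 \<Longrightarrow> k / z * z = (k::real)"
  by simp

lemma cayley_orth_aux: "transpose_mat (cayley n x y t) * cayley n x y t = 1\<^sub>m n"
proof (rule eq_matI)
  fix i j assume ij: "i < dim_row (1\<^sub>m n :: real mat)" "j < dim_col (1\<^sub>m n :: real mat)"
  define a where "a = ip n x x" define b where "b = ip n y y" define p where "p = ip n x y"
  define c where "c = 4 / (4 + t\<^sup>2 * (a * b - p\<^sup>2))"
  have "0 \<le> t\<^sup>2 * (a * b - p\<^sup>2)" using cauchy_ip[of n x y] by (simp add: a_def b_def p_def)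
  then have "4 + t\<^sup>2 * (a * b - p\<^sup>2) \<noteq> 0" by linarith
  then have c4: "c * (4 + t\<^sup>2 * (a * b - p\<^sup>2)) = 4" 
    unfolding c_def by (rule nonzero_divide_mult_cancel_right'[of _ 4])
  define \<alpha> where "\<alpha> i = c * t * y i + c * t\<^sup>2 / 2 * (p * y i - b * x i)" for i
  define \<beta> where "\<beta> i = - c * t * x i + c * t\<^sup>2 / 2 * (p * x i - a * y i)" for i
  have Q: "cayley n x y t $$ (k, l) = fid k l + x k * \<alpha> l + y k * \<beta> l" if "k < n" "l < n" for k l
    unfolding cayley_entry[OF that c_def[unfolded a_def b_def p_def]] outer_skew_def \<alpha>_def \<beta>_def
    by (simp add: a_def[symmetric] b_def[symmetric] p_def[symmetric] algebra_simps
        add_divide_distrib diff_divide_distrib)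
  have i: "i < n" "j < n" using ij by auto
  have "(transpose_mat (cayley n x y t) * cayley n x y t) $$ (i, j)
      = (\<Sum>k<n. cayley n x y t $$ (k, i) * cayley n x y t $$ (k, j))"
    using i carrier_matD[OF cayley_carrier[of n x y t]]
    by (simp add: scalar_prod_def lessThan_atLeast0)
  also have "\<dots> = (\<Sum>k<n. (fid k i + x k * \<alpha> i + y k * \<beta> i) * (fid k j + x k * \<alpha> j + y k * \<beta> j))"
    by (rule sum.cong) (auto simp: Q i)
  also have "\<dots> = (\<Sum>k<n. fid k i * fid k j + fid k i * (x k * \<alpha> j) + fid k i * (y k * \<beta> j)
      + fid k j * (x k * \<alpha> i) + fid k j * (y k * \<beta> i)
      + (x k * x k) * (\<alpha> i * \<alpha> j) + (x k * y k) * (\<alpha> i * \<beta> j + \<beta> i * \<alpha> j) + (y k * y k) * (\<beta> i * \<beta> j))"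
    by (rule sum.cong) (auto simp: algebra_simps)
  also have "\<dots> = fid i j + (x i * \<alpha> j + y i * \<beta> j + x j * \<alpha> i + y j * \<beta> i
      + a * \<alpha> i * \<alpha> j + p * (\<alpha> i * \<beta> j + \<beta> i * \<alpha> j) + b * \<beta> i * \<beta> j)"
    using i by (simp add: sum.distrib a_def b_def p_def ip_def sum_distrib_right mult.assoc)
  also have "\<dots> = fid i j"
    unfolding \<alpha>_def \<beta>_def using cayley_alg[OF c4, of "x i" "y j" "x j" "y i"] by simp
  finally show "(transpose_mat (cayley n x y t) * cayley n x y t) $$ (i, j) = 1\<^sub>m n $$ (i, j)"
    using i by (simp add: fid_def)
qed (auto simp: carrier_matD[OF cayley_carrier])

lemma cayley_orthogonal: "cayley n x y t \<in> orthogonal_matrices n"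
  using cayley_orth_aux[of n x y t] cayley_orth_aux[of n x y "- t"]
  by (simp add: orthogonal_matrices_def cayley_transpose)

lemma orthogonal_matrices_mult:
  assumes "V \<in> orthogonal_matrices n" "Q \<in> orthogonal_matrices n"
  shows "V * Q \<in> orthogonal_matrices n"
proof -
  have c: "V \<in> carrier_mat n n" "Q \<in> carrier_mat n n" "transpose_mat V \<in> carrier_mat n n"
    "transpose_mat Q \<in> carrier_mat n n"
    and o: "transpose_mat V * V = 1\<^sub>m n" "V * transpose_mat V = 1\<^sub>m n"
    "transpose_mat Q * Q = 1\<^sub>m n" "Q * transpose_mat Q = 1\<^sub>m n"
    using assms by (auto simp: orthogonal_matrices_def)
  have "transpose_mat (V * Q) * (V * Q) = transpose_mat Q * (transpose_mat V * V) * Q"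
    using c by (simp add: transpose_mult[OF c(1,2)] assoc_mult_mat[of _ n n _ n _ n])
  moreover have "(V * Q) * transpose_mat (V * Q) = V * (Q * transpose_mat Q) * transpose_mat V"
    using c by (simp add: transpose_mult[OF c(1,2)] assoc_mult_mat[of _ n n _ n _ n])
  ultimately show ?thesis using c o by (simp add: orthogonal_matrices_def)
qed

lemma orthogonal_matrices_sum:
  assumes "V \<in> orthogonal_matrices n" "i < n" "j < n"
  shows "(\<Sum>k<n. V $$ (k, i) * V $$ (k, j)) = fid i j" "(\<Sum>k<n. V $$ (i, k) * V $$ (j, k)) = fid i j"
proof -
  have V: "V \<in> carrier_mat n n" and o: "transpose_mat V * V = 1\<^sub>m n" "V * transpose_mat V = 1\<^sub>m n"
    using assms by (auto simp: orthogonal_matrices_def)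
  have "(\<Sum>k<n. V $$ (k, i) * V $$ (k, j)) = (transpose_mat V * V) $$ (i, j)"
    using V assms by (simp add: scalar_prod_def lessThan_atLeast0)
  then show "(\<Sum>k<n. V $$ (k, i) * V $$ (k, j)) = fid i j" using o assms by (simp add: fid_def)
  have "(\<Sum>k<n. V $$ (i, k) * V $$ (j, k)) = (V * transpose_mat V) $$ (i, j)"
    using V assms by (simp add: scalar_prod_def lessThan_atLeast0)
  then show "(\<Sum>k<n. V $$ (i, k) * V $$ (j, k)) = fid i j" using o assms by (simp add: fid_def)
qed

lemma orthogonal_matrices_entry:
  assumes "V \<in> orthogonal_matrices n" "i < n" "j < n" shows "\<bar>V $$ (i, j)\<bar> \<le> 1"
proof -
  have "(V $$ (i, j))\<^sup>2 \<le> (\<Sum>k<n. (V $$ (i, k))\<^sup>2)"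
    by (rule member_le_sum) (use assms in auto)
  also have "\<dots> = 1" using orthogonal_matrices_sum(2)[OF assms(1,2,2)]
    by (simp add: fid_def power2_eq_square)
  finally show ?thesis by (simp add: abs_square_le_1)
qed

section \<open>Derivatives of conjugates, inverses and words\<close>

definition conj_mat :: "nat \<Rightarrow> real mat \<Rightarrow> fmat \<Rightarrow> fmat" where
  "conj_mat n V A i j = (\<Sum>k<n. \<Sum>l<n. V $$ (k, i) * A k l * V $$ (l, j))"

definition letter_mat :: "nat \<Rightarrow> fmat \<Rightarrow> fmat \<Rightarrow> (real mat \<Rightarrow> fmat) \<Rightarrow> real mat \<Rightarrow> letter \<Rightarrow> fmat" where
  "letter_mat n A B G V c = (case c of LA \<Rightarrow> conj_mat n V A | LB \<Rightarrow> B | LG \<Rightarrow> G V)"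

lemma letter_mat_simps [simp]:
  "letter_mat n A B G V LA = conj_mat n V A" "letter_mat n A B G V LB = B" "letter_mat n A B G V LG = G V"
  by (simp_all add: letter_mat_def)

definition is_sum_inverse :: "nat \<Rightarrow> fmat \<Rightarrow> fmat \<Rightarrow> (real mat \<Rightarrow> fmat) \<Rightarrow> bool" where
  "is_sum_inverse n A B G \<longleftrightarrow> (\<forall>V\<in>orthogonal_matrices n. \<forall>i<n. \<forall>j<n.
     (\<Sum>k<n. G V i k * (conj_mat n V A k j + B k j)) = fid i j \<and>
     (\<Sum>k<n. (conj_mat n V A i k + B i k) * G V k j) = fid i j)"

abbreviation rotate_by :: "nat \<Rightarrow> fvec \<Rightarrow> fvec \<Rightarrow> real \<Rightarrow> real mat \<Rightarrow> real mat" where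
  "rotate_by n x y t V \<equiv> V * cayley n x y t"

abbreviation odiff :: "nat \<Rightarrow> fvec \<Rightarrow> fvec \<Rightarrow> (real mat \<Rightarrow> real) \<Rightarrow> (real mat \<Rightarrow> real) \<Rightarrow> bool" where
  "odiff n x y f f' \<equiv> diffb (orthogonal_matrices n) (rotate_by n x y) f f'"

lemma rotate_closed: "V \<in> orthogonal_matrices n \<Longrightarrow> rotate_by n x y t V \<in> orthogonal_matrices n"
  by (intro orthogonal_matrices_mult cayley_orthogonal)

lemmas odiff_mult = diffb_mult[OF _ _ rotate_closed]
lemmas odiff_cong = diffb_cong[OF _ _ _ rotate_closed]

lemma odiff_cmult: "odiff n x y f f' \<Longrightarrow> odiff n x y (\<lambda>V. k * f V) (\<lambda>V. k * f' V)"
  using odiff_mult[OF diffb_const[of _ _ k]] by simp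

lemma odiff_uminus: "odiff n x y f f' \<Longrightarrow> odiff n x y (\<lambda>V. - f V) (\<lambda>V. - f' V)"
  using odiff_cmult[of n x y f f' "-1"] by simp

lemma odiff_diff: "odiff n x y f f' \<Longrightarrow> odiff n x y g g' \<Longrightarrow> odiff n x y (\<lambda>V. f V - g V) (\<lambda>V. f' V - g' V)"
  using diffb_add[OF _ odiff_uminus, of n x y f f' g g'] by simp

lemma diffb_sum:
  "finite I \<Longrightarrow> (\<And>i. i \<in> I \<Longrightarrow> diffb S T (f i) (f' i)) \<Longrightarrow>
     diffb S T (\<lambda>V. \<Sum>i\<in>I. f i V) (\<lambda>V. \<Sum>i\<in>I. f' i V)"
  by (induction I rule: finite_induct) (auto simp: diffb_const intro: diffb_add)

lemma odiff_power:
  assumes "odiff n x y f f'"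
  shows "odiff n x y (\<lambda>V. f V ^ p) (\<lambda>V. real p * f V ^ (p - 1) * f' V)"
proof (induction p)
  case 0 then show ?case using diffb_const[of _ _ 1] by simp
next
  case (Suc p)
  have "odiff n x y (\<lambda>V. f V * f V ^ p) (\<lambda>V. f' V * f V ^ p + f V * (real p * f V ^ (p - 1) * f' V))"
    by (intro odiff_mult assms Suc)
  moreover have "f' V * f V ^ p + f V * (real p * f V ^ (p - 1) * f' V)
      = real (Suc p) * f V ^ (Suc p - 1) * f' V" for V
    by (cases p) (auto simp: algebra_simps)
  ultimately show ?case by (simp only: power_Suc)
qed

lemma odiff_dq:
  assumes "\<And>L R. odiff n x y (f L R) (f' L R)"
  shows "odiff n x y (\<lambda>V. dq (\<lambda>L R. f L R V) W) (\<lambda>V. dq (\<lambda>L R. f' L R V) W)"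
  using assms
proof (induction W arbitrary: f f')
  case Nil then show ?case by (simp add: diffb_const)
next
  case (Cons c W)
  have IH: "odiff n x y (\<lambda>V. dq (\<lambda>L R. f (c # L) R V) W) (\<lambda>V. dq (\<lambda>L R. f' (c # L) R V) W)"
    by (rule Cons.IH) (rule Cons.prems)
  show ?case
    by (cases c) (use IH in \<open>auto intro!: diffb_add odiff_diff Cons.prems\<close>)
qed

text \<open>The Cayley matrix is I + t (x y^T - y x^T) up to order t^2, since its factor c differs
  from 1 by at most t^2 times the Gram determinant of x and y.\<close>

lemma odiff_entry:
  assumes "i < n" "j < n"
  shows "odiff n x y (\<lambda>V. V $$ (i, j)) (\<lambda>V. \<Sum>k<n. V $$ (i, k) * outer_skew x y k j)"
proof -
  define a where "a = ip n x x" define b where "b = ip n y y" define p where "p = ip n x y"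
  define \<theta> where "\<theta> = a * b - p\<^sup>2"
  define E where "E k = p * (x k * y j + y k * x j) - b * x k * x j - a * y k * y j" for k
  have \<theta>: "0 \<le> \<theta>" using cauchy_ip[of n x y] by (simp add: \<theta>_def a_def b_def p_def)
  define K where "K = (\<Sum>k<n. \<theta> * \<bar>outer_skew x y k j\<bar> + \<bar>E k\<bar>)"
  show ?thesis
  proof (rule diffbI[where c=K and d=1 and e="\<Sum>k<n. \<bar>outer_skew x y k j\<bar>"])
    fix V and t :: real assume V: "V \<in> orthogonal_matrices n" and t: "0 \<le> t" "t \<le> 1"
    have Vc: "V \<in> carrier_mat n n" using V by (simp add: orthogonal_matrices_def)
    define c where "c = 4 / (4 + t\<^sup>2 * \<theta>)"
    have d0: "0 \<le> t\<^sup>2 * \<theta>" using \<theta> by simp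
    have c01: "0 \<le> c" "c \<le> 1" using d0 by (auto simp: c_def divide_simps)
    have c1: "\<bar>c - 1\<bar> \<le> t\<^sup>2 * \<theta>"
    proof -
      have "4 + t\<^sup>2 * \<theta> \<noteq> 0" using d0 by linarith
      then have "1 - c = t\<^sup>2 * \<theta> / (4 + t\<^sup>2 * \<theta>)" by (simp add: c_def field_simps)
      also have "\<dots> \<le> t\<^sup>2 * \<theta> / 1" by (rule divide_left_mono) (use d0 in auto)
      finally show ?thesis using c01 by simp
    qed
    have Q: "cayley n x y t $$ (k, j) = fid k j + t * outer_skew x y k j
        + ((c - 1) * t * outer_skew x y k j + c * t\<^sup>2 / 2 * E k)" if "k < n" for k
    proof -
      have "cayley n x y t $$ (k, j) = fid k j + c * t * outer_skew x y k j + c * t\<^sup>2 / 2 * E k"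
        unfolding cayley_entry[OF that assms(2) c_def[unfolded \<theta>_def a_def b_def p_def]] E_def a_def b_def p_def ..
      then show ?thesis by (simp add: algebra_simps)
    qed
    have "(V * cayley n x y t) $$ (i, j) = (\<Sum>k<n. V $$ (i, k) * cayley n x y t $$ (k, j))"
      using assms Vc carrier_matD[OF cayley_carrier[of n x y t]]
      by (simp add: scalar_prod_def lessThan_atLeast0)
    also have "\<dots> = (\<Sum>k<n. V $$ (i, k) * fid k j + t * (V $$ (i, k) * outer_skew x y k j)
        + V $$ (i, k) * ((c - 1) * t * outer_skew x y k j + c * t\<^sup>2 / 2 * E k))"
      by (rule sum.cong) (auto simp: Q algebra_simps)
    also have "\<dots> = V $$ (i, j) + t * (\<Sum>k<n. V $$ (i, k) * outer_skew x y k j)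
        + (\<Sum>k<n. V $$ (i, k) * ((c - 1) * t * outer_skew x y k j + c * t\<^sup>2 / 2 * E k))"
      using assms by (simp add: sum.distrib sum_distrib_left)
    finally have "\<bar>(V * cayley n x y t) $$ (i, j) - V $$ (i, j) - t * (\<Sum>k<n. V $$ (i, k) * outer_skew x y k j)\<bar>
      = \<bar>\<Sum>k<n. V $$ (i, k) * ((c - 1) * t * outer_skew x y k j + c * t\<^sup>2 / 2 * E k)\<bar>" by simp
    also have "\<dots> \<le> (\<Sum>k<n. (\<theta> * \<bar>outer_skew x y k j\<bar> + \<bar>E k\<bar>) * t\<^sup>2)"
    proof (rule order_trans[OF sum_abs sum_mono])
      fix k assume "k \<in> {..<n}"
      then have v: "\<bar>V $$ (i, k)\<bar> \<le> 1" using orthogonal_matrices_entry[OF V assms(1)] by simp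
      have 1: "\<bar>(c - 1) * t * outer_skew x y k j\<bar> \<le> (t\<^sup>2 * \<theta>) * 1 * \<bar>outer_skew x y k j\<bar>"
        unfolding abs_mult by (intro mult_mono c1) (use t d0 in auto)
      have 2: "\<bar>c * t\<^sup>2 / 2 * E k\<bar> \<le> 1 * t\<^sup>2 * \<bar>E k\<bar>"
      proof -
        have "c * t\<^sup>2 \<le> 2 * t\<^sup>2" by (intro mult_right_mono) (use c01 in auto)
        then show ?thesis unfolding abs_mult using c01
          by (intro mult_right_mono) auto
      qed
      have "\<bar>V $$ (i, k) * ((c - 1) * t * outer_skew x y k j + c * t\<^sup>2 / 2 * E k)\<bar>
          \<le> 1 * (t\<^sup>2 * \<theta> * \<bar>outer_skew x y k j\<bar> + t\<^sup>2 * \<bar>E k\<bar>)"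
        unfolding abs_mult[of "V $$ _"] by (intro mult_mono v) (use 1 2 in linarith)+
      then show "\<bar>V $$ (i, k) * ((c - 1) * t * outer_skew x y k j + c * t\<^sup>2 / 2 * E k)\<bar>
          \<le> (\<theta> * \<bar>outer_skew x y k j\<bar> + \<bar>E k\<bar>) * t\<^sup>2" by (simp add: algebra_simps)
    qed
    finally show "\<bar>(V * cayley n x y t) $$ (i, j) - V $$ (i, j) - t * (\<Sum>k<n. V $$ (i, k) * outer_skew x y k j)\<bar>
       \<le> K * t\<^sup>2" by (simp add: K_def sum_distrib_right)
  next
    fix V assume V: "V \<in> orthogonal_matrices n"
    show "\<bar>V $$ (i, j)\<bar> \<le> 1" by (rule orthogonal_matrices_entry[OF V assms])
    show "\<bar>\<Sum>k<n. V $$ (i, k) * outer_skew x y k j\<bar> \<le> (\<Sum>k<n. \<bar>outer_skew x y k j\<bar>)"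
    proof (rule order_trans[OF sum_abs sum_mono])
      fix k assume "k \<in> {..<n}"
      then show "\<bar>V $$ (i, k) * outer_skew x y k j\<bar> \<le> \<bar>outer_skew x y k j\<bar>"
        using orthogonal_matrices_entry[OF V assms(1), of k] by (simp add: abs_mult mult_left_le_one_le)
    qed
  qed
qed

text \<open>The commutator of M with x y^T. Along a skew generator S the derivative of V^T A V is
  its commutator with S.\<close>

definition conj_deriv :: "nat \<Rightarrow> fmat \<Rightarrow> fvec \<Rightarrow> fvec \<Rightarrow> fmat" where
  "conj_deriv n M x y i j = mvec n M x i * y j - x i * vmat n y M j"

lemma odiff_conj_mat:
  assumes ij: "i < n" "j < n"
  shows "odiff n x y (\<lambda>V. conj_mat n V A i j)
    (\<lambda>V. conj_deriv n (conj_mat n V A) x y i j - conj_deriv n (conj_mat n V A) y x i j)"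
proof (rule odiff_cong)
  show "odiff n x y (\<lambda>V. \<Sum>k<n. \<Sum>l<n. A k l * (V $$ (k, i) * V $$ (l, j)))
     (\<lambda>V. \<Sum>k<n. \<Sum>l<n. A k l * ((\<Sum>m<n. V $$ (k, m) * outer_skew x y m i) * V $$ (l, j)
        + V $$ (k, i) * (\<Sum>m<n. V $$ (l, m) * outer_skew x y m j)))"
    by (intro diffb_sum odiff_cmult odiff_mult odiff_entry ij) auto
  show "conj_mat n V A i j = (\<Sum>k<n. \<Sum>l<n. A k l * (V $$ (k, i) * V $$ (l, j)))" for V
    by (simp add: conj_mat_def mult_ac)
  fix V
  have 1: "(\<Sum>k<n. \<Sum>l<n. A k l * ((\<Sum>m<n. V $$ (k, m) * outer_skew x y m i) * V $$ (l, j)))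
     = (\<Sum>m<n. outer_skew x y m i * conj_mat n V A m j)"
  proof -
    have "(\<Sum>k<n. \<Sum>l<n. A k l * ((\<Sum>m<n. V $$ (k, m) * outer_skew x y m i) * V $$ (l, j)))
      = (\<Sum>k<n. \<Sum>l<n. \<Sum>m<n. outer_skew x y m i * (V $$ (k, m) * A k l * V $$ (l, j)))"
      by (simp add: sum_distrib_left sum_distrib_right mult_ac)
    also have "\<dots> = (\<Sum>k<n. \<Sum>m<n. \<Sum>l<n. outer_skew x y m i * (V $$ (k, m) * A k l * V $$ (l, j)))"
      by (intro sum.cong refl sum.swap)
    also have "\<dots> = (\<Sum>m<n. \<Sum>k<n. \<Sum>l<n. outer_skew x y m i * (V $$ (k, m) * A k l * V $$ (l, j)))"
      by (rule sum.swap)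
    finally show ?thesis by (simp add: conj_mat_def sum_distrib_left)
  qed
  have 2: "(\<Sum>k<n. \<Sum>l<n. A k l * (V $$ (k, i) * (\<Sum>m<n. V $$ (l, m) * outer_skew x y m j)))
     = (\<Sum>m<n. conj_mat n V A i m * outer_skew x y m j)"
  proof -
    have "(\<Sum>k<n. \<Sum>l<n. A k l * (V $$ (k, i) * (\<Sum>m<n. V $$ (l, m) * outer_skew x y m j)))
      = (\<Sum>k<n. \<Sum>l<n. \<Sum>m<n. V $$ (k, i) * A k l * V $$ (l, m) * outer_skew x y m j)"
      by (simp add: sum_distrib_left sum_distrib_right mult_ac)
    also have "\<dots> = (\<Sum>k<n. \<Sum>m<n. \<Sum>l<n. V $$ (k, i) * A k l * V $$ (l, m) * outer_skew x y m j)"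
      by (intro sum.cong refl sum.swap)
    also have "\<dots> = (\<Sum>m<n. \<Sum>k<n. \<Sum>l<n. V $$ (k, i) * A k l * V $$ (l, m) * outer_skew x y m j)"
      by (rule sum.swap)
    finally show ?thesis by (simp add: conj_mat_def sum_distrib_right)
  qed
  show "conj_deriv n (conj_mat n V A) x y i j - conj_deriv n (conj_mat n V A) y x i j
    = (\<Sum>k<n. \<Sum>l<n. A k l * ((\<Sum>m<n. V $$ (k, m) * outer_skew x y m i) * V $$ (l, j)
        + V $$ (k, i) * (\<Sum>m<n. V $$ (l, m) * outer_skew x y m j)))"
    unfolding distrib_left sum.distrib 1 2
    by (simp add: conj_deriv_def mvec_def vmat_def outer_skew_def sum_distrib_left sum_distrib_right
        sum_subtractf sum.distrib algebra_simps)
qed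

text \<open>The resolvent identity G_W - G_V = - G_W (H_W - H_V) G_V, with H the sum that is
  inverted, replaces any differentiability of matrix inversion.\<close>

lemma odiff_inverse:
  assumes inv: "is_sum_inverse n A B G"
    and bnd: "\<And>V i j. V \<in> orthogonal_matrices n \<Longrightarrow> i < n \<Longrightarrow> j < n \<Longrightarrow> \<bar>G V i j\<bar> \<le> g"
    and ij: "i < n" "j < n"
  shows "odiff n x y (\<lambda>V. G V i j)
    (\<lambda>V. - (\<Sum>k<n. \<Sum>l<n. G V i k * (conj_deriv n (conj_mat n V A) x y k l
          - conj_deriv n (conj_mat n V A) y x k l) * G V l j))"
proof -
  define D where "D V k l = conj_deriv n (conj_mat n V A) x y k l - conj_deriv n (conj_mat n V A) y x k l"
    for V k l
  define H where "H V k l = conj_mat n V A k l + B k l" for V k l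
  have "\<forall>k l. \<exists>c. k < n \<longrightarrow> l < n \<longrightarrow> 0 \<le> c \<and> (\<forall>V\<in>orthogonal_matrices n. \<forall>t\<in>{0..1}.
      \<bar>conj_mat n (rotate_by n x y t V) A k l - conj_mat n V A k l - t * D V k l\<bar> \<le> c * t\<^sup>2 \<and> \<bar>D V k l\<bar> \<le> c)"
  proof (intro allI)
    fix k l
    show "\<exists>c. k < n \<longrightarrow> l < n \<longrightarrow> 0 \<le> c \<and> (\<forall>V\<in>orthogonal_matrices n. \<forall>t\<in>{0..1}.
      \<bar>conj_mat n (rotate_by n x y t V) A k l - conj_mat n V A k l - t * D V k l\<bar> \<le> c * t\<^sup>2 \<and> \<bar>D V k l\<bar> \<le> c)"
    proof (cases "k < n \<and> l < n")
      case True
      then have "odiff n x y (\<lambda>V. conj_mat n V A k l) (\<lambda>V. D V k l)"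
        unfolding D_def by (intro odiff_conj_mat) auto
      then show ?thesis by (rule diffbE) (auto intro!: exI)
    qed auto
  qed
  then obtain cc where cc: "\<And>k l. k < n \<Longrightarrow> l < n \<Longrightarrow> 0 \<le> cc k l \<and> (\<forall>V\<in>orthogonal_matrices n. \<forall>t\<in>{0..1}.
      \<bar>conj_mat n (rotate_by n x y t V) A k l - conj_mat n V A k l - t * D V k l\<bar> \<le> cc k l * t\<^sup>2
       \<and> \<bar>D V k l\<bar> \<le> cc k l)"
    by metis
  define C where "C = (\<Sum>k<n. \<Sum>l<n. cc k l)"
  have ccC: "cc k l \<le> C" if "k < n" "l < n" for k l
  proof -
    have "cc k l \<le> (\<Sum>l<n. cc k l)" by (rule member_le_sum) (use that cc in auto)
    also have "\<dots> \<le> C" unfolding C_def by (rule member_le_sum) (use that cc in \<open>auto intro!: sum_nonneg\<close>)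
    finally show ?thesis .
  qed
  have C0: "0 \<le> C" unfolding C_def using cc by (auto intro!: sum_nonneg)
  have Hb: "\<bar>H (rotate_by n x y t V) k l - H V k l - t * D V k l\<bar> \<le> C * t\<^sup>2" "\<bar>D V k l\<bar> \<le> C"
    "\<bar>H (rotate_by n x y t V) k l - H V k l\<bar> \<le> 2 * C * t"
    if "k < n" "l < n" "V \<in> orthogonal_matrices n" "0 \<le> t" "t \<le> 1" for k l V t
  proof -
    have "\<bar>H (rotate_by n x y t V) k l - H V k l - t * D V k l\<bar> \<le> cc k l * t\<^sup>2"
      using cc[of k l] that by (simp add: H_def)
    also have "\<dots> \<le> C * t\<^sup>2" by (intro mult_right_mono ccC that) auto
    finally show 1: "\<bar>H (rotate_by n x y t V) k l - H V k l - t * D V k l\<bar> \<le> C * t\<^sup>2" .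
    show 2: "\<bar>D V k l\<bar> \<le> C" using cc[of k l] ccC[of k l] that by force
    have "t\<^sup>2 \<le> t" using that(4,5) by (simp add: power2_eq_square mult_left_le)
    then have "C * t\<^sup>2 \<le> C * t" using C0 by (rule mult_left_mono)
    moreover have "\<bar>t * D V k l\<bar> \<le> C * t" unfolding abs_mult using 2 that(4)
      by (subst mult.commute) (simp add: mult_right_mono)
    ultimately show "\<bar>H (rotate_by n x y t V) k l - H V k l\<bar> \<le> 2 * C * t" using 1
      by linarith
  qed
  have g0: "0 \<le> g" if "V \<in> orthogonal_matrices n" for V using bnd[OF that ij] by linarith
  have res: "G W i j - G V i j = - (\<Sum>k<n. \<Sum>l<n. G W i k * (H W k l - H V k l) * G V l j)"
    if V: "V \<in> orthogonal_matrices n" and W: "W \<in> orthogonal_matrices n" and ij: "i < n" "j < n" for V W i j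
  proof -
    have "G W i j = (\<Sum>k<n. G W i k * (\<Sum>l<n. H V k l * G V l j))"
      using inv V ij by (simp add: is_sum_inverse_def H_def)
    moreover have "G V i j = (\<Sum>l<n. (\<Sum>k<n. G W i k * H W k l) * G V l j)"
      using inv W ij by (simp add: is_sum_inverse_def H_def)
    moreover have "(\<Sum>l<n. (\<Sum>k<n. G W i k * H W k l) * G V l j) = (\<Sum>k<n. \<Sum>l<n. G W i k * H W k l * G V l j)"
      unfolding sum_distrib_right by (rule sum.swap)
    ultimately show ?thesis
      by (simp add: sum_distrib_left sum_subtractf[symmetric] sum_negf[symmetric] algebra_simps)
  qed
  have sum_le: "\<bar>\<Sum>k<n. \<Sum>l<n. f k l\<bar> \<le> real n * (real n * b)"
    if fb: "\<And>k l. k < n \<Longrightarrow> l < n \<Longrightarrow> \<bar>f k l\<bar> \<le> b" for f and b :: real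
  proof -
    have "\<bar>\<Sum>l<n. f k l\<bar> \<le> real n * b" if "k < n" for k
      by (rule order_trans[OF sum_abs]) (use sum_bounded_above[of "{..<n}" "\<lambda>l. \<bar>f k l\<bar>" b] fb that in auto)
    then show ?thesis
      by (intro order_trans[OF sum_abs]) (use sum_bounded_above[of "{..<n}" "\<lambda>k. \<bar>\<Sum>l<n. f k l\<bar>" "real n * b"] in auto)
  qed
  have mul: "\<bar>u * v\<bar> \<le> a * b" if "\<bar>u\<bar> \<le> a" "\<bar>v\<bar> \<le> b" for u v a b :: real
    unfolding abs_mult by (intro mult_mono that) (use that in auto)
  \<comment> \<open>A Lipschitz bound is required first, because the remainder contains the
    increment of \<open>G\<close> times the first derivative of the sum.\<close>
  have lip: "\<bar>G (rotate_by n x y t V) i j - G V i j\<bar> \<le> real n * (real n * (g * (2 * C * t) * g))"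
    if V: "V \<in> orthogonal_matrices n" and t: "0 \<le> t" "t \<le> 1" and ij: "i < n" "j < n" for V t i j
    unfolding res[OF V rotate_closed[OF V] ij] abs_minus
    by (intro sum_le mul bnd Hb V t ij rotate_closed)
  define e where "e = real n * (real n * (g * C * g)) + real n * (real n * (real n * (real n * (g * (2 * C) * g)) * C * g))"
  show ?thesis
    unfolding D_def[symmetric]
  proof (rule diffbI[where c=e and d=g and e="real n * (real n * (g * C * g))"])
    fix V and t :: real assume V: "V \<in> orthogonal_matrices n" and t: "0 \<le> t" "t \<le> 1"
    let ?W = "rotate_by n x y t V"
    have "G ?W i j - G V i j - t * - (\<Sum>k<n. \<Sum>l<n. G V i k * D V k l * G V l j)
      = - (\<Sum>k<n. \<Sum>l<n. G ?W i k * (H ?W k l - H V k l - t * D V k l) * G V l j)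
        - t * (\<Sum>k<n. \<Sum>l<n. (G ?W i k - G V i k) * D V k l * G V l j)"
      unfolding res[OF V rotate_closed[OF V] ij]
      by (simp add: sum_distrib_left sum_subtractf[symmetric] sum_negf[symmetric] algebra_simps)
    moreover have "\<bar>\<Sum>k<n. \<Sum>l<n. G ?W i k * (H ?W k l - H V k l - t * D V k l) * G V l j\<bar>
       \<le> real n * (real n * (g * (C * t\<^sup>2) * g))"
      by (intro sum_le mul bnd Hb V t ij rotate_closed)
    moreover have "\<bar>t * (\<Sum>k<n. \<Sum>l<n. (G ?W i k - G V i k) * D V k l * G V l j)\<bar>
       \<le> t * (real n * (real n * (real n * (real n * (g * (2 * C * t) * g)) * C * g)))"
      by (intro sum_le mul bnd Hb(2)[OF _ _ V t] V t ij lip) (use t in auto)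
    moreover have "real n * (real n * (g * (C * t\<^sup>2) * g)) + t * (real n * (real n * (real n * (real n * (g * (2 * C * t) * g)) * C * g))) = e * t\<^sup>2"
      by (simp add: e_def algebra_simps power2_eq_square)
    ultimately show "\<bar>G ?W i j - G V i j - t * - (\<Sum>k<n. \<Sum>l<n. G V i k * D V k l * G V l j)\<bar> \<le> e * t\<^sup>2"
      by linarith
  next
    fix V assume V: "V \<in> orthogonal_matrices n"
    show "\<bar>G V i j\<bar> \<le> g" by (rule bnd[OF V ij])
    show "\<bar>- (\<Sum>k<n. \<Sum>l<n. G V i k * D V k l * G V l j)\<bar> \<le> real n * (real n * (g * C * g))"
      unfolding abs_minus by (intro sum_le mul bnd Hb(2)[OF _ _ V, of _ _ 0] V ij) auto
  qed
qed

lemma bform_fid_left: "i < n \<Longrightarrow> bform n (fid i) M b = mvec n M b i"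
  by (simp add: bform_eq_ip_mvec ip_def)

lemma bform_fid_right: "j < n \<Longrightarrow> bform n a M (fid j) = vmat n a M j"
  by (simp add: bform_eq_ip_vmat ip_def)

lemma wb_single: "wb n \<rho> [c] a b = bform n a (\<rho> c) b"
  unfolding wb_Cons wb_Nil bform_eq_ip_vmat[symmetric] ..

text \<open>A resolution of the identity is inserted between \<open>R\<close> and
  \<open>W\<close>.\<close>

lemma wb_append_sum: "(\<Sum>k<n. wb n \<rho> R y (fid k) * wb n \<rho> W (fid k) b) = wb n \<rho> (R @ W) y b"
proof (induction R arbitrary: y)
  case Nil
  have "(\<Sum>k<n. wb n \<rho> [] y (fid k) * wb n \<rho> W (fid k) b) = (\<Sum>k<n. y k * wb n \<rho> W (fid k) b)"
    by (rule sum.cong) (auto simp: wb_Nil ip_def simp del: wmat.simps)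
  then show ?case by (simp add: bform_left_sum del: wmat.simps)
next
  case (Cons c R)
  show ?case unfolding append_Cons wb_Cons Cons ..
qed

text \<open>The cut at the leading letter, split off so that the Leibniz rule can be checked one
  letter at a time.\<close>

definition dqh :: "(letter list \<Rightarrow> letter list \<Rightarrow> real) \<Rightarrow> letter \<Rightarrow> letter list \<Rightarrow> real" where
  "dqh f c W = (case c of LA \<Rightarrow> f [LA] W - f [] (LA # W) | LB \<Rightarrow> 0
     | LG \<Rightarrow> f [LG] (LA # LG # W) - f [LG, LA] (LG # W))"

lemma dq_Cons: "dq f (c # W) = dqh f c W + dq (\<lambda>u v. f (c # u) v) W"
  by (cases c) (auto simp: dqh_def)

text \<open>The derivative of a^T W b along the half generator x y^T; the antisymmetrisation
  \<open>dw\<close> belongs to the skew generator x y^T - y x^T.\<close>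

definition hw :: "nat \<Rightarrow> (letter \<Rightarrow> fmat) \<Rightarrow> letter list \<Rightarrow> fvec \<Rightarrow> fvec \<Rightarrow> fvec \<Rightarrow> fvec \<Rightarrow> real" where
  "hw n \<rho> W a b x y = dq (\<lambda>L R. wb n \<rho> L a x * wb n \<rho> R y b) W"

definition dw :: "nat \<Rightarrow> (letter \<Rightarrow> fmat) \<Rightarrow> letter list \<Rightarrow> fvec \<Rightarrow> fvec \<Rightarrow> fvec \<Rightarrow> fvec \<Rightarrow> real" where
  "dw n \<rho> W a b x y = hw n \<rho> W a b x y - hw n \<rho> W a b y x"

definition hletter :: "nat \<Rightarrow> (letter \<Rightarrow> fmat) \<Rightarrow> letter \<Rightarrow> nat \<Rightarrow> nat \<Rightarrow> fvec \<Rightarrow> fvec \<Rightarrow> real" where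
  "hletter n \<rho> c i k x y = dqh (\<lambda>L R. wb n \<rho> L (fid i) x * wb n \<rho> R y (fid k)) c []"

lemma hletter_sum:
  "(\<Sum>i<n. \<Sum>k<n. a i * hletter n \<rho> c i k x y * wb n \<rho> W (fid k) b)
     = dqh (\<lambda>L R. wb n \<rho> L a x * wb n \<rho> R y b) c W"
proof -
  have *: "(\<Sum>i<n. \<Sum>k<n. a i * (wb n \<rho> L (fid i) x * wb n \<rho> R y (fid k)) * wb n \<rho> W (fid k) b)
      = wb n \<rho> L a x * wb n \<rho> (R @ W) y b" for L R
  proof -
    have "(\<Sum>i<n. \<Sum>k<n. a i * (wb n \<rho> L (fid i) x * wb n \<rho> R y (fid k)) * wb n \<rho> W (fid k) b)
      = (\<Sum>i<n. \<Sum>k<n. (a i * wb n \<rho> L (fid i) x) * (wb n \<rho> R y (fid k) * wb n \<rho> W (fid k) b))"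
      by (simp add: mult_ac)
    also have "\<dots> = (\<Sum>i<n. a i * wb n \<rho> L (fid i) x) * (\<Sum>k<n. wb n \<rho> R y (fid k) * wb n \<rho> W (fid k) b)"
      by (rule sum_product[symmetric])
    finally show ?thesis unfolding wb_append_sum bform_left_sum .
  qed
  show ?thesis
    by (cases c) (simp_all only: hletter_def dqh_def letter.case right_diff_distrib left_diff_distrib
        sum_subtractf * append_Cons append_Nil mult_zero_right mult_zero_left sum.neutral_const)
qed

lemma hw_sum:
  "(\<Sum>i<n. \<Sum>k<n. a i * \<rho> c i k * hw n \<rho> W (fid k) b x y)
     = dq (\<lambda>L R. wb n \<rho> (c # L) a x * wb n \<rho> R y b) W"
  unfolding hw_def dq_cmult[symmetric] dq_sum[symmetric] wb_Cons_sum sum_distrib_right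
  by (simp add: mult_ac)

lemma odiff_letter:
  assumes inv: "is_sum_inverse n A B G"
    and bnd: "\<And>V i j. V \<in> orthogonal_matrices n \<Longrightarrow> i < n \<Longrightarrow> j < n \<Longrightarrow> \<bar>G V i j\<bar> \<le> g"
    and ij: "i < n" "j < n"
  shows "odiff n x y (\<lambda>V. letter_mat n A B G V c i j)
    (\<lambda>V. hletter n (letter_mat n A B G V) c i j x y - hletter n (letter_mat n A B G V) c i j y x)"
proof -
  have A: "conj_deriv n (conj_mat n V A) x y i j = hletter n (letter_mat n A B G V) LA i j x y"
    if "i < n" "j < n" for i j x y V
    using that unfolding hletter_def dqh_def letter.case wb_single wb_Nil
    by (simp add: conj_deriv_def bform_fid_left bform_fid_right ip_def)
  show ?thesis
  proof (cases c)
    case LA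
    show ?thesis unfolding LA A[OF ij, symmetric] letter_mat_simps by (rule odiff_conj_mat[OF ij])
  next
    case LB
    show ?thesis unfolding LB by (simp add: hletter_def dqh_def diffb_const)
  next
    case LG
    \<comment> \<open>The derivative - G [A', x y^T] G of the inverse splits into (G x)(y^T A' G) -
      (G A' x)(y^T G), the two cuts at \<open>LG\<close>.\<close>
    have G: "- (\<Sum>k<n. \<Sum>l<n. G V i k * conj_deriv n (conj_mat n V A) x y k l * G V l j)
        = hletter n (letter_mat n A B G V) LG i j x y" for V x y
    proof -
      have "(\<Sum>k<n. \<Sum>l<n. G V i k * conj_deriv n (conj_mat n V A) x y k l * G V l j)
        = (\<Sum>k<n. \<Sum>l<n. (G V i k * mvec n (conj_mat n V A) x k) * (y l * G V l j))
        - (\<Sum>k<n. \<Sum>l<n. (G V i k * x k) * (vmat n y (conj_mat n V A) l * G V l j))"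
        by (simp add: conj_deriv_def sum_subtractf[symmetric] algebra_simps)
      also have "\<dots> = (\<Sum>k<n. G V i k * mvec n (conj_mat n V A) x k) * (\<Sum>l<n. y l * G V l j)
        - (\<Sum>k<n. G V i k * x k) * (\<Sum>l<n. vmat n y (conj_mat n V A) l * G V l j)"
        unfolding sum_product ..
      also have "\<dots> = wb n (letter_mat n A B G V) [LG, LA] (fid i) x * wb n (letter_mat n A B G V) [LG] y (fid j)
        - wb n (letter_mat n A B G V) [LG] (fid i) x * wb n (letter_mat n A B G V) [LA, LG] y (fid j)"
        unfolding wb_Cons[where c=LG and W="[LA]"] wb_Cons[where c=LA and W="[LG]"] wb_single bform_fmul_mvec letter_mat_simps
        using ij by (simp add: bform_fid_left bform_fid_right mvec_def[of n "G V"] vmat_def[of n _ "G V"]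
            bform_eq_ip_mvec[of n _ "conj_mat n V A"] ip_def)
      finally show ?thesis by (simp add: hletter_def dqh_def del: wmat.simps)
    qed
    have "odiff n x y (\<lambda>V. G V i j)
    (\<lambda>V. - (\<Sum>k<n. \<Sum>l<n. G V i k * (conj_deriv n (conj_mat n V A) x y k l
          - conj_deriv n (conj_mat n V A) y x k l) * G V l j))"
      by (rule odiff_inverse[OF inv bnd ij])
    moreover have "- (\<Sum>k<n. \<Sum>l<n. G V i k * (conj_deriv n (conj_mat n V A) x y k l
          - conj_deriv n (conj_mat n V A) y x k l) * G V l j)
      = hletter n (letter_mat n A B G V) LG i j x y - hletter n (letter_mat n A B G V) LG i j y x" for V
      unfolding G[symmetric] by (simp add: algebra_simps sum_subtractf)
    ultimately show ?thesis unfolding LG by simp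
  qed
qed

text \<open>Leibniz rule: differentiating the leading letter gives the cut there, differentiating
  the rest gives the cuts further right, which is the recursion of \<open>dq\<close>.\<close>

lemma odiff_word:
  assumes inv: "is_sum_inverse n A B G"
    and bnd: "\<And>V i j. V \<in> orthogonal_matrices n \<Longrightarrow> i < n \<Longrightarrow> j < n \<Longrightarrow> \<bar>G V i j\<bar> \<le> g"
  shows "odiff n x y (\<lambda>V. wb n (letter_mat n A B G V) W a b)
    (\<lambda>V. dw n (letter_mat n A B G V) W a b x y)"
proof (induction W arbitrary: a b)
  case Nil
  then show ?case by (simp add: dw_def hw_def diffb_const del: wmat.simps(2))
next
  case (Cons c W)
  let ?\<rho> = "letter_mat n A B G"
  have "odiff n x y (\<lambda>V. \<Sum>i<n. \<Sum>k<n. a i * ?\<rho> V c i k * wb n (?\<rho> V) W (fid k) b)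
    (\<lambda>V. \<Sum>i<n. \<Sum>k<n. a i * (hletter n (?\<rho> V) c i k x y - hletter n (?\<rho> V) c i k y x) * wb n (?\<rho> V) W (fid k) b
        + a i * ?\<rho> V c i k * dw n (?\<rho> V) W (fid k) b x y)"
    by (intro diffb_sum odiff_mult odiff_cmult odiff_letter[OF inv bnd] Cons) auto
  moreover have "(\<Sum>i<n. \<Sum>k<n. a i * (hletter n (?\<rho> V) c i k x y - hletter n (?\<rho> V) c i k y x) * wb n (?\<rho> V) W (fid k) b
        + a i * ?\<rho> V c i k * dw n (?\<rho> V) W (fid k) b x y) = dw n (?\<rho> V) (c # W) a b x y" for V
    unfolding dw_def hw_def[of n "?\<rho> V" "c # W"] dq_Cons hletter_sum[symmetric] hw_sum[symmetric]
    by (simp add: sum.distrib sum_subtractf algebra_simps)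
  ultimately show ?case unfolding wb_Cons_sum by simp
qed

section \<open>Moments of the Schwinger-Dyson forms\<close>

lemma space_borel_mat [simp]: "space (borel_mat n) = carrier_mat n n"
  by (simp add: borel_mat_def)

lemma measurable_borel_mat_entry:
  assumes "i < n" "j < n" shows "(\<lambda>V. V $$ (i, j)) \<in> borel_measurable (borel_mat n)"
proof -
  have "(\<lambda>V. \<lambda>p \<in> {..<n} \<times> {..<n}. V $$ p) \<in> measurable (borel_mat n) (Pi\<^sub>M ({..<n} \<times> {..<n}) (\<lambda>_. borel :: real measure))"
    unfolding borel_mat_def
    by (rule measurable_vimage_algebra1) (auto simp: space_PiM)
  from measurable_compose[OF this measurable_component_singleton[of "(i, j)"]]
  show ?thesis using assms by simp
qed

lemma measurable_borel_matI:
  assumes "\<And>w. w \<in> space M \<Longrightarrow> f w \<in> carrier_mat n n"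
    and "\<And>i j. i < n \<Longrightarrow> j < n \<Longrightarrow> (\<lambda>w. f w $$ (i, j)) \<in> borel_measurable M"
  shows "f \<in> measurable M (borel_mat n)"
  unfolding borel_mat_def
proof (rule measurable_vimage_algebra2)
  show "f \<in> space M \<rightarrow> carrier_mat n n" using assms(1) by auto
  show "(\<lambda>w. \<lambda>p\<in>{..<n} \<times> {..<n}. f w $$ p) \<in> measurable M (Pi\<^sub>M ({..<n} \<times> {..<n}) (\<lambda>_. borel))"
    by (rule measurable_restrict) (use assms(2) in auto)
qed

lemma mult_mat_entry:
  "V \<in> carrier_mat n n \<Longrightarrow> Q \<in> carrier_mat n n \<Longrightarrow> i < n \<Longrightarrow> j < n \<Longrightarrow>
    (V * Q) $$ (i, j) = (\<Sum>k<n. V $$ (i, k) * Q $$ (k, j))"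
  by (simp add: scalar_prod_def lessThan_atLeast0)

lemma measurable_mat_mult:
  assumes "f \<in> measurable M (borel_mat n)" "g \<in> measurable M (borel_mat n)"
  shows "(\<lambda>w. f w * g w) \<in> measurable M (borel_mat n)"
proof (rule measurable_borel_matI)
  have c: "f w \<in> carrier_mat n n" "g w \<in> carrier_mat n n" if "w \<in> space M" for w
    using measurable_space[OF assms(1) that] measurable_space[OF assms(2) that] by auto
  show "f w * g w \<in> carrier_mat n n" if "w \<in> space M" for w using c[OF that] by simp
  fix i j assume ij: "i < n" "j < n"
  have "(\<lambda>w. \<Sum>k<n. f w $$ (i, k) * g w $$ (k, j)) \<in> borel_measurable M"
    by (intro borel_measurable_sum borel_measurable_times measurable_compose[OF assms(1) measurable_borel_mat_entry]
        measurable_compose[OF assms(2) measurable_borel_mat_entry]) (use ij in auto)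
  then show "(\<lambda>w. (f w * g w) $$ (i, j)) \<in> borel_measurable M"
    by (rule measurable_cong[THEN iffD1, rotated]) (rule mult_mat_entry[symmetric, OF c ij])
qed

lemma measurable_mat_transpose:
  assumes "f \<in> measurable M (borel_mat n)"
  shows "(\<lambda>w. transpose_mat (f w)) \<in> measurable M (borel_mat n)"
proof (rule measurable_borel_matI)
  have c: "f w \<in> carrier_mat n n" if "w \<in> space M" for w
    using measurable_space[OF assms(1) that] by auto
  show "transpose_mat (f w) \<in> carrier_mat n n" if "w \<in> space M" for w using c[OF that] by simp
  fix i j assume ij: "i < n" "j < n"
  have "(\<lambda>w. f w $$ (j, i)) \<in> borel_measurable M"
    by (rule measurable_compose[OF assms measurable_borel_mat_entry]) (use ij in auto)
  then show "(\<lambda>w. transpose_mat (f w) $$ (i, j)) \<in> borel_measurable M"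
    by (rule measurable_cong[THEN iffD1, rotated]) (simp add: carrier_matD[OF c] ij)
qed

lemma borel_measurable_wmat:
  assumes "\<And>c i j. i < n \<Longrightarrow> j < n \<Longrightarrow> (\<lambda>w. \<rho> w c i j) \<in> borel_measurable M" "i < n" "j < n"
  shows "(\<lambda>w. wmat n (\<rho> w) W i j) \<in> borel_measurable M"
  using assms(2,3)
  by (induction W arbitrary: i j) (auto simp: fmul_def intro!: borel_measurable_sum borel_measurable_times assms(1))

lemma borel_measurable_wb:
  assumes "\<And>c i j. i < n \<Longrightarrow> j < n \<Longrightarrow> (\<lambda>w. \<rho> w c i j) \<in> borel_measurable M"
    "\<And>i. i < n \<Longrightarrow> (\<lambda>w. a w i) \<in> borel_measurable M" "\<And>i. i < n \<Longrightarrow> (\<lambda>w. b w i) \<in> borel_measurable M"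
  shows "(\<lambda>w. wb n (\<rho> w) W (a w) (b w)) \<in> borel_measurable M"
  unfolding bform_def
  by (intro borel_measurable_sum borel_measurable_times borel_measurable_wmat assms) auto

lemma borel_measurable_wtr:
  assumes "\<And>c i j. i < n \<Longrightarrow> j < n \<Longrightarrow> (\<lambda>w. \<rho> w c i j) \<in> borel_measurable M"
  shows "(\<lambda>w. wtr n (\<rho> w) W) \<in> borel_measurable M"
  unfolding wtr_def
  by (intro borel_measurable_divide borel_measurable_sum borel_measurable_wb assms) auto

lemma borel_measurable_dq:
  assumes "\<And>L R. (\<lambda>w. f w L R) \<in> borel_measurable M"
  shows "(\<lambda>w. dq (f w) W) \<in> borel_measurable M"
  using assms
proof (induction W arbitrary: f)
  case (Cons c W)
  have IH: "(\<lambda>w. dq (\<lambda>L R. f w (c # L) R) W) \<in> borel_measurable M"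
    by (rule Cons.IH) (rule Cons.prems)
  show ?case by (cases c) (use IH Cons.prems in \<open>auto intro!: borel_measurable_add borel_measurable_diff\<close>)
qed simp

lemma borel_measurable_conj_mat:
  assumes "\<And>i j. i < n \<Longrightarrow> j < n \<Longrightarrow> (\<lambda>w. V w $$ (i, j)) \<in> borel_measurable M"
    "\<And>i j. i < n \<Longrightarrow> j < n \<Longrightarrow> (\<lambda>w. A w i j) \<in> borel_measurable M" "i < n" "j < n"
  shows "(\<lambda>w. conj_mat n (V w) (A w) i j) \<in> borel_measurable M"
  unfolding conj_mat_def
  by (intro borel_measurable_sum borel_measurable_times assms) auto

text \<open>The quantity Y of the overview.\<close>

definition sd_form :: "nat \<Rightarrow> (letter \<Rightarrow> fmat) \<Rightarrow> letter list \<Rightarrow> fvec \<Rightarrow> fvec \<Rightarrow> real" where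
  "sd_form n \<rho> W a x = dq (\<lambda>L R. wb n \<rho> L a x * wtr n \<rho> R) W"

definition dwtr :: "nat \<Rightarrow> (letter \<Rightarrow> fmat) \<Rightarrow> letter list \<Rightarrow> fvec \<Rightarrow> fvec \<Rightarrow> real" where
  "dwtr n \<rho> R x y = (\<Sum>j<n. dw n \<rho> R (fid j) (fid j) x y) / real n"

definition dsd_form :: "nat \<Rightarrow> (letter \<Rightarrow> fmat) \<Rightarrow> letter list \<Rightarrow> fvec \<Rightarrow> fvec \<Rightarrow> fvec \<Rightarrow> real" where
  "dsd_form n \<rho> W a x y
     = dq (\<lambda>L R. dw n \<rho> L a x x y * wtr n \<rho> R + wb n \<rho> L a x * dwtr n \<rho> R x y) W"

text \<open>The contribution of the transposed half of the generator. Summation over the unit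
  vectors gives an inner product of two vectors instead of a trace, hence no factor n.\<close>

definition sd_err :: "nat \<Rightarrow> (letter \<Rightarrow> fmat) \<Rightarrow> letter list \<Rightarrow> fvec \<Rightarrow> fvec \<Rightarrow> real" where
  "sd_err n \<rho> W a x = dq (\<lambda>L R. \<Sum>j<n. wb n \<rho> L a (fid j) * wb n \<rho> R x (fid j)) W"

lemma odiff_sd_form:
  assumes inv: "is_sum_inverse n A B G"
    and bnd: "\<And>V i j. V \<in> orthogonal_matrices n \<Longrightarrow> i < n \<Longrightarrow> j < n \<Longrightarrow> \<bar>G V i j\<bar> \<le> g"
  shows "odiff n x y (\<lambda>V. sd_form n (letter_mat n A B G V) W a x)
    (\<lambda>V. dsd_form n (letter_mat n A B G V) W a x y)"
proof -
  have "odiff n x y (\<lambda>V. wtr n (letter_mat n A B G V) R) (\<lambda>V. dwtr n (letter_mat n A B G V) R x y)" for R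
    unfolding wtr_def dwtr_def divide_inverse mult.commute[of _ "inverse (real n)"]
    by (intro odiff_cmult diffb_sum odiff_word[OF inv bnd]) auto
  then show ?thesis unfolding sd_form_def dsd_form_def
    by (intro odiff_dq odiff_mult odiff_word[OF inv bnd])
qed

text \<open>The direction x e_j^T - e_j x^T and the right end e_j are tied together, so the first
  half closes up to n times the normalised trace of the right part.\<close>

lemma dw_sum_units:
  assumes "0 < n"
  shows "(\<Sum>j<n. dw n \<rho> W a (fid j) x (fid j)) = real n * sd_form n \<rho> W a x - sd_err n \<rho> W a x"
proof -
  have "(\<Sum>j<n. wb n \<rho> L a x * wb n \<rho> R (fid j) (fid j)) = real n * (wb n \<rho> L a x * wtr n \<rho> R)" for L R
    using assms by (simp add: wtr_def sum_distrib_left[symmetric])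
  then show ?thesis
    unfolding dw_def hw_def sd_form_def sd_err_def sum_subtractf dq_sum[symmetric] dq_cmult[symmetric]
    by simp
qed

text \<open>Linearity in the second vector of the generator lets a combination of n derivatives be
  bounded as one derivative in one direction, without a factor n.\<close>

lemma dw_linear: "(\<Sum>j<n. f j * dw n \<rho> W a b x (fid j)) = dw n \<rho> W a b x f"
proof -
  have 1: "(\<Sum>j<n. f j * (u * wb n \<rho> R (fid j) b)) = u * wb n \<rho> R f b" for u R
    unfolding mult.left_commute[of "f _" u] sum_distrib_left[symmetric] bform_left_sum ..
  have 2: "(\<Sum>j<n. f j * (wb n \<rho> L a (fid j) * u)) = wb n \<rho> L a f * u" for u L
    unfolding mult.assoc[symmetric] sum_distrib_right[symmetric] bform_right_sum ..
  show ?thesis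
    unfolding dw_def hw_def right_diff_distrib sum_subtractf dq_cmult[symmetric] dq_sum[symmetric] 1 2 ..
qed

lemma dsd_form_linear: "(\<Sum>j<n. f j * dsd_form n \<rho> W a x (fid j)) = dsd_form n \<rho> W a x f"
proof -
  have 2: "(\<Sum>j<n. f j * dwtr n \<rho> R x (fid j)) = dwtr n \<rho> R x f" for R
  proof -
    have "(\<Sum>j<n. f j * dwtr n \<rho> R x (fid j)) = (\<Sum>j<n. \<Sum>i<n. f j * dw n \<rho> R (fid i) (fid i) x (fid j)) / real n"
      by (simp add: dwtr_def sum_divide_distrib sum_distrib_left)
    also have "\<dots> = (\<Sum>i<n. \<Sum>j<n. f j * dw n \<rho> R (fid i) (fid i) x (fid j)) / real n"
      by (subst sum.swap) simp
    finally show ?thesis by (simp add: dw_linear dwtr_def)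
  qed
  have "(\<Sum>j<n. f j * (dw n \<rho> L a x x (fid j) * u + v * dwtr n \<rho> R x (fid j)))
     = dw n \<rho> L a x x f * u + v * dwtr n \<rho> R x f" for L R u v
    unfolding dw_linear[of f, symmetric] 2[symmetric] sum_distrib_left sum_distrib_right
    by (simp add: sum.distrib[symmetric] algebra_simps)
  then show ?thesis unfolding dsd_form_def dq_cmult[symmetric] dq_sum[symmetric] by simp
qed

lemma wb_le:
  assumes "\<And>c. opbound n \<kappa> (\<rho> c)" "0 \<le> \<kappa>"
  shows "\<bar>wb n \<rho> W a b\<bar> \<le> \<kappa> ^ length W * (vnorm n a * vnorm n b)"
proof -
  have "opbound n (\<kappa> ^ length W) (wmat n \<rho> W)" by (rule opbound_wmat) (rule assms)+
  from opboundD[OF this, of a b] show ?thesis by (simp add: mult.assoc)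
qed

lemma hw_le:
  assumes \<rho>: "\<And>c. opbound n \<kappa> (\<rho> c)" and \<kappa>: "2 \<le> \<kappa>"
  shows "\<bar>hw n \<rho> W a b x y\<bar>
    \<le> 2 * real (length W) * (vnorm n a * vnorm n b * vnorm n x * vnorm n y) * \<kappa> ^ (length W + 2)"
  unfolding hw_def
proof (rule dq_bound)
  fix L R
  have "\<bar>wb n \<rho> L a x * wb n \<rho> R y b\<bar>
      \<le> (\<kappa> ^ length L * (vnorm n a * vnorm n x)) * (\<kappa> ^ length R * (vnorm n y * vnorm n b))"
    unfolding abs_mult using \<kappa> by (intro mult_mono wb_le \<rho>) auto
  then show "\<bar>wb n \<rho> L a x * wb n \<rho> R y b\<bar>
     \<le> vnorm n a * vnorm n b * vnorm n x * vnorm n y * \<kappa> ^ (length L + length R)"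
    by (simp add: power_add mult_ac)
qed (use \<kappa> in auto)

lemma dw_le:
  assumes \<rho>: "\<And>c. opbound n \<kappa> (\<rho> c)" and \<kappa>: "2 \<le> \<kappa>"
  shows "\<bar>dw n \<rho> W a b x y\<bar>
    \<le> 4 * real (length W) * (vnorm n a * vnorm n b * vnorm n x * vnorm n y) * \<kappa> ^ (length W + 2)"
proof -
  define z where "z = real (length W) * ((vnorm n a * vnorm n b * vnorm n x * vnorm n y) * \<kappa> ^ (length W + 2))"
  have "\<bar>hw n \<rho> W a b x y\<bar> \<le> 2 * z"
    using hw_le[of n \<kappa> \<rho> W a b x y, OF \<rho> \<kappa>] by (simp only: z_def mult.assoc)
  moreover have "\<bar>hw n \<rho> W a b y x\<bar> \<le> 2 * z"
    using hw_le[of n \<kappa> \<rho> W a b y x, OF \<rho> \<kappa>]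
    by (simp only: z_def mult.assoc mult.commute[of "vnorm n x" "vnorm n y"])
  ultimately have "\<bar>dw n \<rho> W a b x y\<bar> \<le> 4 * z" unfolding dw_def by linarith
  then show ?thesis by (simp only: z_def mult.assoc)
qed

lemma dwtr_le:
  assumes \<rho>: "\<And>c. opbound n \<kappa> (\<rho> c)" and \<kappa>: "2 \<le> \<kappa>"
  shows "\<bar>dwtr n \<rho> R x y\<bar> \<le> 4 * real (length R) * (vnorm n x * vnorm n y) * \<kappa> ^ (length R + 2)"
proof (cases "n = 0")
  case True
  then show ?thesis using \<kappa> by (simp add: dwtr_def)
next
  case False
  let ?b = "4 * real (length R) * (vnorm n x * vnorm n y) * \<kappa> ^ (length R + 2)"
  have "\<bar>\<Sum>j<n. dw n \<rho> R (fid j) (fid j) x y\<bar> \<le> (\<Sum>j<n. ?b)"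
    by (rule order_trans[OF sum_abs sum_mono], rule order_trans[OF dw_le[OF \<rho> \<kappa>]]) auto
  then show ?thesis using False by (simp add: dwtr_def abs_div field_simps)
qed

lemma sd_form_le:
  assumes \<rho>: "\<And>c. opbound n \<kappa> (\<rho> c)" and \<kappa>: "2 \<le> \<kappa>"
  shows "\<bar>sd_form n \<rho> W a x\<bar> \<le> 2 * real (length W) * (vnorm n a * vnorm n x) * \<kappa> ^ (length W + 2)"
  unfolding sd_form_def
proof (rule dq_bound)
  fix L R
  have "\<bar>wb n \<rho> L a x * wtr n \<rho> R\<bar> \<le> (\<kappa> ^ length L * (vnorm n a * vnorm n x)) * \<kappa> ^ length R"
    unfolding abs_mult using \<kappa> by (intro mult_mono wb_le wtr_le \<rho>) auto
  then show "\<bar>wb n \<rho> L a x * wtr n \<rho> R\<bar> \<le> vnorm n a * vnorm n x * \<kappa> ^ (length L + length R)"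
    by (simp add: power_add mult_ac)
qed (use \<kappa> in auto)

lemma sd_err_le:
  assumes \<rho>: "\<And>c. opbound n \<kappa> (\<rho> c)" and \<kappa>: "2 \<le> \<kappa>"
  shows "\<bar>sd_err n \<rho> W a x\<bar> \<le> 2 * real (length W) * (vnorm n a * vnorm n x) * \<kappa> ^ (length W + 2)"
  unfolding sd_err_def
proof (rule dq_bound)
  fix L R
  have k: "0 \<le> \<kappa>" and k2: "0 \<le> \<kappa> ^ m" for m using \<kappa> by simp_all
  have ow: "opbound n (\<kappa> ^ length W) (wmat n \<rho> W)" for W
    by (rule opbound_wmat[OF \<rho> k])
  have v: "vnorm n (vmat n a (wmat n \<rho> L)) \<le> \<kappa> ^ length L * vnorm n a" for a L
    by (rule vnorm_vmat[OF ow k2])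
  \<comment> \<open>The sum is the inner product of a^T L and x^T R, so Cauchy-Schwarz bounds it
    independently of n.\<close>
  have e: "(\<Sum>j<n. wb n \<rho> L a (fid j) * wb n \<rho> R x (fid j))
      = ip n (vmat n a (wmat n \<rho> L)) (vmat n x (wmat n \<rho> R))"
    by (simp add: ip_def bform_fid_right)
  have "\<bar>\<Sum>j<n. wb n \<rho> L a (fid j) * wb n \<rho> R x (fid j)\<bar>
      \<le> vnorm n (vmat n a (wmat n \<rho> L)) * vnorm n (vmat n x (wmat n \<rho> R))"
    unfolding e by (rule ip_le)
  also have "\<dots> \<le> (\<kappa> ^ length L * vnorm n a) * (\<kappa> ^ length R * vnorm n x)"
    by (rule mult_mono[OF v v mult_nonneg_nonneg[OF k2 vnorm_nonneg] vnorm_nonneg])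
  finally show "\<bar>\<Sum>j<n. wb n \<rho> L a (fid j) * wb n \<rho> R x (fid j)\<bar>
     \<le> vnorm n a * vnorm n x * \<kappa> ^ (length L + length R)"
    by (simp add: power_add mult_ac)
qed (use \<kappa> in auto)

lemma length_le_power: "2 \<le> \<kappa> \<Longrightarrow> real m \<le> \<kappa> ^ m" for \<kappa> :: real
proof -
  assume "2 \<le> \<kappa>"
  then have "(2::real) ^ m \<le> \<kappa> ^ m" by (intro power_mono) auto
  moreover have "real m \<le> 2 ^ m" using of_nat_less_two_power[of m] by (simp add: less_imp_le)
  ultimately show ?thesis by linarith
qed

text \<open>\<open>dq_bound\<close> accepts only geometric growth in the lengths of the two parts.
  The length factors of the inner derivatives are absorbed by \<open>length_le_power\<close>, at the
  price of the base \<open>\<kappa>\<^sup>2\<close>.\<close>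

lemma dsd_form_le:
  assumes \<rho>: "\<And>c. opbound n \<kappa> (\<rho> c)" and \<kappa>: "2 \<le> \<kappa>"
  shows "\<bar>dsd_form n \<rho> W a x y\<bar>
    \<le> 2 * real (length W) * (8 * \<kappa>\<^sup>2 * (vnorm n a * vnorm n x * vnorm n x * vnorm n y)) * (\<kappa>\<^sup>2) ^ (length W + 2)"
  unfolding dsd_form_def
proof (rule dq_bound)
  fix L R
  let ?N = "vnorm n a * vnorm n x * vnorm n x * vnorm n y"
  have k: "0 \<le> \<kappa>" "1 \<le> \<kappa>" using \<kappa> by auto
  have p: "real (length u) * \<kappa> ^ (length u + 2) * \<kappa> ^ length v \<le> \<kappa>\<^sup>2 * (\<kappa>\<^sup>2) ^ (length u + length v)"
    for u v :: "letter list"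
  proof -
    have "real (length u) * \<kappa> ^ (length u + 2) * \<kappa> ^ length v
       \<le> \<kappa> ^ length u * \<kappa> ^ (length u + 2) * \<kappa> ^ (2 * length v)"
      by (intro mult_mono length_le_power \<kappa> power_increasing) (use k in auto)
    also have "\<dots> = \<kappa>\<^sup>2 * (\<kappa>\<^sup>2) ^ (length u + length v)"
      unfolding power_add[symmetric] power_mult[symmetric] by (rule arg_cong[where f="power \<kappa>"]) simp
    finally show ?thesis .
  qed
  have "\<bar>dw n \<rho> L a x x y * wtr n \<rho> R\<bar>
     \<le> (4 * real (length L) * (vnorm n a * vnorm n x * vnorm n x * vnorm n y) * \<kappa> ^ (length L + 2)) * \<kappa> ^ length R"
    unfolding abs_mult using k by (intro mult_mono dw_le wtr_le \<rho> \<kappa>) auto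
  also have "\<dots> = 4 * ?N * (real (length L) * \<kappa> ^ (length L + 2) * \<kappa> ^ length R)" by (simp add: mult_ac)
  also have "\<dots> \<le> 4 * ?N * (\<kappa>\<^sup>2 * (\<kappa>\<^sup>2) ^ (length L + length R))" by (intro mult_left_mono p) auto
  finally have 1: "\<bar>dw n \<rho> L a x x y * wtr n \<rho> R\<bar> \<le> 4 * ?N * (\<kappa>\<^sup>2 * (\<kappa>\<^sup>2) ^ (length L + length R))" .
  have "\<bar>wb n \<rho> L a x * dwtr n \<rho> R x y\<bar>
     \<le> (\<kappa> ^ length L * (vnorm n a * vnorm n x)) * (4 * real (length R) * (vnorm n x * vnorm n y) * \<kappa> ^ (length R + 2))"
    unfolding abs_mult using k by (intro mult_mono wb_le dwtr_le \<rho> \<kappa>) auto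
  also have "\<dots> = 4 * ?N * (real (length R) * \<kappa> ^ (length R + 2) * \<kappa> ^ length L)" by (simp add: mult_ac)
  also have "\<dots> \<le> 4 * ?N * (\<kappa>\<^sup>2 * (\<kappa>\<^sup>2) ^ (length R + length L))" by (intro mult_left_mono p) auto
  finally have 2: "\<bar>wb n \<rho> L a x * dwtr n \<rho> R x y\<bar> \<le> 4 * ?N * (\<kappa>\<^sup>2 * (\<kappa>\<^sup>2) ^ (length L + length R))"
    by (simp add: add.commute)
  show "\<bar>dw n \<rho> L a x x y * wtr n \<rho> R + wb n \<rho> L a x * dwtr n \<rho> R x y\<bar>
     \<le> 8 * \<kappa>\<^sup>2 * ?N * (\<kappa>\<^sup>2) ^ (length L + length R)"
    using 1 2 by (simp add: mult_ac)
  show "1 \<le> \<kappa>\<^sup>2" using k(2) by (rule one_le_power)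
qed (intro mult_nonneg_nonneg vnorm_nonneg, auto)

text \<open>The cost of one integration by parts. The first summand bounds \<open>sd_err\<close>
  times \<open>sd_form\<close>, the second 2 k + 1 times the derivative of the form in the direction
  a^T W; the norms of the fixed vectors are replaced by \<kappa>, that of a^T W by
  \<open>\<kappa> ^ length W * \<kappa>\<close>.\<close>

definition sd_const :: "real \<Rightarrow> letter list \<Rightarrow> nat \<Rightarrow> real" where
  "sd_const \<kappa> W k = (2 * real (length W) * (\<kappa> * \<kappa>) * \<kappa> ^ (length W + 2))\<^sup>2
     + real (2 * k + 1) * (2 * real (length W) * (8 * \<kappa>\<^sup>2 * (\<kappa> * \<kappa> * \<kappa> * (\<kappa> ^ length W * \<kappa>))) * (\<kappa>\<^sup>2) ^ (length W + 2))"

definition moment_const :: "real \<Rightarrow> letter list \<Rightarrow> nat \<Rightarrow> real" where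
  "moment_const \<kappa> W k = (\<Prod>j<k. sd_const \<kappa> W j)"

section \<open>Integration by parts against a right invariant law\<close>

locale right_haar = prob_space \<mu> for \<mu> :: "real mat measure" +
  fixes n :: nat
  assumes sets_eq: "sets \<mu> = sets (borel_mat n)"
    and AE_orthogonal: "AE V in \<mu>. V \<in> orthogonal_matrices n"
    and right_invariant: "\<And>Q. Q \<in> orthogonal_matrices n \<Longrightarrow> distr \<mu> (borel_mat n) (\<lambda>V. V * Q) = \<mu>"
begin

lemma measurable_eq: "borel_measurable \<mu> = borel_measurable (borel_mat n)"
  by (intro measurable_cong_sets sets_eq refl)

lemma integrable_bounded:
  assumes "f \<in> borel_measurable \<mu>" "\<And>V. V \<in> orthogonal_matrices n \<Longrightarrow> \<bar>f V\<bar> \<le> (c::real)"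
  shows "integrable \<mu> f"
  by (rule integrable_const_bound[where B=c]) (use AE_orthogonal assms in auto)

text \<open>By invariance the integral of f does not change along the rotation, so its expansion
  bounds t times the integral of f' by c t^2; dividing by t and letting t be small leaves 0.\<close>

lemma integral_derivative_zero:
  assumes d: "odiff n x y f f'" and f: "f \<in> borel_measurable \<mu>" and f': "f' \<in> borel_measurable \<mu>"
  shows "integrable \<mu> f'" "integral\<^sup>L \<mu> f' = 0"
proof -
  obtain c where c: "0 \<le> c"
    "\<And>V t. V \<in> orthogonal_matrices n \<Longrightarrow> 0 \<le> t \<Longrightarrow> t \<le> 1 \<Longrightarrow> \<bar>f (rotate_by n x y t V) - f V - t * f' V\<bar> \<le> c * t\<^sup>2"
    "\<And>V. V \<in> orthogonal_matrices n \<Longrightarrow> \<bar>f V\<bar> \<le> c" "\<And>V. V \<in> orthogonal_matrices n \<Longrightarrow> \<bar>f' V\<bar> \<le> c"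
    using diffbE[OF d] by metis
  show i': "integrable \<mu> f'" by (rule integrable_bounded[OF f' c(4)])
  have i: "integrable \<mu> f" by (rule integrable_bounded[OF f c(3)])
  have le: "\<bar>integral\<^sup>L \<mu> f'\<bar> \<le> c * t" if t: "0 < t" "t \<le> 1" for t
  proof -
    have m: "rotate_by n x y t \<in> measurable \<mu> (borel_mat n)"
      by (rule measurable_mat_mult) (auto simp: measurable_cong_sets[OF sets_eq refl] intro: measurable_const)
    have fm: "f \<in> borel_measurable (borel_mat n)" using f by (simp add: measurable_eq)
    have "integral\<^sup>L \<mu> f = integral\<^sup>L (distr \<mu> (borel_mat n) (rotate_by n x y t)) f"
      using right_invariant[OF cayley_orthogonal[of n x y t]] by simp
    also have "\<dots> = (\<integral>V. f (rotate_by n x y t V) \<partial>\<mu>)" by (rule integral_distr[OF m fm])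
    finally have e: "(\<integral>V. f (rotate_by n x y t V) \<partial>\<mu>) = integral\<^sup>L \<mu> f" by simp
    have it: "integrable \<mu> (\<lambda>V. f (rotate_by n x y t V))"
      by (rule integrable_bounded[OF measurable_compose[OF m fm]]) (rule c(3), rule rotate_closed)
    have "(\<integral>V. f (rotate_by n x y t V) - f V - t * f' V \<partial>\<mu>) = - t * integral\<^sup>L \<mu> f'"
      using it i i' e by simp
    moreover have "\<bar>\<integral>V. f (rotate_by n x y t V) - f V - t * f' V \<partial>\<mu>\<bar> \<le> (\<integral>V. \<bar>f (rotate_by n x y t V) - f V - t * f' V\<bar> \<partial>\<mu>)"
      by (rule integral_abs_bound)
    moreover have "\<dots> \<le> (\<integral>V. c * t\<^sup>2 \<partial>\<mu>)"
      by (rule integral_mono_AE) (use it i i' AE_orthogonal c(2) t in auto)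
    moreover have "(\<integral>V. c * t\<^sup>2 \<partial>\<mu>) = t * (c * t)" by (simp add: prob_space power2_eq_square)
    moreover have "\<bar>- t * integral\<^sup>L \<mu> f'\<bar> = t * \<bar>integral\<^sup>L \<mu> f'\<bar>" using t by (simp add: abs_mult)
    ultimately have "t * \<bar>integral\<^sup>L \<mu> f'\<bar> \<le> t * (c * t)" by linarith
    then show ?thesis by (rule mult_left_le_imp_le) (rule t)
  qed
  have "\<bar>integral\<^sup>L \<mu> f'\<bar> \<le> 0"
  proof (rule ccontr)
    assume "\<not> \<bar>integral\<^sup>L \<mu> f'\<bar> \<le> 0"
    then have p: "0 < \<bar>integral\<^sup>L \<mu> f'\<bar>" by simp
    let ?t = "min 1 (\<bar>integral\<^sup>L \<mu> f'\<bar> / (2 * (c + 1)))"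
    have "\<bar>integral\<^sup>L \<mu> f'\<bar> \<le> c * ?t" by (rule le) (use p c(1) in \<open>auto simp: field_simps\<close>)
    also have "\<dots> \<le> (c + 1) * (\<bar>integral\<^sup>L \<mu> f'\<bar> / (2 * (c + 1)))"
      by (intro mult_mono) (use p c(1) in auto)
    also have "\<dots> = \<bar>integral\<^sup>L \<mu> f'\<bar> / 2" using c(1) by (simp add: field_simps)
    finally show False using p by simp
  qed
  then show "integral\<^sup>L \<mu> f' = 0" by simp
qed

text \<open>The products of a^T W e_j with Y^(2k+1) are differentiated along x e_j^T - e_j x^T,
  integrated to 0 and summed over j. The first factor yields n Y minus a bounded error, the second
  (2k+1) Y^(2k) times a bounded derivative, so every step of the induction gains a factor
  1/n.\<close>

theorem sd_moment:
  assumes n: "0 < n" and inv: "is_sum_inverse n A B G"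
    and G: "\<And>i j. i < n \<Longrightarrow> j < n \<Longrightarrow> (\<lambda>V. G V i j) \<in> borel_measurable (borel_mat n)"
    and \<kappa>: "2 \<le> \<kappa>"
    and \<rho>: "\<And>V c. V \<in> orthogonal_matrices n \<Longrightarrow> opbound n \<kappa> (letter_mat n A B G V c)"
    and a: "vnorm n a \<le> \<kappa>" and x: "vnorm n x \<le> \<kappa>"
  shows "(\<integral>V. sd_form n (letter_mat n A B G V) W a x ^ (2 * k) \<partial>\<mu>) \<le> moment_const \<kappa> W k / real n ^ k"
proof (induction k)
  case 0
  then show ?case by (simp add: moment_const_def prob_space)
next
  case (Suc k)
  define \<rho>' where "\<rho>' = letter_mat n A B G"
  define Y where "Y V = sd_form n (\<rho>' V) W a x" for V
  define D where "D V y = dsd_form n (\<rho>' V) W a x y" for V y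
  define p where "p = 2 * k + 1"
  have \<kappa>0: "0 \<le> \<kappa>" using \<kappa> by simp
  have bnd: "\<bar>G V i j\<bar> \<le> \<kappa>" if "V \<in> orthogonal_matrices n" "i < n" "j < n" for V i j
    using opboundD[OF \<rho>[OF that(1), of LG], of "fid i" "fid j"] that by (simp add: bform_unit)
  have m\<rho>: "(\<lambda>V. \<rho>' V c i j) \<in> borel_measurable (borel_mat n)" if "i < n" "j < n" for c i j
    unfolding \<rho>'_def letter_mat_def
    by (cases c) (use that in \<open>auto intro!: borel_measurable_conj_mat measurable_borel_mat_entry G\<close>)
  have mwb: "(\<lambda>V. wb n (\<rho>' V) U b c) \<in> borel_measurable (borel_mat n)" for U b c
    by (rule borel_measurable_wb) (auto intro: m\<rho>)
  have mdw: "(\<lambda>V. dw n (\<rho>' V) U b c z y) \<in> borel_measurable (borel_mat n)" for U b c z y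
    unfolding dw_def hw_def by (intro borel_measurable_diff borel_measurable_dq borel_measurable_times mwb)
  have mtr: "(\<lambda>V. wtr n (\<rho>' V) U) \<in> borel_measurable (borel_mat n)" for U
    by (rule borel_measurable_wtr) (rule m\<rho>)
  have mY: "Y \<in> borel_measurable (borel_mat n)" unfolding Y_def sd_form_def
    by (intro borel_measurable_dq borel_measurable_times mwb mtr)
  have mD: "(\<lambda>V. D V y) \<in> borel_measurable (borel_mat n)" for y unfolding D_def dsd_form_def dwtr_def
    by (intro borel_measurable_dq borel_measurable_times borel_measurable_add borel_measurable_divide
        borel_measurable_sum mwb mtr mdw) auto
  define F where "F j V = dw n (\<rho>' V) W a (fid j) x (fid j) * Y V ^ p
      + wb n (\<rho>' V) W a (fid j) * (real p * Y V ^ (p - 1) * D V (fid j))" for j V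
  have dF: "odiff n x (fid j) (\<lambda>V. wb n (\<rho>' V) W a (fid j) * Y V ^ p) (F j)" for j
    unfolding F_def Y_def D_def \<rho>'_def
    by (intro odiff_mult odiff_word[OF inv bnd] odiff_power odiff_sd_form[OF inv bnd])
  have mF: "F j \<in> borel_measurable \<mu>" for j unfolding F_def measurable_eq
    by (intro borel_measurable_add borel_measurable_times borel_measurable_power mdw mwb mY mD) auto
  have mF0: "(\<lambda>V. wb n (\<rho>' V) W a (fid j) * Y V ^ p) \<in> borel_measurable \<mu>" for j unfolding measurable_eq
    by (intro borel_measurable_times borel_measurable_power mwb mY)
  \<comment> \<open>The row vector a^T W. It collects the n derivatives of Y into a single one in
    the direction y, and its norm does not grow with n.\<close>
  define y where "y V j = wb n (\<rho>' V) W a (fid j)" for V j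
  define E where "E V = sd_err n (\<rho>' V) W a x" for V
  have sumF: "(\<Sum>j<n. F j V) = (real n * Y V - E V) * Y V ^ p + real p * Y V ^ (p - 1) * D V (y V)" for V
  proof -
    have "(\<Sum>j<n. F j V) = (\<Sum>j<n. dw n (\<rho>' V) W a (fid j) x (fid j)) * Y V ^ p
       + real p * Y V ^ (p - 1) * (\<Sum>j<n. y V j * D V (fid j))"
      by (simp add: F_def y_def sum.distrib sum_distrib_left sum_distrib_right mult_ac)
    then show ?thesis unfolding dw_sum_units[OF n] D_def dsd_form_linear Y_def E_def .
  qed
  have iF: "integrable \<mu> (\<lambda>V. \<Sum>j<n. F j V)"
    by (intro Bochner_Integration.integrable_sum integral_derivative_zero(1)[OF dF mF0 mF])
  have zero: "(\<integral>V. (\<Sum>j<n. F j V) \<partial>\<mu>) = 0"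
    by (subst Bochner_Integration.integral_sum)
       (auto intro: integral_derivative_zero[OF dF mF0 mF] simp: integral_derivative_zero(2)[OF dF mF0 mF])
  define cY where "cY = 2 * real (length W) * (\<kappa> * \<kappa>) * \<kappa> ^ (length W + 2)"
  have ax: "vnorm n a * vnorm n x \<le> \<kappa> * \<kappa>" by (intro mult_mono a x) (use \<kappa>0 in auto)
  have cY: "2 * real (length W) * (vnorm n a * vnorm n x) * \<kappa> ^ (length W + 2) \<le> cY"
    unfolding cY_def by (intro mult_right_mono mult_left_mono ax) (use \<kappa>0 in auto)
  have bY: "\<bar>Y V\<bar> \<le> cY" "\<bar>E V\<bar> \<le> cY" if "V \<in> orthogonal_matrices n" for V
    using sd_form_le[of n \<kappa> "\<rho>' V" W a x] sd_err_le[of n \<kappa> "\<rho>' V" W a x] \<rho>[OF that] \<kappa> cY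
    unfolding Y_def E_def \<rho>'_def by fastforce+
  define cD where "cD = 2 * real (length W) * (8 * \<kappa>\<^sup>2 * (\<kappa> * \<kappa> * \<kappa> * (\<kappa> ^ length W * \<kappa>))) * (\<kappa>\<^sup>2) ^ (length W + 2)"
  have bD: "\<bar>D V (y V)\<bar> \<le> cD" if V: "V \<in> orthogonal_matrices n" for V
  proof -
    have "vnorm n (y V) = vnorm n (vmat n a (wmat n (\<rho>' V) W))"
      unfolding vnorm_def by (rule L2_set_cong) (auto simp: y_def bform_fid_right)
    also have "\<dots> \<le> \<kappa> ^ length W * vnorm n a"
      by (intro vnorm_vmat opbound_wmat) (use \<rho>[OF V] \<kappa>0 in \<open>auto simp: \<rho>'_def\<close>)
    also have "\<dots> \<le> \<kappa> ^ length W * \<kappa>" by (intro mult_left_mono a) (use \<kappa>0 in auto)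
    finally have vy: "vnorm n (y V) \<le> \<kappa> ^ length W * \<kappa>" .
    have "\<bar>D V (y V)\<bar> \<le> 2 * real (length W) * (8 * \<kappa>\<^sup>2 * (vnorm n a * vnorm n x * vnorm n x * vnorm n (y V))) * (\<kappa>\<^sup>2) ^ (length W + 2)"
      unfolding D_def by (rule dsd_form_le) (use \<rho>[OF V] \<kappa> in \<open>auto simp: \<rho>'_def\<close>)
    also have "\<dots> \<le> cD" unfolding cD_def
      by (intro mult_right_mono mult_left_mono mult_mono a x vy) (use \<kappa>0 in auto)
    finally show ?thesis .
  qed
  have iY: "integrable \<mu> (\<lambda>V. Y V ^ m)" for m
  proof (rule integrable_bounded)
    show "(\<lambda>V. Y V ^ m) \<in> borel_measurable \<mu>" unfolding measurable_eq by (intro borel_measurable_power mY)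
    show "\<bar>Y V ^ m\<bar> \<le> cY ^ m" if "V \<in> orthogonal_matrices n" for V
      unfolding power_abs by (intro power_mono bY that) auto
  qed
  have sdc: "sd_const \<kappa> W k = cY\<^sup>2 + real p * cD" by (simp add: sd_const_def cY_def cD_def p_def)
  \<comment> \<open>\<open>Y V ^ (2 * k)\<close> is nonnegative because its exponent is even, so its
    coefficient may be replaced by the upper bound \<open>sd_const\<close>.\<close>
  have pw: "real n * Y V ^ (2 * Suc k) \<le> (\<Sum>j<n. F j V) + sd_const \<kappa> W k * Y V ^ (2 * k)"
    if V: "V \<in> orthogonal_matrices n" for V
  proof -
    have e: "real n * Y V ^ (2 * Suc k) = (\<Sum>j<n. F j V) + (E V * Y V - real p * D V (y V)) * Y V ^ (2 * k)"
      unfolding sumF p_def by (simp add: algebra_simps power2_eq_square)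
    have "\<bar>E V * Y V\<bar> \<le> cY * cY" unfolding abs_mult by (intro mult_mono bY V) (use bY(1)[OF V] in auto)
    moreover have "\<bar>real p * D V (y V)\<bar> \<le> real p * cD" unfolding abs_mult using bD[OF V] by (simp add: mult_left_mono)
    ultimately have "E V * Y V - real p * D V (y V) \<le> sd_const \<kappa> W k"
      unfolding sdc power2_eq_square by linarith
    then have "(E V * Y V - real p * D V (y V)) * Y V ^ (2 * k) \<le> sd_const \<kappa> W k * Y V ^ (2 * k)"
      by (rule mult_right_mono) (simp add: power_mult)
    then show ?thesis unfolding e by simp
  qed
  have "real n * (\<integral>V. Y V ^ (2 * Suc k) \<partial>\<mu>) = (\<integral>V. real n * Y V ^ (2 * Suc k) \<partial>\<mu>)"
    by simp
  also have "\<dots> \<le> (\<integral>V. (\<Sum>j<n. F j V) + sd_const \<kappa> W k * Y V ^ (2 * k) \<partial>\<mu>)"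
    by (rule integral_mono_AE)
       (use AE_orthogonal pw in \<open>auto intro!: Bochner_Integration.integrable_add iF integrable_mult_right iY simp del: power_Suc mult_Suc_right\<close>)
  also have "\<dots> = sd_const \<kappa> W k * (\<integral>V. Y V ^ (2 * k) \<partial>\<mu>)"
    using iF iY zero by simp
  also have "\<dots> \<le> sd_const \<kappa> W k * (moment_const \<kappa> W k / real n ^ k)"
  proof (rule mult_left_mono)
    show "(\<integral>V. Y V ^ (2 * k) \<partial>\<mu>) \<le> moment_const \<kappa> W k / real n ^ k"
      using Suc.IH by (simp add: Y_def \<rho>'_def)
    show "0 \<le> sd_const \<kappa> W k"
      using \<kappa>0 by (auto simp: sd_const_def intro!: add_nonneg_nonneg mult_nonneg_nonneg)
  qed
  finally have "(\<integral>V. Y V ^ (2 * Suc k) \<partial>\<mu>) \<le> sd_const \<kappa> W k * moment_const \<kappa> W k / real n ^ Suc k"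
    using n by (simp add: field_simps)
  then show ?case by (simp add: Y_def \<rho>'_def moment_const_def mult.commute)
qed

end

section \<open>Right invariance of the Haar law\<close>

lemma distr_eqI_nn_integral:
  assumes T: "T \<in> measurable \<mu> \<mu>"
    and "\<And>f. f \<in> borel_measurable \<mu> \<Longrightarrow> (\<integral>\<^sup>+x. f (T x) \<partial>\<mu>) = (\<integral>\<^sup>+x. f x \<partial>\<mu>)"
    and "sets N = sets \<mu>"
  shows "distr \<mu> N T = \<mu>"
proof (rule measure_eqI)
  fix X assume "X \<in> sets (distr \<mu> N T)"
  then have X: "X \<in> sets \<mu>" using assms(3) by simp
  have T': "T \<in> measurable \<mu> N" using T measurable_cong_sets[OF refl assms(3)] by blast
  have "emeasure (distr \<mu> N T) X = (\<integral>\<^sup>+x. indicator X x \<partial>distr \<mu> N T)"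
    using X assms(3) by simp
  also have "\<dots> = (\<integral>\<^sup>+x. indicator X (T x) \<partial>\<mu>)"
    by (rule nn_integral_distr[OF T']) (use X assms(3) in simp)
  also have "\<dots> = emeasure \<mu> X" using assms(2)[of "indicator X"] X by simp
  finally show "emeasure (distr \<mu> N T) X = emeasure \<mu> X" .
qed (use assms in simp)

lemma nn_integral_distr_invariant:
  assumes "distr \<mu> N T = \<mu>" "T \<in> measurable \<mu> N" "f \<in> borel_measurable N"
  shows "(\<integral>\<^sup>+x. f (T x) \<partial>\<mu>) = (\<integral>\<^sup>+x. f x \<partial>\<mu>)"
proof -
  have "(\<integral>\<^sup>+x. f x \<partial>distr \<mu> N T) = (\<integral>\<^sup>+x. f (T x) \<partial>\<mu>)"
    by (rule nn_integral_distr[OF assms(2)]) (use assms(3) in simp)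
  then show ?thesis using assms(1) by simp
qed

lemma orthogonal_matrices_transpose:
  "V \<in> orthogonal_matrices n \<Longrightarrow> transpose_mat V \<in> orthogonal_matrices n"
  by (auto simp: orthogonal_matrices_def)

text \<open>Finitely many polynomial equations between entries. Measurability of the set lets almost
  sure orthogonality pass from \<open>U\<close> to its law.\<close>

lemma sets_orthogonal_matrices: "{V \<in> carrier_mat n n. V \<in> orthogonal_matrices n} \<in> sets (borel_mat n)"
proof -
  have id: "(\<lambda>V. V) \<in> measurable (borel_mat n) (borel_mat n)" by simp
  have "{V \<in> carrier_mat n n. V \<in> orthogonal_matrices n}
      = {V \<in> space (borel_mat n). \<forall>p\<in>{..<n} \<times> {..<n}. (transpose_mat V * V) $$ (fst p, snd p) = fid (fst p) (snd p)
           \<and> (V * transpose_mat V) $$ (fst p, snd p) = fid (fst p) (snd p)}"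
    by (auto simp: orthogonal_matrices_def fid_def intro!: eq_matI)
  also have "\<dots> \<in> sets (borel_mat n)"
  proof (rule sets.sets_Collect_finite_All[OF _ finite_cartesian_product[OF finite_lessThan finite_lessThan]])
    fix p :: "nat \<times> nat" assume p: "p \<in> {..<n} \<times> {..<n}"
    have m: "(\<lambda>V. (transpose_mat V * V) $$ (fst p, snd p)) \<in> borel_measurable (borel_mat n)"
      "(\<lambda>V. (V * transpose_mat V) $$ (fst p, snd p)) \<in> borel_measurable (borel_mat n)"
      using p by (auto intro!: measurable_compose[OF measurable_mat_mult measurable_borel_mat_entry]
          measurable_mat_transpose[OF id])
    show "{V \<in> space (borel_mat n). (transpose_mat V * V) $$ (fst p, snd p) = fid (fst p) (snd p)
           \<and> (V * transpose_mat V) $$ (fst p, snd p) = fid (fst p) (snd p)} \<in> sets (borel_mat n)"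
      by (intro sets.sets_Collect_conj borel_measurable_eq m) auto
  qed
  finally show ?thesis .
qed

text \<open>Convolving a left-invariant law with its image under transposition identifies the two,
  so the law is also right invariant.\<close>
lemma right_haar_distr:
  assumes "prob_space P" and h: "haar_orthogonal P n U"
  shows "right_haar (distr P (borel_mat n) U) n"
proof -
  interpret P: prob_space P by fact
  define \<mu> where "\<mu> = distr P (borel_mat n) U"
  have U: "U \<in> measurable P (borel_mat n)" and AEU: "AE w in P. U w \<in> orthogonal_matrices n"
    and inv: "\<And>Q. Q \<in> orthogonal_matrices n \<Longrightarrow> distr P (borel_mat n) (\<lambda>w. Q * U w) = distr P (borel_mat n) U"
    using h by (auto simp: haar_orthogonal_def)
  interpret \<mu>: prob_space \<mu> unfolding \<mu>_def by (rule P.prob_space_distr[OF U])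
  have s [measurable_cong]: "sets \<mu> = sets (borel_mat n)" by (simp add: \<mu>_def)
  have sp: "space \<mu> = carrier_mat n n" using sets_eq_imp_space_eq[OF s] by simp
  have AE\<mu>: "AE V in \<mu>. V \<in> orthogonal_matrices n"
    unfolding \<mu>_def by (subst AE_distr_iff[OF U]) (use sets_orthogonal_matrices AEU in auto)
  have id: "(\<lambda>V. V) \<in> measurable \<mu> (borel_mat n)" by (simp add: measurable_cong_sets[OF s refl])
  have const: "Q \<in> orthogonal_matrices n \<Longrightarrow> (\<lambda>V. Q) \<in> measurable M (borel_mat n)" for Q and M :: "'c measure"
    by (rule measurable_const) (simp add: orthogonal_matrices_def)
  have ml: "(\<lambda>V. Q * V) \<in> measurable \<mu> \<mu>" if "Q \<in> orthogonal_matrices n" for Q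
    using measurable_mat_mult[OF const[OF that] id] by (simp add: measurable_cong_sets[OF refl s])
  have mr: "(\<lambda>V. V * Q) \<in> measurable \<mu> \<mu>" if "Q \<in> orthogonal_matrices n" for Q
    using measurable_mat_mult[OF id const[OF that]] by (simp add: measurable_cong_sets[OF refl s])
  have mt: "transpose_mat \<in> measurable \<mu> \<mu>"
    using measurable_mat_transpose[OF id] by (simp add: measurable_cong_sets[OF refl s])
  have left: "(\<integral>\<^sup>+V. f (Q * V) \<partial>\<mu>) = (\<integral>\<^sup>+V. f V \<partial>\<mu>)"
    if Q: "Q \<in> orthogonal_matrices n" and f: "f \<in> borel_measurable \<mu>" for Q f
  proof (rule nn_integral_distr_invariant[OF _ ml[OF Q] f])
    have "distr \<mu> \<mu> (\<lambda>V. Q * V) = distr \<mu> (borel_mat n) (\<lambda>V. Q * V)"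
      by (rule distr_cong) (use s in auto)
    also have "\<dots> = distr P (borel_mat n) ((\<lambda>V. Q * V) \<circ> U)"
      unfolding \<mu>_def by (rule distr_distr) (use ml[OF Q] U in \<open>auto simp: measurable_cong_sets[OF s s]\<close>)
    also have "\<dots> = \<mu>" using inv[OF Q] by (simp add: \<mu>_def comp_def)
    finally show "distr \<mu> \<mu> (\<lambda>V. Q * V) = \<mu>" .
  qed
  interpret pp: pair_prob_space \<mu> \<mu> ..
  have transp: "(\<integral>\<^sup>+V. f (transpose_mat V) \<partial>\<mu>) = (\<integral>\<^sup>+V. f V \<partial>\<mu>)" if f: "f \<in> borel_measurable \<mu>" for f
  proof -
    have mf: "(\<lambda>p. f (transpose_mat (fst p) * snd p)) \<in> borel_measurable (\<mu> \<Otimes>\<^sub>M \<mu>)"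
    proof (rule measurable_compose[OF _ f])
      have "(\<lambda>p. transpose_mat (fst p) * snd p) \<in> measurable (\<mu> \<Otimes>\<^sub>M \<mu>) (borel_mat n)"
        by (intro measurable_mat_mult measurable_mat_transpose)
           (use measurable_fst measurable_snd in \<open>auto simp: measurable_cong_sets[OF refl s, symmetric]\<close>)
      then show "(\<lambda>p. transpose_mat (fst p) * snd p) \<in> measurable (\<mu> \<Otimes>\<^sub>M \<mu>) \<mu>"
        by (simp add: measurable_cong_sets[OF refl s])
    qed
    have mft: "(\<lambda>V. f (transpose_mat V)) \<in> borel_measurable \<mu>" by (rule measurable_compose[OF mt f])
    \<comment> \<open>The double integral of f(V^T W) is evaluated twice. Over W, left invariance
      under V^T gives the integral of f; over V, the identity V^T W = (W^T V)^T and left invariance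
      under W^T give the integral of f after transposition.\<close>
    have "(\<integral>\<^sup>+V. f V \<partial>\<mu>) = (\<integral>\<^sup>+V. (\<integral>\<^sup>+W. f W \<partial>\<mu>) \<partial>\<mu>)" by (simp add: \<mu>.emeasure_space_1)
    also have "\<dots> = (\<integral>\<^sup>+V. (\<integral>\<^sup>+W. f (transpose_mat V * W) \<partial>\<mu>) \<partial>\<mu>)"
      by (rule nn_integral_cong_AE)
         (use AE\<mu> in \<open>auto elim!: eventually_mono simp: left[OF orthogonal_matrices_transpose f]\<close>)
    also have "\<dots> = (\<integral>\<^sup>+W. (\<integral>\<^sup>+V. f (transpose_mat V * W) \<partial>\<mu>) \<partial>\<mu>)"
      using pp.Fubini'[of "\<lambda>V W. f (transpose_mat V * W)"] mf by (simp add: split_beta')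
    also have "\<dots> = (\<integral>\<^sup>+W. (\<integral>\<^sup>+V. f (transpose_mat V) \<partial>\<mu>) \<partial>\<mu>)"
    proof (rule nn_integral_cong_AE)
      show "AE W in \<mu>. (\<integral>\<^sup>+V. f (transpose_mat V * W) \<partial>\<mu>) = (\<integral>\<^sup>+V. f (transpose_mat V) \<partial>\<mu>)"
        using AE\<mu>
      proof (eventually_elim)
        case (elim W)
        then have W: "W \<in> carrier_mat n n" by (simp add: orthogonal_matrices_def)
        have "(\<integral>\<^sup>+V. f (transpose_mat V * W) \<partial>\<mu>) = (\<integral>\<^sup>+V. f (transpose_mat (transpose_mat W * V)) \<partial>\<mu>)"
          by (rule nn_integral_cong) (use W in \<open>simp add: sp transpose_mult[of _ n n _ n]\<close>)
        then show ?case using left[OF orthogonal_matrices_transpose[OF elim] mft] by simp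
      qed
    qed
    also have "\<dots> = (\<integral>\<^sup>+V. f (transpose_mat V) \<partial>\<mu>)" by (simp add: \<mu>.emeasure_space_1)
    finally show ?thesis by simp
  qed
  show ?thesis
    unfolding \<mu>_def[symmetric]
  proof
    show "sets \<mu> = sets (borel_mat n)" by (rule s)
    show "AE V in \<mu>. V \<in> orthogonal_matrices n" by (rule AE\<mu>)
    fix Q assume Q: "Q \<in> orthogonal_matrices n"
    then have Qc: "Q \<in> carrier_mat n n" by (simp add: orthogonal_matrices_def)
    note Qt = orthogonal_matrices_transpose[OF Q]
    show "distr \<mu> (borel_mat n) (\<lambda>V. V * Q) = \<mu>"
    proof (rule distr_eqI_nn_integral[OF mr[OF Q]])
      fix f :: "real mat \<Rightarrow> ennreal" assume f: "f \<in> borel_measurable \<mu>"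
      have mft: "(\<lambda>V. f (transpose_mat V)) \<in> borel_measurable \<mu>" by (rule measurable_compose[OF mt f])
      \<comment> \<open>V Q is the transpose of Q^T V^T, so right multiplication is left
        multiplication between two transpositions.\<close>
      have "(\<integral>\<^sup>+V. f (V * Q) \<partial>\<mu>) = (\<integral>\<^sup>+V. f (transpose_mat (transpose_mat Q * transpose_mat V)) \<partial>\<mu>)"
        by (rule nn_integral_cong) (use Qc in \<open>simp add: sp transpose_mult[of _ n n _ n]\<close>)
      also have "\<dots> = (\<integral>\<^sup>+V. f (transpose_mat (transpose_mat Q * V)) \<partial>\<mu>)"
        by (rule transp) (rule measurable_compose[OF ml[OF Qt] mft])
      also have "\<dots> = (\<integral>\<^sup>+V. f (transpose_mat V) \<partial>\<mu>)" by (rule left[OF Qt mft])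
      also have "\<dots> = (\<integral>\<^sup>+V. f V \<partial>\<mu>)" by (rule transp[OF f])
      finally show "(\<integral>\<^sup>+V. f (V * Q) \<partial>\<mu>) = (\<integral>\<^sup>+V. f V \<partial>\<mu>)" .
    qed (rule s[symmetric])
  qed
qed

section \<open>Almost sure Schwinger-Dyson relations\<close>

text \<open>Cramer's rule makes each entry a rational, hence measurable, function of the entries of
  \<open>M\<close>; for a singular matrix division by zero gives the zero matrix.\<close>

definition finv :: "nat \<Rightarrow> fmat \<Rightarrow> fmat" where
  "finv n M i j = adj_mat (mat n n (\<lambda>(i, j). M i j)) $$ (i, j) / det (mat n n (\<lambda>(i, j). M i j))"

section \<open>Determinants and inverses as measurable functions\<close>

lemma borel_measurable_det:
  assumes "\<And>i j. i < n \<Longrightarrow> j < n \<Longrightarrow> (\<lambda>w. M w i j :: real) \<in> borel_measurable S"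
  shows "(\<lambda>w. det (mat n n (\<lambda>(i, j). M w i j))) \<in> borel_measurable S"
proof -
  have "det (mat n n (\<lambda>(i, j). M w i j)) = (\<Sum>p\<in>{p. p permutes {0..<n}}. signof p * (\<Prod>i = 0..<n. M w i (p i)))" for w
  proof -
    have "det (mat n n (\<lambda>(i, j). M w i j))
       = (\<Sum>p\<in>{p. p permutes {0..<n}}. signof p * (\<Prod>i = 0..<n. mat n n (\<lambda>(i, j). M w i j) $$ (i, p i)))"
      by (rule det_def') simp
    also have "\<dots> = (\<Sum>p\<in>{p. p permutes {0..<n}}. signof p * (\<Prod>i = 0..<n. M w i (p i)))"
      by (intro sum.cong prod.cong arg_cong2[where f="times"] refl)
         (auto dest: permutes_in_image)
    finally show ?thesis .
  qed
  then show ?thesis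
    by (auto intro!: borel_measurable_sum borel_measurable_times borel_measurable_prod assms
        dest: permutes_in_image)
qed

lemma borel_measurable_finv:
  assumes M: "\<And>i j. i < n \<Longrightarrow> j < n \<Longrightarrow> (\<lambda>w. M w i j :: real) \<in> borel_measurable S"
    and ij: "i < n" "j < n"
  shows "(\<lambda>w. finv n (M w) i j) \<in> borel_measurable S"
proof -
  \<comment> \<open>A minor is again a matrix with measurable entries, its indices skipping one row
    and one column.\<close>
  have e: "adj_mat (mat n n (\<lambda>(i, j). M w i j)) $$ (i, j)
      = (-1) ^ (j + i) * det (mat (n - 1) (n - 1) (\<lambda>(k, l). M w (if k < j then k else Suc k) (if l < i then l else Suc l)))" for w
  proof -
    have "mat_delete (mat n n (\<lambda>(i, j). M w i j)) j i
      = mat (n - 1) (n - 1) (\<lambda>(k, l). M w (if k < j then k else Suc k) (if l < i then l else Suc l))"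
      by (rule eq_matI) (auto simp: mat_delete_def)
    then show ?thesis using ij by (simp add: adj_mat_def cofactor_def)
  qed
  show ?thesis unfolding finv_def e
    by (intro borel_measurable_divide borel_measurable_times borel_measurable_const borel_measurable_det M)
       (auto simp: less_diff_conv)
qed

lemma finv_inverse:
  assumes d: "det (mat n n (\<lambda>(i, j). M i j)) \<noteq> 0" and ij: "i < n" "j < n"
  shows "(\<Sum>k<n. finv n M i k * M k j) = fid i j" "(\<Sum>k<n. M i k * finv n M k j) = fid i j"
proof -
  let ?M = "mat n n (\<lambda>(i, j). M i j)"
  have c: "?M \<in> carrier_mat n n" by simp
  note a = adj_mat[OF c]
  have "(\<Sum>k<n. finv n M i k * M k j) = (\<Sum>k<n. adj_mat ?M $$ (i, k) * ?M $$ (k, j)) / det ?M"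
    unfolding finv_def sum_divide_distrib by (rule sum.cong) (use ij in auto)
  also have "(\<Sum>k<n. adj_mat ?M $$ (i, k) * ?M $$ (k, j)) = (adj_mat ?M * ?M) $$ (i, j)"
    by (rule mult_mat_entry[OF a(1) c ij, symmetric])
  finally show "(\<Sum>k<n. finv n M i k * M k j) = fid i j"
    unfolding a(3) using d ij by (simp add: fid_def)
  have "(\<Sum>k<n. M i k * finv n M k j) = (\<Sum>k<n. ?M $$ (i, k) * adj_mat ?M $$ (k, j)) / det ?M"
    unfolding finv_def sum_divide_distrib by (rule sum.cong) (use ij in auto)
  also have "(\<Sum>k<n. ?M $$ (i, k) * adj_mat ?M $$ (k, j)) = (?M * adj_mat ?M) $$ (i, j)"
    by (rule mult_mat_entry[OF c a(1) ij, symmetric])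
  finally show "(\<Sum>k<n. M i k * finv n M k j) = fid i j"
    unfolding a(2) using d ij by (simp add: fid_def)
qed

text \<open>The quadratic form is at least 1/\<kappa> times the squared norm, for \<kappa> > 0. This
  lower bound yields invertibility, bounds the inverse by \<kappa>, and survives orthogonal
  conjugation and the addition of nonnegative forms.\<close>

definition coercive :: "nat \<Rightarrow> real \<Rightarrow> fmat \<Rightarrow> bool" where
  "coercive n \<kappa> M \<longleftrightarrow> (\<forall>a. ip n a a \<le> \<kappa> * bform n a M a)"

definition conditioned :: "nat \<Rightarrow> real \<Rightarrow> fmat \<Rightarrow> bool" where
  "conditioned n \<kappa> M \<longleftrightarrow> opbound n \<kappa> M \<and> coercive n \<kappa> M"

definition sum_inv :: "nat \<Rightarrow> fmat \<Rightarrow> fmat \<Rightarrow> real mat \<Rightarrow> fmat" where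
  "sum_inv n A B V = finv n (\<lambda>i j. conj_mat n V A i j + B i j)"

abbreviation letters :: "nat \<Rightarrow> fmat \<Rightarrow> fmat \<Rightarrow> real mat \<Rightarrow> letter \<Rightarrow> fmat" where
  "letters n A B \<equiv> letter_mat n A B (sum_inv n A B)"

section \<open>Uniform bounds for conjugates and inverses\<close>

lemma ip_self_nonneg: "0 \<le> ip n a a" by (simp add: ip_def sum_nonneg)

lemma coercive_det:
  assumes "coercive n \<kappa> M"
  shows "det (mat n n (\<lambda>(i, j). M i j)) \<noteq> 0"
proof
  let ?M = "mat n n (\<lambda>(i, j). M i j)"
  assume "det ?M = 0"
  then obtain v where v: "v \<in> carrier_vec n" "v \<noteq> 0\<^sub>v n" "?M *\<^sub>v v = 0\<^sub>v n"
    using det_0_iff_vec_prod_zero[of ?M n] by auto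
  have "mvec n M (\<lambda>i. v $ i) i = 0" if "i < n" for i
  proof -
    have "mvec n M (\<lambda>i. v $ i) i = (?M *\<^sub>v v) $ i"
      using that v(1) by (simp add: mvec_def scalar_prod_def lessThan_atLeast0)
    then show ?thesis using v(3) that by simp
  qed
  then have "bform n (\<lambda>i. v $ i) M (\<lambda>i. v $ i) = 0" by (simp add: bform_eq_ip_mvec ip_def)
  then have "ip n (\<lambda>i. v $ i) (\<lambda>i. v $ i) \<le> 0"
    using assms unfolding coercive_def by (metis mult_zero_right)
  then have "(\<Sum>i<n. v $ i * v $ i) = 0" using ip_self_nonneg[of n "\<lambda>i. v $ i"] by (simp add: ip_def)
  then have "\<forall>i<n. v $ i = 0" by (subst (asm) sum_nonneg_eq_0_iff) auto
  then have "v = 0\<^sub>v n" using v(1) by (intro eq_vecI) auto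
  then show False using v(2) by simp
qed

text \<open>For y = M^(-1) b coercivity reads |y|^2 \<le> \<kappa> y^T M y = \<kappa> y^T b, and one
  factor |y| cancels.\<close>

lemma opbound_finv:
  assumes c: "coercive n \<kappa> M" and k: "0 \<le> \<kappa>"
  shows "opbound n \<kappa> (finv n M)"
  unfolding opbound_def
proof (intro allI)
  fix a b
  define y where "y = mvec n (finv n M) b"
  have My: "mvec n M y i = b i" if "i < n" for i
  proof -
    have "mvec n M y i = mvec n (fmul n M (finv n M)) b i" by (simp add: y_def mvec_fmul)
    also have "\<dots> = (\<Sum>j<n. fid i j * b j)" unfolding mvec_def
      by (intro sum.cong refl arg_cong2[where f="times"])
         (use finv_inverse(2)[OF coercive_det[OF c] that] in \<open>simp_all add: fmul_def\<close>)
    finally show ?thesis using that by simp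
  qed
  have "(vnorm n y)\<^sup>2 \<le> \<kappa> * ip n y b"
    using c unfolding coercive_def vnorm_sq bform_eq_ip_mvec by (metis (no_types, lifting) My ip_def lessThan_iff sum.cong)
  also have "\<dots> \<le> \<kappa> * (vnorm n y * vnorm n b)"
    using ip_le[of n y b] k by (intro mult_left_mono) auto
  finally have "vnorm n y * vnorm n y \<le> vnorm n y * (\<kappa> * vnorm n b)" by (simp add: power2_eq_square mult_ac)
  then have y: "vnorm n y \<le> \<kappa> * vnorm n b"
    using k vnorm_nonneg[of n y] by (cases "vnorm n y = 0") (auto simp: mult_le_cancel_left)
  have "\<bar>bform n a (finv n M) b\<bar> \<le> vnorm n a * vnorm n y"
    unfolding bform_eq_ip_mvec y_def[symmetric] by (rule ip_le)
  also have "\<dots> \<le> vnorm n a * (\<kappa> * vnorm n b)" by (intro mult_left_mono y) simp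
  finally show "\<bar>bform n a (finv n M) b\<bar> \<le> \<kappa> * vnorm n a * vnorm n b" by (simp add: mult_ac)
qed

lemma bform_conj_mat:
  "bform n a (conj_mat n V A) b = bform n (\<lambda>k. \<Sum>i<n. V $$ (k, i) * a i) A (\<lambda>k. \<Sum>i<n. V $$ (k, i) * b i)"
proof -
  have "bform n a (conj_mat n V A) b
      = (\<Sum>i<n. \<Sum>j<n. \<Sum>k<n. \<Sum>l<n. (V $$ (k, i) * a i) * A k l * (V $$ (l, j) * b j))"
    by (simp add: bform_def conj_mat_def sum_distrib_left sum_distrib_right mult_ac)
  also have "\<dots> = (\<Sum>i<n. \<Sum>k<n. \<Sum>j<n. \<Sum>l<n. (V $$ (k, i) * a i) * A k l * (V $$ (l, j) * b j))"
    by (intro sum.cong refl sum.swap)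
  also have "\<dots> = (\<Sum>k<n. \<Sum>i<n. \<Sum>j<n. \<Sum>l<n. (V $$ (k, i) * a i) * A k l * (V $$ (l, j) * b j))"
    by (rule sum.swap)
  also have "\<dots> = (\<Sum>k<n. \<Sum>i<n. \<Sum>l<n. \<Sum>j<n. (V $$ (k, i) * a i) * A k l * (V $$ (l, j) * b j))"
    by (intro sum.cong refl sum.swap)
  also have "\<dots> = (\<Sum>k<n. \<Sum>l<n. \<Sum>i<n. \<Sum>j<n. (V $$ (k, i) * a i) * A k l * (V $$ (l, j) * b j))"
    by (intro sum.cong refl sum.swap)
  finally show ?thesis by (simp add: bform_def sum_distrib_left sum_distrib_right mult_ac)
qed

lemma ip_orthogonal:
  assumes V: "V \<in> orthogonal_matrices n"
  shows "ip n (\<lambda>k. \<Sum>i<n. V $$ (k, i) * a i) (\<lambda>k. \<Sum>i<n. V $$ (k, i) * b i) = ip n a b"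
proof -
  have "ip n (\<lambda>k. \<Sum>i<n. V $$ (k, i) * a i) (\<lambda>k. \<Sum>i<n. V $$ (k, i) * b i) = bform n a (conj_mat n V fid) b"
    unfolding bform_conj_mat bform_fid ..
  also have "\<dots> = bform n a fid b"
    by (rule bform_cong) (auto simp: conj_mat_def mult.assoc orthogonal_matrices_sum[OF V]
        sum_distrib_left[symmetric])
  finally show ?thesis by (simp add: bform_fid)
qed

lemma conditioned_conj_mat:
  assumes V: "V \<in> orthogonal_matrices n" and A: "conditioned n \<kappa> A"
  shows "conditioned n \<kappa> (conj_mat n V A)"
proof -
  have n: "vnorm n (\<lambda>k. \<Sum>i<n. V $$ (k, i) * a i) = vnorm n a" for a
    using ip_orthogonal[OF V, of a a] unfolding vnorm_sq[symmetric]
    by (simp add: power2_eq_iff_nonneg)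
  have o: "opbound n \<kappa> (conj_mat n V A)"
    unfolding opbound_def bform_conj_mat
  proof (intro allI)
    fix a b
    show "\<bar>bform n (\<lambda>k. \<Sum>i<n. V $$ (k, i) * a i) A (\<lambda>k. \<Sum>i<n. V $$ (k, i) * b i)\<bar>
        \<le> \<kappa> * vnorm n a * vnorm n b"
      using A opboundD[of n \<kappa> A "\<lambda>k. \<Sum>i<n. V $$ (k, i) * a i" "\<lambda>k. \<Sum>i<n. V $$ (k, i) * b i"]
      unfolding n conditioned_def by blast
  qed
  have "coercive n \<kappa> (conj_mat n V A)"
    unfolding coercive_def bform_conj_mat
  proof
    fix a
    show "ip n a a \<le> \<kappa> * bform n (\<lambda>k. \<Sum>i<n. V $$ (k, i) * a i) A (\<lambda>k. \<Sum>i<n. V $$ (k, i) * a i)"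
      using A unfolding conditioned_def coercive_def ip_orthogonal[OF V, of a a, symmetric] by blast
  qed
  with o show ?thesis by (simp add: conditioned_def)
qed

lemma coercive_add:
  assumes "conditioned n \<kappa> A" "conditioned n \<kappa> B" "0 < \<kappa>"
  shows "coercive n \<kappa> (\<lambda>i j. A i j + B i j)"
  unfolding coercive_def
proof
  fix a
  have "0 \<le> \<kappa> * bform n a A a" using assms(1) ip_self_nonneg[of n a]
    unfolding conditioned_def coercive_def by (meson order_trans)
  moreover have "bform n a (\<lambda>i j. A i j + B i j) a = bform n a A a + bform n a B a"
    by (simp add: bform_def algebra_simps sum.distrib)
  ultimately show "ip n a a \<le> \<kappa> * bform n a (\<lambda>i j. A i j + B i j) a"
    using assms(2) unfolding conditioned_def coercive_def by (smt (verit) distrib_left)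
qed

lemma conditioned_letters:
  assumes "conditioned n \<kappa> A" "conditioned n \<kappa> B" "0 < \<kappa>"
  shows "V \<in> orthogonal_matrices n \<Longrightarrow> opbound n \<kappa> (letters n A B V c)"
    and "is_sum_inverse n A B (sum_inv n A B)"
proof -
  have c: "coercive n \<kappa> (\<lambda>i j. conj_mat n V A i j + B i j)" if "V \<in> orthogonal_matrices n" for V
    by (rule coercive_add[OF conditioned_conj_mat[OF that assms(1)] assms(2,3)])
  show "opbound n \<kappa> (letters n A B V c)" if V: "V \<in> orthogonal_matrices n"
  proof (cases c)
    case LA
    then show ?thesis using conditioned_conj_mat[OF V assms(1)] by (simp add: conditioned_def)
  next
    case LB
    then show ?thesis using assms(2) by (simp add: conditioned_def)
  next
    case LG
    then show ?thesis using opbound_finv[OF c[OF V]] assms(3) by (simp add: sum_inv_def)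
  qed
  show "is_sum_inverse n A B (sum_inv n A B)"
    unfolding is_sum_inverse_def sum_inv_def
    using finv_inverse[OF coercive_det[OF c]] by auto
qed

section \<open>Uniform almost sure vanishing over polynomially many vectors\<close>

definition sd_value :: "nat \<Rightarrow> letter list \<Rightarrow> fmat \<Rightarrow> fmat \<Rightarrow> real mat \<Rightarrow> fvec \<Rightarrow> fvec \<Rightarrow> real" where
  "sd_value n W A B V a x = sd_form n (letters n A B V) W a x"

lemma borel_measurable_sd_value:
  assumes "\<And>i j. i < n \<Longrightarrow> j < n \<Longrightarrow> (\<lambda>w. V w $$ (i, j)) \<in> borel_measurable M"
    "\<And>i j. i < n \<Longrightarrow> j < n \<Longrightarrow> (\<lambda>w. A w i j) \<in> borel_measurable M"
    "\<And>i j. i < n \<Longrightarrow> j < n \<Longrightarrow> (\<lambda>w. B w i j) \<in> borel_measurable M"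
    "\<And>i. i < n \<Longrightarrow> (\<lambda>w. a w i) \<in> borel_measurable M"
    "\<And>i. i < n \<Longrightarrow> (\<lambda>w. x w i) \<in> borel_measurable M"
  shows "(\<lambda>w. sd_value n W (A w) (B w) (V w) (a w) (x w)) \<in> borel_measurable M"
proof -
  have c: "(\<lambda>w. conj_mat n (V w) (A w) i j) \<in> borel_measurable M" if "i < n" "j < n" for i j
    by (rule borel_measurable_conj_mat[OF assms(1,2) that])
  have "(\<lambda>w. sum_inv n (A w) (B w) (V w) i j) \<in> borel_measurable M" if "i < n" "j < n" for i j
    unfolding sum_inv_def by (rule borel_measurable_finv[OF borel_measurable_add[OF c assms(3)] that])
  then have r: "(\<lambda>w. letters n (A w) (B w) (V w) c i j) \<in> borel_measurable M" if "i < n" "j < n" for c i j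
    by (cases c) (use that c assms(3) in simp_all)
  show ?thesis unfolding sd_value_def sd_form_def
    by (intro borel_measurable_dq borel_measurable_times borel_measurable_wb borel_measurable_wtr r assms)
qed

lemma (in right_haar) sd_value_nn_moment:
  assumes n: "0 < n" and A: "conditioned n \<kappa> A" and B: "conditioned n \<kappa> B" and \<kappa>: "2 \<le> \<kappa>"
    and a: "vnorm n a \<le> \<kappa>" and x: "vnorm n x \<le> \<kappa>"
  shows "(\<integral>\<^sup>+V. ennreal (sd_value n W A B V a x ^ (2 * k)) \<partial>\<mu>) \<le> ennreal (moment_const \<kappa> W k / real n ^ k)"
proof -
  have k0: "0 < \<kappa>" using \<kappa> by simp
  note good = conditioned_letters[OF A B k0]
  have m: "(\<lambda>V. sd_value n W A B V a x) \<in> borel_measurable (borel_mat n)"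
    by (rule borel_measurable_sd_value) (auto intro: measurable_borel_mat_entry)
  have "integrable \<mu> (\<lambda>V. sd_value n W A B V a x ^ (2 * k))"
  proof (rule integrable_bounded)
    show "(\<lambda>V. sd_value n W A B V a x ^ (2 * k)) \<in> borel_measurable \<mu>"
      unfolding measurable_eq by (intro borel_measurable_power m)
    show "\<bar>sd_value n W A B V a x ^ (2 * k)\<bar>
        \<le> (2 * real (length W) * (vnorm n a * vnorm n x) * \<kappa> ^ (length W + 2)) ^ (2 * k)"
      if "V \<in> orthogonal_matrices n" for V
      unfolding power_abs sd_value_def by (intro power_mono sd_form_le good(1) that \<kappa>) auto
  qed
  then have "(\<integral>\<^sup>+V. ennreal (sd_value n W A B V a x ^ (2 * k)) \<partial>\<mu>)
     = ennreal (\<integral>V. sd_value n W A B V a x ^ (2 * k) \<partial>\<mu>)"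
    by (rule nn_integral_eq_integral) (simp add: power_mult)
  also have "\<dots> \<le> ennreal (moment_const \<kappa> W k / real n ^ k)"
    unfolding sd_value_def
  proof (intro ennreal_leI sd_moment n good(2) \<kappa> good(1) a x)
    fix i j assume "i < n" "j < n"
    then show "(\<lambda>V. sum_inv n A B V i j) \<in> borel_measurable (borel_mat n)"
      unfolding sum_inv_def
      by (intro borel_measurable_finv borel_measurable_add borel_measurable_conj_mat borel_measurable_const measurable_borel_mat_entry)
  qed
  finally show ?thesis .
qed

text \<open>Rather than proving that the bounds on the spectra are measurable events, the exceptional
  set is cut out by the (measurable) conditional moment, which those bounds control.\<close>
lemma sd_value_event:
  fixes Z :: "'w \<Rightarrow> 'z"
  assumes "prob_space P" and haar: "haar_orthogonal P n U" and n: "0 < n"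
    and Z: "Z \<in> measurable P S"
    and indep: "prob_space.indep_set P (sets (vimage_algebra (space P) U (borel_mat n)))
      (sets (vimage_algebra (space P) Z S))"
    and A: "\<And>i j. i < n \<Longrightarrow> j < n \<Longrightarrow> (\<lambda>z. A z i j) \<in> borel_measurable S"
    and B: "\<And>i j. i < n \<Longrightarrow> j < n \<Longrightarrow> (\<lambda>z. B z i j) \<in> borel_measurable S"
    and a: "\<And>i. i < n \<Longrightarrow> (\<lambda>z. a z i) \<in> borel_measurable S"
    and x: "\<And>i. i < n \<Longrightarrow> (\<lambda>z. x z i) \<in> borel_measurable S"
    and \<kappa>: "2 \<le> \<kappa>" and \<epsilon>: "0 < \<epsilon>"
  shows "\<exists>E\<in>sets P. measure P E \<le> moment_const \<kappa> W k / \<epsilon> ^ (2 * k) / real n ^ k \<and>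
    (\<forall>w\<in>space P. conditioned n \<kappa> (A (Z w)) \<longrightarrow> conditioned n \<kappa> (B (Z w)) \<longrightarrow>
       vnorm n (a (Z w)) \<le> \<kappa> \<longrightarrow> vnorm n (x (Z w)) \<le> \<kappa> \<longrightarrow>
       \<epsilon> < \<bar>sd_value n W (A (Z w)) (B (Z w)) (U w) (a (Z w)) (x (Z w))\<bar> \<longrightarrow> w \<in> E)"
proof -
  interpret P: prob_space P by fact
  have U: "U \<in> measurable P (borel_mat n)" using haar by (simp add: haar_orthogonal_def)
  define \<mu> where "\<mu> = distr P (borel_mat n) U"
  define \<nu> where "\<nu> = distr P S Z"
  interpret \<mu>: right_haar \<mu> n unfolding \<mu>_def by (rule right_haar_distr) fact+
  interpret \<nu>: prob_space \<nu> unfolding \<nu>_def by (rule P.prob_space_distr[OF Z])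
  interpret pp: pair_prob_space \<mu> \<nu> ..
  \<comment> \<open>Independence makes the joint law of \<open>U\<close> and \<open>Z\<close> a
    product, so Fubini can integrate over \<open>U\<close> with \<open>Z\<close> frozen.\<close>
  have joint: "\<mu> \<Otimes>\<^sub>M \<nu> = distr P (borel_mat n \<Otimes>\<^sub>M S) (\<lambda>w. (U w, Z w))"
  proof (rule pair_measure_eqI)
    show "sigma_finite_measure \<mu>" "sigma_finite_measure \<nu>" by unfold_locales
    show "sets (\<mu> \<Otimes>\<^sub>M \<nu>) = sets (distr P (borel_mat n \<Otimes>\<^sub>M S) (\<lambda>w. (U w, Z w)))"
      unfolding sets_distr by (intro sets_pair_measure_cong) (simp_all add: \<mu>_def \<nu>_def)
    fix X Y assume "X \<in> sets \<mu>" "Y \<in> sets \<nu>"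
    then have XY: "X \<in> sets (borel_mat n)" "Y \<in> sets S" by (simp_all add: \<mu>_def \<nu>_def)
    have "emeasure (distr P (borel_mat n \<Otimes>\<^sub>M S) (\<lambda>w. (U w, Z w))) (X \<times> Y)
        = emeasure P ((\<lambda>w. (U w, Z w)) -` (X \<times> Y) \<inter> space P)"
      by (rule emeasure_distr[OF measurable_Pair[OF U Z]]) (use XY in auto)
    also have "(\<lambda>w. (U w, Z w)) -` (X \<times> Y) \<inter> space P = (U -` X \<inter> space P) \<inter> (Z -` Y \<inter> space P)"
      by auto
    also have "emeasure P \<dots> = ennreal (measure P (U -` X \<inter> space P) * measure P (Z -` Y \<inter> space P))"
      unfolding P.emeasure_eq_measure
      by (subst P.indep_setD[OF indep]) (use XY in \<open>auto intro: in_vimage_algebra\<close>)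
    also have "\<dots> = emeasure \<mu> X * emeasure \<nu> Y"
      unfolding \<mu>_def \<nu>_def emeasure_distr[OF U XY(1)] emeasure_distr[OF Z XY(2)]
      by (simp add: P.emeasure_eq_measure ennreal_mult)
    finally show "emeasure \<mu> X * emeasure \<nu> Y
        = emeasure (distr P (borel_mat n \<Otimes>\<^sub>M S) (\<lambda>w. (U w, Z w))) (X \<times> Y)" by simp
  qed
  define Y where "Y p = sd_value n W (A (snd p)) (B (snd p)) (fst p) (a (snd p)) (x (snd p))" for p
  have mY: "Y \<in> borel_measurable (borel_mat n \<Otimes>\<^sub>M S)"
    unfolding Y_def
    by (intro borel_measurable_sd_value measurable_compose[OF measurable_snd] A B a x
        measurable_compose[OF measurable_fst measurable_borel_mat_entry])
  have s2: "sets (\<mu> \<Otimes>\<^sub>M \<nu>) = sets (borel_mat n \<Otimes>\<^sub>M S)"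
    by (intro sets_pair_measure_cong) (simp_all add: \<mu>_def \<nu>_def)
  define C where "C = moment_const \<kappa> W k / real n ^ k"
  define g where "g z = (\<integral>\<^sup>+V. ennreal (Y (V, z) ^ (2 * k)) \<partial>\<mu>)" for z
  have mf: "(\<lambda>p. ennreal (Y p ^ (2 * k))) \<in> borel_measurable (\<mu> \<Otimes>\<^sub>M \<nu>)"
    unfolding measurable_cong_sets[OF s2 refl] using mY by measurable
  have mg: "g \<in> borel_measurable S"
  proof -
    have "g \<in> borel_measurable \<nu>" unfolding g_def
      by (rule \<mu>.borel_measurable_nn_integral) 
         (use measurable_compose[OF measurable_pair_swap' mf] in \<open>simp add: split_beta' case_prod_unfold\<close>)
    then show ?thesis by (simp add: \<nu>_def)
  qed
  define D where "D = {z \<in> space S. g z \<le> ennreal C}"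
  have D: "D \<in> sets S" unfolding D_def using mg by measurable
  have mYw: "(\<lambda>w. Y (U w, Z w)) \<in> borel_measurable P"
    by (rule measurable_compose[OF measurable_Pair[OF U Z] mY])
  define E where "E = {w \<in> space P. Z w \<in> D \<and> \<epsilon> < \<bar>Y (U w, Z w)\<bar>}"
  have E: "E \<in> sets P" unfolding E_def using mYw Z D by measurable
  have ek: "0 < \<epsilon> ^ (2 * k)" using \<epsilon> by simp
  \<comment> \<open>Markov's inequality for the power 2 k, restricted to those \<open>Z\<close>
    whose conditional moment is at most \<open>C\<close>.\<close>
  have "ennreal (\<epsilon> ^ (2 * k)) * emeasure P E = (\<integral>\<^sup>+w. ennreal (\<epsilon> ^ (2 * k)) * indicator E w \<partial>P)"
    by (rule nn_integral_cmult_indicator[OF E, symmetric])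
  also have "\<dots> \<le> (\<integral>\<^sup>+w. indicator D (Z w) * ennreal (Y (U w, Z w) ^ (2 * k)) \<partial>P)"
  proof (rule nn_integral_mono)
    fix w assume "w \<in> space P"
    show "ennreal (\<epsilon> ^ (2 * k)) * indicator E w \<le> indicator D (Z w) * ennreal (Y (U w, Z w) ^ (2 * k))"
    proof (cases "w \<in> E")
      case True
      then have "\<epsilon> ^ (2 * k) \<le> \<bar>Y (U w, Z w)\<bar> ^ (2 * k)" using \<epsilon> by (intro power_mono) (auto simp: E_def)
      then show ?thesis using True by (auto simp: E_def power_mult intro!: ennreal_leI)
    qed simp
  qed
  also have "\<dots> = (\<integral>\<^sup>+p. indicator D (snd p) * ennreal (Y p ^ (2 * k)) \<partial>(\<mu> \<Otimes>\<^sub>M \<nu>))"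
    unfolding joint
    by (subst nn_integral_distr[OF measurable_Pair[OF U Z]]) (use mY D in simp_all)
  also have "\<dots> = (\<integral>\<^sup>+z. (\<integral>\<^sup>+V. indicator D z * ennreal (Y (V, z) ^ (2 * k)) \<partial>\<mu>) \<partial>\<nu>)"
  proof (subst pp.nn_integral_snd[symmetric])
    show "(\<lambda>p. indicator D (snd p) * ennreal (Y p ^ (2 * k))) \<in> borel_measurable (\<mu> \<Otimes>\<^sub>M \<nu>)"
      unfolding measurable_cong_sets[OF s2 refl] using mY D by measurable
  qed simp
  also have "\<dots> = (\<integral>\<^sup>+z. indicator D z * g z \<partial>\<nu>)"
  proof (rule nn_integral_cong)
    fix z assume "z \<in> space \<nu>"
    then have "(\<lambda>V. ennreal (Y (V, z) ^ (2 * k))) \<in> borel_measurable \<mu>"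
      using measurable_compose[OF measurable_Pair2' mf] by simp
    then show "(\<integral>\<^sup>+V. indicator D z * ennreal (Y (V, z) ^ (2 * k)) \<partial>\<mu>) = indicator D z * g z"
      unfolding g_def by (rule nn_integral_cmult)
  qed
  also have "\<dots> \<le> (\<integral>\<^sup>+z. ennreal C \<partial>\<nu>)"
    by (rule nn_integral_mono) (auto simp: D_def indicator_def)
  also have "\<dots> = ennreal C" by (simp add: \<nu>.emeasure_space_1)
  finally have "ennreal (\<epsilon> ^ (2 * k)) * emeasure P E \<le> ennreal C" .
  then have "ennreal (\<epsilon> ^ (2 * k) * measure P E) \<le> ennreal C"
    using ek by (simp add: P.emeasure_eq_measure ennreal_mult)
  moreover have "0 \<le> C"
    unfolding C_def moment_const_def sd_const_def using \<kappa>
    by (intro divide_nonneg_nonneg prod_nonneg) (auto intro!: add_nonneg_nonneg mult_nonneg_nonneg)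
  ultimately have "\<epsilon> ^ (2 * k) * measure P E \<le> C" by simp
  then have "measure P E \<le> C / \<epsilon> ^ (2 * k)"
    unfolding pos_le_divide_eq[OF ek] by (simp only: mult.commute)
  then have "measure P E \<le> moment_const \<kappa> W k / \<epsilon> ^ (2 * k) / real n ^ k"
    by (simp add: C_def mult.commute)
  moreover have "w \<in> E" if w: "w \<in> space P" and g: "conditioned n \<kappa> (A (Z w))" "conditioned n \<kappa> (B (Z w))"
       "vnorm n (a (Z w)) \<le> \<kappa>" "vnorm n (x (Z w)) \<le> \<kappa>"
     and e: "\<epsilon> < \<bar>sd_value n W (A (Z w)) (B (Z w)) (U w) (a (Z w)) (x (Z w))\<bar>" for w
  proof -
    have "g (Z w) \<le> ennreal C"
      unfolding g_def C_def Y_def fst_conv snd_conv by (rule \<mu>.sd_value_nn_moment[OF n g(1,2) \<kappa> g(3,4)])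
    moreover have "Z w \<in> space S" using w Z by (rule measurable_space[rotated])
    ultimately show ?thesis using w e by (simp add: E_def D_def Y_def)
  qed
  ultimately show ?thesis using E by blast
qed

text \<open>Norm bounds and accuracies are natural numbers, so the exceptional sets form a countable
  family. The norm conditions stand inside the event because a realisation meets them only
  eventually and with its own \<kappa>.\<close>

lemma AE_sd_value_vanishes:
  fixes Z :: "nat \<Rightarrow> 'w \<Rightarrow> 'z"
  assumes P: "prob_space P" and haar: "\<And>N. N \<ge> 1 \<Longrightarrow> haar_orthogonal P N (U N)"
    and Z: "\<And>N. N \<ge> 1 \<Longrightarrow> Z N \<in> measurable P (S N)"
    and indep: "\<And>N. N \<ge> 1 \<Longrightarrow> prob_space.indep_set P (sets (vimage_algebra (space P) (U N) (borel_mat N)))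
      (sets (vimage_algebra (space P) (Z N) (S N)))"
    and A: "\<And>N i j. N \<ge> 1 \<Longrightarrow> i < N \<Longrightarrow> j < N \<Longrightarrow> (\<lambda>z. A z i j) \<in> borel_measurable (S N)"
    and B: "\<And>N i j. N \<ge> 1 \<Longrightarrow> i < N \<Longrightarrow> j < N \<Longrightarrow> (\<lambda>z. B z i j) \<in> borel_measurable (S N)"
    and a: "\<And>N l i. N \<ge> 1 \<Longrightarrow> l < m N \<Longrightarrow> i < N \<Longrightarrow> (\<lambda>z. a N l z i) \<in> borel_measurable (S N)"
    and x: "\<And>N l i. N \<ge> 1 \<Longrightarrow> l < m N \<Longrightarrow> i < N \<Longrightarrow> (\<lambda>z. x N l z i) \<in> borel_measurable (S N)"
    and m: "\<And>N. N \<ge> 1 \<Longrightarrow> m N \<le> N ^ c"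
  shows "AE w in P. \<forall>\<kappa>::nat. 2 \<le> \<kappa> \<longrightarrow> (\<forall>e::nat. \<forall>\<^sub>F N in sequentially. \<forall>l<m N.
     conditioned N \<kappa> (A (Z N w)) \<longrightarrow> conditioned N \<kappa> (B (Z N w)) \<longrightarrow>
     vnorm N (a N l (Z N w)) \<le> \<kappa> \<longrightarrow> vnorm N (x N l (Z N w)) \<le> \<kappa> \<longrightarrow>
     \<bar>sd_value N W (A (Z N w)) (B (Z N w)) (U N w) (a N l (Z N w)) (x N l (Z N w))\<bar> \<le> 1 / real (Suc e))"
proof -
  interpret P: prob_space P by fact
  have "AE w in P. \<forall>\<^sub>F N in sequentially. \<forall>l<m N.
     conditioned N \<kappa> (A (Z N w)) \<longrightarrow> conditioned N \<kappa> (B (Z N w)) \<longrightarrow>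
     vnorm N (a N l (Z N w)) \<le> \<kappa> \<longrightarrow> vnorm N (x N l (Z N w)) \<le> \<kappa> \<longrightarrow>
     \<bar>sd_value N W (A (Z N w)) (B (Z N w)) (U N w) (a N l (Z N w)) (x N l (Z N w))\<bar> \<le> 1 / real (Suc e)"
    if \<kappa>: "2 \<le> \<kappa>" for \<kappa> e :: nat
  proof -
    define \<epsilon> where "\<epsilon> = 1 / real (Suc e)"
    \<comment> \<open>The moment order c + 2 beats the union bound over at most N^c pairs by a
      summable factor N^(-2).\<close>
    define C where "C = moment_const \<kappa> W (c + 2) / \<epsilon> ^ (2 * (c + 2))"
    have "\<forall>N l. \<exists>E. N \<ge> 1 \<longrightarrow> l < m N \<longrightarrow> E \<in> sets P \<and> measure P E \<le> C / real N ^ (c + 2) \<and>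
    (\<forall>w\<in>space P. conditioned N \<kappa> (A (Z N w)) \<longrightarrow> conditioned N \<kappa> (B (Z N w)) \<longrightarrow>
       vnorm N (a N l (Z N w)) \<le> \<kappa> \<longrightarrow> vnorm N (x N l (Z N w)) \<le> \<kappa> \<longrightarrow>
       \<epsilon> < \<bar>sd_value N W (A (Z N w)) (B (Z N w)) (U N w) (a N l (Z N w)) (x N l (Z N w))\<bar> \<longrightarrow> w \<in> E)"
    proof (intro allI)
      fix N l
      show "\<exists>E. N \<ge> 1 \<longrightarrow> l < m N \<longrightarrow> E \<in> sets P \<and> measure P E \<le> C / real N ^ (c + 2) \<and>
    (\<forall>w\<in>space P. conditioned N \<kappa> (A (Z N w)) \<longrightarrow> conditioned N \<kappa> (B (Z N w)) \<longrightarrow>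
       vnorm N (a N l (Z N w)) \<le> \<kappa> \<longrightarrow> vnorm N (x N l (Z N w)) \<le> \<kappa> \<longrightarrow>
       \<epsilon> < \<bar>sd_value N W (A (Z N w)) (B (Z N w)) (U N w) (a N l (Z N w)) (x N l (Z N w))\<bar> \<longrightarrow> w \<in> E)"
      proof (cases "N \<ge> 1 \<and> l < m N")
        case True
        then have N: "N \<ge> 1" and l: "l < m N" by auto
        have "\<exists>E\<in>sets P. measure P E \<le> moment_const \<kappa> W (c + 2) / \<epsilon> ^ (2 * (c + 2)) / real N ^ (c + 2) \<and>
          (\<forall>w\<in>space P. conditioned N \<kappa> (A (Z N w)) \<longrightarrow> conditioned N \<kappa> (B (Z N w)) \<longrightarrow>
           vnorm N (a N l (Z N w)) \<le> \<kappa> \<longrightarrow> vnorm N (x N l (Z N w)) \<le> \<kappa> \<longrightarrow>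
           \<epsilon> < \<bar>sd_value N W (A (Z N w)) (B (Z N w)) (U N w) (a N l (Z N w)) (x N l (Z N w))\<bar> \<longrightarrow> w \<in> E)"
          by (rule sd_value_event[OF P haar[OF N] _ Z[OF N] indep[OF N]])
             (use N l \<kappa> A B a x in \<open>auto simp: \<epsilon>_def\<close>)
        then show ?thesis unfolding C_def by blast
      qed auto
    qed
    then obtain E where E: "\<And>N l. N \<ge> 1 \<Longrightarrow> l < m N \<Longrightarrow> E N l \<in> sets P \<and> measure P (E N l) \<le> C / real N ^ (c + 2) \<and>
    (\<forall>w\<in>space P. conditioned N \<kappa> (A (Z N w)) \<longrightarrow> conditioned N \<kappa> (B (Z N w)) \<longrightarrow>
       vnorm N (a N l (Z N w)) \<le> \<kappa> \<longrightarrow> vnorm N (x N l (Z N w)) \<le> \<kappa> \<longrightarrow>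
       \<epsilon> < \<bar>sd_value N W (A (Z N w)) (B (Z N w)) (U N w) (a N l (Z N w)) (x N l (Z N w))\<bar> \<longrightarrow> w \<in> E N l)"
      by metis
    define F where "F N = (if N \<ge> 1 then \<Union>l<m N. E N l else {})" for N
    have F: "F N \<in> sets P" for N using E by (auto simp: F_def)
    have le: "measure P (F N) \<le> C * inverse (real N ^ 2)" if N: "N \<ge> 1" for N
    proof -
      have C0: "0 \<le> C / real N ^ (c + 2)" if "m N \<noteq> 0"
        using E[OF N, of 0] that measure_nonneg[of P "E N 0"] by linarith
      have "measure P (F N) \<le> (\<Sum>l<m N. measure P (E N l))"
        unfolding F_def using N E by (auto intro!: P.finite_measure_subadditive_finite)
      also have "\<dots> \<le> (\<Sum>l<m N. C / real N ^ (c + 2))" by (rule sum_mono) (use E N in auto)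
      also have "\<dots> = real (m N) * (C / real N ^ (c + 2))" by simp
      also have "\<dots> \<le> real (N ^ c) * (C / real N ^ (c + 2))"
      proof (cases "m N = 0")
        case True
        have "0 \<le> moment_const (real \<kappa>) W (c + 2)"
          unfolding moment_const_def sd_const_def using \<kappa>
          by (intro prod_nonneg) (auto intro!: add_nonneg_nonneg mult_nonneg_nonneg)
        then show ?thesis unfolding True by (simp add: C_def \<epsilon>_def)
      next
        case False
        have "real (m N) \<le> real (N ^ c)" using m[OF N] by (rule of_nat_mono)
        then show ?thesis by (rule mult_right_mono) (rule C0[OF False])
      qed
      also have "\<dots> = C * inverse (real N ^ 2)" using N by (simp add: power_add field_simps power2_eq_square)
      finally show ?thesis .
    qed
    have summ: "summable (\<lambda>N. measure P (F N))"
    proof (rule summable_comparison_test')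
      show "summable (\<lambda>N. C * inverse (real N ^ 2))"
        by (intro summable_mult inverse_power_summable) simp
      show "norm (measure P (F N)) \<le> C * inverse (real N ^ 2)" if "N \<ge> 1" for N
        using le[OF that] by simp
    qed
    have "AE w in P. \<forall>\<^sub>F N in sequentially. w \<in> space P - F N"
      by (rule borel_cantelli_AE1[OF F _ summ]) (simp add: P.emeasure_eq_measure)
    then show ?thesis
    proof (eventually_elim)
      case (elim w)
      show ?case using elim eventually_ge_at_top[of "1::nat"]
      proof (eventually_elim)
        case (elim N)
        show ?case
        proof (intro allI impI)
          fix l assume l: "l < m N" and g: "conditioned N \<kappa> (A (Z N w))" "conditioned N \<kappa> (B (Z N w))"
            "vnorm N (a N l (Z N w)) \<le> \<kappa>" "vnorm N (x N l (Z N w)) \<le> \<kappa>"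
          have "w \<notin> E N l" using elim l by (auto simp: F_def)
          then show "\<bar>sd_value N W (A (Z N w)) (B (Z N w)) (U N w) (a N l (Z N w)) (x N l (Z N w))\<bar> \<le> 1 / real (Suc e)"
            using E[OF elim(2) l] g elim(1) unfolding \<epsilon>_def by (meson DiffD1 not_le_imp_less)
        qed
      qed
    qed
  qed
  then show ?thesis by (simp add: AE_all_countable)
qed

section \<open>The spectral theorem\<close>

definition ftr :: "fmat \<Rightarrow> fmat" where "ftr M i j = M j i"
definition fidn :: "nat \<Rightarrow> fmat" where "fidn n i j = (if i = j \<and> i < n then 1 else 0)"
text \<open>Vanishing outside the n by n block turns matrix identities into equalities of functions,
  which the induction on n can shift by one index.\<close>

definition fsupp :: "nat \<Rightarrow> fmat \<Rightarrow> bool" where "fsupp n M \<longleftrightarrow> (\<forall>i j. \<not> (i < n \<and> j < n) \<longrightarrow> M i j = 0)"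
definition fdiag :: "nat \<Rightarrow> fvec \<Rightarrow> fmat" where "fdiag n d i j = (if i = j \<and> i < n then d i else 0)"

lemma ftr_fmul: "ftr (fmul n M K) = fmul n (ftr K) (ftr M)"
  by (intro ext) (simp add: ftr_def fmul_def mult.commute)

lemma ftr_ftr [simp]: "ftr (ftr M) = M" by (intro ext) (simp add: ftr_def)

lemma fsupp_fmul: "fsupp n M \<Longrightarrow> fsupp n K \<Longrightarrow> fsupp n (fmul n M K)"
  by (auto simp: fsupp_def fmul_def intro!: sum.neutral)

lemma fsupp_simps [simp]: "fsupp n (fidn n)" "fsupp n (fdiag n d)" "fsupp n M \<Longrightarrow> fsupp n (ftr M)"
  by (auto simp: fsupp_def fidn_def fdiag_def ftr_def)

lemma fmul_fidn_left: "fsupp n M \<Longrightarrow> fmul n (fidn n) M = M"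
proof (intro ext)
  fix i j assume M: "fsupp n M"
  show "fmul n (fidn n) M i j = M i j"
  proof (cases "i < n")
    case True
    then have "fmul n (fidn n) M i j = (\<Sum>k<n. fid i k * M k j)"
      unfolding fmul_def by (intro sum.cong) (auto simp: fidn_def fid_def)
    then show ?thesis using True by simp
  qed (use M in \<open>simp add: fmul_def fidn_def fsupp_def\<close>)
qed

lemma ftr_fidn [simp]: "ftr (fidn n) = fidn n" by (intro ext) (auto simp: ftr_def fidn_def)

lemma fmul_fidn_right: "fsupp n M \<Longrightarrow> fmul n M (fidn n) = M"
  using ftr_fmul[of n "fidn n" "ftr M"] fmul_fidn_left[of n "ftr M"] by (metis fsupp_simps(3) ftr_fidn ftr_ftr)

text \<open>The fundamental theorem of algebra gives a complex eigenvalue. Comparing q^T A p with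
  p^T A q for the real part p and the imaginary part q of an eigenvector removes the imaginary part
  of the eigenvalue; then p or q is a real eigenvector.\<close>

lemma symmetric_eigenvector:
  assumes n: "0 < n" and sym: "\<And>i j. i < n \<Longrightarrow> j < n \<Longrightarrow> A i j = (A j i :: real)"
  shows "\<exists>v e. ip n v v = 1 \<and> (\<forall>i<n. mvec n A v i = e * v i)"
proof -
  define M where "M = mat n n (\<lambda>(i, j). complex_of_real (A i j))"
  have M: "M \<in> carrier_mat n n" by (simp add: M_def)
  have "\<not> constant (poly (char_poly M))"
    using degree_monic_char_poly[OF M] n by (simp add: constant_degree)
  then obtain l where "poly (char_poly M) l = 0" using fundamental_theorem_of_algebra by blast
  then have "eigenvalue M l" by (simp add: eigenvalue_root_char_poly[OF M])
  then obtain z where z: "z \<in> carrier_vec n" "z \<noteq> 0\<^sub>v n" "M *\<^sub>v z = l \<cdot>\<^sub>v z"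
    using M by (auto simp: eigenvalue_def eigenvector_def)
  define p where "p i = Re (z $ i)" for i
  define q where "q i = Im (z $ i)" for i
  have eq: "(\<Sum>j<n. complex_of_real (A i j) * z $ j) = l * z $ i" if "i < n" for i
  proof -
    have "(M *\<^sub>v z) $ i = (\<Sum>j<n. complex_of_real (A i j) * z $ j)"
      using that z(1) by (simp add: M_def scalar_prod_def lessThan_atLeast0)
    then show ?thesis using z(1,3) that by simp
  qed
  have Ap: "mvec n A p i = Re l * p i - Im l * q i" if "i < n" for i
    using arg_cong[OF eq[OF that], of Re] by (simp add: mvec_def p_def q_def)
  have Aq: "mvec n A q i = Re l * q i + Im l * p i" if "i < n" for i
    using arg_cong[OF eq[OF that], of Im] by (simp add: mvec_def p_def q_def)
  have "bform n q A p = bform n p A q"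
  proof -
    have "bform n q A p = (\<Sum>i<n. \<Sum>j<n. p j * A j i * q i)" unfolding bform_def
      by (intro sum.cong refl) (use sym in \<open>auto simp: mult_ac\<close>)
    also have "\<dots> = bform n p A q" unfolding bform_def by (rule sum.swap)
    finally show ?thesis .
  qed
  moreover have "bform n q A p = Re l * ip n q p - Im l * ip n q q"
  proof -
    have "bform n q A p = (\<Sum>i<n. q i * (Re l * p i - Im l * q i))"
      unfolding bform_eq_ip_mvec ip_def by (intro sum.cong refl) (simp add: Ap)
    then show ?thesis by (simp add: ip_def sum_distrib_left sum_subtractf algebra_simps)
  qed
  moreover have "bform n p A q = Re l * ip n q p + Im l * ip n p p"
  proof -
    have "bform n p A q = (\<Sum>i<n. p i * (Re l * q i + Im l * p i))"
      unfolding bform_eq_ip_mvec ip_def by (intro sum.cong refl) (simp add: Aq)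
    then show ?thesis by (simp add: ip_def sum_distrib_left sum.distrib algebra_simps)
  qed
  ultimately have 0: "Im l * (ip n p p + ip n q q) = 0" by (simp add: algebra_simps)
  have nn: "0 \<le> ip n a a" for a by (simp add: ip_def sum_nonneg)
  have nz: "ip n p p \<noteq> 0 \<or> ip n q q \<noteq> 0"
  proof (rule ccontr)
    assume "\<not> ?thesis"
    then have "(\<Sum>i<n. p i * p i) = 0" "(\<Sum>i<n. q i * q i) = 0" by (auto simp: ip_def)
    then have "\<forall>i<n. p i = 0" "\<forall>i<n. q i = 0" by (auto simp: sum_nonneg_eq_0_iff)
    then have "z = 0\<^sub>v n" using z(1) by (intro eq_vecI) (auto simp: p_def q_def complex_eq_iff)
    then show False using z(2) by simp
  qed
  then have "ip n p p + ip n q q \<noteq> 0" using nn[of p] nn[of q] by linarith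
  then have im: "Im l = 0" using 0 by simp
  obtain u where u: "ip n u u \<noteq> 0" "\<And>i. i < n \<Longrightarrow> mvec n A u i = Re l * u i"
    using nz Ap Aq im by (metis add.right_neutral diff_zero mult_zero_left)
  define s where "s = sqrt (ip n u u)"
  have s: "s * s = ip n u u" "s \<noteq> 0" using u(1) nn[of u] by (auto simp: s_def)
  have "ip n (\<lambda>i. u i / s) (\<lambda>i. u i / s) = ip n u u / (s * s)"
    by (simp add: ip_def sum_divide_distrib)
  then have "ip n (\<lambda>i. u i / s) (\<lambda>i. u i / s) = 1" using s u(1) by simp
  moreover have "mvec n A (\<lambda>i. u i / s) i = Re l * (u i / s)" if "i < n" for i
  proof -
    have "mvec n A (\<lambda>i. u i / s) i = mvec n A u i / s" by (simp add: mvec_def sum_divide_distrib)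
    then show ?thesis using u(2)[OF that] by simp
  qed
  ultimately show ?thesis by (intro exI[of _ "\<lambda>i. u i / s"] exI[of _ "Re l"]) auto
qed

text \<open>The reflection along w = e_0 - v, which exchanges e_0 and the unit vector v.\<close>

lemma householder:
  assumes v: "ip n v v = 1" and n: "0 < n"
  shows "\<exists>W. fsupp n W \<and> ftr W = W \<and> fmul n W W = fidn n \<and> (\<forall>i<n. W i 0 = v i)"
proof -
  define w where "w i = fid i 0 - v i" for i
  define b where "b = ip n w w"
  \<comment> \<open>If v = e_0 then b = 0, division by zero gives c = 0, and W is the identity as
    desired.\<close>
  define c where "c = 2 / b"
  define W where "W i j = (if i < n \<and> j < n then fid i j - c * w i * w j else 0)" for i j
  \<comment> \<open>|e_0 - v|^2 = 2 - 2 v_0 because v is a unit vector; this is what makes column 0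
    of W equal to v.\<close>
  have b: "b = 2 * w 0"
  proof -
    have "b = (\<Sum>i<n. fid i 0 * fid i 0 - 2 * (fid i 0 * v i) + v i * v i)"
      by (simp add: b_def ip_def w_def algebra_simps)
    also have "\<dots> = 1 - 2 * v 0 + ip n v v"
      using n unfolding sum.distrib sum_subtractf sum_distrib_left[symmetric]
      by (simp add: ip_def) (simp add: fid_def)
    finally show ?thesis using v by (simp add: w_def fid_def)
  qed
  have w0: "w i = 0" if "b = 0" "i < n" for i
  proof -
    have "(\<Sum>i<n. w i * w i) = 0" using that by (simp add: b_def ip_def)
    then show ?thesis using that(2) by (auto simp: sum_nonneg_eq_0_iff)
  qed
  have "fmul n W W i j = fidn n i j" for i j
  proof (cases "i < n \<and> j < n")
    case True
    then have "fmul n W W i j = (\<Sum>k<n. fid i k * fid k j - c * w j * (fid i k * w k) - c * w i * (fid k j * w k) + c * c * w i * w j * (w k * w k))"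
      unfolding fmul_def by (intro sum.cong refl) (auto simp: W_def algebra_simps)
    also have "\<dots> = fid i j - c * w j * w i - c * w i * w j + c * c * w i * w j * b"
      using True unfolding sum.distrib sum_subtractf sum_distrib_left[symmetric]
      by (simp add: b_def ip_def)
    also have "\<dots> = fid i j"
      using w0[of i] True by (cases "b = 0") (auto simp: c_def field_simps)
    finally show ?thesis using True by (simp add: fid_def fidn_def)
  qed (auto simp: fmul_def W_def fidn_def)
  moreover have "W i 0 = v i" if "i < n" for i
  proof (cases "b = 0")
    case True
    then show ?thesis using w0[OF True that] that n by (simp add: W_def) (simp add: w_def)
  next
    case False
    then have "c * w 0 = 1" using b by (simp add: c_def)
    then have "c * w i * w 0 = w i" by (metis mult.assoc mult.commute mult.right_neutral)
    moreover have "W i 0 = fid i 0 - c * w i * w 0" using that n by (simp add: W_def)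
    ultimately have "W i 0 = fid i 0 - w i" by simp
    then show ?thesis by (simp add: w_def)
  qed
  moreover have "ftr W = W" by (intro ext) (auto simp: ftr_def W_def fid_sym)
  moreover have "fsupp n W" by (auto simp: fsupp_def W_def)
  ultimately show ?thesis by (metis ext)
qed

text \<open>Deflation: conjugation by a Householder matrix whose first column is an eigenvector
  clears the first column off the diagonal and, by symmetry, the first row. The induction hypothesis
  diagonalises the remaining block.\<close>

lemma spectral_theorem_supp:
  assumes "fsupp n A" "ftr A = A"
  shows "\<exists>V d. fsupp n V \<and> fmul n (ftr V) V = fidn n \<and> fmul n V (ftr V) = fidn n
    \<and> A = fmul n (fmul n V (fdiag n d)) (ftr V)"
  using assms
proof (induction n arbitrary: A)
  case 0
  then have "A = fmul 0 (fmul 0 (fidn 0) (fdiag 0 d)) (ftr (fidn 0))" for d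
    by (intro ext) (simp add: fmul_def fsupp_def)
  then show ?case by (intro exI[of _ "fidn 0"]) (auto simp: fmul_fidn_left)
next
  case (Suc n)
  let ?n = "Suc n"
  have symA: "A i j = A j i" for i j using Suc.prems(2) by (metis ftr_def)
  obtain v e where v: "ip ?n v v = 1" "\<And>i. i < ?n \<Longrightarrow> mvec ?n A v i = e * v i"
    using symmetric_eigenvector[of ?n A] symA by (metis zero_less_Suc)
  obtain W where W: "fsupp ?n W" "ftr W = W" "fmul ?n W W = fidn ?n" "\<And>i. i < ?n \<Longrightarrow> W i 0 = v i"
    using householder[OF v(1)] by auto
  define A' where "A' = fmul ?n W (fmul ?n A W)"
  have sA': "fsupp ?n A'" unfolding A'_def by (intro fsupp_fmul W Suc.prems)
  have tA': "ftr A' = A'" unfolding A'_def ftr_fmul W(2) Suc.prems(2) fmul_assoc ..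
  have A'0: "A' i 0 = e * fidn ?n i 0" for i
  proof -
    have "fmul ?n A W k 0 = e * W k 0" if "k < ?n" for k
    proof -
      have "fmul ?n A W k 0 = mvec ?n A v k" unfolding fmul_def mvec_def
        by (intro sum.cong refl) (simp add: W(4))
      then show ?thesis using v(2)[OF that] W(4)[OF that] by simp
    qed
    then have "A' i 0 = (\<Sum>k<?n. W i k * (e * W k 0))"
      unfolding A'_def fmul_def[of ?n W] by (intro sum.cong refl) auto
    also have "\<dots> = e * fmul ?n W W i 0" by (simp only: fmul_def sum_distrib_left mult.left_commute)
    finally show ?thesis unfolding W(3) .
  qed
  define A3 where "A3 i j = A' (Suc i) (Suc j)" for i j
  have "fsupp n A3" using sA' by (auto simp: fsupp_def A3_def)
  moreover have "ftr A3 = A3" using tA' by (intro ext) (metis A3_def ftr_def)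
  ultimately obtain V3 d3 where V3: "fsupp n V3" "fmul n (ftr V3) V3 = fidn n" "fmul n V3 (ftr V3) = fidn n"
    "A3 = fmul n (fmul n V3 (fdiag n d3)) (ftr V3)" using Suc.IH by blast
  define V' where "V' i j = (case i of 0 \<Rightarrow> (if j = 0 then 1 else 0)
     | Suc i' \<Rightarrow> (case j of 0 \<Rightarrow> 0 | Suc j' \<Rightarrow> V3 i' j'))" for i j
  define d where "d i = (case i of 0 \<Rightarrow> e | Suc i' \<Rightarrow> d3 i')" for i
  have V's [simp]: "V' 0 0 = 1" "V' 0 (Suc j) = 0" "V' (Suc i) 0 = 0" "V' (Suc i) (Suc j) = V3 i j"
    "d 0 = e" "d (Suc i) = d3 i" for i j by (simp_all add: V'_def d_def)
  have sV': "fsupp ?n V'" using V3(1) by (auto simp: fsupp_def V'_def split: nat.split)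
  have 1: "fmul ?n (ftr V') V' = fidn ?n"
  proof (intro ext)
    fix i j show "fmul ?n (ftr V') V' i j = fidn ?n i j"
      using fun_cong[OF fun_cong[OF V3(2)], of "i - 1" "j - 1"]
      by (cases i; cases j) (simp_all add: fmul_def sum.lessThan_Suc_shift fidn_def ftr_def del: sum.lessThan_Suc)
  qed
  have 2: "fmul ?n V' (ftr V') = fidn ?n"
  proof (intro ext)
    fix i j show "fmul ?n V' (ftr V') i j = fidn ?n i j"
      using fun_cong[OF fun_cong[OF V3(3)], of "i - 1" "j - 1"]
      by (cases i; cases j) (simp_all add: fmul_def sum.lessThan_Suc_shift fidn_def ftr_def del: sum.lessThan_Suc)
  qed
  have A'0': "A' 0 j = e * fidn ?n j 0" for j using A'0[of j] tA' by (metis ftr_def)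
  have diag: "fmul m M (fdiag m d) i j = M i j * d j" if "j < m" for m M d i j
  proof -
    have "fmul m M (fdiag m d) i j = (\<Sum>k<m. (M i k * d k) * fid k j)"
      unfolding fmul_def using that by (intro sum.cong refl) (auto simp: fdiag_def fid_def)
    then show ?thesis using that by simp
  qed
  have vd: "fmul m (fmul m M (fdiag m d)) K i j = (\<Sum>k<m. M i k * d k * K k j)" for m M d K i j
    unfolding fmul_def[of m "fmul m M (fdiag m d)"] by (intro sum.cong refl) (simp add: diag)
  have 3: "A' = fmul ?n (fmul ?n V' (fdiag ?n d)) (ftr V')"
  proof (intro ext)
    fix i j show "A' i j = fmul ?n (fmul ?n V' (fdiag ?n d)) (ftr V') i j"
      using A'0[of i] A'0'[of j] fun_cong[OF fun_cong[OF V3(4)], of "i - 1" "j - 1"]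
      by (cases i; cases j) (simp_all add: vd sum.lessThan_Suc_shift fidn_def ftr_def A3_def del: sum.lessThan_Suc)
  qed
  define V where "V = fmul ?n W V'"
  have tV: "ftr V = fmul ?n (ftr V') W" by (simp add: V_def ftr_fmul W(2))
  have WA: "fmul ?n W (fmul ?n A' W) = A"
  proof -
    have "fmul ?n W (fmul ?n A' W) = fmul ?n (fmul ?n W W) (fmul ?n A (fmul ?n W W))"
      by (simp add: A'_def fmul_assoc)
    then show ?thesis unfolding W(3)
      by (simp add: fmul_fidn_left fmul_fidn_right Suc.prems fsupp_fmul)
  qed
  show ?case
  proof (intro exI conjI)
    show "fsupp ?n V" unfolding V_def by (intro fsupp_fmul W sV')
    have "fmul ?n (ftr V) V = fmul ?n (ftr V') (fmul ?n (fmul ?n W W) V')"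
      by (simp only: tV) (simp only: V_def fmul_assoc)
    then show "fmul ?n (ftr V) V = fidn ?n" unfolding W(3) by (simp add: fmul_fidn_left sV' 1)
    have "fmul ?n V (ftr V) = fmul ?n W (fmul ?n (fmul ?n V' (ftr V')) W)"
      by (simp only: tV) (simp only: V_def fmul_assoc)
    then show "fmul ?n V (ftr V) = fidn ?n" unfolding 2 by (simp add: fmul_fidn_left W)
    have "A = fmul ?n (fmul ?n (fmul ?n W V') (fdiag ?n d)) (fmul ?n (ftr V') W)"
      by (subst WA[symmetric]) (simp only: 3 fmul_assoc)
    then show "A = fmul ?n (fmul ?n V (fdiag ?n d)) (ftr V)"
      unfolding tV unfolding V_def .
  qed
qed

text \<open>Orthonormality, completeness in the form of Parseval's identity, and diagonalisation of
  the form. In this shape conjugation changes only \<open>w\<close>, and inversion only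
  \<open>d\<close>.\<close>

definition spectral_decomp :: "nat \<Rightarrow> fmat \<Rightarrow> fvec \<Rightarrow> (nat \<Rightarrow> fvec) \<Rightarrow> bool" where
  "spectral_decomp n A d w \<longleftrightarrow> (\<forall>j<n. \<forall>k<n. ip n (w j) (w k) = fid j k) \<and>
     (\<forall>a b. ip n a b = (\<Sum>k<n. ip n a (w k) * ip n b (w k))) \<and>
     (\<forall>a b. bform n a A b = (\<Sum>k<n. d k * ip n a (w k) * ip n b (w k)))"

lemma spectral_theorem:
  assumes "\<And>i j. i < n \<Longrightarrow> j < n \<Longrightarrow> A i j = A j i"
  shows "\<exists>V d. V \<in> orthogonal_matrices n \<and>
     (\<forall>i<n. \<forall>j<n. A i j = (\<Sum>k<n. V $$ (i, k) * d k * V $$ (j, k))) \<and>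
     spectral_decomp n A d (\<lambda>k i. V $$ (i, k))"
proof -
  define A' where "A' i j = (if i < n \<and> j < n then A i j else 0)" for i j
  have "fsupp n A'" "ftr A' = A'" using assms by (auto simp: fsupp_def A'_def ftr_def intro!: ext)
  from spectral_theorem_supp[OF this] obtain F d where F: "fmul n (ftr F) F = fidn n"
    "fmul n F (ftr F) = fidn n" and A': "A' = fmul n (fmul n F (fdiag n d)) (ftr F)" by blast
  define V where "V = mat n n (\<lambda>(i, j). F i j)"
  have Vc: "V \<in> carrier_mat n n" by (simp add: V_def)
  have VF: "V $$ (i, j) = F i j" if "i < n" "j < n" for i j using that by (simp add: V_def)
  have s1: "(\<Sum>k<n. F k i * F k j) = fid i j" "(\<Sum>k<n. F i k * F j k) = fid i j" if "i < n" "j < n" for i j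
    using fun_cong[OF fun_cong[OF F(1)], of i j] fun_cong[OF fun_cong[OF F(2)], of i j] that
    by (auto simp: fmul_def ftr_def fidn_def fid_def)
  have V: "V \<in> orthogonal_matrices n"
  proof -
    have "(transpose_mat V * V) $$ (i, j) = 1\<^sub>m n $$ (i, j)" "(V * transpose_mat V) $$ (i, j) = 1\<^sub>m n $$ (i, j)"
      if "i < n" "j < n" for i j
      using that Vc s1[OF that] by (simp_all add: scalar_prod_def lessThan_atLeast0 VF fid_def)
    then show ?thesis using Vc by (auto simp: orthogonal_matrices_def intro!: eq_matI)
  qed
  have A: "A i j = (\<Sum>k<n. V $$ (i, k) * d k * V $$ (j, k))" if ij: "i < n" "j < n" for i j
  proof -
    have "A i j = (\<Sum>k<n. (\<Sum>l<n. F i l * fdiag n d l k) * F j k)"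
      using fun_cong[OF fun_cong[OF A'], of i j] ij by (simp add: A'_def fmul_def ftr_def)
    also have "\<dots> = (\<Sum>k<n. F i k * d k * F j k)"
    proof (rule sum.cong[OF refl])
      fix k assume k: "k \<in> {..<n}"
      have "(\<Sum>l<n. F i l * fdiag n d l k) = (\<Sum>l<n. (F i l * d l) * fid l k)"
        by (rule sum.cong) (auto simp: fdiag_def fid_def)
      then show "(\<Sum>l<n. F i l * fdiag n d l k) * F j k = F i k * d k * F j k" using k by simp
    qed
    finally show ?thesis by (simp add: VF ij)
  qed
  let ?w = "\<lambda>k i. V $$ (i, k)"
  have sep: "(\<Sum>i<n. \<Sum>j<n. a i * (\<Sum>k<n. V $$ (i, k) * e k * V $$ (j, k)) * b j)
      = (\<Sum>k<n. e k * ip n a (?w k) * ip n b (?w k))" for a b e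
  proof -
    have "(\<Sum>i<n. \<Sum>j<n. a i * (\<Sum>k<n. V $$ (i, k) * e k * V $$ (j, k)) * b j)
      = (\<Sum>i<n. \<Sum>j<n. \<Sum>k<n. e k * ((a i * V $$ (i, k)) * (b j * V $$ (j, k))))"
      by (simp add: sum_distrib_left sum_distrib_right mult_ac)
    also have "\<dots> = (\<Sum>i<n. \<Sum>k<n. \<Sum>j<n. e k * ((a i * V $$ (i, k)) * (b j * V $$ (j, k))))"
      by (intro sum.cong refl sum.swap)
    also have "\<dots> = (\<Sum>k<n. \<Sum>i<n. \<Sum>j<n. e k * ((a i * V $$ (i, k)) * (b j * V $$ (j, k))))"
      by (rule sum.swap)
    also have "\<dots> = (\<Sum>k<n. e k * (ip n a (?w k) * ip n b (?w k)))"
      unfolding ip_def sum_distrib_left[symmetric] sum_distrib_right[symmetric] ..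
    finally show ?thesis by (simp only: mult.assoc)
  qed
  have "spectral_decomp n A d ?w"
    unfolding spectral_decomp_def
  proof (intro conjI allI impI)
    show "ip n (?w j) (?w k) = fid j k" if "j < n" "k < n" for j k
      unfolding ip_def by (rule orthogonal_matrices_sum(1)[OF V that])
    fix a b
    have "ip n a b = (\<Sum>i<n. \<Sum>j<n. a i * fid i j * b j)"
      using bform_fid[of n a b] by (simp add: bform_def)
    also have "\<dots> = (\<Sum>i<n. \<Sum>j<n. a i * (\<Sum>k<n. V $$ (i, k) * 1 * V $$ (j, k)) * b j)"
      by (intro sum.cong refl) (simp add: orthogonal_matrices_sum(2)[OF V])
    also have "\<dots> = (\<Sum>k<n. ip n a (?w k) * ip n b (?w k))" unfolding sep by simp
    finally show "ip n a b = (\<Sum>k<n. ip n a (?w k) * ip n b (?w k))" .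
    have "bform n a A b = (\<Sum>i<n. \<Sum>j<n. a i * (\<Sum>k<n. V $$ (i, k) * d k * V $$ (j, k)) * b j)"
      unfolding bform_def by (intro sum.cong refl) (simp add: A)
    then show "bform n a A b = (\<Sum>k<n. d k * ip n a (?w k) * ip n b (?w k))" unfolding sep .
  qed
  then show ?thesis using V A by blast
qed

lemma spectral_decomp_orthonormal:
  "spectral_decomp n A d w \<Longrightarrow> j < n \<Longrightarrow> k < n \<Longrightarrow> ip n (w j) (w k) = fid j k"
  unfolding spectral_decomp_def by blast

lemma spectral_decomp_ip:
  "spectral_decomp n A d w \<Longrightarrow> ip n a b = (\<Sum>k<n. ip n a (w k) * ip n b (w k))"
  unfolding spectral_decomp_def by blast

lemma char_poly_spectral:
  assumes V: "V \<in> orthogonal_matrices n" and A: "A \<in> carrier_mat n n"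
    and e: "\<And>i j. i < n \<Longrightarrow> j < n \<Longrightarrow> A $$ (i, j) = (\<Sum>k<n. V $$ (i, k) * d k * V $$ (j, k))"
  shows "char_poly A = (\<Prod>k\<leftarrow>[0..<n]. [:- d k, 1:])"
proof -
  define D where "D = mat n n (\<lambda>(i, j). if i = j then d i else (0::real))"
  have c: "V \<in> carrier_mat n n" "D \<in> carrier_mat n n" "transpose_mat V \<in> carrier_mat n n"
    using V by (auto simp: orthogonal_matrices_def D_def)
  have VD: "(V * D) $$ (i, k) = V $$ (i, k) * d k" if "i < n" "k < n" for i k
  proof -
    have "(V * D) $$ (i, k) = (\<Sum>l<n. (V $$ (i, l) * d l) * fid l k)"
      unfolding mult_mat_entry[OF c(1,2) that] using that
      by (intro sum.cong refl) (auto simp: D_def fid_def)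
    then show ?thesis using that by simp
  qed
  have "A = V * D * transpose_mat V"
  proof (rule eq_matI)
    fix i j assume "i < dim_row (V * D * transpose_mat V)" "j < dim_col (V * D * transpose_mat V)"
    then have ij: "i < n" "j < n" using c by auto
    have "(V * D * transpose_mat V) $$ (i, j) = (\<Sum>k<n. (V * D) $$ (i, k) * transpose_mat V $$ (k, j))"
      by (rule mult_mat_entry[OF mult_carrier_mat[OF c(1,2)] c(3) ij])
    also have "\<dots> = (\<Sum>k<n. V $$ (i, k) * d k * V $$ (j, k))"
      by (intro sum.cong refl) (use ij c in \<open>simp add: VD del: index_mult_mat\<close>)
    finally show "A $$ (i, j) = (V * D * transpose_mat V) $$ (i, j)" using e[OF ij] by simp
  qed (use A c in auto)
  then have "similar_mat_wit A D V (transpose_mat V)"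
    using V A c by (auto simp: similar_mat_wit_def orthogonal_matrices_def Let_def)
  then have "char_poly A = char_poly D" by (intro char_poly_similar) (auto simp: similar_mat_def)
  also have "\<dots> = (\<Prod>a\<leftarrow>diag_mat D. [:- a, 1:])"
    by (rule char_poly_upper_triangular[OF c(2)]) (auto simp: D_def upper_triangular_def)
  also have "diag_mat D = map d [0..<n]" by (auto simp: diag_mat_def D_def intro!: map_cong)
  finally show ?thesis by (simp add: comp_def)
qed

section \<open>Singular values and empirical eigenvalue distributions\<close>

lemma bform_eq_scalar_prod:
  assumes "A \<in> carrier_mat n n"
  shows "bform n a (\<lambda>i j. A $$ (i, j)) b = scalar_prod (vec n a) (A *\<^sub>v vec n b)"
proof -
  have 1: "(A *\<^sub>v vec n b) $ i = mvec n (\<lambda>i j. A $$ (i, j)) b i" if "i < n" for i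
    using that assms by (simp add: mvec_def scalar_prod_def lessThan_atLeast0)
  have d: "dim_vec (A *\<^sub>v vec n b) = n" using assms by simp
  show ?thesis
    unfolding bform_eq_ip_mvec ip_def scalar_prod_def d lessThan_atLeast0
    by (intro sum.cong refl) (simp add: 1 del: index_mult_mat_vec)
qed

text \<open>A^T A has the eigenvalues d_k^2, and positivity makes their roots d_k again, so the
  singular values bound the spectrum of A itself. The roots of the characteristic polynomial keep
  their multiplicity, which makes the empirical integral a plain average over k.\<close>

lemma spd_spectral:
  assumes spd: "symmetric_positive_definite n A" and n: "0 < n"
  shows "\<exists>d w. spectral_decomp n (\<lambda>i j. A $$ (i, j)) d w \<and> singular_values A = d ` {..<n}
    \<and> (\<forall>f\<in>borel_measurable borel. (LINT x|empirical_eigenvalue_distribution A. f x) = (\<Sum>k<n. f (d k)) / real n)"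
proof -
  have A: "A \<in> carrier_mat n n" and t: "transpose_mat A = A"
    and pos: "\<And>x. x \<in> carrier_vec n \<Longrightarrow> x \<noteq> 0\<^sub>v n \<Longrightarrow> 0 < scalar_prod x (A *\<^sub>v x)"
    using spd by (auto simp: symmetric_positive_definite_def)
  have "A $$ (i, j) = A $$ (j, i)" if "i < n" "j < n" for i j
    using arg_cong[OF t, of "\<lambda>M. M $$ (j, i)"] that A by simp
  then obtain V d where V: "V \<in> orthogonal_matrices n"
    and e: "\<And>i j. i < n \<Longrightarrow> j < n \<Longrightarrow> A $$ (i, j) = (\<Sum>k<n. V $$ (i, k) * d k * V $$ (j, k))"
    and sp: "spectral_decomp n (\<lambda>i j. A $$ (i, j)) d (\<lambda>k i. V $$ (i, k))"
    using spectral_theorem[of n "\<lambda>i j. A $$ (i, j)"] by blast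
  define w where "w k i = V $$ (i, k)" for k i
  have sp': "spectral_decomp n (\<lambda>i j. A $$ (i, j)) d w" using sp by (simp add: w_def[abs_def])
  have on: "ip n (w j) (w k) = fid j k" if "j < n" "k < n" for j k
    by (rule spectral_decomp_orthonormal[OF sp' that])
  have dpos: "0 < d k" if k: "k < n" for k
  proof -
    have "bform n (w k) (\<lambda>i j. A $$ (i, j)) (w k) = (\<Sum>j<n. d j * ip n (w k) (w j) * ip n (w k) (w j))"
      using sp' unfolding spectral_decomp_def by blast
    also have "\<dots> = (\<Sum>j<n. fid k j * (d j * fid k j))"
      using k by (intro sum.cong refl) (simp add: on)
    also have "\<dots> = d k" using k by (simp) (simp add: fid_def)
    finally have 1: "scalar_prod (vec n (w k)) (A *\<^sub>v vec n (w k)) = d k"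
      unfolding bform_eq_scalar_prod[OF A] .
    have "vec n (w k) \<noteq> 0\<^sub>v n"
    proof
      assume z: "vec n (w k) = 0\<^sub>v n"
      have "w k i = 0" if "i < n" for i
        using arg_cong[OF z, of "\<lambda>x. x $ i"] that by simp
      then have "ip n (w k) (w k) = 0" by (simp add: ip_def)
      then show False using on[OF k k] by (simp add: fid_def)
    qed
    then show ?thesis using pos[of "vec n (w k)"] 1 by simp
  qed
  have cp: "char_poly A = (\<Prod>k\<leftarrow>[0..<n]. [:- d k, 1:])" by (rule char_poly_spectral[OF V A e])
  have AA: "transpose_mat A * A \<in> carrier_mat n n" using A by simp
  have cp2: "char_poly (transpose_mat A * A) = (\<Prod>k\<leftarrow>[0..<n]. [:- ((d k)\<^sup>2), 1:])"
  proof (rule char_poly_spectral[OF V AA])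
    fix i j assume ij: "i < n" "j < n"
    have "(transpose_mat A * A) $$ (i, j) = (\<Sum>l<n. A $$ (i, l) * A $$ (l, j))"
      unfolding t by (rule mult_mat_entry[OF A A ij])
    also have "\<dots> = (\<Sum>l<n. (\<Sum>k<n. V $$ (i, k) * d k * V $$ (l, k)) * (\<Sum>m<n. V $$ (l, m) * d m * V $$ (j, m)))"
      by (intro sum.cong refl) (simp add: e ij)
    also have "\<dots> = (\<Sum>l<n. \<Sum>k<n. \<Sum>m<n. V $$ (i, k) * d k * d m * V $$ (j, m) * (V $$ (l, k) * V $$ (l, m)))"
      by (simp add: sum_product mult_ac)
    also have "\<dots> = (\<Sum>k<n. \<Sum>l<n. \<Sum>m<n. V $$ (i, k) * d k * d m * V $$ (j, m) * (V $$ (l, k) * V $$ (l, m)))"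
      by (rule sum.swap)
    also have "\<dots> = (\<Sum>k<n. \<Sum>m<n. \<Sum>l<n. V $$ (i, k) * d k * d m * V $$ (j, m) * (V $$ (l, k) * V $$ (l, m)))"
      by (intro sum.cong refl sum.swap)
    also have "\<dots> = (\<Sum>k<n. \<Sum>m<n. V $$ (i, k) * d k * d m * V $$ (j, m) * fid k m)"
      unfolding sum_distrib_left[symmetric]
      by (intro sum.cong refl) (simp add: orthogonal_matrices_sum(1)[OF V])
    also have "\<dots> = (\<Sum>k<n. V $$ (i, k) * (d k)\<^sup>2 * V $$ (j, k))"
      by (intro sum.cong refl) (simp, simp add: power2_eq_square mult_ac)
    finally show "(transpose_mat A * A) $$ (i, j) = (\<Sum>k<n. V $$ (i, k) * (d k)\<^sup>2 * V $$ (j, k))" .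
  qed
  have "eigenvalue (transpose_mat A * A) l \<longleftrightarrow> l \<in> (\<lambda>k. (d k)\<^sup>2) ` {..<n}" for l
    unfolding eigenvalue_root_char_poly[OF AA] cp2 poly_prod_list prod_list_zero_iff by auto
  then have "singular_values A = sqrt ` ((\<lambda>k. (d k)\<^sup>2) ` {..<n})"
    unfolding singular_values_def by (intro arg_cong[where f="image sqrt"]) auto
  also have "\<dots> = d ` {..<n}" unfolding image_image
    using dpos by (intro image_cong) (auto simp: less_imp_le)
  finally have sv: "singular_values A = d ` {..<n}" .
  have pr: "proots (char_poly A) = image_mset d (mset_set {..<n})"
  proof -
    have "proots (char_poly A) = sum_list (map proots (map (\<lambda>k. [:- d k, 1:]) [0..<n]))"
    proof -
      have "proots (\<Prod>p\<leftarrow>map (\<lambda>k. [:- d k, 1:]) [0..<n]. p)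
          = sum_list (map proots (map (\<lambda>k. [:- d k, 1:]) [0..<n]))"
        by (rule proots_prod_list) auto
      then show ?thesis unfolding cp by simp
    qed
    also have "\<dots> = sum_list (map (\<lambda>k. {#d k#}) [0..<n])"
      by (simp add: comp_def proots_linear_factor)
    also have "\<dots> = mset (map d [0..<n])"
      by (induction n) auto
    also have "\<dots> = image_mset d (mset_set {..<n})"
      by (simp add: lessThan_atLeast0)
    finally show ?thesis .
  qed
  have emp: "(LINT x|empirical_eigenvalue_distribution A. f x) = (\<Sum>k<n. f (d k)) / real n"
    if f: "f \<in> borel_measurable borel" for f :: "real \<Rightarrow> real"
  proof -
    have ne: "{..<n} \<noteq> {}" using n by auto
    have pm: "pmf_of_multiset (proots (char_poly A)) = map_pmf d (pmf_of_set {..<n})"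
      unfolding pr map_pmf_of_set[OF finite_lessThan ne] ..
    have "(LINT x|empirical_eigenvalue_distribution A. f x)
       = measure_pmf.expectation (pmf_of_multiset (proots (char_poly A))) f"
      unfolding empirical_eigenvalue_distribution_def
      by (subst integral_distr) (use f in auto)
    also have "\<dots> = (\<Sum>k<n. f (d k)) / real n"
      unfolding pm integral_map_pmf by (subst integral_pmf_of_set) (use ne in auto)
    finally show ?thesis .
  qed
  show ?thesis using sp' sv emp by blast
qed

lemma spectral_decomp_conditioned:
  assumes sp: "spectral_decomp n A d w" and k: "0 < \<kappa>"
    and d: "\<And>k. k < n \<Longrightarrow> d k \<le> \<kappa>" "\<And>k. k < n \<Longrightarrow> 1 / \<kappa> \<le> d k"
  shows "conditioned n \<kappa> A"
proof -
  have ip: "ip n a b = (\<Sum>k<n. ip n a (w k) * ip n b (w k))"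
    and bf: "bform n a A b = (\<Sum>k<n. d k * ip n a (w k) * ip n b (w k))" for a b
    using sp unfolding spectral_decomp_def by blast+
  have d0: "0 \<le> d k" if "k < n" for k using d(2)[OF that] k by (meson divide_nonneg_nonneg less_imp_le order_trans zero_le_one)
  have nrm: "vnorm n a = L2_set (\<lambda>k. ip n a (w k)) {..<n}" for a
    using ip[of a a] unfolding vnorm_sq[symmetric]
    by (simp add: L2_set_def power2_eq_square real_sqrt_unique[symmetric])
  have "opbound n \<kappa> A"
    unfolding opbound_def
  proof (intro allI)
    fix a b
    have "\<bar>bform n a A b\<bar> \<le> (\<Sum>k<n. \<kappa> * (\<bar>ip n a (w k)\<bar> * \<bar>ip n b (w k)\<bar>))"
      unfolding bf
    proof (rule order_trans[OF sum_abs sum_mono])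
      fix j assume "j \<in> {..<n}"
      then show "\<bar>d j * ip n a (w j) * ip n b (w j)\<bar> \<le> \<kappa> * (\<bar>ip n a (w j)\<bar> * \<bar>ip n b (w j)\<bar>)"
        unfolding abs_mult mult.assoc using d(1)[of j] d0[of j] by (intro mult_right_mono) auto
    qed
    also have "\<dots> \<le> \<kappa> * (vnorm n a * vnorm n b)"
      unfolding sum_distrib_left[symmetric] nrm by (intro mult_left_mono L2_set_mult_ineq) (use k in auto)
    finally show "\<bar>bform n a A b\<bar> \<le> \<kappa> * vnorm n a * vnorm n b" by (simp add: mult.assoc)
  qed
  moreover have "coercive n \<kappa> A"
    unfolding coercive_def
  proof
    fix a
    show "ip n a a \<le> \<kappa> * bform n a A a"
      unfolding bf ip[of a a] sum_distrib_left
    proof (rule sum_mono)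
      fix j assume "j \<in> {..<n}"
      then have "1 \<le> \<kappa> * d j" using d(2)[of j] k by (simp add: field_simps)
      then have "1 * (ip n a (w j) * ip n a (w j)) \<le> (\<kappa> * d j) * (ip n a (w j) * ip n a (w j))"
        by (intro mult_right_mono) auto
      then show "ip n a (w j) * ip n a (w j) \<le> \<kappa> * (d j * ip n a (w j) * ip n a (w j))"
        by (simp add: mult_ac)
    qed
  qed
  ultimately show ?thesis by (simp add: conditioned_def)
qed

lemma spd_conditioned_spectral:
  assumes spd: "symmetric_positive_definite n A" and n: "0 < n" and k: "0 < \<kappa>"
    and mx: "sigma_max A \<le> \<kappa>" and mn: "1 / \<kappa> \<le> sigma_min A"
  shows "conditioned n \<kappa> (\<lambda>i j. A $$ (i, j)) \<and> (\<exists>d w. spectral_decomp n (\<lambda>i j. A $$ (i, j)) d w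
    \<and> (\<forall>k<n. 1 / \<kappa> \<le> d k \<and> d k \<le> \<kappa>)
    \<and> (\<forall>f\<in>borel_measurable borel. (LINT x|empirical_eigenvalue_distribution A. f x) = (\<Sum>k<n. f (d k)) / real n))"
proof -
  obtain d w where sp: "spectral_decomp n (\<lambda>i j. A $$ (i, j)) d w" and sv: "singular_values A = d ` {..<n}"
    and f: "\<forall>f\<in>borel_measurable borel. (LINT x|empirical_eigenvalue_distribution A. f x) = (\<Sum>k<n. f (d k)) / real n"
    using spd_spectral[OF spd n] by blast
  have d: "1 / \<kappa> \<le> d k \<and> d k \<le> \<kappa>" if "k < n" for k
  proof -
    have m: "d k \<in> singular_values A" and fin: "finite (singular_values A)" using that by (auto simp: sv)
    have "d k \<le> sigma_max A" unfolding sigma_max_def by (rule Max_ge[OF fin m])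
    moreover have "sigma_min A \<le> d k" unfolding sigma_min_def by (rule Min_le[OF fin m])
    ultimately show ?thesis using mx mn by linarith
  qed
  then show ?thesis using spectral_decomp_conditioned[OF sp k] sp f by blast
qed

section \<open>Conjugation and traces in an eigenbasis\<close>

lemma spectral_decomp_conj:
  assumes sp: "spectral_decomp n A d w" and V: "V \<in> orthogonal_matrices n"
  shows "spectral_decomp n (conj_mat n V A) d (\<lambda>k i. \<Sum>l<n. V $$ (l, i) * w k l)"
proof -
  define T where "T a k = (\<Sum>i<n. V $$ (k, i) * a i)" for a :: fvec and k
  define S where "S a i = (\<Sum>l<n. V $$ (l, i) * a l)" for a :: fvec and i
  have adj: "ip n a (S b) = ip n (T a) b" for a b
  proof -
    have "ip n a (S b) = (\<Sum>i<n. \<Sum>l<n. V $$ (l, i) * a i * b l)"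
      by (simp add: ip_def S_def sum_distrib_left mult_ac)
    also have "\<dots> = (\<Sum>l<n. \<Sum>i<n. V $$ (l, i) * a i * b l)" by (rule sum.swap)
    finally show ?thesis by (simp add: ip_def T_def sum_distrib_right)
  qed
  have TS: "T (S b) k = b k" if "k < n" for b k
  proof -
    have "T (S b) k = (\<Sum>i<n. \<Sum>l<n. V $$ (k, i) * V $$ (l, i) * b l)"
      by (simp add: T_def S_def sum_distrib_left mult_ac)
    also have "\<dots> = (\<Sum>l<n. \<Sum>i<n. V $$ (k, i) * V $$ (l, i) * b l)" by (rule sum.swap)
    also have "\<dots> = (\<Sum>l<n. fid k l * b l)"
      unfolding sum_distrib_right[symmetric] using that
      by (intro sum.cong refl) (simp add: orthogonal_matrices_sum(2)[OF V])
    finally show ?thesis using that by simp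
  qed
  have on: "ip n (S (w j)) (S (w k)) = fid j k" if "j < n" "k < n" for j k
  proof -
    have "ip n (S (w j)) (S (w k)) = ip n (w j) (w k)"
      unfolding adj by (simp add: ip_def TS)
    then show ?thesis using spectral_decomp_orthonormal[OF sp that] by simp
  qed
  have "ip n a b = (\<Sum>k<n. ip n a (S (w k)) * ip n b (S (w k)))" for a b
  proof -
    have "ip n a b = ip n (T a) (T b)" unfolding T_def ip_orthogonal[OF V] ..
    then show ?thesis unfolding adj by (rule trans[OF _ spectral_decomp_ip[OF sp]])
  qed
  moreover have "bform n a (conj_mat n V A) b = (\<Sum>k<n. d k * ip n a (S (w k)) * ip n b (S (w k)))" for a b
    unfolding bform_conj_mat T_def[symmetric] adj using sp unfolding spectral_decomp_def by blast
  ultimately show ?thesis using on unfolding spectral_decomp_def S_def[symmetric] by blast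
qed

text \<open>On an eigenbasis of the letter \<open>c\<close> a power acts by d_j^m, and the trace may
  be taken in that basis.\<close>

lemma wtr_power_append:
  assumes sp: "spectral_decomp n (\<rho> c) d w"
  shows "wtr n \<rho> (replicate m c @ W) = (\<Sum>j<n. d j ^ m * wb n \<rho> W (w j) (w j)) / real n"
proof -
  have ip: "ip n a b = (\<Sum>k<n. ip n a (w k) * ip n b (w k))"
    and bf: "bform n a (\<rho> c) b = (\<Sum>k<n. d k * ip n a (w k) * ip n b (w k))" for a b
    using sp unfolding spectral_decomp_def by blast+
  have on: "ip n (w j) (w k) = fid j k" if "j < n" "k < n" for j k
    by (rule spectral_decomp_orthonormal[OF sp that])
  have lin: "wb n \<rho> W a b = (\<Sum>j<n. ip n a (w j) * wb n \<rho> W (w j) b)" for a b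
    unfolding bform_eq_ip_mvec using ip[of a "mvec n (wmat n \<rho> W) b"]
    by (simp add: ip_def[of n "w _"] mult.commute[of "w _ _"] flip: ip_def[of n "mvec n (wmat n \<rho> W) b"])
  have pw: "wb n \<rho> (replicate m c @ W) a b = (\<Sum>j<n. d j ^ m * ip n a (w j) * wb n \<rho> W (w j) b)" for a b
  proof (induction m arbitrary: a)
    case 0
    then show ?case using lin[of a b] by simp
  next
    case (Suc m)
    have "wb n \<rho> (replicate (Suc m) c @ W) a b = wb n \<rho> (replicate m c @ W) (vmat n a (\<rho> c)) b"
      unfolding replicate_Suc append_Cons by (rule wb_Cons)
    also have "\<dots> = (\<Sum>j<n. d j ^ m * ip n (vmat n a (\<rho> c)) (w j) * wb n \<rho> W (w j) b)" by (rule Suc)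
    also have "\<dots> = (\<Sum>j<n. d j ^ Suc m * ip n a (w j) * wb n \<rho> W (w j) b)"
    proof (rule sum.cong[OF refl])
      fix j assume j: "j \<in> {..<n}"
      have "ip n (vmat n a (\<rho> c)) (w j) = (\<Sum>k<n. d k * ip n a (w k) * ip n (w j) (w k))"
        unfolding bform_eq_ip_vmat[symmetric] bf ..
      also have "\<dots> = (\<Sum>k<n. fid j k * (d k * ip n a (w k)))"
        using j by (intro sum.cong refl) (simp add: on)
      finally have "ip n (vmat n a (\<rho> c)) (w j) = d j * ip n a (w j)" using j by simp
      then show "d j ^ m * ip n (vmat n a (\<rho> c)) (w j) * wb n \<rho> W (w j) b
         = d j ^ Suc m * ip n a (w j) * wb n \<rho> W (w j) b" by simp
    qed
    finally show ?case .
  qed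
  have "(\<Sum>i<n. wb n \<rho> (replicate m c @ W) (fid i) (fid i))
     = (\<Sum>i<n. \<Sum>j<n. d j ^ m * (w j i * wb n \<rho> W (w j) (fid i)))"
    unfolding pw by (intro sum.cong refl) (simp add: ip_def mult.assoc)
  also have "\<dots> = (\<Sum>j<n. d j ^ m * (\<Sum>i<n. w j i * wb n \<rho> W (w j) (fid i)))"
    unfolding sum_distrib_left by (rule sum.swap)
  finally show ?thesis unfolding wtr_def bform_right_sum by simp
qed

lemma wtr_power:
  assumes sp: "spectral_decomp n (\<rho> c) d w"
  shows "wtr n \<rho> (replicate m c) = (\<Sum>j<n. d j ^ m) / real n"
proof -
  have on: "ip n (w j) (w j) = 1" if "j < n" for j
    using spectral_decomp_orthonormal[OF sp that that] by (simp add: fid_def)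
  have "wtr n \<rho> (replicate m c @ []) = (\<Sum>j<n. d j ^ m) / real n"
    unfolding wtr_power_append[of n \<rho> c d w, OF sp] by (simp add: wb_Nil bform_fid on)
  then show ?thesis by simp
qed

section \<open>Averages over eigenvalues\<close>

text \<open>The method of moments: Stone-Weierstrass gives a polynomial close to f on [-L, L], and
  the constant K, common to all large N and the limit, carries the approximation error
  through.\<close>

lemma functional_convergence:
  fixes \<Lambda> :: "nat \<Rightarrow> (real \<Rightarrow> real) \<Rightarrow> real" and \<Phi> :: "(real \<Rightarrow> real) \<Rightarrow> real"
  assumes f: "continuous_on {-L..L} f" and K: "0 < K"
    and poly: "\<forall>\<^sub>F N in sequentially. \<forall>a m. \<Lambda> N (\<lambda>x. \<Sum>k\<le>m. a k * x ^ k) = (\<Sum>k\<le>m. a k * \<Lambda> N (\<lambda>x. x ^ k))"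
    and poly0: "\<And>a m. \<Phi> (\<lambda>x. \<Sum>k\<le>m. a k * x ^ k) = (\<Sum>k\<le>m. a k * \<Phi> (\<lambda>x. x ^ k))"
    and lip: "\<forall>\<^sub>F N in sequentially. \<forall>g \<epsilon>. continuous_on UNIV g \<longrightarrow> (\<forall>x\<in>{-L..L}. \<bar>f x - g x\<bar> \<le> \<epsilon>)
       \<longrightarrow> \<bar>\<Lambda> N f - \<Lambda> N g\<bar> \<le> K * \<epsilon>"
    and lip0: "\<And>g \<epsilon>. continuous_on UNIV g \<Longrightarrow> (\<forall>x\<in>{-L..L}. \<bar>f x - g x\<bar> \<le> \<epsilon>) \<Longrightarrow> \<bar>\<Phi> f - \<Phi> g\<bar> \<le> K * \<epsilon>"
    and moments: "\<And>k. (\<lambda>N. \<Lambda> N (\<lambda>x. x ^ k)) \<longlonglongrightarrow> \<Phi> (\<lambda>x. x ^ k)"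
  shows "(\<lambda>N. \<Lambda> N f) \<longlonglongrightarrow> \<Phi> f"
proof (rule tendstoI)
  fix e :: real assume e: "0 < e"
  define \<epsilon> where "\<epsilon> = e / (4 * K)"
  have \<epsilon>: "0 < \<epsilon>" "K * \<epsilon> = e / 4" using e K by (simp_all add: \<epsilon>_def)
  obtain g where g: "real_polynomial_function g" "\<And>x. x \<in> {-L..L} \<Longrightarrow> \<bar>f x - g x\<bar> < \<epsilon>"
    using Stone_Weierstrass_real_polynomial_function[OF compact_Icc f \<epsilon>(1)] by blast
  obtain a m where gm: "g = (\<lambda>x. \<Sum>k\<le>m. a k * x ^ k)"
    using g(1) unfolding real_polynomial_function_iff_sum by blast
  have cg: "continuous_on UNIV g" unfolding gm by (intro continuous_intros)
  have le: "\<forall>x\<in>{-L..L}. \<bar>f x - g x\<bar> \<le> \<epsilon>" using g(2) by (simp add: less_imp_le)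
  have "(\<lambda>N. \<Sum>k\<le>m. a k * \<Lambda> N (\<lambda>x. x ^ k)) \<longlonglongrightarrow> (\<Sum>k\<le>m. a k * \<Phi> (\<lambda>x. x ^ k))"
    by (intro tendsto_intros moments)
  then have "\<forall>\<^sub>F N in sequentially. dist (\<Sum>k\<le>m. a k * \<Lambda> N (\<lambda>x. x ^ k)) (\<Phi> g) < e / 4"
    unfolding gm poly0 using e by (intro tendstoD) auto
  then show "\<forall>\<^sub>F N in sequentially. dist (\<Lambda> N f) (\<Phi> f) < e"
    using poly lip
  proof (eventually_elim)
    case (elim N)
    have "\<bar>\<Lambda> N g - \<Phi> g\<bar> < e / 4" using elim(1,2) by (simp add: gm dist_real_def)
    moreover have "\<bar>\<Lambda> N f - \<Lambda> N g\<bar> \<le> e / 4" using elim(3) cg le \<epsilon>(2) by metis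
    moreover have "\<bar>\<Phi> f - \<Phi> g\<bar> \<le> e / 4" using lip0[OF cg le] \<epsilon>(2) by simp
    ultimately show ?case using e unfolding dist_real_def by linarith
  qed
qed

section \<open>Averages with bounded weights\<close>

definition average :: "nat \<Rightarrow> (nat \<Rightarrow> real) \<Rightarrow> real" where
  "average n f = (\<Sum>j<n. f j) / real n"

lemma average_diff: "average n (\<lambda>j. f j - g j) = average n f - average n g"
  by (simp add: average_def sum_subtractf diff_divide_distrib)

lemma average_cmult: "average n (\<lambda>j. c * f j) = c * average n f"
  by (simp add: average_def sum_distrib_left)

lemma average_sum: "average n (\<lambda>j. \<Sum>k\<in>S. f k j) = (\<Sum>k\<in>S. average n (f k))"
  unfolding average_def by (subst sum.swap) (simp add: sum_divide_distrib)

lemma average_mono: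
  "(\<And>j. j < n \<Longrightarrow> f j \<le> g j) \<Longrightarrow> average n f \<le> average n g"
  unfolding average_def by (intro divide_right_mono sum_mono) auto

lemma average_const: "0 < n \<Longrightarrow> average n (\<lambda>j. c) = c"
  by (simp add: average_def)

lemma average_abs_le:
  assumes "\<And>j. j < n \<Longrightarrow> \<bar>f j\<bar> \<le> c" "0 \<le> c" shows "\<bar>average n f\<bar> \<le> c"
proof (cases "n = 0")
  case False
  have "average n f \<le> average n (\<lambda>j. c)" by (rule average_mono) (use assms in force)
  moreover have "average n (\<lambda>j. - c) \<le> average n f" by (rule average_mono) (use assms in force)
  ultimately show ?thesis using False average_const[of n c] average_const[of n "- c"] by simp
qed (use assms in \<open>simp add: average_def\<close>)

lemma average_cong: "(\<And>j. j < n \<Longrightarrow> f j = g j) \<Longrightarrow> average n f = average n g"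
  by (simp add: average_def)

text \<open>The weights may have either sign. With c = 1 and b = 1 moments are upgraded to
  continuous functions; with b = 0 weights that are asymptotically orthogonal to all powers become
  so to all continuous functions.\<close>

lemma weighted_average_convergence:
  fixes d c :: "nat \<Rightarrow> nat \<Rightarrow> real" and F :: "real measure"
  assumes f: "continuous_on UNIV f" and K: "0 < K" and F: "real_distribution F"
    and R: "AE x in F. \<bar>x\<bar> \<le> L" and b: "\<bar>b\<bar> \<le> K"
    and d: "\<forall>\<^sub>F N in sequentially. \<forall>j<N. \<bar>d N j\<bar> \<le> L" and c: "\<forall>\<^sub>F N in sequentially. \<forall>j<N. \<bar>c N j\<bar> \<le> K"
    and mom: "\<And>k. (\<lambda>N. average N (\<lambda>j. d N j ^ k * c N j)) \<longlonglongrightarrow> b * (LINT x|F. x ^ k)"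
  shows "(\<lambda>N. average N (\<lambda>j. f (d N j) * c N j)) \<longlonglongrightarrow> b * (LINT x|F. f x)"
proof -
  interpret F: real_distribution F by fact
  have int: "integrable F g" if g: "continuous_on UNIV g" for g :: "real \<Rightarrow> real"
  proof -
    have "compact (g ` {-L..L})" by (intro compact_continuous_image continuous_on_subset[OF g]) auto
    then obtain B where B: "\<And>y. y \<in> g ` {-L..L} \<Longrightarrow> norm y \<le> B"
      using compact_imp_bounded bounded_iff by metis
    show ?thesis
    proof (rule F.integrable_const_bound)
      show "AE x in F. norm (g x) \<le> B" using R by eventually_elim (use B in \<open>auto simp: abs_le_iff\<close>)
      show "g \<in> borel_measurable F" using borel_measurable_continuous_onI[OF g] by simp
    qed
  qed
  show ?thesis
  proof (rule functional_convergence[where \<Lambda>="\<lambda>N f. average N (\<lambda>j. f (d N j) * c N j)"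
        and \<Phi>="\<lambda>f. b * (LINT x|F. f x)" and K=K and L=L])
    show "continuous_on {-L..L} f" by (rule continuous_on_subset[OF f]) auto
    show "\<forall>\<^sub>F N in sequentially. \<forall>a m. average N (\<lambda>j. (\<Sum>k\<le>m. a k * d N j ^ k) * c N j)
        = (\<Sum>k\<le>m. a k * average N (\<lambda>j. d N j ^ k * c N j))"
      by (intro always_eventually allI) (simp add: sum_distrib_right mult.assoc average_sum average_cmult)
    show "b * (LINT x|F. (\<Sum>k\<le>m. a k * x ^ k)) = (\<Sum>k\<le>m. a k * (b * (LINT x|F. x ^ k)))" for a m
    proof -
      have "(LINT x|F. (\<Sum>k\<le>m. a k * x ^ k)) = (\<Sum>k\<le>m. a k * (LINT x|F. x ^ k))"
        by (subst Bochner_Integration.integral_sum) (auto intro!: integrable_mult_right int continuous_intros)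
      then show ?thesis by (simp add: sum_distrib_left mult_ac)
    qed
    show "\<forall>\<^sub>F N in sequentially. \<forall>g \<epsilon>. continuous_on UNIV g \<longrightarrow> (\<forall>x\<in>{-L..L}. \<bar>f x - g x\<bar> \<le> \<epsilon>)
       \<longrightarrow> \<bar>average N (\<lambda>j. f (d N j) * c N j) - average N (\<lambda>j. g (d N j) * c N j)\<bar> \<le> K * \<epsilon>"
      using d c eventually_gt_at_top[of "0::nat"]
    proof (eventually_elim)
      case (elim N)
      show ?case
      proof (intro allI impI)
        fix g \<epsilon> assume g: "\<forall>x\<in>{-L..L}. \<bar>f x - g x\<bar> \<le> \<epsilon>"
        have le: "\<bar>f (d N j) - g (d N j)\<bar> \<le> \<epsilon>" if "j < N" for j
        proof -
          have "\<bar>d N j\<bar> \<le> L" using elim(1) that by blast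
          then have "d N j \<in> {-L..L}" by auto
          then show ?thesis using g by blast
        qed
        have "0 \<le> \<epsilon>" using le[of 0] elim(3) by linarith
        have "\<bar>average N (\<lambda>j. (f (d N j) - g (d N j)) * c N j)\<bar> \<le> \<epsilon> * K"
        proof (rule average_abs_le)
          show "\<bar>(f (d N j) - g (d N j)) * c N j\<bar> \<le> \<epsilon> * K" if "j < N" for j
            unfolding abs_mult using le[OF that] elim(2) that \<open>0 \<le> \<epsilon>\<close> by (intro mult_mono) auto
        qed (use \<open>0 \<le> \<epsilon>\<close> K in auto)
        moreover have "average N (\<lambda>j. f (d N j) * c N j) - average N (\<lambda>j. g (d N j) * c N j)
            = average N (\<lambda>j. (f (d N j) - g (d N j)) * c N j)"
          by (simp only: average_diff[symmetric] left_diff_distrib)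
        ultimately show "\<bar>average N (\<lambda>j. f (d N j) * c N j) - average N (\<lambda>j. g (d N j) * c N j)\<bar> \<le> K * \<epsilon>"
          by (simp only: mult.commute[of K])
      qed
    qed
    show "\<bar>b * (LINT x|F. f x) - b * (LINT x|F. g x)\<bar> \<le> K * \<epsilon>"
      if g: "continuous_on UNIV g" "\<forall>x\<in>{-L..L}. \<bar>f x - g x\<bar> \<le> \<epsilon>" for g \<epsilon>
    proof -
      have ae: "AE x in F. \<bar>f x - g x\<bar> \<le> \<epsilon>" using R by eventually_elim (use g(2) in \<open>simp add: abs_le_iff\<close>)
      have "\<bar>LINT x|F. f x - g x\<bar> \<le> (LINT x|F. \<bar>f x - g x\<bar>)" by (rule integral_abs_bound)
      also have "\<dots> \<le> (LINT x|F. \<epsilon>)"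
        by (rule integral_mono_AE) (use ae in \<open>auto intro!: int continuous_intros f g\<close>)
      finally have 1: "\<bar>LINT x|F. f x - g x\<bar> \<le> \<epsilon>" using F.prob_space by simp
      have "b * (LINT x|F. f x) - b * (LINT x|F. g x) = b * (LINT x|F. f x - g x)"
        using int[OF f] int[OF g(1)] by (simp add: right_diff_distrib)
      also have "\<bar>\<dots>\<bar> \<le> K * \<epsilon>" unfolding abs_mult by (intro mult_mono b 1) (use K in auto)
      finally show ?thesis .
    qed
  qed (use K mom in auto)
qed

section \<open>Supports and inverse moments of the limits\<close>

lemma real_distribution_integrable:
  assumes F: "real_distribution F" and "continuous_on UNIV f" "\<And>x. \<bar>f x\<bar> \<le> (B::real)"
  shows "integrable F f"
proof -
  interpret real_distribution F by fact
  show ?thesis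
    by (rule integrable_const_bound[where B=B])
       (use assms borel_measurable_continuous_onI[OF assms(2)] in auto)
qed

lemma AE_ge_of_integral_zero:
  assumes F: "real_distribution F" and z: "(LINT x|F. max 0 (min 1 (lo - x))) = 0"
  shows "AE x in F. lo \<le> x"
proof -
  have i: "integrable F (\<lambda>x. max 0 (min 1 (lo - x)))"
    by (rule real_distribution_integrable[OF F, where B=1]) (auto intro!: continuous_intros)
  have "AE x in F. max 0 (min 1 (lo - x)) = 0"
    using integral_nonneg_eq_0_iff_AE[OF i] z by auto
  then show ?thesis by eventually_elim (auto simp: max_def min_def split: if_splits)
qed

text \<open>The bounded continuous test function vanishes exactly on [lo, \<infinity>), so a lower
  bound on the eigenvalues survives in the limit.\<close>

lemma AE_ge_of_averages:
  assumes F: "real_distribution F" and d: "\<forall>\<^sub>F N in sequentially. \<forall>j<N. lo \<le> d N j"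
    and c: "(\<lambda>N. average N (\<lambda>j. max 0 (min 1 (lo - d N j)))) \<longlonglongrightarrow> (LINT x|F. max 0 (min 1 (lo - x)))"
  shows "AE x in F. lo \<le> x"
proof -
  have "\<forall>\<^sub>F N in sequentially. average N (\<lambda>j. max 0 (min 1 (lo - d N j))) = 0"
    using d by eventually_elim (auto simp: average_def max_def min_def intro!: sum.neutral)
  then have "(\<lambda>N. average N (\<lambda>j. max 0 (min 1 (lo - d N j)))) \<longlonglongrightarrow> 0"
    by (rule tendsto_eventually)
  from LIMSEQ_unique[OF c this] show ?thesis by (rule AE_ge_of_integral_zero[OF F])
qed

text \<open>1/x is replaced by 1 / max lo x, which is continuous everywhere and agrees with it on
  the eigenvalues and on the support of the limit.\<close>

lemma inverse_moment_limit:
  assumes cs: "compactly_supported F" and lo: "0 < lo"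
    and d: "\<forall>\<^sub>F N in sequentially. \<forall>j<N. lo \<le> d N j \<and> d N j \<le> hi"
    and mom: "\<And>k. (\<lambda>N. average N (\<lambda>j. d N j ^ k)) \<longlonglongrightarrow> (LINT x|F. x ^ k)"
  shows "(\<lambda>N. average N (\<lambda>j. 1 / d N j)) \<longlonglongrightarrow> (LINT x|F. 1 / x)"
proof -
  obtain R where F: "real_distribution F" and R: "AE x in F. \<bar>x\<bar> \<le> R"
    using cs by (auto simp: compactly_supported_def)
  define L where "L = max R hi"
  have RL: "AE x in F. \<bar>x\<bar> \<le> L" using R by eventually_elim (auto simp: L_def)
  have dL: "\<forall>\<^sub>F N in sequentially. \<forall>j<N. \<bar>d N j\<bar> \<le> L"
    using d by eventually_elim (use lo in \<open>fastforce simp: L_def\<close>)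
  have conv: "(\<lambda>N. average N (\<lambda>j. f (d N j))) \<longlonglongrightarrow> (LINT x|F. f x)" if "continuous_on UNIV f" for f
  proof -
    have "(\<lambda>N. average N (\<lambda>j. f (d N j) * 1)) \<longlonglongrightarrow> 1 * (LINT x|F. f x)"
      by (rule weighted_average_convergence[where K=1 and L=L]) (use that F RL dL mom in auto)
    then show ?thesis by simp
  qed
  have ge: "AE x in F. lo \<le> x"
    by (rule AE_ge_of_averages[OF F, of lo d]) (use d in \<open>auto elim: eventually_mono intro!: conv continuous_intros\<close>)
  have c: "continuous_on UNIV (\<lambda>x. 1 / max lo x)"
    using lo by (intro continuous_intros) (auto simp: max_def)
  have "(LINT x|F. 1 / max lo x) = (LINT x|F. 1 / x)"
  proof (rule integral_cong_AE)
    interpret real_distribution F by fact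
    show "(\<lambda>x. 1 / max lo x) \<in> borel_measurable F" using borel_measurable_continuous_onI[OF c] by simp
    show "(\<lambda>x. 1 / x) \<in> borel_measurable F" by simp
    show "AE x in F. 1 / max lo x = 1 / x" using ge by eventually_elim (simp add: max_def)
  qed
  moreover have "(\<lambda>N. average N (\<lambda>j. 1 / max lo (d N j))) \<longlonglongrightarrow> (LINT x|F. 1 / max lo x)" by (rule conv[OF c])
  moreover have "\<forall>\<^sub>F N in sequentially. average N (\<lambda>j. 1 / max lo (d N j)) = average N (\<lambda>j. 1 / d N j)"
    using d by eventually_elim (auto intro!: average_cong simp: max_def)
  ultimately show ?thesis by (simp add: tendsto_cong)
qed


section \<open>The subordination equation\<close>

lemma stieltjes_strict:
  assumes cs: "compactly_supported F" and lo: "0 < lo" and ge: "AE x in F. lo \<le> x" and st: "0 < s" "s < t"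
  shows "stieltjes F (- t) < stieltjes F (- s)"
    and "stieltjes F (- s) = (LINT x|F. 1 / (max lo x + s))"
proof -
  obtain R where F: "real_distribution F" and R: "AE x in F. \<bar>x\<bar> \<le> R"
    using cs by (auto simp: compactly_supported_def)
  interpret real_distribution F by fact
  have c: "continuous_on UNIV (\<lambda>x. 1 / (max lo x + s))" if "0 < s" for s
  proof -
    have "max lo x + s \<noteq> 0" for x using lo that by (simp add: max_def)
    then show ?thesis by (intro continuous_intros) auto
  qed
  have i: "integrable F (\<lambda>x. 1 / (max lo x + s))" if s: "0 < s" for s
  proof (rule real_distribution_integrable[OF F c[OF s], where B="1 / s"])
    fix x
    have "s \<le> max lo x + s" using lo by (simp add: max_def)
    then show "\<bar>1 / (max lo x + s)\<bar> \<le> 1 / s" using s by (simp add: frac_le abs_le_iff)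
  qed
  have e: "stieltjes F (- s) = (LINT x|F. 1 / (max lo x + s))" if s: "0 < s" for s
    unfolding stieltjes_def
  proof (rule integral_cong_AE)
    show "(\<lambda>x. 1 / (max lo x + s)) \<in> borel_measurable F"
      using borel_measurable_continuous_onI[OF c[OF s]] by simp
    show "AE x in F. 1 / (x - - s) = 1 / (max lo x + s)"
      using ge by eventually_elim (simp add: max_def)
  qed simp
  show "stieltjes F (- s) = (LINT x|F. 1 / (max lo x + s))" by (rule e[OF st(1)])
  \<comment> \<open>A positive lower bound of 1/(y+s) - 1/(y+t) over the support, attained at its
    right end; compact support makes the monotonicity strict.\<close>
  define k where "k = (t - s) / ((max R lo + s) * (max R lo + t))"
  have k: "0 < k" using st lo unfolding k_def by (intro divide_pos_pos mult_pos_pos) (auto simp: max_def)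
  have t: "0 < t" using st by simp
  have "k = (LINT x|F. k)" using prob_space by simp
  also have "\<dots> \<le> (LINT x|F. 1 / (max lo x + s) - 1 / (max lo x + t))"
  proof (rule integral_mono_AE)
    show "integrable F (\<lambda>x. 1 / (max lo x + s) - 1 / (max lo x + t))"
      by (intro Bochner_Integration.integrable_diff i st t)
    show "AE x in F. k \<le> 1 / (max lo x + s) - 1 / (max lo x + t)"
      using ge R
    proof (eventually_elim)
      case (elim x)
      define y where "y = max lo x"
      have y: "0 < y" "y \<le> max R lo" using elim lo by (auto simp: y_def max_def)
      have "1 / (y + s) - 1 / (y + t) = (t - s) / ((y + s) * (y + t))"
        using y st by (simp add: field_simps)
      moreover have "k \<le> (t - s) / ((y + s) * (y + t))"
        unfolding k_def using y st by (intro divide_left_mono mult_mono mult_pos_pos) auto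
      ultimately show ?case by (simp add: y_def)
    qed
  qed simp
  also have "\<dots> = stieltjes F (- s) - stieltjes F (- t)"
    unfolding e[OF st(1)] e[OF t] by (intro Bochner_Integration.integral_diff i st t)
  finally show "stieltjes F (- t) < stieltjes F (- s)" using k by simp
qed

lemma R_transform_eq:
  assumes cs: "compactly_supported F" and lo: "0 < lo" and ge: "AE x in F. lo \<le> x"
    and s: "0 < s" "stieltjes F (- s) = \<eta>"
  shows "R_transform F (- \<eta>) = 1 / \<eta> - s"
proof -
  have "inj_on (stieltjes F) {..<0}"
  proof (rule linorder_inj_onI)
    fix x y :: real assume xy: "x < y" "x \<in> {..<0}" "y \<in> {..<0}"
    show "stieltjes F x \<noteq> stieltjes F y"
      using stieltjes_strict(1)[OF cs lo ge, of "- y" "- x"] xy by simp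
  qed auto
  then have "the_inv_into {..<0} (stieltjes F) \<eta> = - s"
    using s by (intro the_inv_into_f_eq) auto
  then show ?thesis by (simp add: R_transform_def)
qed

text \<open>The Schwinger-Dyson relations say that (d + \<omega>) \<gamma> averages to 1 against every polynomial in d;
  testing against 1 / (d + s) shows that every limit point s of \<omega> solves
  \<open>stieltjes F (- s) = \<eta>\<close>.\<close>
lemma subordination_limit:
  fixes d \<gamma> :: "nat \<Rightarrow> nat \<Rightarrow> real" and g h :: "nat \<Rightarrow> real"
  assumes cs: "compactly_supported F" and lo: "0 < lo" and k0: "0 \<le> \<kappa>"
    and d: "\<forall>\<^sub>F N in sequentially. \<forall>j<N. lo \<le> d N j \<and> d N j \<le> hi"
    and weak: "\<And>f B. continuous_on UNIV f \<Longrightarrow> (\<And>x. \<bar>f x\<bar> \<le> B) \<Longrightarrow>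
       (\<lambda>N. average N (\<lambda>j. f (d N j))) \<longlonglongrightarrow> (LINT x|F. f x)"
    and \<gamma>: "\<forall>\<^sub>F N in sequentially. \<forall>j<N. 0 \<le> \<gamma> N j \<and> \<gamma> N j \<le> \<kappa>"
    and g: "\<forall>\<^sub>F N in sequentially. g N = average N (\<gamma> N)" and g_lim: "g \<longlonglongrightarrow> \<eta>" and \<eta>: "0 < \<eta>"
    and h: "\<forall>\<^sub>F N in sequentially. h N = average N (\<lambda>j. d N j * \<gamma> N j)"
    and s0: "0 < s0" and \<omega>_bounds: "\<forall>\<^sub>F N in sequentially. s0 * g N \<le> 1 - h N \<and> 1 - h N \<le> s1 * g N"
    and sd: "\<And>k. (\<lambda>N. average N (\<lambda>j. d N j ^ k) * g N - average N (\<lambda>j. d N j ^ k * \<gamma> N j)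
       + average N (\<lambda>j. d N j ^ k * \<gamma> N j) * h N - average N (\<lambda>j. d N j ^ Suc k * \<gamma> N j) * g N) \<longlonglongrightarrow> 0"
  shows "(\<lambda>N. h N / g N) \<longlonglongrightarrow> R_transform F (- \<eta>)" and "lo \<le> R_transform F (- \<eta>)"
proof -
  obtain R where F: "real_distribution F" and R: "AE x in F. \<bar>x\<bar> \<le> R"
    using cs by (auto simp: compactly_supported_def)
  \<comment> \<open>Chosen so that (d + \<omega>) \<gamma> averages to exactly 1 once N is
    large.\<close>
  define \<omega> where "\<omega> N = (1 - h N) / g N" for N
  have gpos: "\<forall>\<^sub>F N in sequentially. 0 < g N" using g_lim \<eta> by (rule order_tendstoD)
  have \<omega>b: "\<forall>\<^sub>F N in sequentially. s0 \<le> \<omega> N \<and> \<omega> N \<le> s1"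
    using \<omega>_bounds gpos by eventually_elim (simp add: \<omega>_def pos_le_divide_eq pos_divide_le_eq)
  have ge: "AE x in F. lo \<le> x"
  proof (rule AE_ge_of_averages[OF F])
    show "\<forall>\<^sub>F N in sequentially. \<forall>j<N. lo \<le> d N j" using d by eventually_elim auto
    show "(\<lambda>N. average N (\<lambda>j. max 0 (min 1 (lo - d N j)))) \<longlonglongrightarrow> (LINT x|F. max 0 (min 1 (lo - x)))"
      by (rule weak[where B=1]) (auto intro!: continuous_intros)
  qed
  define L where "L = max R hi"
  \<comment> \<open>The residual of this normalisation. The relations \<open>sd\<close>, divided by
    g, are its moments against powers of d; boundedness extends their vanishing to continuous
    functions.\<close>
  define c where "c N j = 1 - (d N j + \<omega> N) * \<gamma> N j" for N j
  have test: "(\<lambda>N. average N (\<lambda>j. f (d N j) * c N j)) \<longlonglongrightarrow> 0" if f: "continuous_on UNIV f" for f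
  proof -
    define K where "K = 1 + (\<bar>hi\<bar> + \<bar>s1\<bar>) * \<kappa>"
    have "(\<lambda>N. average N (\<lambda>j. f (d N j) * c N j)) \<longlonglongrightarrow> 0 * (LINT x|F. f x)"
    proof (rule weighted_average_convergence[OF f _ F, where K=K and L=L])
      show "0 < K" using k0 unfolding K_def by (intro add_pos_nonneg mult_nonneg_nonneg) auto
      then show "\<bar>0\<bar> \<le> K" by simp
      show "AE x in F. \<bar>x\<bar> \<le> L" using R by eventually_elim (auto simp: L_def)
      show "\<forall>\<^sub>F N in sequentially. \<forall>j<N. \<bar>d N j\<bar> \<le> L"
        using d by eventually_elim (use lo in \<open>fastforce simp: L_def\<close>)
      show "\<forall>\<^sub>F N in sequentially. \<forall>j<N. \<bar>c N j\<bar> \<le> K"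
        using d \<gamma> \<omega>b
      proof (eventually_elim)
        case (elim N)
        show ?case
        proof (intro allI impI)
          fix j assume j: "j < N"
          have a: "0 \<le> d N j + \<omega> N" "d N j + \<omega> N \<le> \<bar>hi\<bar> + \<bar>s1\<bar>" using elim j lo s0 by (smt (verit))+
          have "(d N j + \<omega> N) * \<gamma> N j \<le> (\<bar>hi\<bar> + \<bar>s1\<bar>) * \<kappa>" using a elim(2) j by (intro mult_mono) auto
          moreover have "0 \<le> (d N j + \<omega> N) * \<gamma> N j" using a elim(2) j by (intro mult_nonneg_nonneg) auto
          ultimately show "\<bar>c N j\<bar> \<le> K" unfolding c_def K_def by linarith
        qed
      qed
      fix k
      let ?T = "\<lambda>N. average N (\<lambda>j. d N j ^ k) * g N - average N (\<lambda>j. d N j ^ k * \<gamma> N j)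
       + average N (\<lambda>j. d N j ^ k * \<gamma> N j) * h N - average N (\<lambda>j. d N j ^ Suc k * \<gamma> N j) * g N"
      have "(\<lambda>N. ?T N / g N) \<longlonglongrightarrow> 0 / \<eta>" by (intro tendsto_divide sd g_lim) (use \<eta> in simp)
      moreover have "\<forall>\<^sub>F N in sequentially. ?T N / g N = average N (\<lambda>j. d N j ^ k * c N j)"
        using gpos
      proof (eventually_elim)
        case (elim N)
        have "average N (\<lambda>j. d N j ^ k * c N j)
          = average N (\<lambda>j. d N j ^ k) - average N (\<lambda>j. d N j ^ Suc k * \<gamma> N j) - \<omega> N * average N (\<lambda>j. d N j ^ k * \<gamma> N j)"
          unfolding average_cmult[symmetric] average_diff[symmetric]
          by (rule average_cong) (simp add: c_def algebra_simps)
        then show ?case using elim by (simp add: \<omega>_def field_simps)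
      qed
      ultimately show "(\<lambda>N. average N (\<lambda>j. d N j ^ k * c N j)) \<longlonglongrightarrow> 0 * (LINT x|F. x ^ k)"
        by (simp add: tendsto_cong)
    qed
    then show ?thesis by simp
  qed
  define r where "r N s = average N (\<lambda>j. \<gamma> N j / (d N j + s))" for N s
  have rb: "\<forall>\<^sub>F N in sequentially. 0 \<le> r N s \<and> r N s \<le> \<kappa> / s" if s: "0 < s" for s
    using d \<gamma>
  proof (eventually_elim)
    case (elim N)
    have "0 \<le> \<gamma> N j / (d N j + s) \<and> \<gamma> N j / (d N j + s) \<le> \<kappa> / s" if j: "j < N" for j
    proof -
      have a: "0 \<le> \<gamma> N j" "\<gamma> N j \<le> \<kappa>" "s \<le> d N j + s" using elim j lo by fastforce+
      then show ?thesis using s k0 by (auto intro!: frac_le)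
    qed
    then have "average N (\<lambda>j. 0) \<le> r N s" and "\<And>j. j < N \<Longrightarrow> \<bar>\<gamma> N j / (d N j + s)\<bar> \<le> \<kappa> / s"
      unfolding r_def abs_le_iff by (auto intro!: average_mono) (smt (verit))
    moreover from this(2) have "\<bar>r N s\<bar> \<le> \<kappa> / s"
      unfolding r_def by (rule average_abs_le) (use s k0 in auto)
    ultimately show ?case by (simp add: average_def)
  qed
  \<comment> \<open>Testing the residual against 1 / (d + s) and splitting d + \<omega> as (d + s) +
    (\<omega> - s) isolates the product of \<omega> - s with \<open>r\<close>.\<close>
  have main: "(\<lambda>N. (\<omega> N - s) * r N s) \<longlonglongrightarrow> stieltjes F (- s) - \<eta>" if s: "0 < s" for s
  proof -
    let ?f = "\<lambda>x. 1 / (max lo x + s)"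
    have ne: "max lo x + s \<noteq> 0" for x using lo s by (simp add: max_def)
    have cf: "continuous_on UNIV ?f" using ne by (intro continuous_intros) auto
    have w: "(\<lambda>N. average N (\<lambda>j. ?f (d N j))) \<longlonglongrightarrow> stieltjes F (- s)"
      unfolding stieltjes_strict(2)[OF cs lo ge s less_add_one]
    proof (rule weak[OF cf, where B="1 / s"])
      fix x
      have "s \<le> max lo x + s" using lo by (simp add: max_def)
      then show "\<bar>?f x\<bar> \<le> 1 / s" using s by (simp add: frac_le abs_le_iff)
    qed
    have "(\<lambda>N. average N (\<lambda>j. ?f (d N j)) - g N - average N (\<lambda>j. ?f (d N j) * c N j)) \<longlonglongrightarrow> stieltjes F (- s) - \<eta> - 0"
      by (intro tendsto_intros w g_lim test[OF cf])
    moreover have "\<forall>\<^sub>F N in sequentially. average N (\<lambda>j. ?f (d N j)) - g N - average N (\<lambda>j. ?f (d N j) * c N j)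
        = (\<omega> N - s) * r N s"
      using d g
    proof (eventually_elim)
      case (elim N)
      show ?case unfolding elim(2) r_def average_cmult[symmetric] average_diff[symmetric]
      proof (rule average_cong)
        fix j assume j: "j < N"
        then have e: "max lo (d N j) = d N j" and p: "d N j + s \<noteq> 0" using elim(1) s lo by (fastforce simp: max_def)+
        show "?f (d N j) - \<gamma> N j - ?f (d N j) * c N j = (\<omega> N - s) * (\<gamma> N j / (d N j + s))"
        proof -
          define D where "D = d N j + s"
          have D: "d N j + \<omega> N = D + (\<omega> N - s)" "D \<noteq> 0" using p by (simp_all add: D_def)
          show ?thesis unfolding e c_def D(1) D_def[symmetric] using D(2) by (simp add: field_simps)
        qed
      qed
    qed
    ultimately show ?thesis by (simp add: tendsto_cong)
  qed
  obtain N0 where N0: "\<And>N. N \<ge> N0 \<Longrightarrow> s0 \<le> \<omega> N \<and> \<omega> N \<le> s1"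
    using \<omega>b unfolding eventually_sequentially by blast
  \<comment> \<open>Existence of a solution l comes from a limit point of \<omega>, not from a study
    of the range of \<open>stieltjes\<close>.\<close>
  have "seq_compact {s0..s1}" by (rule compact_imp_seq_compact) (rule compact_Icc)
  then obtain l \<phi> where l: "l \<in> {s0..s1}" and \<phi>: "strict_mono \<phi>" and lim: "((\<lambda>N. \<omega> (N + N0)) \<circ> \<phi>) \<longlonglongrightarrow> l"
    using seq_compactE[of "{s0..s1}" "\<lambda>N. \<omega> (N + N0)"] N0 by (metis atLeastAtMost_iff le_add2)
  have l0: "0 < l" using l s0 by auto
  define \<psi> where "\<psi> N = \<phi> N + N0" for N
  have \<psi>: "filterlim \<psi> sequentially sequentially"
    unfolding \<psi>_def using filterlim_compose[OF filterlim_add_const_nat_at_top filterlim_subseq[OF \<phi>]] by simp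
  have S: "stieltjes F (- l) = \<eta>"
  proof -
    have "(\<lambda>N. (\<omega> (\<psi> N) - l) * r (\<psi> N) l) \<longlonglongrightarrow> stieltjes F (- l) - \<eta>"
      using filterlim_compose[OF main[OF l0] \<psi>] by simp
    moreover have "(\<lambda>N. (\<omega> (\<psi> N) - l) * r (\<psi> N) l) \<longlonglongrightarrow> 0"
    proof (rule Lim_null_comparison)
      have "\<forall>\<^sub>F N in sequentially. 0 \<le> r (\<psi> N) l \<and> r (\<psi> N) l \<le> \<kappa> / l"
        by (rule eventually_compose_filterlim[OF rb[OF l0] \<psi>])
      then show "\<forall>\<^sub>F N in sequentially. norm ((\<omega> (\<psi> N) - l) * r (\<psi> N) l) \<le> \<bar>\<omega> (\<psi> N) - l\<bar> * (\<kappa> / l)"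
        by eventually_elim (unfold real_norm_def abs_mult, intro mult_left_mono, auto)
      have "(\<lambda>N. \<omega> (\<psi> N)) \<longlonglongrightarrow> l" using lim by (simp add: comp_def \<psi>_def)
      then have "(\<lambda>N. \<bar>\<omega> (\<psi> N) - l\<bar> * (\<kappa> / l)) \<longlonglongrightarrow> \<bar>l - l\<bar> * (\<kappa> / l)" by (intro tendsto_intros)
      then show "(\<lambda>N. \<bar>\<omega> (\<psi> N) - l\<bar> * (\<kappa> / l)) \<longlonglongrightarrow> 0" by simp
    qed
    ultimately show ?thesis using LIMSEQ_unique by fastforce
  qed
  \<comment> \<open>Away from l the limit in \<open>main\<close> has a strict sign. Since
    \<open>r\<close> is nonnegative, this is the sign of \<omega> - s, so l is the only limit
    point.\<close>
  have upper: "\<forall>\<^sub>F N in sequentially. \<omega> N < s" if s: "l < s" for s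
  proof -
    have s': "0 < s" using s l0 by simp
    have "stieltjes F (- s) - \<eta> < 0" using stieltjes_strict(1)[OF cs lo ge l0 s] S by simp
    from order_tendstoD(2)[OF main[OF s'] this] rb[OF s'] show ?thesis
      by eventually_elim (auto simp: mult_less_0_iff)
  qed
  have lower: "\<forall>\<^sub>F N in sequentially. s < \<omega> N" if s: "s < l" for s
  proof (cases "0 < s")
    case True
    have "0 < stieltjes F (- s) - \<eta>" using stieltjes_strict(1)[OF cs lo ge True s] S by simp
    from order_tendstoD(1)[OF main[OF True] this] rb[OF True] show ?thesis
      by eventually_elim (auto simp: zero_less_mult_iff)
  next
    case False
    show ?thesis using \<omega>b by eventually_elim (use False s0 in auto)
  qed
  have \<omega>_lim: "\<omega> \<longlonglongrightarrow> l" by (rule order_tendstoI) (fact lower, fact upper)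
  have Req: "R_transform F (- \<eta>) = 1 / \<eta> - l" by (rule R_transform_eq[OF cs lo ge l0 S])
  have "(\<lambda>N. 1 / g N - \<omega> N) \<longlonglongrightarrow> 1 / \<eta> - l"
    by (intro tendsto_intros g_lim \<omega>_lim) (use \<eta> in simp)
  moreover have "\<forall>\<^sub>F N in sequentially. 1 / g N - \<omega> N = h N / g N"
    using gpos by eventually_elim (simp add: \<omega>_def field_simps)
  ultimately show lim: "(\<lambda>N. h N / g N) \<longlonglongrightarrow> R_transform F (- \<eta>)" unfolding Req by (simp add: tendsto_cong)
  \<comment> \<open>h is the average of d \<gamma> with d at least \<open>lo\<close> and \<gamma>
    nonnegative; this bound is the source of zstar < 0.\<close>
  show "lo \<le> R_transform F (- \<eta>)"
  proof (rule tendsto_lowerbound[OF lim])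
    show "\<forall>\<^sub>F N in sequentially. lo \<le> h N / g N"
      using d \<gamma> g h gpos
    proof (eventually_elim)
      case (elim N)
      have "average N (\<lambda>j. lo * \<gamma> N j) \<le> average N (\<lambda>j. d N j * \<gamma> N j)"
        by (rule average_mono) (use elim in \<open>auto intro!: mult_right_mono\<close>)
      then have "lo * g N \<le> h N" unfolding elim(3,4) average_cmult .
      then show ?case using elim(5) by (simp add: pos_le_divide_eq)
    qed
  qed simp
qed

section \<open>Limits along one realisation\<close>

lemma wtr_cyclic: "wtr n \<rho> (u @ v) = wtr n \<rho> (v @ u)"
proof -
  have "(\<Sum>i<n. wb n \<rho> (u @ v) (fid i) (fid i))
      = (\<Sum>i<n. \<Sum>k<n. wb n \<rho> u (fid i) (fid k) * wb n \<rho> v (fid k) (fid i))"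
    unfolding wb_append_sum ..
  also have "\<dots> = (\<Sum>k<n. \<Sum>i<n. wb n \<rho> v (fid k) (fid i) * wb n \<rho> u (fid i) (fid k))"
    by (subst sum.swap) (simp add: mult.commute)
  also have "\<dots> = (\<Sum>k<n. wb n \<rho> (v @ u) (fid k) (fid k))" unfolding wb_append_sum ..
  finally show ?thesis by (simp add: wtr_def)
qed

text \<open>Taking both fixed vectors equal to e_i and averaging over i turns the left pairing into
  a normalised trace as well; this is the step from vector relations to the difference quotient of
  the trace.\<close>

lemma average_sd_form:
  "average n (\<lambda>i. sd_form n \<rho> W (fid i) (fid i)) = dq (\<lambda>L R. wtr n \<rho> L * wtr n \<rho> R) W"
  unfolding average_def sd_form_def dq_sum[symmetric] dq_divide[symmetric] sum_distrib_right[symmetric]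
  by (simp add: wtr_def)

definition emb :: "bool \<Rightarrow> letter" where "emb i = (if i then LB else LA)"

lemma emb_simps [simp]: "emb False = LA" "emb True = LB" by (simp_all add: emb_def)

lemma word_dq_eq_dq:
  "(\<And>u v. f u v = g (map emb u) (map emb v)) \<Longrightarrow> word_dq f w = dq g (map emb w)"
proof (induction w arbitrary: f g)
  case (Cons i w)
  have "word_dq (\<lambda>u v. f (i # u) v) w = dq (\<lambda>u v. g (emb i # u) v) (map emb w)"
    by (rule Cons.IH) (simp add: Cons.prems)
  then show ?case by (cases i) (simp_all add: Cons.prems)
qed simp

lemma dq_replicate_LA:
  "dq f (replicate k LA @ W) = f (replicate k LA) W - f [] (replicate k LA @ W)
     + dq (\<lambda>u v. f (replicate k LA @ u) v) W"
  by (induction k arbitrary: f) auto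

text \<open>The cuts inside A'^k telescope, and traciality moves the A' behind G to the
  front.\<close>

lemma dq_power_inverse:
  assumes "\<And>u v. tr (u @ v) = tr (v @ u)"
  shows "dq (\<lambda>L R. tr L * tr R) (replicate k LA @ [LG])
    = tr (replicate k LA) * tr [LG] - tr [] * tr (replicate k LA @ [LG])
      + tr (replicate k LA @ [LG]) * tr [LA, LG] - tr (replicate (Suc k) LA @ [LG]) * tr [LG]"
proof -
  have "tr (replicate k LA @ [LG, LA]) = tr ((replicate k LA @ [LG]) @ [LA])" by simp
  also have "\<dots> = tr ([LA] @ (replicate k LA @ [LG]))" by (rule assms)
  finally have e: "tr (replicate k LA @ [LG, LA]) = tr (replicate (Suc k) LA @ [LG])" by simp
  show ?thesis unfolding dq_replicate_LA using e by simp
qed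

section \<open>Eigenvectors of inverses and powers of a sum\<close>

lemma spectral_decomp_mvec:
  assumes sp: "spectral_decomp n M d w" and j: "j < n"
  shows "bform n (w j) M b = d j * ip n b (w j)" "bform n a M (w j) = d j * ip n a (w j)"
proof -
  have bf: "bform n a M b = (\<Sum>k<n. d k * ip n a (w k) * ip n b (w k))" for a b
    using sp unfolding spectral_decomp_def by blast
  have "bform n (w j) M b = (\<Sum>k<n. fid j k * (d k * ip n b (w k)))"
    unfolding bf by (intro sum.cong refl) (use j in \<open>simp add: spectral_decomp_orthonormal[OF sp]\<close>)
  then show "bform n (w j) M b = d j * ip n b (w j)" using j by simp
  have "bform n a M (w j) = (\<Sum>k<n. fid j k * (d k * ip n a (w k)))"
    unfolding bf by (intro sum.cong refl) (use j in \<open>simp add: spectral_decomp_orthonormal[OF sp]\<close>)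
  then show "bform n a M (w j) = d j * ip n a (w j)" using j by simp
qed

lemma mvec_finv:
  assumes "det (mat n n (\<lambda>(i, j). M i j)) \<noteq> 0" "i < n"
  shows "mvec n M (mvec n (finv n M) b) i = b i"
proof -
  have "mvec n M (mvec n (finv n M) b) i = mvec n (fmul n M (finv n M)) b i" by (simp add: mvec_fmul)
  also have "\<dots> = (\<Sum>j<n. fid i j * b j)" unfolding mvec_def
    by (intro sum.cong refl arg_cong2[where f="times"])
       (use finv_inverse(2)[OF assms] in \<open>simp_all add: fmul_def\<close>)
  finally show ?thesis using assms(2) by simp
qed

lemma ip_commute: "ip n a b = ip n b a" by (simp add: ip_def mult.commute)

lemma spectral_decomp_finv:
  assumes sp: "spectral_decomp n M d w" and d: "\<And>j. j < n \<Longrightarrow> d j \<noteq> 0"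
    and det: "det (mat n n (\<lambda>(i, j). M i j)) \<noteq> 0"
  shows "spectral_decomp n (finv n M) (\<lambda>j. 1 / d j) w"
proof -
  have "bform n a (finv n M) b = (\<Sum>k<n. 1 / d k * ip n a (w k) * ip n b (w k))" for a b
  proof -
    define y where "y = mvec n (finv n M) b"
    have "ip n y (w k) = 1 / d k * ip n b (w k)" if k: "k < n" for k
    proof -
      have "ip n b (w k) = ip n (w k) (mvec n M y)"
        unfolding ip_commute[of n b] y_def ip_def by (intro sum.cong refl) (simp add: mvec_finv[OF det])
      also have "\<dots> = d k * ip n y (w k)"
        unfolding bform_eq_ip_mvec[symmetric] by (rule spectral_decomp_mvec(1)[OF sp k])
      finally show ?thesis using d[OF k] by simp
    qed
    then have "(\<Sum>k<n. ip n a (w k) * ip n y (w k)) = (\<Sum>k<n. 1 / d k * ip n a (w k) * ip n b (w k))"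
      by (intro sum.cong refl) simp
    then show ?thesis
      unfolding bform_eq_ip_mvec y_def[symmetric] spectral_decomp_ip[OF sp, of a y] .
  qed
  then show ?thesis using sp unfolding spectral_decomp_def by blast
qed

lemma spectral_decomp_bounds:
  assumes sp: "spectral_decomp n M d w" and c: "coercive n \<kappa> M" and o: "opbound n \<beta> M" and k: "0 < \<kappa>" and j: "j < n"
  shows "1 / \<kappa> \<le> d j \<and> d j \<le> \<beta>"
proof -
  have w1: "ip n (w j) (w j) = 1" using spectral_decomp_orthonormal[OF sp j j] by (simp add: fid_def)
  have v1: "vnorm n (w j) = 1" using w1 vnorm_sq[of n "w j"] vnorm_nonneg[of n "w j"] by (simp add: power2_eq_1_iff)
  have e: "bform n (w j) M (w j) = d j" using spectral_decomp_mvec(1)[OF sp j, of "w j"] w1 by simp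
  have "1 \<le> \<kappa> * d j" using c w1 e unfolding coercive_def by metis
  moreover have "d j \<le> \<beta>" using opboundD[OF o, of "w j" "w j"] e v1 by simp
  ultimately show ?thesis using k by (simp add: field_simps)
qed

text \<open>Noncommutative binomial expansion: in \<open>\<rho>'\<close> the single letter
  \<open>c\<close> stands for the sum of \<open>LA\<close> and \<open>LB\<close>.\<close>

lemma wmat_sum_power:
  assumes "\<And>i j. i < n \<Longrightarrow> j < n \<Longrightarrow> \<rho>' c i j = \<rho> LA i j + \<rho> LB i j" "i < n" "j < n"
  shows "wmat n \<rho>' (replicate k c) i j = (\<Sum>w | length w = k. wmat n \<rho> (map emb w) i j)"
  using assms(2,3)
proof (induction k arbitrary: i j)
  case 0
  have "{w :: bool list. length w = 0} = {[]}" by auto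
  then show ?case by simp
next
  case (Suc k)
  have fin: "finite {w :: bool list. length w = m}" for m
    using finite_lists_length_eq[of "UNIV :: bool set" m] by simp
  have split: "{w :: bool list. length w = Suc k} = (#) False ` {w. length w = k} \<union> (#) True ` {w. length w = k}"
    by (auto simp: length_Suc_conv)
  have "wmat n \<rho>' (replicate (Suc k) c) i j
      = (\<Sum>l<n. (\<rho> LA i l + \<rho> LB i l) * (\<Sum>w | length w = k. wmat n \<rho> (map emb w) l j))"
    by (simp add: fmul_def) (intro sum.cong refl, simp add: Suc assms(1))
  also have "\<dots> = (\<Sum>w | length w = k. \<Sum>l<n. (\<rho> LA i l + \<rho> LB i l) * wmat n \<rho> (map emb w) l j)"
    unfolding sum_distrib_left by (rule sum.swap)
  also have "\<dots> = (\<Sum>w | length w = k. wmat n \<rho> (map emb (False # w)) i j)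
      + (\<Sum>w | length w = k. wmat n \<rho> (map emb (True # w)) i j)"
    unfolding sum.distrib[symmetric]
    by (simp only: list.map emb_simps wmat.simps fmul_def sum.distrib[symmetric] distrib_right)
  also have "\<dots> = (\<Sum>w | length w = Suc k. wmat n \<rho> (map emb w) i j)"
    unfolding split
    by (subst sum.union_disjoint) (auto simp: fin sum.reindex)
  finally show ?case .
qed

lemma wtr_sum_power:
  assumes "\<And>i j. i < n \<Longrightarrow> j < n \<Longrightarrow> \<rho>' c i j = \<rho> LA i j + \<rho> LB i j"
  shows "wtr n \<rho>' (replicate k c) = (\<Sum>w | length w = k. wtr n \<rho> (map emb w))"
proof -
  have t: "wtr n \<rho> W = (\<Sum>i<n. wmat n \<rho> W i i) / real n" for \<rho> W
    by (simp add: wtr_def bform_unit)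
  have "(\<Sum>i<n. wmat n \<rho>' (replicate k c) i i) = (\<Sum>i<n. \<Sum>w | length w = k. wmat n \<rho> (map emb w) i i)"
    by (intro sum.cong refl wmat_sum_power assms) auto
  also have "\<dots> = (\<Sum>w | length w = k. \<Sum>i<n. wmat n \<rho> (map emb w) i i)" by (rule sum.swap)
  finally show ?thesis unfolding t by (simp add: sum_divide_distrib)
qed

lemma wtr_complement:
  assumes inv: "is_sum_inverse n A B G" and V: "V \<in> orthogonal_matrices n" and n: "0 < n"
  shows "wtr n (letter_mat n A B G V) [LA, LG] + wtr n (letter_mat n A B G V) [LB, LG] = 1"
proof -
  have t: "wtr n \<rho> W = (\<Sum>i<n. wmat n \<rho> W i i) / real n" for \<rho> W
    by (simp add: wtr_def bform_unit)
  have e: "wmat n \<rho> [c, c'] i i = (\<Sum>k<n. \<rho> c i k * \<rho> c' k i)" if "i < n" for \<rho> c c' i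
    using that by (simp add: fmul_def)
  have "(\<Sum>i<n. wmat n (letter_mat n A B G V) [LA, LG] i i) + (\<Sum>i<n. wmat n (letter_mat n A B G V) [LB, LG] i i)
     = (\<Sum>i<n. \<Sum>k<n. (conj_mat n V A i k + B i k) * G V k i)"
    unfolding sum.distrib[symmetric]
    by (intro sum.cong refl) (simp only: e lessThan_iff letter_mat_simps sum.distrib[symmetric] distrib_right)
  also have "\<dots> = (\<Sum>i<n. 1)"
    using inv V by (intro sum.cong refl) (auto simp: is_sum_inverse_def fid_def)
  finally show ?thesis unfolding t using n by (simp add: add_divide_distrib[symmetric] del: wmat.simps)
qed

lemma conj_mat_sym:
  assumes "\<And>i j. i < n \<Longrightarrow> j < n \<Longrightarrow> A i j = A j i"
  shows "conj_mat n V A i j = conj_mat n V A j i"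
proof -
  have "conj_mat n V A i j = (\<Sum>l<n. \<Sum>k<n. V $$ (k, i) * A k l * V $$ (l, j))"
    unfolding conj_mat_def by (rule sum.swap)
  also have "\<dots> = conj_mat n V A j i" unfolding conj_mat_def
    by (intro sum.cong refl) (use assms in \<open>auto simp: mult_ac\<close>)
  finally show ?thesis .
qed

text \<open>Weak convergence tests bounded functions only, so x^k is clipped outside an interval
  that contains the support and, eventually, the eigenvalues.\<close>

lemma power_average_limit:
  assumes cs: "compactly_supported F"
    and d: "\<forall>\<^sub>F N in sequentially. \<forall>j<N. \<bar>d N j\<bar> \<le> hi"
    and weak: "\<And>f B. continuous_on UNIV f \<Longrightarrow> (\<And>x. \<bar>f x\<bar> \<le> B) \<Longrightarrow>
       (\<lambda>N. average N (\<lambda>j. f (d N j))) \<longlonglongrightarrow> (LINT x|F. f x)"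
  shows "(\<lambda>N. average N (\<lambda>j. d N j ^ k)) \<longlonglongrightarrow> (LINT x|F. x ^ k)"
proof -
  obtain R where F: "real_distribution F" and R: "AE x in F. \<bar>x\<bar> \<le> R"
    using cs by (auto simp: compactly_supported_def)
  define K where "K = max 0 (max R hi)"
  define f where "f x = (max (- K) (min x K)) ^ k" for x :: real
  have c: "continuous_on UNIV f" unfolding f_def by (intro continuous_intros)
  have fK: "f x = x ^ k" if "\<bar>x\<bar> \<le> K" for x
    using that by (auto simp: f_def max_def min_def abs_le_iff intro!: arg_cong[where f="\<lambda>y. y ^ k"])
  have "\<bar>f x\<bar> \<le> K ^ k" for x
    unfolding f_def power_abs by (intro power_mono) (auto simp: K_def max_def min_def abs_le_iff)
  from weak[OF c this] have "(\<lambda>N. average N (\<lambda>j. f (d N j))) \<longlonglongrightarrow> (LINT x|F. f x)" .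
  moreover have "(LINT x|F. f x) = (LINT x|F. x ^ k)"
  proof (rule integral_cong_AE)
    interpret real_distribution F by fact
    show "f \<in> borel_measurable F" using borel_measurable_continuous_onI[OF c] by simp
    have "continuous_on UNIV (\<lambda>x::real. x ^ k)" by (intro continuous_intros)
    from borel_measurable_continuous_onI[OF this] show "(\<lambda>x. x ^ k) \<in> borel_measurable F" by simp
    show "AE x in F. f x = x ^ k" using R by eventually_elim (rule fK, simp add: K_def)
  qed
  moreover have "\<forall>\<^sub>F N in sequentially. average N (\<lambda>j. f (d N j)) = average N (\<lambda>j. d N j ^ k)"
    using d by eventually_elim (auto intro!: average_cong fK simp: K_def)
  ultimately show ?thesis by (simp add: tendsto_cong)
qed


lemma opbound_add:
  assumes "opbound n c M" "opbound n d K"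
  shows "opbound n (c + d) (\<lambda>i j. M i j + K i j)"
  unfolding opbound_def
proof (intro allI)
  fix a b
  have "bform n a (\<lambda>i j. M i j + K i j) b = bform n a M b + bform n a K b"
    by (simp add: bform_def algebra_simps sum.distrib)
  then show "\<bar>bform n a (\<lambda>i j. M i j + K i j) b\<bar> \<le> (c + d) * vnorm n a * vnorm n b"
    using opboundD[OF assms(1), of a b] opboundD[OF assms(2), of a b] by (simp add: algebra_simps)
qed

text \<open>No probability is left here: one realisation is fixed, with spectral decompositions as
  data and the averaged Schwinger-Dyson forms given to vanish for every word.\<close>

theorem pathwise_limits:
  fixes A B :: "nat \<Rightarrow> fmat" and V :: "nat \<Rightarrow> real mat"
  assumes F: "is_free_additive_convolution FA FB F" and \<kappa>: "2 \<le> \<kappa>"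
    and good: "\<forall>\<^sub>F N in sequentially. V N \<in> orthogonal_matrices N
      \<and> conditioned N \<kappa> (A N) \<and> conditioned N \<kappa> (B N)
      \<and> (\<forall>i<N. \<forall>j<N. A N i j = A N j i) \<and> (\<forall>i<N. \<forall>j<N. B N i j = B N j i)
      \<and> spectral_decomp N (A N) (dA N) (wA N) \<and> spectral_decomp N (B N) (dB N) (wB N)"
    and weakA: "\<And>f c. continuous_on UNIV f \<Longrightarrow> (\<And>x. \<bar>f x\<bar> \<le> c) \<Longrightarrow>
       (\<lambda>N. average N (\<lambda>j. f (dA N j))) \<longlonglongrightarrow> (LINT x|FA. f x)"
    and weakB: "\<And>f c. continuous_on UNIV f \<Longrightarrow> (\<And>x. \<bar>f x\<bar> \<le> c) \<Longrightarrow>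
       (\<lambda>N. average N (\<lambda>j. f (dB N j))) \<longlonglongrightarrow> (LINT x|FB. f x)"
    and sd: "\<And>W. (\<lambda>N. average N (\<lambda>i. sd_value N W (A N) (B N) (V N) (fid i) (fid i))) \<longlonglongrightarrow> 0"
  defines "\<rho> \<equiv> \<lambda>N. letters N (A N) (B N) (V N)" and "\<eta> \<equiv> (LINT x|F. 1 / x)"
  shows "(\<lambda>N. wtr N (\<rho> N) [LG]) \<longlonglongrightarrow> \<eta>"
    and "(\<lambda>N. wtr N (\<rho> N) [LA, LG] / wtr N (\<rho> N) [LG]) \<longlonglongrightarrow> R_transform FA (- \<eta>)"
    and "0 < \<eta>" and "0 < R_transform FA (- \<eta>)"
proof -
  have k0: "0 < \<kappa>" using \<kappa> by simp
  then have k1: "0 < 1 / \<kappa>" by simp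
  have cA: "compactly_supported FA" and cB: "compactly_supported FB" and cF: "compactly_supported F"
    using F by (auto simp: is_free_additive_convolution_def)
  obtain m where free: "free_joint_law m"
    and mA: "\<And>k. m (replicate k False) = (LINT x|FA. x ^ k)" and mB: "\<And>k. m (replicate k True) = (LINT x|FB. x ^ k)"
    and mF: "\<And>k. (LINT x|F. x ^ k) = (\<Sum>w | length w = k. m w)"
    using F unfolding is_free_additive_convolution_def by blast
  define w where "w N k i = (\<Sum>l<N. V N $$ (l, i) * wA N k l)" for N k i
  have goodD: "V N \<in> orthogonal_matrices N" "conditioned N \<kappa> (A N)" "conditioned N \<kappa> (B N)"
      "conditioned N \<kappa> (conj_mat N (V N) (A N))"
      "spectral_decomp N (\<rho> N LA) (dA N) (w N)" "spectral_decomp N (\<rho> N LB) (dB N) (wB N)"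
      "\<And>j. j < N \<Longrightarrow> 1 / \<kappa> \<le> dA N j \<and> dA N j \<le> \<kappa>" "\<And>j. j < N \<Longrightarrow> 1 / \<kappa> \<le> dB N j \<and> dB N j \<le> \<kappa>"
      "\<And>i j. i < N \<Longrightarrow> j < N \<Longrightarrow> conj_mat N (V N) (A N) i j + B N i j = conj_mat N (V N) (A N) j i + B N j i"
      "coercive N \<kappa> (\<lambda>i j. conj_mat N (V N) (A N) i j + B N i j)"
      "opbound N (2 * \<kappa>) (\<lambda>i j. conj_mat N (V N) (A N) i j + B N i j)"
      "\<And>c. opbound N \<kappa> (\<rho> N c)"
    if g: "V N \<in> orthogonal_matrices N \<and> conditioned N \<kappa> (A N) \<and> conditioned N \<kappa> (B N)
      \<and> (\<forall>i<N. \<forall>j<N. A N i j = A N j i) \<and> (\<forall>i<N. \<forall>j<N. B N i j = B N j i)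
      \<and> spectral_decomp N (A N) (dA N) (wA N) \<and> spectral_decomp N (B N) (dB N) (wB N)" for N
  proof -
    show V: "V N \<in> orthogonal_matrices N" and A: "conditioned N \<kappa> (A N)" and B: "conditioned N \<kappa> (B N)"
      using g by auto
    show cj: "conditioned N \<kappa> (conj_mat N (V N) (A N))" by (rule conditioned_conj_mat[OF V A])
    have sA: "spectral_decomp N (A N) (dA N) (wA N)" using g by simp
    show "spectral_decomp N (\<rho> N LA) (dA N) (w N)"
      using spectral_decomp_conj[OF sA V] by (simp add: \<rho>_def w_def[abs_def])
    show sB: "spectral_decomp N (\<rho> N LB) (dB N) (wB N)" using g by (simp add: \<rho>_def)
    show "1 / \<kappa> \<le> dA N j \<and> dA N j \<le> \<kappa>" if "j < N" for j
      by (rule spectral_decomp_bounds[OF sA _ _ k0 that]) (use A in \<open>simp_all add: conditioned_def\<close>)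
    show "1 / \<kappa> \<le> dB N j \<and> dB N j \<le> \<kappa>" if "j < N" for j
      by (rule spectral_decomp_bounds[OF sB _ _ k0 that]) (use B in \<open>simp_all add: conditioned_def \<rho>_def\<close>)
    show "conj_mat N (V N) (A N) i j + B N i j = conj_mat N (V N) (A N) j i + B N j i" if "i < N" "j < N" for i j
      using g that conj_mat_sym[of N "A N" "V N" i j] by simp
    show "coercive N \<kappa> (\<lambda>i j. conj_mat N (V N) (A N) i j + B N i j)" by (rule coercive_add[OF cj B k0])
    show "opbound N (2 * \<kappa>) (\<lambda>i j. conj_mat N (V N) (A N) i j + B N i j)"
      using opbound_add[of N \<kappa> _ \<kappa> "B N"] cj B by (simp add: conditioned_def)
    show "opbound N \<kappa> (\<rho> N c)" for c unfolding \<rho>_def by (rule conditioned_letters(1)[OF A B k0 V])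
  qed
  define M where "M N u = wtr N (\<rho> N) (map emb u)" for N u
  have sd': "(\<lambda>N. dq (\<lambda>L R. wtr N (\<rho> N) L * wtr N (\<rho> N) R) W) \<longlonglongrightarrow> 0" for W
    using sd[of W] unfolding sd_value_def average_sd_form \<rho>_def .
  have trpow: "wtr N (\<rho> N) (replicate k c) = average N (\<lambda>j. d j ^ k)"
    if "spectral_decomp N (\<rho> N c) d v" for N c d v k
    using wtr_power[of N "\<rho> N" c d v k] that by (simp add: average_def)
  have Mlim: "(\<lambda>N. M N u) \<longlonglongrightarrow> m u" for u
  proof (rule asymptotic_freeness[OF free])
    show "M N (u @ v) = M N (v @ u)" for N u v unfolding M_def map_append by (rule wtr_cyclic)
    show "(\<lambda>N. word_dq (\<lambda>u v. M N u * M N v) w) \<longlonglongrightarrow> 0" for w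
    proof -
      have "word_dq (\<lambda>u v. M N u * M N v) w = dq (\<lambda>L R. wtr N (\<rho> N) L * wtr N (\<rho> N) R) (map emb w)" for N
        by (rule word_dq_eq_dq) (simp add: M_def)
      then show ?thesis using sd' by simp
    qed
    show "(\<lambda>N. M N (replicate k i)) \<longlonglongrightarrow> m (replicate k i)" for i k
    proof (cases i)
      case True
      then have i: "i = True" by simp
      have "(\<lambda>N. average N (\<lambda>j. dB N j ^ k)) \<longlonglongrightarrow> m (replicate k i)"
        unfolding i mB
      proof (rule power_average_limit[OF cB _ weakB])
        show "\<forall>\<^sub>F N in sequentially. \<forall>j<N. \<bar>dB N j\<bar> \<le> \<kappa>"
          using good by eventually_elim (use goodD(8) k0 in \<open>smt (verit) divide_pos_pos\<close>)
      qed
      moreover have "\<forall>\<^sub>F N in sequentially. average N (\<lambda>j. dB N j ^ k) = M N (replicate k i)"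
        using good by eventually_elim
          (simp add: M_def i trpow[OF goodD(6)])
      ultimately show ?thesis by (simp add: tendsto_cong)
    next
      case False
      then have i: "i = False" by simp
      have "(\<lambda>N. average N (\<lambda>j. dA N j ^ k)) \<longlonglongrightarrow> m (replicate k i)"
        unfolding i mA
      proof (rule power_average_limit[OF cA _ weakA])
        show "\<forall>\<^sub>F N in sequentially. \<forall>j<N. \<bar>dA N j\<bar> \<le> \<kappa>"
          using good by eventually_elim (use goodD(7) k0 in \<open>smt (verit) divide_pos_pos\<close>)
      qed
      moreover have "\<forall>\<^sub>F N in sequentially. average N (\<lambda>j. dA N j ^ k) = M N (replicate k i)"
        using good by eventually_elim
          (simp add: M_def i trpow[OF goodD(5)])
      ultimately show ?thesis by (simp add: tendsto_cong)
    qed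
  qed
  define H where "H N i j = conj_mat N (V N) (A N) i j + B N i j" for N i j
  have "\<forall>N. \<exists>d w. (\<forall>i<N. \<forall>j<N. H N i j = H N j i) \<longrightarrow> spectral_decomp N (H N) d w"
    using spectral_theorem by blast
  then obtain dH wH where dH: "\<And>N. (\<forall>i<N. \<forall>j<N. H N i j = H N j i) \<Longrightarrow> spectral_decomp N (H N) (dH N) (wH N)"
    by metis
  have goodH: "\<forall>\<^sub>F N in sequentially. spectral_decomp N (H N) (dH N) (wH N)
      \<and> (\<forall>j<N. 1 / \<kappa> \<le> dH N j \<and> dH N j \<le> 2 * \<kappa>)
      \<and> spectral_decomp N (\<rho> N LG) (\<lambda>j. 1 / dH N j) (wH N)"
    using good
  proof (eventually_elim)
    case (elim N)
    have HN: "H N = (\<lambda>i j. conj_mat N (V N) (A N) i j + B N i j)" by (intro ext) (simp add: H_def)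
    have sp: "spectral_decomp N (H N) (dH N) (wH N)" by (rule dH) (use goodD(9)[OF elim] in \<open>simp add: H_def\<close>)
    have co: "coercive N \<kappa> (H N)" using goodD(10)[OF elim] by (simp add: HN)
    have b: "1 / \<kappa> \<le> dH N j \<and> dH N j \<le> 2 * \<kappa>" if "j < N" for j
      by (rule spectral_decomp_bounds[OF sp co _ k0 that]) (use goodD(11)[OF elim] in \<open>simp add: HN\<close>)
    have "dH N j \<noteq> 0" if "j < N" for j
      using b[OF that] k1 by linarith
    from spectral_decomp_finv[OF sp this coercive_det[OF co]]
    have "spectral_decomp N (\<rho> N LG) (\<lambda>j. 1 / dH N j) (wH N)"
      by (simp add: \<rho>_def sum_inv_def HN)
    with sp b show ?case by blast
  qed
  have momH: "(\<lambda>N. average N (\<lambda>j. dH N j ^ k)) \<longlonglongrightarrow> (LINT x|F. x ^ k)" for k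
  proof -
    \<comment> \<open>The moments of A' + B expand into words in the two letters, and so do those of
      \<open>F\<close> by the definition of the free convolution.\<close>
    have "(\<lambda>N. \<Sum>u | length u = k. M N u) \<longlonglongrightarrow> (\<Sum>u | length u = k. m u)" by (intro tendsto_sum Mlim)
    moreover have "\<forall>\<^sub>F N in sequentially. (\<Sum>u | length u = k. M N u) = average N (\<lambda>j. dH N j ^ k)"
      using goodH
    proof (eventually_elim)
      case (elim N)
      have "(\<Sum>u | length u = k. M N u) = wtr N (\<lambda>_. H N) (replicate k LA)"
        unfolding M_def by (rule wtr_sum_power[symmetric]) (simp add: H_def \<rho>_def)
      also have "\<dots> = average N (\<lambda>j. dH N j ^ k)"
        unfolding average_def by (rule wtr_power[where w="wH N"]) (use elim in simp)
      finally show ?case .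
    qed
    ultimately show ?thesis unfolding mF by (simp add: tendsto_cong)
  qed
  define g where "g N = wtr N (\<rho> N) [LG]" for N
  define h where "h N = wtr N (\<rho> N) [LA, LG]" for N
  have geq: "\<forall>\<^sub>F N in sequentially. average N (\<lambda>j. 1 / dH N j) = g N"
    using goodH
  proof (eventually_elim)
    case (elim N)
    then show ?case using wtr_power[of N "\<rho> N" LG "\<lambda>j. 1 / dH N j" "wH N" 1] by (simp add: g_def average_def)
  qed
  have "(\<lambda>N. average N (\<lambda>j. 1 / dH N j)) \<longlonglongrightarrow> \<eta>"
    unfolding \<eta>_def
  proof (rule inverse_moment_limit[OF cF _ _ momH])
    show "0 < 1 / \<kappa>" using k0 by simp
    show "\<forall>\<^sub>F N in sequentially. \<forall>j<N. 1 / \<kappa> \<le> dH N j \<and> dH N j \<le> 2 * \<kappa>"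
      using goodH by eventually_elim simp
  qed
  then have g_lim: "g \<longlonglongrightarrow> \<eta>" using geq by (rule Lim_transform_eventually)
  then show "(\<lambda>N. wtr N (\<rho> N) [LG]) \<longlonglongrightarrow> \<eta>" by (simp add: g_def[abs_def])
  \<comment> \<open>The eigenvalues of G are at least 1 / (2 \<kappa>), as A' + B has norm at most 2
    \<kappa>; this keeps the division by tr G under control.\<close>
  have "1 / (2 * \<kappa>) \<le> \<eta>"
  proof (rule tendsto_lowerbound[OF g_lim])
    show "\<forall>\<^sub>F N in sequentially. 1 / (2 * \<kappa>) \<le> g N"
      using goodH geq eventually_gt_at_top[of "0::nat"]
    proof (eventually_elim)
      case (elim N)
      have "average N (\<lambda>j. 1 / (2 * \<kappa>)) \<le> average N (\<lambda>j. 1 / dH N j)"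
      proof (rule average_mono)
        fix j assume "j < N"
        then have b: "1 / \<kappa> \<le> dH N j" "dH N j \<le> 2 * \<kappa>" using elim(1) by auto
        have "0 < dH N j" using b(1) k1 by linarith
        then show "1 / (2 * \<kappa>) \<le> 1 / dH N j" using b(2) by (intro frac_le) auto
      qed
      then show ?case using elim average_const[of N "1 / (2 * \<kappa>)"] by simp
    qed
  qed simp
  moreover have "0 < 1 / (2 * \<kappa>)" using k0 by simp
  ultimately show \<eta>: "0 < \<eta>" by linarith
  \<comment> \<open>The diagonal of G in the eigenbasis of A', through which traces of A'^k G become
    averages weighted by \<gamma>.\<close>
  define \<gamma> where "\<gamma> N j = bform N (w N j) (\<rho> N LG) (w N j)" for N j
  have pw: "wtr N (\<rho> N) (replicate k LA @ [LG]) = average N (\<lambda>j. dA N j ^ k * \<gamma> N j)"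
    if "spectral_decomp N (\<rho> N LA) (dA N) (w N)" for N k
    unfolding wtr_power_append[of N "\<rho> N" LA "dA N" "w N", OF that] average_def \<gamma>_def wb_single ..
  have sub: "(\<lambda>N. h N / g N) \<longlonglongrightarrow> R_transform FA (- \<eta>) \<and> 1 / \<kappa> \<le> R_transform FA (- \<eta>)"
  proof (rule conjI)
    have prem1: "0 < 1 / \<kappa>" "0 \<le> \<kappa>" using k0 by simp_all
    have prem2: "\<forall>\<^sub>F N in sequentially. \<forall>j<N. 1 / \<kappa> \<le> dA N j \<and> dA N j \<le> \<kappa>"
      using good by eventually_elim (use goodD(7) in blast)
    have prem3: "\<forall>\<^sub>F N in sequentially. \<forall>j<N. 0 \<le> \<gamma> N j \<and> \<gamma> N j \<le> \<kappa>"
      using good goodH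
    proof (eventually_elim)
      case (elim N)
      show ?case
      proof (intro allI impI conjI)
        fix j assume j: "j < N"
        have w1: "vnorm N (w N j) = 1"
          using vnorm_sq[of N "w N j"] spectral_decomp_orthonormal[OF goodD(5)[OF elim(1)] j j] vnorm_nonneg[of N "w N j"]
          by (simp add: fid_def power2_eq_1_iff)
        show "\<gamma> N j \<le> \<kappa>" using opboundD[OF goodD(12)[OF elim(1), of LG], of "w N j" "w N j"] w1 by (simp add: \<gamma>_def)
        have \<gamma>_eq: "\<gamma> N j = (\<Sum>k<N. 1 / dH N k * ip N (w N j) (wH N k) * ip N (w N j) (wH N k))"
          using elim(2) unfolding \<gamma>_def spectral_decomp_def by blast
        have nn: "0 \<le> 1 / dH N k * ip N (w N j) (wH N k) * ip N (w N j) (wH N k)" if "k < N" for k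
        proof -
          have "1 / \<kappa> \<le> dH N k" using elim(2) that by blast
          then have "0 \<le> dH N k" using k1 by linarith
          then show ?thesis by (simp add: mult.assoc)
        qed
        show "0 \<le> \<gamma> N j" unfolding \<gamma>_eq by (rule sum_nonneg) (rule nn, simp)
      qed
    qed
    have prem4: "\<forall>\<^sub>F N in sequentially. g N = average N (\<gamma> N)"
      using good by eventually_elim (use pw[OF goodD(5), of _ 0] in \<open>simp add: g_def\<close>)
    have prem5: "\<forall>\<^sub>F N in sequentially. h N = average N (\<lambda>j. dA N j * \<gamma> N j)"
      using good by eventually_elim (use pw[OF goodD(5), of _ 1] in \<open>simp add: h_def\<close>)
    \<comment> \<open>1 - h is the normalised trace of B G. In the eigenbasis of A' + B the weights
      1 / dH are nonnegative and the diagonal of B lies between 1/\<kappa> and \<kappa>.\<close>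
    have prem6: "\<forall>\<^sub>F N in sequentially. 1 / \<kappa> * g N \<le> 1 - h N \<and> 1 - h N \<le> \<kappa> * g N"
      using good goodH geq eventually_gt_at_top[of "0::nat"]
    proof (eventually_elim)
      case (elim N)
      have "1 - h N = wtr N (\<rho> N) [LB, LG]"
        using wtr_complement[OF conditioned_letters(2)[OF goodD(2,3)[OF elim(1)] k0] goodD(1)[OF elim(1)] elim(4)]
        by (simp add: h_def \<rho>_def del: wmat.simps)
      also have "\<dots> = wtr N (\<rho> N) ([LG] @ [LB])" using wtr_cyclic[of N "\<rho> N" "[LB]" "[LG]"] by simp
      also have "\<dots> = average N (\<lambda>j. 1 / dH N j * bform N (wH N j) (B N) (wH N j))"
        using wtr_power_append[of N "\<rho> N" LG "\<lambda>j. 1 / dH N j" "wH N" 1 "[LB]"] elim(2)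
        unfolding wb_single by (simp add: average_def \<rho>_def)
      finally have e: "1 - h N = average N (\<lambda>j. 1 / dH N j * bform N (wH N j) (B N) (wH N j))" .
      have b: "1 / \<kappa> \<le> bform N (wH N j) (B N) (wH N j) \<and> bform N (wH N j) (B N) (wH N j) \<le> \<kappa>" if j: "j < N" for j
      proof -
        have w1: "ip N (wH N j) (wH N j) = 1"
          using spectral_decomp_orthonormal[OF conjunct1[OF elim(2)] j j] by (simp add: fid_def)
        have v1: "vnorm N (wH N j) = 1"
          using vnorm_sq[of N "wH N j"] w1 vnorm_nonneg[of N "wH N j"] by (simp add: power2_eq_1_iff)
        have o: "opbound N \<kappa> (B N)" and c: "coercive N \<kappa> (B N)" using goodD(3)[OF elim(1)] by (simp_all add: conditioned_def)
        have "1 \<le> \<kappa> * bform N (wH N j) (B N) (wH N j)" using c w1 unfolding coercive_def by metis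
        moreover have "bform N (wH N j) (B N) (wH N j) \<le> \<kappa>" using opboundD[OF o, of "wH N j" "wH N j"] v1 by simp
        ultimately show ?thesis using k0 by (simp add: field_simps)
      qed
      have d0: "0 \<le> 1 / dH N j" if "j < N" for j
      proof -
        have "1 / \<kappa> \<le> dH N j" using elim(2) that by blast
        then have "0 \<le> dH N j" using k1 by linarith
        then show ?thesis by simp
      qed
      have "1 / \<kappa> * g N = average N (\<lambda>j. 1 / dH N j * (1 / \<kappa>))"
        unfolding elim(3)[symmetric] average_cmult[symmetric] by (simp add: mult.commute)
      also have "\<dots> \<le> 1 - h N" unfolding e by (intro average_mono mult_left_mono d0) (use b in auto)
      finally have 1: "1 / \<kappa> * g N \<le> 1 - h N" .
      have "1 - h N \<le> average N (\<lambda>j. 1 / dH N j * \<kappa>)" unfolding e by (intro average_mono mult_left_mono d0) (use b in auto)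
      also have "\<dots> = \<kappa> * g N" unfolding elim(3)[symmetric] average_cmult[symmetric] by (simp add: mult.commute)
      finally show ?case using 1 by simp
    qed
    have prem7: "(\<lambda>N. average N (\<lambda>j. dA N j ^ k) * g N - average N (\<lambda>j. dA N j ^ k * \<gamma> N j)
       + average N (\<lambda>j. dA N j ^ k * \<gamma> N j) * h N - average N (\<lambda>j. dA N j ^ Suc k * \<gamma> N j) * g N) \<longlonglongrightarrow> 0" for k
    proof -
      have "\<forall>\<^sub>F N in sequentially. dq (\<lambda>L R. wtr N (\<rho> N) L * wtr N (\<rho> N) R) (replicate k LA @ [LG])
        = average N (\<lambda>j. dA N j ^ k) * g N - average N (\<lambda>j. dA N j ^ k * \<gamma> N j)
       + average N (\<lambda>j. dA N j ^ k * \<gamma> N j) * h N - average N (\<lambda>j. dA N j ^ Suc k * \<gamma> N j) * g N"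
        using good eventually_gt_at_top[of "0::nat"]
      proof (eventually_elim)
        case (elim N)
        have 1: "wtr N (\<rho> N) [] = 1"
          using trpow[OF goodD(5)[OF elim(1)], of 0] elim(2) by (simp add: average_const del: wmat.simps)
        have "wtr N (\<rho> N) (replicate k LA) = average N (\<lambda>j. dA N j ^ k)"
          by (rule trpow[OF goodD(5)[OF elim(1)]])
        then show ?case
          unfolding dq_power_inverse[of "wtr N (\<rho> N)", OF wtr_cyclic] pw[OF goodD(5)[OF elim(1)]]
          by (simp add: g_def h_def 1 del: wmat.simps)
      qed
      then show ?thesis using sd'[of "replicate k LA @ [LG]"] by (simp add: tendsto_cong)
    qed
    note sl = subordination_limit[OF cA prem1 prem2 weakA prem3 prem4 g_lim \<eta> prem5 prem1(1) prem6 prem7]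
    show "(\<lambda>N. h N / g N) \<longlonglongrightarrow> R_transform FA (- \<eta>)" by (rule sl(1))
    show "1 / \<kappa> \<le> R_transform FA (- \<eta>)" by (rule sl(2))
  qed
  then show "(\<lambda>N. wtr N (\<rho> N) [LA, LG] / wtr N (\<rho> N) [LG]) \<longlonglongrightarrow> R_transform FA (- \<eta>)"
    by (simp add: g_def[abs_def] h_def[abs_def])
  show "0 < R_transform FA (- \<eta>)" using sub k1 by linarith
qed

section \<open>The deterministic equivalent\<close>

text \<open>Words become countable, so one null set serves the relations of all words.\<close>

instance letter :: countable by countable_datatype

text \<open>Gauss-Jordan elimination, used in the theorem, and Cramer's rule, used for
  measurability, agree: with F for \<open>finv\<close> and X the computed inverse, F = F (M X) = (F
  M) X = X.\<close>

lemma matrix_inverse_finv: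
  assumes M: "M \<in> carrier_mat n n" and d: "det (mat n n (\<lambda>(i, j). M $$ (i, j))) \<noteq> 0"
  shows "matrix_inverse M \<in> carrier_mat n n"
    and "i < n \<Longrightarrow> j < n \<Longrightarrow> matrix_inverse M $$ (i, j) = finv n (\<lambda>i j. M $$ (i, j)) i j"
proof -
  have "mat n n (\<lambda>(i, j). M $$ (i, j)) = M" using M by (intro eq_matI) auto
  then have "det M \<noteq> 0" using d by simp
  then have "M \<in> Units (ring_mat TYPE(real) n ())" by (rule det_non_zero_imp_unit[OF M])
  then have "mat_inverse M \<noteq> None" using mat_inverse(1)[OF M, of "()"] by blast
  then obtain X where X: "mat_inverse M = Some X" by blast
  have MX: "M * X = 1\<^sub>m n" and Xc: "X \<in> carrier_mat n n" using mat_inverse(2)[OF M X] by auto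
  have e: "matrix_inverse M = X" by (simp add: matrix_inverse_def X)
  show "matrix_inverse M \<in> carrier_mat n n" using Xc e by simp
  assume ij: "i < n" "j < n"
  let ?F = "finv n (\<lambda>i j. M $$ (i, j))"
  have "?F i j = (\<Sum>l<n. ?F i l * (M * X) $$ (l, j))"
    unfolding MX using ij sum_fid_right[of j n "?F i"]
    by (intro trans[OF sum_fid_right[symmetric, of j n "?F i"]]) (auto simp: fid_def intro!: sum.cong)
  also have "\<dots> = (\<Sum>l<n. \<Sum>k<n. ?F i l * M $$ (l, k) * X $$ (k, j))"
    by (intro sum.cong refl) (simp add: mult_mat_entry[OF M Xc] ij sum_distrib_left mult.assoc del: index_mult_mat)
  also have "\<dots> = (\<Sum>k<n. \<Sum>l<n. ?F i l * M $$ (l, k) * X $$ (k, j))" by (rule sum.swap)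
  also have "\<dots> = (\<Sum>k<n. fid i k * X $$ (k, j))"
    unfolding sum_distrib_right[symmetric]
    by (intro sum.cong refl) (simp add: finv_inverse(1)[OF d] ij)
  finally show "matrix_inverse M $$ (i, j) = ?F i j" using ij e by simp
qed

lemma conjugate_entry:
  assumes "V \<in> carrier_mat n n" "A \<in> carrier_mat n n" "i < n" "j < n"
  shows "(transpose_mat V * A * V) $$ (i, j) = conj_mat n V (\<lambda>i j. A $$ (i, j)) i j"
proof -
  have Vt: "transpose_mat V \<in> carrier_mat n n" using assms by simp
  have "(transpose_mat V * A * V) $$ (i, j) = (\<Sum>l<n. (transpose_mat V * A) $$ (i, l) * V $$ (l, j))"
    by (rule mult_mat_entry[OF mult_carrier_mat[OF Vt assms(2)] assms(1,3,4)])
  also have "\<dots> = (\<Sum>l<n. \<Sum>k<n. V $$ (k, i) * A $$ (k, l) * V $$ (l, j))"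
  proof (rule sum.cong[OF refl])
    fix l assume "l \<in> {..<n}"
    then have "(transpose_mat V * A) $$ (i, l) = (\<Sum>k<n. transpose_mat V $$ (i, k) * A $$ (k, l))"
      by (intro mult_mat_entry[OF Vt assms(2,3)]) simp
    also have "\<dots> = (\<Sum>k<n. V $$ (k, i) * A $$ (k, l))"
      using assms by (intro sum.cong refl) auto
    finally show "(transpose_mat V * A) $$ (i, l) * V $$ (l, j) = (\<Sum>k<n. V $$ (k, i) * A $$ (k, l) * V $$ (l, j))"
      by (simp add: sum_distrib_right)
  qed
  also have "\<dots> = conj_mat n V (\<lambda>i j. A $$ (i, j)) i j" unfolding conj_mat_def by (rule sum.swap)
  finally show ?thesis .
qed

lemma trace_sum_rank_one:
  assumes "D \<in> carrier_mat n n"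
  shows "matrix_trace (sum_rank_one n m l u v * D)
     = (\<Sum>i = 1..m. l i * bform n (\<lambda>k. v i $ k) (\<lambda>r c. D $$ (r, c)) (\<lambda>k. u i $ k))"
proof -
  let ?K = "sum_rank_one n m l u v"
  have K: "?K \<in> carrier_mat n n" by (simp add: sum_rank_one_def)
  have "matrix_trace (?K * D) = (\<Sum>r<n. (?K * D) $$ (r, r))"
    using K by (simp add: matrix_trace_def)
  also have "\<dots> = (\<Sum>r<n. \<Sum>c<n. \<Sum>i = 1..m. l i * (v i $ c * D $$ (c, r) * u i $ r))"
  proof (rule sum.cong[OF refl])
    fix r assume r: "r \<in> {..<n}"
    then have "(?K * D) $$ (r, r) = (\<Sum>c<n. ?K $$ (r, c) * D $$ (c, r))"
      by (intro mult_mat_entry[OF K assms]) auto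
    also have "\<dots> = (\<Sum>c<n. \<Sum>i = 1..m. l i * (v i $ c * D $$ (c, r) * u i $ r))"
      using r by (intro sum.cong refl) (simp add: sum_rank_one_def sum_distrib_left sum_distrib_right mult_ac)
    finally show "(?K * D) $$ (r, r) = (\<Sum>c<n. \<Sum>i = 1..m. l i * (v i $ c * D $$ (c, r) * u i $ r))" .
  qed
  also have "\<dots> = (\<Sum>r<n. \<Sum>i = 1..m. \<Sum>c<n. l i * (v i $ c * D $$ (c, r) * u i $ r))"
    by (intro sum.cong refl sum.swap)
  also have "\<dots> = (\<Sum>i = 1..m. \<Sum>r<n. \<Sum>c<n. l i * (v i $ c * D $$ (c, r) * u i $ r))"
    by (rule sum.swap)
  also have "\<dots> = (\<Sum>i = 1..m. \<Sum>c<n. \<Sum>r<n. l i * (v i $ c * D $$ (c, r) * u i $ r))"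
    by (intro sum.cong refl sum.swap)
  finally show ?thesis by (simp add: bform_def sum_distrib_left)
qed

lemma bform_cong_right:
  "(\<And>i. i < n \<Longrightarrow> b i = b' i) \<Longrightarrow> bform n a M b = bform n a M b'"
  by (simp add: bform_def)

lemma bform_lincomb:
  "bform n a M (\<lambda>i. b i - c i + k * d i) = bform n a M b - bform n a M c + k * bform n a M d"
  by (simp add: bform_def sum_distrib_left sum.distrib[symmetric] sum_subtractf[symmetric] algebra_simps)

text \<open>From b = (B + \<omega>) x = (A' + B) x - A' x + \<omega> x follows v^T G b = v^T x - v^T
  G A' x + \<omega> v^T G x. The form for the word G is (v^T G x) tr (A' G) - (v^T G A' x) tr G with
  normalised traces, and eliminating v^T G A' x gives the formula.\<close>

lemma resolvent_difference:
  assumes inv: "is_sum_inverse n A B G" and V: "V \<in> orthogonal_matrices n"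
    and x: "\<And>i. i < n \<Longrightarrow> mvec n B x i + \<omega> * x i = b i"
  defines "\<rho> \<equiv> letter_mat n A B G V"
  assumes g: "wtr n \<rho> [LG] \<noteq> 0"
  shows "bform n v (G V) b - ip n v x = sd_form n \<rho> [LG] v x / wtr n \<rho> [LG]
     + (\<omega> - wtr n \<rho> [LA, LG] / wtr n \<rho> [LG]) * bform n v (G V) x"
proof -
  have H: "bform n v (G V) (mvec n (\<lambda>i j. conj_mat n V A i j + B i j) x) = ip n v x"
  proof -
    have "bform n v (G V) (mvec n (\<lambda>i j. conj_mat n V A i j + B i j) x)
       = bform n v (fmul n (G V) (\<lambda>i j. conj_mat n V A i j + B i j)) x"
      unfolding bform_fmul_mvec ..
    also have "\<dots> = bform n v fid x"
      by (rule bform_cong) (use inv V in \<open>auto simp: fmul_def is_sum_inverse_def\<close>)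
    finally show ?thesis unfolding bform_fid .
  qed
  have "bform n v (G V) b = bform n v (G V) (\<lambda>i. mvec n (\<lambda>i j. conj_mat n V A i j + B i j) x i
      - mvec n (conj_mat n V A) x i + \<omega> * x i)"
    by (rule bform_cong_right) (simp add: x[symmetric] mvec_def algebra_simps sum.distrib)
  also have "\<dots> = ip n v x - bform n v (G V) (mvec n (conj_mat n V A) x) + \<omega> * bform n v (G V) x"
    unfolding bform_lincomb H ..
  finally have 1: "bform n v (G V) b = ip n v x - bform n v (G V) (mvec n (conj_mat n V A) x) + \<omega> * bform n v (G V) x" .
  have 2: "wb n \<rho> [LG] v x = bform n v (G V) x" unfolding wb_single \<rho>_def by simp
  have 3: "wb n \<rho> [LG, LA] v x = bform n v (G V) (mvec n (conj_mat n V A) x)"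
    unfolding wb_Cons[where c=LG and W="[LA]"] wb_single bform_fmul_vmat[symmetric] bform_fmul_mvec \<rho>_def by simp
  have "sd_form n \<rho> [LG] v x = bform n v (G V) x * wtr n \<rho> [LA, LG]
      - bform n v (G V) (mvec n (conj_mat n V A) x) * wtr n \<rho> [LG]"
    unfolding sd_form_def dq.simps 2 3 by simp
  then show ?thesis unfolding 1 using g by (simp add: field_simps)
qed

section \<open>Random vectors, spectral bounds and entry functions\<close>

lemma space_borel_vec [simp]: "space (borel_vec n) = carrier_vec n"
  by (simp add: borel_vec_def)

lemma measurable_borel_vec_entry:
  assumes "i < n" shows "(\<lambda>x. x $ i) \<in> borel_measurable (borel_vec n)"
proof -
  have "(\<lambda>x. \<lambda>i \<in> {..<n}. x $ i) \<in> measurable (borel_vec n) (Pi\<^sub>M {..<n} (\<lambda>_. borel :: real measure))"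
    unfolding borel_vec_def
    by (rule measurable_vimage_algebra1) (auto simp: space_PiM)
  from measurable_compose[OF this measurable_component_singleton[of i]]
  show ?thesis using assms by simp
qed

lemma euclidean_norm_vnorm: "x \<in> carrier_vec n \<Longrightarrow> euclidean_norm x = vnorm n (\<lambda>i. x $ i)"
  by (simp add: euclidean_norm_def vnorm_def L2_set_def scalar_prod_def lessThan_atLeast0 power2_eq_square)

lemma real_distribution_empirical: "real_distribution (empirical_eigenvalue_distribution A)"
  unfolding empirical_eigenvalue_distribution_def
  by (rule prob_space.real_distribution_distr[OF prob_space_measure_pmf]) simp

lemma eventually_le_of_limsup:
  assumes "limsup (\<lambda>N. ereal (X N)) < \<infinity>"
  shows "\<exists>K. \<forall>\<^sub>F N in sequentially. X N \<le> K"
proof -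
  obtain K where "limsup (\<lambda>N. ereal (X N)) < ereal K" using assms ereal_dense2 by blast
  from Limsup_lessD[OF this] show ?thesis by (intro exI[of _ K]) (auto elim!: eventually_mono)
qed

lemma eventually_ge_of_liminf:
  assumes "liminf (\<lambda>N. ereal (X N)) > 0"
  shows "\<exists>k>0. \<forall>\<^sub>F N in sequentially. k \<le> X N"
proof -
  obtain k where k: "0 < ereal k" "ereal k < liminf (\<lambda>N. ereal (X N))" using assms ereal_dense2 by blast
  from less_LiminfD[OF k(2)] show ?thesis using k(1) by (intro exI[of _ k]) (auto elim!: eventually_mono)
qed

lemma finv_cong:
  assumes "\<And>i j. i < n \<Longrightarrow> j < n \<Longrightarrow> M i j = M' i j" shows "finv n M = finv n M'"
proof -
  have "mat n n (\<lambda>(i, j). M i j) = mat n n (\<lambda>(i, j). M' i j)" using assms by (intro eq_matI) auto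
  then show ?thesis by (intro ext) (simp add: finv_def)
qed

abbreviation ent :: "real mat \<Rightarrow> fmat" where "ent M \<equiv> \<lambda>i j. M $$ (i, j)"

abbreviation shifted_inverse :: "nat \<Rightarrow> real \<Rightarrow> fmat \<Rightarrow> fmat" where
  "shifted_inverse n \<omega> B \<equiv> finv n (\<lambda>i j. B i j + \<omega> * fid i j)"

lemma coercive_shift:
  assumes B: "coercive n \<kappa> B" and "0 < \<omega>" "0 < \<kappa>"
  shows "coercive n \<kappa> (\<lambda>i j. B i j + \<omega> * fid i j)"
  unfolding coercive_def
proof
  fix a
  have "bform n a (\<lambda>i j. B i j + \<omega> * fid i j) a = bform n a B a + \<omega> * bform n a fid a"
    by (simp add: bform_def algebra_simps sum.distrib sum_distrib_left)
  then have "bform n a B a \<le> bform n a (\<lambda>i j. B i j + \<omega> * fid i j) a"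
    using assms(2) ip_self_nonneg[of n a] by (simp add: bform_fid)
  then have "\<kappa> * bform n a B a \<le> \<kappa> * bform n a (\<lambda>i j. B i j + \<omega> * fid i j) a"
    using assms(3) by simp
  moreover have "ip n a a \<le> \<kappa> * bform n a B a" using B unfolding coercive_def by blast
  ultimately show "ip n a a \<le> \<kappa> * bform n a (\<lambda>i j. B i j + \<omega> * fid i j) a" by linarith
qed

text \<open>The factor \<open>\<kappa>\<^sup>2\<close> is one \<kappa> for the norm of G and one for
  that of x. The positive shift \<omega> preserves the coercivity constant of B, so x obeys the same
  bound.\<close>

lemma deterministic_equivalent_entry:
  assumes A: "conditioned n \<kappa> (ent A)" and B: "conditioned n \<kappa> (ent B)" and \<kappa>: "0 < \<kappa>"
    and V: "V \<in> orthogonal_matrices n" and Ac: "A \<in> carrier_mat n n" and Bc: "B \<in> carrier_mat n n"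
    and \<omega>: "0 < \<omega>" and g: "0 < wtr n (letters n (ent A) (ent B) V) [LG]"
    and v: "vnorm n v = 1" and u: "vnorm n u = 1"
  defines "\<rho> \<equiv> letters n (ent A) (ent B) V"
    and "x \<equiv> mvec n (shifted_inverse n \<omega> (ent B)) u"
    and "D \<equiv> matrix_inverse (transpose_mat V * A * V + B) - matrix_inverse (B - (- \<omega>) \<cdot>\<^sub>m 1\<^sub>m n)"
  shows "vnorm n x \<le> \<kappa>" and "D \<in> carrier_mat n n"
    and "\<bar>bform n v (ent D) u\<bar> \<le> \<bar>sd_value n [LG] (ent A) (ent B) V v x\<bar> / wtr n \<rho> [LG]
      + \<bar>\<omega> - wtr n \<rho> [LA, LG] / wtr n \<rho> [LG]\<bar> * \<kappa>\<^sup>2"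
proof -
  have Vc: "V \<in> carrier_mat n n" using V by (simp add: orthogonal_matrices_def)
  note good = conditioned_letters[OF A B \<kappa>]
  have coS: "coercive n \<kappa> (\<lambda>i j. ent B i j + \<omega> * fid i j)"
    using coercive_shift[OF _ \<omega> \<kappa>] B by (simp add: conditioned_def)
  have coH: "coercive n \<kappa> (\<lambda>i j. conj_mat n V (ent A) i j + ent B i j)"
    by (rule coercive_add[OF conditioned_conj_mat[OF V A] B \<kappa>])
  have oS: "opbound n \<kappa> (shifted_inverse n \<omega> (ent B))" by (rule opbound_finv[OF coS]) (use \<kappa> in simp)
  show x: "vnorm n x \<le> \<kappa>" using vnorm_mvec[OF oS, of u] \<kappa> u by (simp add: x_def)
  define H where "H = transpose_mat V * A * V + B"
  define S where "S = B - (- \<omega>) \<cdot>\<^sub>m 1\<^sub>m n"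
  have Hc: "H \<in> carrier_mat n n" and Sc: "S \<in> carrier_mat n n" using Vc Ac Bc by (auto simp: H_def S_def)
  have He: "ent H i j = conj_mat n V (ent A) i j + ent B i j" if "i < n" "j < n" for i j
  proof -
    have "ent H i j = (transpose_mat V * A * V) $$ (i, j) + B $$ (i, j)"
      unfolding H_def by (rule index_add_mat(1)) (use that Bc in auto)
    then show ?thesis unfolding conjugate_entry[OF Vc Ac that] .
  qed
  have Se: "ent S i j = ent B i j + \<omega> * fid i j" if "i < n" "j < n" for i j
    using that Bc by (simp add: S_def fid_def)
  have detH: "det (mat n n (\<lambda>(i, j). ent H i j)) \<noteq> 0"
  proof -
    have "mat n n (\<lambda>(i, j). ent H i j) = mat n n (\<lambda>(i, j). conj_mat n V (ent A) i j + ent B i j)"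
      by (intro eq_matI) (auto simp: He)
    then show ?thesis using coercive_det[OF coH] by simp
  qed
  have detS: "det (mat n n (\<lambda>(i, j). ent S i j)) \<noteq> 0"
  proof -
    have "mat n n (\<lambda>(i, j). ent S i j) = mat n n (\<lambda>(i, j). ent B i j + \<omega> * fid i j)"
      by (intro eq_matI) (auto simp: Se)
    then show ?thesis using coercive_det[OF coS] by simp
  qed
  have iH: "matrix_inverse H \<in> carrier_mat n n"
    "\<And>i j. i < n \<Longrightarrow> j < n \<Longrightarrow> matrix_inverse H $$ (i, j) = sum_inv n (ent A) (ent B) V i j"
    using matrix_inverse_finv[OF Hc detH] finv_cong[of n "ent H" "\<lambda>i j. conj_mat n V (ent A) i j + ent B i j"] He
    by (simp_all add: sum_inv_def)
  have iS: "matrix_inverse S \<in> carrier_mat n n"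
    "\<And>i j. i < n \<Longrightarrow> j < n \<Longrightarrow> matrix_inverse S $$ (i, j) = shifted_inverse n \<omega> (ent B) i j"
    using matrix_inverse_finv[OF Sc detS] finv_cong[of n "ent S" "\<lambda>i j. ent B i j + \<omega> * fid i j"] Se
    by simp_all
  have DHS: "D = matrix_inverse H - matrix_inverse S" by (simp add: D_def H_def S_def)
  show "D \<in> carrier_mat n n" unfolding DHS by (rule minus_carrier_mat[OF iS(1)])
  have "bform n v (ent D) u = (\<Sum>i<n. \<Sum>j<n. v i * (sum_inv n (ent A) (ent B) V i j - shifted_inverse n \<omega> (ent B) i j) * u j)"
    unfolding bform_def
  proof (intro sum.cong refl)
    fix i j assume "i \<in> {..<n}" "j \<in> {..<n}"
    then have ij: "i < n" "j < n" by auto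
    have "ent D i j = matrix_inverse H $$ (i, j) - matrix_inverse S $$ (i, j)"
      unfolding DHS by (rule index_minus_mat(1)) (use ij iS(1) in auto)
    then show "v i * ent D i j * u j = v i * (sum_inv n (ent A) (ent B) V i j - shifted_inverse n \<omega> (ent B) i j) * u j"
      unfolding iH(2)[OF ij] iS(2)[OF ij] by simp
  qed
  also have "\<dots> = bform n v (sum_inv n (ent A) (ent B) V) u - ip n v x"
    unfolding x_def bform_eq_ip_mvec[symmetric] bform_def
    by (simp add: sum_subtractf[symmetric] algebra_simps)
  also have "\<dots> = sd_form n \<rho> [LG] v x / wtr n \<rho> [LG]
     + (\<omega> - wtr n \<rho> [LA, LG] / wtr n \<rho> [LG]) * bform n v (sum_inv n (ent A) (ent B) V) x"
    unfolding \<rho>_def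
  proof (rule resolvent_difference[OF good(2) V])
    fix i assume i: "i < n"
    have "mvec n (\<lambda>i j. ent B i j + \<omega> * fid i j) x i = u i" unfolding x_def by (rule mvec_finv[OF coercive_det[OF coS] i])
    moreover have "mvec n (\<lambda>i j. ent B i j + \<omega> * fid i j) x i = mvec n (ent B) x i + \<omega> * (\<Sum>j<n. fid i j * x j)"
      by (simp add: mvec_def algebra_simps sum.distrib sum_distrib_left del: sum_fid_left)
    ultimately show "mvec n (ent B) x i + \<omega> * x i = u i" using i by simp
  qed (use g in simp)
  finally have eq: "bform n v (ent D) u = sd_form n \<rho> [LG] v x / wtr n \<rho> [LG]
     + (\<omega> - wtr n \<rho> [LA, LG] / wtr n \<rho> [LG]) * bform n v (sum_inv n (ent A) (ent B) V) x" .
  have "\<bar>bform n v (sum_inv n (ent A) (ent B) V) x\<bar> \<le> \<kappa> * vnorm n v * vnorm n x"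
    using opboundD[OF good(1)[OF V, of LG]] by simp
  also have "\<dots> \<le> \<kappa>\<^sup>2" using mult_left_mono[OF x, of \<kappa>] \<kappa> v by (simp add: power2_eq_square)
  finally have b: "\<bar>bform n v (sum_inv n (ent A) (ent B) V) x\<bar> \<le> \<kappa>\<^sup>2" .
  have "\<bar>bform n v (ent D) u\<bar> \<le> \<bar>sd_form n \<rho> [LG] v x / wtr n \<rho> [LG]\<bar>
     + \<bar>(\<omega> - wtr n \<rho> [LA, LG] / wtr n \<rho> [LG]) * bform n v (sum_inv n (ent A) (ent B) V) x\<bar>"
    unfolding eq by (rule abs_triangle_ineq)
  moreover have "\<bar>sd_form n \<rho> [LG] v x / wtr n \<rho> [LG]\<bar> = \<bar>sd_value n [LG] (ent A) (ent B) V v x\<bar> / wtr n \<rho> [LG]"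
    using g by (simp add: sd_value_def \<rho>_def)
  moreover have "\<bar>(\<omega> - wtr n \<rho> [LA, LG] / wtr n \<rho> [LG]) * bform n v (sum_inv n (ent A) (ent B) V) x\<bar>
     \<le> \<bar>\<omega> - wtr n \<rho> [LA, LG] / wtr n \<rho> [LG]\<bar> * \<kappa>\<^sup>2"
    unfolding abs_mult by (intro mult_left_mono b) simp
  ultimately show "\<bar>bform n v (ent D) u\<bar> \<le> \<bar>sd_value n [LG] (ent A) (ent B) V v x\<bar> / wtr n \<rho> [LG]
      + \<bar>\<omega> - wtr n \<rho> [LA, LG] / wtr n \<rho> [LG]\<bar> * \<kappa>\<^sup>2" by linarith
qed

text \<open>The trace is a sum of at most N^q terms with bounded coefficients, so a bound on v_i^T D
  u_i that is uniform in i suffices.\<close>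

theorem pathwise_deterministic_equivalent:
  fixes A B U :: "nat \<Rightarrow> real mat" and u v :: "nat \<Rightarrow> nat \<Rightarrow> real Matrix.vec" and lam :: "nat \<Rightarrow> nat \<Rightarrow> real"
  assumes A_spd: "\<And>N. N \<ge> 1 \<Longrightarrow> symmetric_positive_definite N (A N)"
    and B_spd: "\<And>N. N \<ge> 1 \<Longrightarrow> symmetric_positive_definite N (B N)"
    and U: "\<And>N. N \<ge> 1 \<Longrightarrow> U N \<in> orthogonal_matrices N"
    and FA: "real_distribution FA" and FB: "real_distribution FB"
    and A_esd: "weak_conv_m (\<lambda>N. empirical_eigenvalue_distribution (A N)) FA"
    and B_esd: "weak_conv_m (\<lambda>N. empirical_eigenvalue_distribution (B N)) FB"
    and A_min: "liminf (\<lambda>N. ereal (sigma_min (A N))) > 0" and A_max: "limsup (\<lambda>N. ereal (sigma_max (A N))) < \<infinity>"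
    and B_min: "liminf (\<lambda>N. ereal (sigma_min (B N))) > 0" and B_max: "limsup (\<lambda>N. ereal (sigma_max (B N))) < \<infinity>"
    and F: "is_free_additive_convolution FA FB F"
    and zstar: "zstar = - R_transform FA (- (LINT x|F. 1 / x))"
    and r: "\<And>N. r N = nat \<lfloor>real N powr q N\<rfloor>"
    and lam: "limsup (\<lambda>N. ereal (MAX i\<in>{1..r N}. \<bar>lam N i\<bar>)) < \<infinity>"
    and uv: "\<And>N i. N \<ge> 1 \<Longrightarrow> i \<in> {1..r N} \<Longrightarrow> vnorm N (\<lambda>k. u N i $ k) = 1 \<and> vnorm N (\<lambda>k. v N i $ k) = 1"
    and sd_tr: "\<And>W (\<kappa>::nat) e::nat. (2::nat) \<le> \<kappa> \<Longrightarrow> \<forall>\<^sub>F N in sequentially. \<forall>l<N.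
       conditioned N \<kappa> (ent (A N)) \<longrightarrow> conditioned N \<kappa> (ent (B N)) \<longrightarrow>
       \<bar>sd_value N W (ent (A N)) (ent (B N)) (U N) (fid l) (fid l)\<bar> \<le> 1 / real (Suc e)"
    and sd_uv: "\<And>(\<kappa>::nat) e::nat. (2::nat) \<le> \<kappa> \<Longrightarrow> \<forall>\<^sub>F N in sequentially. \<forall>l<r N.
       conditioned N \<kappa> (ent (A N)) \<longrightarrow> conditioned N \<kappa> (ent (B N)) \<longrightarrow>
       vnorm N (\<lambda>k. v N (Suc l) $ k) \<le> \<kappa> \<longrightarrow>
       vnorm N (mvec N (shifted_inverse N (- zstar) (ent (B N))) (\<lambda>k. u N (Suc l) $ k)) \<le> \<kappa> \<longrightarrow>
       \<bar>sd_value N [LG] (ent (A N)) (ent (B N)) (U N) (\<lambda>k. v N (Suc l) $ k)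
          (mvec N (shifted_inverse N (- zstar) (ent (B N))) (\<lambda>k. u N (Suc l) $ k))\<bar> \<le> 1 / real (Suc e)"
  shows "(\<lambda>N. 1 / real N powr q N * matrix_trace (sum_rank_one N (r N) (lam N) (u N) (v N) *
      (matrix_inverse (transpose_mat (U N) * A N * U N + B N) - matrix_inverse (B N - zstar \<cdot>\<^sub>m 1\<^sub>m N))))
    \<longlonglongrightarrow> 0"
proof -
  obtain K1 K2 \<Lambda> where K1: "\<forall>\<^sub>F N in sequentially. sigma_max (A N) \<le> K1"
    and K2: "\<forall>\<^sub>F N in sequentially. sigma_max (B N) \<le> K2"
    and \<Lambda>: "\<forall>\<^sub>F N in sequentially. (MAX i\<in>{1..r N}. \<bar>lam N i\<bar>) \<le> \<Lambda>"
    using eventually_le_of_limsup[OF A_max] eventually_le_of_limsup[OF B_max] eventually_le_of_limsup[OF lam] by blast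
  obtain k1 k2 where k1: "0 < k1" "\<forall>\<^sub>F N in sequentially. k1 \<le> sigma_min (A N)"
    and k2: "0 < k2" "\<forall>\<^sub>F N in sequentially. k2 \<le> sigma_min (B N)"
    using eventually_ge_of_liminf[OF A_min] eventually_ge_of_liminf[OF B_min] by blast
  \<comment> \<open>One natural number dominates both norms and both inverses; \<open>sd_tr\<close>
    and \<open>sd_uv\<close> are stated for natural \<kappa>.\<close>
  obtain \<kappa> :: nat where kb: "max 2 (max (max K1 K2) (max (1 / k1) (1 / k2))) \<le> real \<kappa>"
    using real_arch_simple by blast
  have \<kappa>: "2 \<le> \<kappa>" "2 \<le> real \<kappa>" "0 < real \<kappa>" "K1 \<le> \<kappa>" "K2 \<le> \<kappa>" using kb by auto
  have "1 / k1 \<le> \<kappa>" "1 / k2 \<le> \<kappa>" using kb by auto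
  then have \<kappa>k: "1 / \<kappa> \<le> k1" "1 / \<kappa> \<le> k2" using k1(1) k2(1) \<kappa>(3) by (simp_all add: field_simps)
  define PA where "PA N d w \<longleftrightarrow> spectral_decomp N (ent (A N)) d w
      \<and> (\<forall>f\<in>borel_measurable borel. (LINT x|empirical_eigenvalue_distribution (A N). f x) = (\<Sum>k<N. f (d k)) / real N)"
    for N d w
  define PB where "PB N d w \<longleftrightarrow> spectral_decomp N (ent (B N)) d w
      \<and> (\<forall>f\<in>borel_measurable borel. (LINT x|empirical_eigenvalue_distribution (B N). f x) = (\<Sum>k<N. f (d k)) / real N)"
    for N d w
  have evA: "\<forall>\<^sub>F N in sequentially. conditioned N \<kappa> (ent (A N)) \<and> (\<exists>d w. PA N d w)"
    using K1 k1(2) eventually_ge_at_top[of "1::nat"]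
  proof (eventually_elim)
    case (elim N)
    have "conditioned N \<kappa> (ent (A N)) \<and> (\<exists>d w. spectral_decomp N (ent (A N)) (d :: fvec) w
        \<and> (\<forall>k<N. 1 / real \<kappa> \<le> d k \<and> d k \<le> real \<kappa>)
        \<and> (\<forall>f\<in>borel_measurable borel. (LINT x|empirical_eigenvalue_distribution (A N). f x) = (\<Sum>k<N. f (d k)) / real N))"
      by (rule spd_conditioned_spectral[OF A_spd]) (use elim \<kappa> \<kappa>k in auto)
    then show ?case unfolding PA_def by blast
  qed
  have evB: "\<forall>\<^sub>F N in sequentially. conditioned N \<kappa> (ent (B N)) \<and> (\<exists>d w. PB N d w)"
    using K2 k2(2) eventually_ge_at_top[of "1::nat"]
  proof (eventually_elim)
    case (elim N)
    have "conditioned N \<kappa> (ent (B N)) \<and> (\<exists>d w. spectral_decomp N (ent (B N)) (d :: fvec) w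
        \<and> (\<forall>k<N. 1 / real \<kappa> \<le> d k \<and> d k \<le> real \<kappa>)
        \<and> (\<forall>f\<in>borel_measurable borel. (LINT x|empirical_eigenvalue_distribution (B N). f x) = (\<Sum>k<N. f (d k)) / real N))"
      by (rule spd_conditioned_spectral[OF B_spd]) (use elim \<kappa> \<kappa>k in auto)
    then show ?case unfolding PB_def by blast
  qed
  \<comment> \<open>Decompositions with the required properties are known only for large N;
    \<open>SOME\<close> makes the choice total, and only the tail matters for limits.\<close>
  define dA where "dA N = fst (SOME p. PA N (fst p) (snd p))" for N
  define wA where "wA N = snd (SOME p. PA N (fst p) (snd p))" for N
  define dB where "dB N = fst (SOME p. PB N (fst p) (snd p))" for N
  define wB where "wB N = snd (SOME p. PB N (fst p) (snd p))" for N
  have dA: "PA N (dA N) (wA N)" if "\<exists>d w. PA N d w" for N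
    unfolding dA_def wA_def by (rule someI_ex) (use that in auto)
  have dB: "PB N (dB N) (wB N)" if "\<exists>d w. PB N d w" for N
    unfolding dB_def wB_def by (rule someI_ex) (use that in auto)
  have spd_sym: "M $$ (i, j) = M $$ (j, i)" if "symmetric_positive_definite N M" "i < N" "j < N" for M :: "real mat" and N i j
  proof -
    have c: "M \<in> carrier_mat N N" and t: "transpose_mat M = M"
      using that(1) by (auto simp: symmetric_positive_definite_def)
    have "transpose_mat M $$ (j, i) = M $$ (i, j)"
      by (rule index_transpose_mat(1)) (use c that in auto)
    then show ?thesis unfolding t by (rule sym)
  qed
  have good: "\<forall>\<^sub>F N in sequentially. U N \<in> orthogonal_matrices N
      \<and> conditioned N \<kappa> (ent (A N)) \<and> conditioned N \<kappa> (ent (B N))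
      \<and> (\<forall>i<N. \<forall>j<N. ent (A N) i j = ent (A N) j i) \<and> (\<forall>i<N. \<forall>j<N. ent (B N) i j = ent (B N) j i)
      \<and> spectral_decomp N (ent (A N)) (dA N) (wA N) \<and> spectral_decomp N (ent (B N)) (dB N) (wB N)"
    using evA evB eventually_ge_at_top[of "1::nat"]
  proof (eventually_elim)
    case (elim N)
    then show ?case using U[of N] dA[of N] dB[of N] spd_sym[OF A_spd[of N]] spd_sym[OF B_spd[of N]]
      unfolding PA_def PB_def by blast
  qed
  have weakA: "(\<lambda>N. average N (\<lambda>j. f (dA N j))) \<longlonglongrightarrow> (LINT x|FA. f x)"
    if f: "continuous_on UNIV f" "\<And>x. \<bar>f x\<bar> \<le> c" for f c
  proof -
    have "(\<lambda>N. LINT x|empirical_eigenvalue_distribution (A N). f x) \<longlonglongrightarrow> (LINT x|FA. f x)"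
      by (rule weak_conv_imp_integral_bdd_continuous_conv[OF real_distribution_empirical FA A_esd, of f c])
         (use f in \<open>auto simp: continuous_on_eq_continuous_within\<close>)
    moreover have "\<forall>\<^sub>F N in sequentially. (LINT x|empirical_eigenvalue_distribution (A N). f x) = average N (\<lambda>j. f (dA N j))"
      using evA by eventually_elim
        (use dA borel_measurable_continuous_onI[OF f(1)] in \<open>auto simp: PA_def average_def\<close>)
    ultimately show ?thesis by (rule Lim_transform_eventually)
  qed
  have weakB: "(\<lambda>N. average N (\<lambda>j. f (dB N j))) \<longlonglongrightarrow> (LINT x|FB. f x)"
    if f: "continuous_on UNIV f" "\<And>x. \<bar>f x\<bar> \<le> c" for f c
  proof -
    have "(\<lambda>N. LINT x|empirical_eigenvalue_distribution (B N). f x) \<longlonglongrightarrow> (LINT x|FB. f x)"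
      by (rule weak_conv_imp_integral_bdd_continuous_conv[OF real_distribution_empirical FB B_esd, of f c])
         (use f in \<open>auto simp: continuous_on_eq_continuous_within\<close>)
    moreover have "\<forall>\<^sub>F N in sequentially. (LINT x|empirical_eigenvalue_distribution (B N). f x) = average N (\<lambda>j. f (dB N j))"
      using evB by eventually_elim
        (use dB borel_measurable_continuous_onI[OF f(1)] in \<open>auto simp: PB_def average_def\<close>)
    ultimately show ?thesis by (rule Lim_transform_eventually)
  qed
  have sd0: "(\<lambda>N. average N (\<lambda>i. sd_value N W (ent (A N)) (ent (B N)) (U N) (fid i) (fid i))) \<longlonglongrightarrow> 0" for W
  proof (rule LIMSEQ_I)
    fix \<epsilon> :: real assume "0 < \<epsilon>"
    then obtain e where e: "1 / real (Suc e) < \<epsilon>" using nat_approx_posE by blast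
    have "\<forall>\<^sub>F N in sequentially. \<bar>average N (\<lambda>i. sd_value N W (ent (A N)) (ent (B N)) (U N) (fid i) (fid i))\<bar> \<le> 1 / real (Suc e)"
      using good sd_tr[OF \<kappa>(1), of W e] by eventually_elim (rule average_abs_le, auto)
    then show "\<exists>no. \<forall>N\<ge>no. norm (average N (\<lambda>i. sd_value N W (ent (A N)) (ent (B N)) (U N) (fid i) (fid i)) - 0) < \<epsilon>"
      unfolding eventually_sequentially using e by (auto intro: le_less_trans)
  qed
  define \<rho> where "\<rho> N = letters N (ent (A N)) (ent (B N)) (U N)" for N
  define \<eta> where "\<eta> = (LINT x|F. 1 / x)"
  have lims: "(\<lambda>N. wtr N (\<rho> N) [LG]) \<longlonglongrightarrow> \<eta>"
    "(\<lambda>N. wtr N (\<rho> N) [LA, LG] / wtr N (\<rho> N) [LG]) \<longlonglongrightarrow> R_transform FA (- \<eta>)"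
    "0 < \<eta>" "0 < R_transform FA (- \<eta>)"
    unfolding \<rho>_def \<eta>_def
    by (rule pathwise_limits[OF F \<kappa>(2) good]; (rule weakA | rule weakB | rule sd0); assumption)+
  define \<omega> where "\<omega> = - zstar"
  have \<omega>: "\<omega> = R_transform FA (- \<eta>)" by (simp add: \<omega>_def zstar \<eta>_def)
  have \<omega>0: "0 < \<omega>" using lims(4) \<omega> by simp
  define D where "D N = matrix_inverse (transpose_mat (U N) * A N * U N + B N) - matrix_inverse (B N - zstar \<cdot>\<^sub>m 1\<^sub>m N)" for N
  have entries: "\<forall>\<^sub>F N in sequentially. D N \<in> carrier_mat N N \<and>
      (\<forall>l<r N. \<bar>bform N (\<lambda>k. v N (Suc l) $ k) (ent (D N)) (\<lambda>k. u N (Suc l) $ k)\<bar> \<le> \<delta>)" if \<delta>: "0 < \<delta>" for \<delta>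
  proof -
    \<comment> \<open>The normalised trace of G eventually exceeds \<eta>/2, so a form of size at
      most \<delta> \<eta> / 4, divided by it, is at most \<delta>/2.\<close>
    obtain e where e: "1 / real (Suc e) < \<delta> * \<eta> / 4" using nat_approx_posE[of "\<delta> * \<eta> / 4"] \<delta> lims(3) by auto
    have 1: "\<forall>\<^sub>F N in sequentially. \<eta> / 2 < wtr N (\<rho> N) [LG]"
      by (rule order_tendstoD(1)[OF lims(1)]) (use lims(3) in simp)
    have "(\<lambda>N. \<bar>\<omega> - wtr N (\<rho> N) [LA, LG] / wtr N (\<rho> N) [LG]\<bar> * (real \<kappa>)\<^sup>2) \<longlonglongrightarrow> \<bar>\<omega> - \<omega>\<bar> * (real \<kappa>)\<^sup>2"
      using lims(2) unfolding \<omega>[symmetric] by (intro tendsto_intros)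
    then have 2: "\<forall>\<^sub>F N in sequentially. \<bar>\<omega> - wtr N (\<rho> N) [LA, LG] / wtr N (\<rho> N) [LG]\<bar> * (real \<kappa>)\<^sup>2 < \<delta> / 2"
      by (rule order_tendstoD(2)) (use \<delta> in simp)
    show ?thesis
      using good 1 2 sd_uv[OF \<kappa>(1), of e] eventually_ge_at_top[of "1::nat"]
    proof (eventually_elim)
      case (elim N)
      have N: "N \<ge> 1" by (rule elim(5))
      have g: "0 < wtr N (\<rho> N) [LG]" using elim(2) lims(3) by linarith
      have Ac: "A N \<in> carrier_mat N N" and Bc: "B N \<in> carrier_mat N N"
        using A_spd[OF N] B_spd[OF N] by (auto simp: symmetric_positive_definite_def)
      have cA: "conditioned N \<kappa> (ent (A N))" and cB: "conditioned N \<kappa> (ent (B N))"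
        and V: "U N \<in> orthogonal_matrices N" using elim(1) by blast+
      have Deq: "D N = matrix_inverse (transpose_mat (U N) * A N * U N + B N) - matrix_inverse (B N - (- \<omega>) \<cdot>\<^sub>m 1\<^sub>m N)"
        by (simp add: D_def \<omega>_def)
      \<comment> \<open>A sample unit vector, with which the carrier claim of the entry lemma is
        instantiated.\<close>
      have e1: "vnorm N (fid 0) = 1" using N by simp
      note det = deterministic_equivalent_entry[OF cA cB \<kappa>(3) V Ac Bc \<omega>0 g[unfolded \<rho>_def], folded \<rho>_def, folded Deq]
      show ?case
      proof (intro conjI allI impI)
        show "D N \<in> carrier_mat N N" by (rule det(2)[OF e1 e1])
        fix l assume l: "l < r N"
        let ?v = "\<lambda>k. v N (Suc l) $ k" and ?u = "\<lambda>k. u N (Suc l) $ k"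
        let ?x = "mvec N (shifted_inverse N \<omega> (ent (B N))) ?u"
        have v1: "vnorm N ?v = 1" and u1: "vnorm N ?u = 1" using uv[OF N, of "Suc l"] l by auto
        have "\<bar>sd_value N [LG] (ent (A N)) (ent (B N)) (U N) ?v ?x\<bar> \<le> 1 / real (Suc e)"
          using elim(4) l cA cB v1 det(1)[OF v1 u1] \<kappa>(2) unfolding \<omega>_def by auto
        also have "\<dots> \<le> \<delta> * \<eta> / 4" using e by simp
        also have "\<dots> \<le> \<delta> / 2 * wtr N (\<rho> N) [LG]" using elim(2) \<delta> by (simp add: field_simps)
        finally have "\<bar>sd_value N [LG] (ent (A N)) (ent (B N)) (U N) ?v ?x\<bar> / wtr N (\<rho> N) [LG] \<le> \<delta> / 2"
          using g by (simp add: pos_divide_le_eq)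
        then show "\<bar>bform N ?v (ent (D N)) ?u\<bar> \<le> \<delta>"
          using det(3)[OF v1 u1] elim(3) by linarith
      qed
    qed
  qed
  show ?thesis
    unfolding D_def[symmetric]
  proof (rule LIMSEQ_I)
    fix \<epsilon> :: real assume \<epsilon>: "0 < \<epsilon>"
    \<comment> \<open>The added 1 keeps the denominator positive if \<Lambda> is 0, and the 2 leaves
      room for a strict inequality.\<close>
    define \<delta> where "\<delta> = \<epsilon> / (2 * (\<bar>\<Lambda>\<bar> + 1))"
    have \<delta>: "0 < \<delta>" using \<epsilon> by (simp add: \<delta>_def)
    have "\<bar>\<Lambda>\<bar> * \<delta> \<le> (\<bar>\<Lambda>\<bar> + 1) * \<delta>" using \<delta> by (intro mult_right_mono) auto
    also have "\<dots> = \<epsilon> / 2" by (simp add: \<delta>_def field_simps)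
    finally have \<Lambda>\<delta>: "\<bar>\<Lambda>\<bar> * \<delta> < \<epsilon>" using \<epsilon> by simp
    have "\<forall>\<^sub>F N in sequentially. \<bar>1 / real N powr q N * matrix_trace (sum_rank_one N (r N) (lam N) (u N) (v N) * D N)\<bar> \<le> \<bar>\<Lambda>\<bar> * \<delta>"
      using entries[OF \<delta>] \<Lambda> eventually_ge_at_top[of "1::nat"]
    proof (eventually_elim)
      case (elim N)
      let ?p = "real N powr q N"
      have p: "0 < ?p" using elim(3) by simp
      have rp: "real (r N) \<le> ?p" unfolding r using p by simp
      have "\<bar>matrix_trace (sum_rank_one N (r N) (lam N) (u N) (v N) * D N)\<bar>
          \<le> (\<Sum>i = 1..r N. \<bar>lam N i * bform N (\<lambda>k. v N i $ k) (ent (D N)) (\<lambda>k. u N i $ k)\<bar>)"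
        unfolding trace_sum_rank_one[OF conjunct1[OF elim(1)]] by (rule sum_abs)
      also have "\<dots> \<le> (\<Sum>i = 1..r N. \<bar>\<Lambda>\<bar> * \<delta>)"
      proof (rule sum_mono)
        fix i assume i: "i \<in> {1..r N}"
        \<comment> \<open>The uniform bound is indexed from 0, the rank one terms from 1.\<close>
        then have s: "i = Suc (i - 1)" "i - 1 < r N" by auto
        have "\<bar>lam N i\<bar> \<le> (MAX i\<in>{1..r N}. \<bar>lam N i\<bar>)" by (rule Max_ge) (use i in auto)
        then have "\<bar>lam N i\<bar> \<le> \<bar>\<Lambda>\<bar>" using elim(2) by linarith
        moreover have "\<bar>bform N (\<lambda>k. v N i $ k) (ent (D N)) (\<lambda>k. u N i $ k)\<bar> \<le> \<delta>"
          using elim(1) s by metis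
        ultimately show "\<bar>lam N i * bform N (\<lambda>k. v N i $ k) (ent (D N)) (\<lambda>k. u N i $ k)\<bar> \<le> \<bar>\<Lambda>\<bar> * \<delta>"
          unfolding abs_mult by (intro mult_mono) auto
      qed
      also have "\<dots> = real (r N) * (\<bar>\<Lambda>\<bar> * \<delta>)" by simp
      also have "\<dots> \<le> ?p * (\<bar>\<Lambda>\<bar> * \<delta>)" using rp \<delta> by (intro mult_right_mono) auto
      finally have "\<bar>matrix_trace (sum_rank_one N (r N) (lam N) (u N) (v N) * D N)\<bar> / ?p \<le> \<bar>\<Lambda>\<bar> * \<delta>"
        using p by (simp add: pos_divide_le_eq mult.commute)
      then show ?case using p by (simp add: abs_mult)
    qed
    then show "\<exists>no. \<forall>N\<ge>no. norm (1 / real N powr q N * matrix_trace (sum_rank_one N (r N) (lam N) (u N) (v N) * D N) - 0) < \<epsilon>"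
      unfolding eventually_sequentially using \<Lambda>\<delta> by (auto intro: le_less_trans)
  qed
qed

theorem theorem1:
  fixes P :: "'w measure"
    and A B U :: "nat \<Rightarrow> 'w \<Rightarrow> real mat"
    and FA FB F :: "real measure"
    and C chi zstar :: real
    and q :: "nat \<Rightarrow> real"
    and r :: "nat \<Rightarrow> nat"
    and lam :: "nat \<Rightarrow> nat \<Rightarrow> 'w \<Rightarrow> real"
    and u v :: "nat \<Rightarrow> nat \<Rightarrow> 'w \<Rightarrow> real Matrix.vec"
    and K :: "nat \<Rightarrow> 'w \<Rightarrow> real mat"
  assumes "prob_space P"
    and A_measurable: "\<And>N. N \<ge> 1 \<Longrightarrow> A N \<in> measurable P (borel_mat N)"
    and B_measurable: "\<And>N. N \<ge> 1 \<Longrightarrow> B N \<in> measurable P (borel_mat N)"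
    and A_spd: "\<And>N w. N \<ge> 1 \<Longrightarrow> w \<in> space P \<Longrightarrow> symmetric_positive_definite N (A N w)"
    and B_spd: "\<And>N w. N \<ge> 1 \<Longrightarrow> w \<in> space P \<Longrightarrow> symmetric_positive_definite N (B N w)"
    and FA: "real_distribution FA"
    and FB: "real_distribution FB"
    and A_esd: "AE w in P. weak_conv_m (\<lambda>N. empirical_eigenvalue_distribution (A N w)) FA"
    and B_esd: "AE w in P. weak_conv_m (\<lambda>N. empirical_eigenvalue_distribution (B N w)) FB"
    and A_sigma_min: "AE w in P. liminf (\<lambda>N. ereal (sigma_min (A N w))) > 0"
    and A_sigma_max: "AE w in P. limsup (\<lambda>N. ereal (sigma_max (A N w))) < \<infinity>"
    and B_sigma_min: "AE w in P. liminf (\<lambda>N. ereal (sigma_min (B N w))) > 0"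
    and B_sigma_max: "AE w in P. limsup (\<lambda>N. ereal (sigma_max (B N w))) < \<infinity>"
    and F: "is_free_additive_convolution FA FB F"
    and chi_def: "chi = (LINT x|F. 1 / x)"
    and zstar_def: "zstar = - R_transform FA (- chi)"
    and C: "C \<ge> 0"
    and q: "\<And>N. N \<ge> 1 \<Longrightarrow> q N \<in> {0..C}"
    and r: "\<And>N. r N = nat \<lfloor>real N powr q N\<rfloor>"
    and lam_measurable: "\<And>N i. N \<ge> 1 \<Longrightarrow> i \<in> {1..r N} \<Longrightarrow> lam N i \<in> borel_measurable P"
    and lam_bounded: "AE w in P. limsup (\<lambda>N. ereal (MAX i\<in>{1..r N}. \<bar>lam N i w\<bar>)) < \<infinity>"
    and u_measurable: "\<And>N i. N \<ge> 1 \<Longrightarrow> i \<in> {1..r N} \<Longrightarrow> u N i \<in> measurable P (borel_vec N)"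
    and v_measurable: "\<And>N i. N \<ge> 1 \<Longrightarrow> i \<in> {1..r N} \<Longrightarrow> v N i \<in> measurable P (borel_vec N)"
    and u_unit: "\<And>N i w. N \<ge> 1 \<Longrightarrow> i \<in> {1..r N} \<Longrightarrow> w \<in> space P \<Longrightarrow> euclidean_norm (u N i w) = 1"
    and v_unit: "\<And>N i w. N \<ge> 1 \<Longrightarrow> i \<in> {1..r N} \<Longrightarrow> w \<in> space P \<Longrightarrow> euclidean_norm (v N i w) = 1"
    and K: "\<And>N w. K N w = sum_rank_one N (r N) (\<lambda>i. lam N i w) (\<lambda>i. u N i w) (\<lambda>i. v N i w)"
    and U_haar: "\<And>N. N \<ge> 1 \<Longrightarrow> haar_orthogonal P N (U N)"
    and U_indep: "\<And>N. N \<ge> 1 \<Longrightarrow> prob_space.indep_set P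
          (sets (vimage_algebra (space P) (U N) (borel_mat N)))
          (sets (vimage_algebra (space P)
             (\<lambda>w. (A N w, B N w, \<lambda>i\<in>{1..r N}. (u N i w, v N i w)))
             (borel_mat N \<Otimes>\<^sub>M borel_mat N \<Otimes>\<^sub>M
                Pi\<^sub>M {1..r N} (\<lambda>_. borel_vec N \<Otimes>\<^sub>M borel_vec N))))"
  shows "AE w in P.
    (\<lambda>N. 1 / real N powr q N *
       matrix_trace (K N w *
         (matrix_inverse (transpose_mat (U N w) * A N w * U N w + B N w)
          - matrix_inverse (B N w - zstar \<cdot>\<^sub>m 1\<^sub>m N))))
    \<longlonglongrightarrow> 0"
proof -
  interpret P: prob_space P by fact
  define S where "S N = borel_mat N \<Otimes>\<^sub>M borel_mat N \<Otimes>\<^sub>M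
     Pi\<^sub>M {1..r N} (\<lambda>_. borel_vec N \<Otimes>\<^sub>M borel_vec N)" for N
  define Z where "Z N w = (A N w, B N w, \<lambda>i\<in>{1..r N}. (u N i w, v N i w))" for N w
  have Z: "Z N \<in> measurable P (S N)" if N: "N \<ge> 1" for N
    unfolding Z_def S_def
    by (intro measurable_Pair measurable_restrict A_measurable B_measurable u_measurable v_measurable N)
  have indep: "P.indep_set (sets (vimage_algebra (space P) (U N) (borel_mat N)))
      (sets (vimage_algebra (space P) (Z N) (S N)))" if "N \<ge> 1" for N
    using U_indep[OF that] unfolding Z_def S_def .
  \<comment> \<open>All data of the forms are read off \<open>Z\<close>, which is independent of
    \<open>U\<close>. The coefficients \<open>lam\<close> are not among them; they enter afterwards
    through their bound.\<close>
  define Af Bf :: "real mat \<times> real mat \<times> (nat \<Rightarrow> real Matrix.vec \<times> real Matrix.vec) \<Rightarrow> fmat"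
    where "Af z = ent (fst z)" and "Bf z = ent (fst (snd z))" for z
  define uf vf :: "nat \<Rightarrow> real mat \<times> real mat \<times> (nat \<Rightarrow> real Matrix.vec \<times> real Matrix.vec) \<Rightarrow> fvec"
    where "uf l z k = fst (snd (snd z) (Suc l)) $ k" and "vf l z k = snd (snd (snd z) (Suc l)) $ k" for l z k
  have Af: "(\<lambda>z. Af z i j) \<in> borel_measurable (S N)" if "i < N" "j < N" for N i j
    unfolding Af_def S_def by (rule measurable_compose[OF measurable_fst measurable_borel_mat_entry[OF that]])
  have Bf: "(\<lambda>z. Bf z i j) \<in> borel_measurable (S N)" if "i < N" "j < N" for N i j
    unfolding Bf_def S_def
    by (rule measurable_compose[OF measurable_compose[OF measurable_snd measurable_fst] measurable_borel_mat_entry[OF that]])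
  have comp: "(\<lambda>z. snd (snd z) (Suc l)) \<in> measurable (S N) (borel_vec N \<Otimes>\<^sub>M borel_vec N)" if "l < r N" for N l
    unfolding S_def
    by (rule measurable_compose[OF measurable_compose[OF measurable_snd measurable_snd] measurable_component_singleton])
       (use that in simp)
  have uf: "(\<lambda>z. uf l z i) \<in> borel_measurable (S N)" if "l < r N" "i < N" for N l i
    unfolding uf_def
    by (rule measurable_compose[OF measurable_compose[OF comp[OF that(1)] measurable_fst] measurable_borel_vec_entry[OF that(2)]])
  have vf: "(\<lambda>z. vf l z i) \<in> borel_measurable (S N)" if "l < r N" "i < N" for N l i
    unfolding vf_def
    by (rule measurable_compose[OF measurable_compose[OF comp[OF that(1)] measurable_snd] measurable_borel_vec_entry[OF that(2)]])
  \<comment> \<open>Since \<open>zstar\<close> is a constant, this vector is a measurable function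
    of B and u, hence of \<open>Z\<close>.\<close>
  have xf: "(\<lambda>z. mvec N (shifted_inverse N (- zstar) (Bf z)) (uf l z) i) \<in> borel_measurable (S N)"
    if "l < r N" "i < N" for N l i
  proof -
    have "(\<lambda>z. shifted_inverse N (- zstar) (Bf z) i j) \<in> borel_measurable (S N)" if "i < N" "j < N" for i j
      by (rule borel_measurable_finv[OF borel_measurable_add[OF Bf borel_measurable_const] that])
    then show ?thesis unfolding mvec_def
      by (intro borel_measurable_sum borel_measurable_times uf) (use that in auto)
  qed
  \<comment> \<open>A natural exponent above every \<open>q N\<close>, so that the number of test
    vectors is polynomial in N.\<close>
  define c where "c = nat \<lceil>C\<rceil>"
  have r_le: "r N \<le> N ^ c" if N: "N \<ge> 1" for N
  proof -
    have "real N powr q N \<le> real N powr real c"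
    proof (rule powr_mono)
      have "q N \<le> C" using q[OF N] by simp
      also have "C \<le> real c" unfolding c_def by (rule of_nat_ceiling)
      finally show "q N \<le> real c" .
    qed (use N in simp)
    also have "\<dots> = real (N ^ c)" using N by (simp add: powr_realpow)
    finally have "\<lfloor>real N powr q N\<rfloor> \<le> int (N ^ c)" by (metis floor_mono floor_of_nat)
    then have "nat \<lfloor>real N powr q N\<rfloor> \<le> nat (int (N ^ c))" by (rule nat_mono)
    then show ?thesis unfolding r by (metis nat_int)
  qed
  \<comment> \<open>N pairs of equal unit vectors per dimension; their average is the tracial
    relation that \<open>pathwise_limits\<close> requires.\<close>
  have tr: "AE w in P. \<forall>W. \<forall>\<kappa>::nat. 2 \<le> real \<kappa> \<longrightarrow> (\<forall>e::nat. \<forall>\<^sub>F N in sequentially. \<forall>l<N.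
     conditioned N \<kappa> (Af (Z N w)) \<longrightarrow> conditioned N \<kappa> (Bf (Z N w)) \<longrightarrow>
     vnorm N (fid l) \<le> \<kappa> \<longrightarrow> vnorm N (fid l) \<le> \<kappa> \<longrightarrow>
     \<bar>sd_value N W (Af (Z N w)) (Bf (Z N w)) (U N w) (fid l) (fid l)\<bar> \<le> 1 / real (Suc e))"
  proof (rule AE_all_countable[THEN iffD2], rule allI)
    fix W
    show "AE w in P. \<forall>\<kappa>::nat. 2 \<le> real \<kappa> \<longrightarrow> (\<forall>e::nat. \<forall>\<^sub>F N in sequentially. \<forall>l<N.
     conditioned N \<kappa> (Af (Z N w)) \<longrightarrow> conditioned N \<kappa> (Bf (Z N w)) \<longrightarrow>
     vnorm N (fid l) \<le> \<kappa> \<longrightarrow> vnorm N (fid l) \<le> \<kappa> \<longrightarrow>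
     \<bar>sd_value N W (Af (Z N w)) (Bf (Z N w)) (U N w) (fid l) (fid l)\<bar> \<le> 1 / real (Suc e))"
      by (rule AE_sd_value_vanishes[where Z=Z and S=S and U=U and c=1 and m="\<lambda>N. N"
            and a="\<lambda>N l z. fid l" and x="\<lambda>N l z. fid l", OF \<open>prob_space P\<close> U_haar Z indep])
         (auto intro: Af Bf)
  qed
  \<comment> \<open>Here a single word is enough, but all \<open>r N\<close> pairs of test vectors
    are treated at once.\<close>
  have uv: "AE w in P. \<forall>\<kappa>::nat. 2 \<le> real \<kappa> \<longrightarrow> (\<forall>e::nat. \<forall>\<^sub>F N in sequentially. \<forall>l<r N.
     conditioned N \<kappa> (Af (Z N w)) \<longrightarrow> conditioned N \<kappa> (Bf (Z N w)) \<longrightarrow>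
     vnorm N (vf l (Z N w)) \<le> \<kappa> \<longrightarrow>
     vnorm N (mvec N (shifted_inverse N (- zstar) (Bf (Z N w))) (uf l (Z N w))) \<le> \<kappa> \<longrightarrow>
     \<bar>sd_value N [LG] (Af (Z N w)) (Bf (Z N w)) (U N w) (vf l (Z N w))
        (mvec N (shifted_inverse N (- zstar) (Bf (Z N w))) (uf l (Z N w)))\<bar> \<le> 1 / real (Suc e))"
    by (rule AE_sd_value_vanishes[where Z=Z and S=S and U=U and c=c and m=r
          and a="\<lambda>N l z. vf l z" and x="\<lambda>N l z. mvec N (shifted_inverse N (- zstar) (Bf z)) (uf l z)",
          OF \<open>prob_space P\<close> U_haar Z indep])
       (assumption | rule Af Bf vf xf r_le)+
  have "AE w in P. N \<ge> 1 \<longrightarrow> U N w \<in> orthogonal_matrices N" for N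
    using U_haar[of N] by (cases "N \<ge> 1") (auto simp: haar_orthogonal_def)
  then have orth: "AE w in P. \<forall>N. N \<ge> 1 \<longrightarrow> U N w \<in> orthogonal_matrices N"
    unfolding AE_all_countable by blast
  have uf_Z: "uf l (Z N w) = (\<lambda>k. u N (Suc l) w $ k)" "vf l (Z N w) = (\<lambda>k. v N (Suc l) w $ k)" if "l < r N" for N l w
    using that by (auto simp: uf_def vf_def Z_def)
  have ABZ: "Af (Z N w) = ent (A N w)" "Bf (Z N w) = ent (B N w)" for N w
    by (simp_all add: Af_def Bf_def Z_def)
  show ?thesis
    using AE_space tr uv orth A_esd B_esd A_sigma_min A_sigma_max B_sigma_min B_sigma_max lam_bounded
  proof (eventually_elim)
    case (elim w)
    have unit: "vnorm N (\<lambda>k. u N i w $ k) = 1 \<and> vnorm N (\<lambda>k. v N i w $ k) = 1"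
      if "N \<ge> 1" "i \<in> {1..r N}" for N i
      using u_unit[OF that elim(1)] v_unit[OF that elim(1)]
        measurable_space[OF u_measurable[OF that] elim(1)] measurable_space[OF v_measurable[OF that] elim(1)]
      by (simp add: euclidean_norm_vnorm)
    have z: "zstar = - R_transform FA (- (LINT x|F. 1 / x))" unfolding zstar_def chi_def ..
    show ?case
      unfolding K
    proof (rule pathwise_deterministic_equivalent[OF A_spd[OF _ elim(1)] B_spd[OF _ elim(1)] _ FA FB elim(5-10) F z r elim(11) unit])
      show "U N w \<in> orthogonal_matrices N" if "N \<ge> 1" for N using elim(4) that by blast
      fix W and \<kappa> e :: nat assume "(2::nat) \<le> \<kappa>"
      then have \<kappa>: "2 \<le> real \<kappa>" by simp
      have "\<forall>\<^sub>F N in sequentially. \<forall>l<N.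
         conditioned N \<kappa> (Af (Z N w)) \<longrightarrow> conditioned N \<kappa> (Bf (Z N w)) \<longrightarrow>
         vnorm N (fid l) \<le> \<kappa> \<longrightarrow> vnorm N (fid l) \<le> \<kappa> \<longrightarrow>
         \<bar>sd_value N W (Af (Z N w)) (Bf (Z N w)) (U N w) (fid l) (fid l)\<bar> \<le> 1 / real (Suc e)"
        using elim(2) \<kappa> by blast
      then show "\<forall>\<^sub>F N in sequentially. \<forall>l<N. conditioned N \<kappa> (ent (A N w)) \<longrightarrow> conditioned N \<kappa> (ent (B N w)) \<longrightarrow>
         \<bar>sd_value N W (ent (A N w)) (ent (B N w)) (U N w) (fid l) (fid l)\<bar> \<le> 1 / real (Suc e)"
        unfolding ABZ by eventually_elim (use \<kappa> in simp)
    next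
      fix \<kappa> e :: nat assume "(2::nat) \<le> \<kappa>"
      then have \<kappa>: "2 \<le> real \<kappa>" by simp
      have "\<forall>\<^sub>F N in sequentially. \<forall>l<r N.
         conditioned N \<kappa> (Af (Z N w)) \<longrightarrow> conditioned N \<kappa> (Bf (Z N w)) \<longrightarrow>
         vnorm N (vf l (Z N w)) \<le> \<kappa> \<longrightarrow>
         vnorm N (mvec N (shifted_inverse N (- zstar) (Bf (Z N w))) (uf l (Z N w))) \<le> \<kappa> \<longrightarrow>
         \<bar>sd_value N [LG] (Af (Z N w)) (Bf (Z N w)) (U N w) (vf l (Z N w))
            (mvec N (shifted_inverse N (- zstar) (Bf (Z N w))) (uf l (Z N w)))\<bar> \<le> 1 / real (Suc e)"
        using elim(3) \<kappa> by blast
      then show "\<forall>\<^sub>F N in sequentially. \<forall>l<r N.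
         conditioned N \<kappa> (ent (A N w)) \<longrightarrow> conditioned N \<kappa> (ent (B N w)) \<longrightarrow>
         vnorm N (\<lambda>k. v N (Suc l) w $ k) \<le> \<kappa> \<longrightarrow>
         vnorm N (mvec N (shifted_inverse N (- zstar) (ent (B N w))) (\<lambda>k. u N (Suc l) w $ k)) \<le> \<kappa> \<longrightarrow>
         \<bar>sd_value N [LG] (ent (A N w)) (ent (B N w)) (U N w) (\<lambda>k. v N (Suc l) w $ k)
            (mvec N (shifted_inverse N (- zstar) (ent (B N w))) (\<lambda>k. u N (Suc l) w $ k))\<bar> \<le> 1 / real (Suc e)"
        unfolding ABZ by eventually_elim (simp add: uf_Z)
    qed
  qed
qed

end
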